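(* Assume the Exact-$k$-Clique hypothesis. Let $k\ge 3$ be a constant integer. (i) For any $\gamma\in[0,k]$, listing $t=\tilde\Theta(n^\gamma)$ $k$-cliques in a graph with $n$ nodes requires time $$\left(n^{\frac{2}{k-1}}\,t^{1-\frac{2}{k(k-1)}}\right)^{1-o(1)} .$$ (ii) For any $\gamma\in[0,k/2]$, listing $t=\tilde\Theta(m^\gamma)$ $k$-cliques in a graph with $m$ edges requires time $$\left(m^{\frac{1}{k-2}}\,t^{1-\frac{2}{k(k-2)}}\right)^{1-o(1)} .$$
   Context: Graphs are finite, simple and undirected. The model of computation is the word-RAM with $O(\log n)$-bit words; algorithms may be randomized (correct with high probability). $\tilde O,\tilde\Theta$ hide polylogarithmic factors. Listing $t$ $k$-cliques: given a graph and a number $t$, output $\min\{t,\Delta_k\}$ distinct $k$-cliques, where $\Delta_k$ is the number of $k$-cliques in the graph. (Up to polylogarithmic factors in the running time this is equivalent to listing all $k$-cliques of a graph having $t$ $k$-cliques in total, and the two versions are used interchangeably.) "Requires time $T^{1-o(1)}$" means that for no constant $\varepsilon>0$ is there an algorithm running in time $O(T^{1-\varepsilon})$ on all such instances. Exact-$k$-Clique hypothesis: for constant $k\ge3$, let Exact-$k$-Clique be the problem that, given an $n$-node graph with edge weights in $\{-n^{100k},\dots,n^{100k}\}$, asks whether the graph contains a $k$-clique whose edge weights sum to $0$. The hypothesis states that Exact-$k$-Clique requires $n^{k-o(1)}$ time on the word-RAM with $O(\log n)$-bit words. *)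

theory Defs
  imports "HOL-Probability.Probability_Mass_Function"
begin

section \<open>A randomized word-RAM\<close>

text \<open>
  The word length \<open>w\<close> is a parameter of the semantics, not of the program.  All words are
  natural numbers below \<open>2 ^ w\<close>, and arithmetic is modulo \<open>2 ^ w\<close>.  A program is a fixed
  finite list of instructions, so it mentions only finitely many registers; the memory has one
  cell for each of the \<open>2 ^ w\<close> addresses that a word can denote.
\<close>

datatype binop = Plus | Minus | Times | Div | Mod | And | Or | Xor | Shl | Shr | Less | Equal

fun eval_binop :: "nat \<Rightarrow> binop \<Rightarrow> nat \<Rightarrow> nat \<Rightarrow> nat" where
  "eval_binop w Plus a b = (a + b) mod 2 ^ w"
| "eval_binop w Minus a b = (a + 2 ^ w - b) mod 2 ^ w"
| "eval_binop w Times a b = (a * b) mod 2 ^ w"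
| "eval_binop w Div a b = (a div b) mod 2 ^ w"
| "eval_binop w Mod a b = (a mod b) mod 2 ^ w"
| "eval_binop w And a b = (Bit_Operations.and a b) mod 2 ^ w"
| "eval_binop w Or a b = (Bit_Operations.or a b) mod 2 ^ w"
| "eval_binop w Xor a b = (Bit_Operations.xor a b) mod 2 ^ w"
| "eval_binop w Shl a b = (push_bit b a) mod 2 ^ w"
| "eval_binop w Shr a b = (drop_bit b a) mod 2 ^ w"
| "eval_binop w Less a b = (if a < b then 1 else 0) mod 2 ^ w"
| "eval_binop w Equal a b = (if a = b then 1 else 0) mod 2 ^ w"

text \<open>
  In \<open>Load r a\<close> and \<open>Store a r\<close> the address is the content of register \<open>a\<close>.
  \<open>Rand r\<close> draws a uniformly random word, and \<open>Out r\<close> appends the content of \<open>r\<close>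
  to the write-only output.
\<close>

datatype instr =
    Const nat nat
  | Oper binop nat nat nat
  | Load nat nat
  | Store nat nat
  | Jump nat
  | JumpZero nat nat
  | Rand nat
  | Out nat

type_synonym program = "instr list"

record config =
  pc :: nat
  regs :: "nat \<Rightarrow> nat"
  mem :: "nat \<Rightarrow> nat"
  outp :: "nat list"

definition set_reg :: "nat \<Rightarrow> nat \<Rightarrow> config \<Rightarrow> config" where
  "set_reg r v s = s\<lparr>pc := Suc (pc s), regs := (regs s)(r := v)\<rparr>"

fun exec_instr :: "nat \<Rightarrow> instr \<Rightarrow> config \<Rightarrow> config pmf" where
  "exec_instr w (Const r v) s = return_pmf (set_reg r (v mod 2 ^ w) s)"
| "exec_instr w (Oper f r a b) s = return_pmf (set_reg r (eval_binop w f (regs s a) (regs s b)) s)"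
| "exec_instr w (Load r a) s = return_pmf (set_reg r (mem s (regs s a)) s)"
| "exec_instr w (Store a r) s =
     return_pmf (s\<lparr>pc := Suc (pc s), mem := (mem s)(regs s a := regs s r)\<rparr>)"
| "exec_instr w (Jump l) s = return_pmf (s\<lparr>pc := l\<rparr>)"
| "exec_instr w (JumpZero r l) s =
     return_pmf (s\<lparr>pc := (if regs s r = 0 then l else Suc (pc s))\<rparr>)"
| "exec_instr w (Rand r) s = map_pmf (\<lambda>v. set_reg r v s) (pmf_of_set {..<2 ^ w})"
| "exec_instr w (Out r) s = return_pmf (s\<lparr>pc := Suc (pc s), outp := outp s @ [regs s r]\<rparr>)"

definition halted :: "program \<Rightarrow> config \<Rightarrow> bool" where
  "halted P s \<longleftrightarrow> length P \<le> pc s"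

definition step :: "nat \<Rightarrow> program \<Rightarrow> config \<Rightarrow> config pmf" where
  "step w P s = (if halted P s then return_pmf s else exec_instr w (P ! pc s) s)"

primrec run :: "nat \<Rightarrow> program \<Rightarrow> nat \<Rightarrow> config \<Rightarrow> config pmf" where
  "run w P 0 s = return_pmf s"
| "run w P (Suc i) s = bind_pmf (step w P s) (run w P i)"

text \<open>The input occupies the memory cells from address 0 on; everything else is zero.\<close>

definition init_config :: "nat list \<Rightarrow> config" where
  "init_config xs = \<lparr>pc = 0, regs = (\<lambda>_. 0),
     mem = (\<lambda>a. if a < length xs then xs ! a else 0), outp = []\<rparr>"

definition input_fits :: "nat \<Rightarrow> nat list \<Rightarrow> bool" where
  "input_fits w xs \<longleftrightarrow> length xs \<le> 2 ^ w \<and> (\<forall>x\<in>set xs. x < 2 ^ w)"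

text \<open>
  Since a halted configuration no longer changes, the following is the probability that the
  program halts within \<open>i\<close> steps with an output in \<open>Y\<close>.
\<close>

definition success_prob :: "nat \<Rightarrow> program \<Rightarrow> nat list \<Rightarrow> nat \<Rightarrow> nat list set \<Rightarrow> real" where
  "success_prob w P xs i Y =
     measure_pmf.prob (run w P i (init_config xs)) {s. halted P s \<and> outp s \<in> Y}"


section \<open>Problems and conditional running times\<close>

text \<open>
  A task is one instance of a problem: the words of the input, the size parameter \<open>n\<close> that
  governs the word length and the success probability (for graph problems the number of nodes),
  the correct outputs, and the value on this instance of the time bound \<open>T\<close> under discussion.
\<close>

record task =
  task_input :: "nat list"
  task_size :: nat
  task_answers :: "nat list set"
  task_bound :: real

text \<open>The constant \<open>c\<close> in the word length \<open>O(log n)\<close> is chosen by the algorithm.\<close>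

definition word_length :: "nat \<Rightarrow> nat \<Rightarrow> nat" where
  "word_length c n = c * nat \<lceil>log 2 (real n)\<rceil>"

text \<open>
  With probability at least \<open>1 - 1/n\<close> the program halts within \<open>A * T powr (1 - \<epsilon>)\<close>
  steps and its output is correct.
\<close>

definition solves_within :: "program \<Rightarrow> nat \<Rightarrow> real \<Rightarrow> real \<Rightarrow> task \<Rightarrow> bool" where
  "solves_within P c A \<epsilon> x \<longleftrightarrow>
     (let w = word_length c (task_size x) in
        input_fits w (task_input x) \<and>
        success_prob w P (task_input x) (nat \<lfloor>A * task_bound x powr (1 - \<epsilon>)\<rfloor>) (task_answers x)
          \<ge> 1 - 1 / real (task_size x))"

text \<open>``Requires time \<open>T^(1 - o(1))\<close>''.\<close>

definition requires_time :: "task set \<Rightarrow> bool" where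
  "requires_time X \<longleftrightarrow>
     (\<forall>\<epsilon>>0. \<not> (\<exists>P c A. \<forall>x\<in>X. solves_within P c A \<epsilon> x))"


section \<open>Graphs and cliques\<close>

definition simple_graph :: "nat \<Rightarrow> nat set set \<Rightarrow> bool" where
  "simple_graph n E \<longleftrightarrow> (\<forall>e\<in>E. e \<subseteq> {..<n} \<and> card e = 2)"

definition no_isolated :: "nat \<Rightarrow> nat set set \<Rightarrow> bool" where
  "no_isolated n E \<longleftrightarrow> \<Union> E = {..<n}"

definition cliques :: "nat \<Rightarrow> nat \<Rightarrow> nat set set \<Rightarrow> nat set set" where
  "cliques k n E =
     {S. S \<subseteq> {..<n} \<and> card S = k \<and> (\<forall>u\<in>S. \<forall>v\<in>S. u \<noteq> v \<longrightarrow> {u, v} \<in> E)}"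

text \<open>
  Graphs are given as edge lists: every edge occurs exactly once, in an arbitrary position and
  with its endpoints in an arbitrary order.
\<close>

definition edge_list :: "nat set set \<Rightarrow> (nat \<times> nat) list \<Rightarrow> bool" where
  "edge_list E es \<longleftrightarrow>
     distinct (map (\<lambda>(u, v). {u, v}) es) \<and> set (map (\<lambda>(u, v). {u, v}) es) = E"


section \<open>Exact-k-Clique\<close>

definition clique_weight :: "nat set set \<Rightarrow> (nat set \<Rightarrow> int) \<Rightarrow> nat set \<Rightarrow> int" where
  "clique_weight E W S = (\<Sum>e\<in>{e \<in> E. e \<subseteq> S}. W e)"

text \<open>A weight is encoded by two words, its sign (1 if negative) and its absolute value.\<close>

definition weighted_input :: "nat \<Rightarrow> (nat \<times> nat) list \<Rightarrow> (nat set \<Rightarrow> int) \<Rightarrow> nat list" where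
  "weighted_input n es W =
     n # length es # concat (map (\<lambda>(u, v).
       [u, v, if W {u, v} < 0 then 1 else 0, nat \<bar>W {u, v}\<bar>]) es)"

definition exact_clique_tasks :: "nat \<Rightarrow> task set" where
  "exact_clique_tasks k =
     {\<lparr>task_input = weighted_input n es W,
       task_size = n,
       task_answers = (if \<exists>S\<in>cliques k n E. clique_weight E W S = 0 then {[1]} else {[0]}),
       task_bound = real n powr real k\<rparr> | n E es W.
       2 \<le> n \<and> simple_graph n E \<and> edge_list E es \<and> (\<forall>e\<in>E. \<bar>W e\<bar> \<le> int n ^ (100 * k))}"

definition exact_clique_hypothesis :: "nat \<Rightarrow> bool" where
  "exact_clique_hypothesis k \<longleftrightarrow> requires_time (exact_clique_tasks k)"


section \<open>Listing k-cliques\<close>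

definition listing_input :: "nat \<Rightarrow> (nat \<times> nat) list \<Rightarrow> nat \<Rightarrow> nat list" where
  "listing_input n es t = n # length es # t # concat (map (\<lambda>(u, v). [u, v]) es)"

text \<open>
  The output is a concatenation of blocks of \<open>k\<close> words, each block enumerating one clique.
\<close>

definition listing_answers :: "nat \<Rightarrow> nat \<Rightarrow> nat set set \<Rightarrow> nat \<Rightarrow> nat list set" where
  "listing_answers k n E t =
     {concat Ks | Ks.
       (\<forall>K\<in>set Ks. length K = k \<and> set K \<in> cliques k n E) \<and>
       distinct (map set Ks) \<and>
       length Ks = min t (card (cliques k n E))}"

text \<open>
  The instances with \<open>t\<close> in \<open>\<Theta>(N^\<gamma>)\<close> up to polylogarithmic factors, where \<open>C\<close> and \<open>d\<close>
  are the hidden constants; meaningful for \<open>N \<ge> 2\<close>.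
\<close>

definition polylog_close :: "real \<Rightarrow> nat \<Rightarrow> real \<Rightarrow> nat \<Rightarrow> nat \<Rightarrow> bool" where
  "polylog_close C d \<gamma> N t \<longleftrightarrow>
     real N powr \<gamma> / (C * log 2 (real N) ^ d) \<le> real t \<and>
     real t \<le> C * log 2 (real N) ^ d * real N powr \<gamma>"

definition node_listing_tasks :: "nat \<Rightarrow> real \<Rightarrow> real \<Rightarrow> nat \<Rightarrow> task set" where
  "node_listing_tasks k \<gamma> C d =
     {\<lparr>task_input = listing_input n es t,
       task_size = n,
       task_answers = listing_answers k n E t,
       task_bound = real n powr (2 / (real k - 1)) *
                    real t powr (1 - 2 / (real k * (real k - 1)))\<rparr> | n E es t.
       2 \<le> n \<and> simple_graph n E \<and> edge_list E es \<and> polylog_close C d \<gamma> n t}"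

text \<open>
  When running times are measured in the number \<open>m\<close> of edges alone, graphs have no isolated
  vertices.  Hence \<open>n \<le> 2 * m\<close>, and words of \<open>O(log n)\<close> and of \<open>O(log m)\<close> bits are the same.
\<close>

definition edge_listing_tasks :: "nat \<Rightarrow> real \<Rightarrow> real \<Rightarrow> nat \<Rightarrow> task set" where
  "edge_listing_tasks k \<gamma> C d =
     {\<lparr>task_input = listing_input n es t,
       task_size = n,
       task_answers = listing_answers k n E t,
       task_bound = real m powr (1 / (real k - 2)) *
                    real t powr (1 - 2 / (real k * (real k - 2)))\<rparr> | n m E es t.
       simple_graph n E \<and> no_isolated n E \<and> card E = m \<and> 2 \<le> m \<and>
       edge_list E es \<and> polylog_close C d \<gamma> m t}"

end

theory Submission
 imports Defs "HOL-Probability.Product_PMF" "HOL-Number_Theory.Cong"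
begin

text \<open>
 The vertices of a weighted graph are copied into \<open>k\<close> parts.  An edge between two parts is hashed by
 \<open>r * weight\<close> plus two random potentials to one of \<open>2 ^ a\<close> buckets, where the potentials of a copy sum to
 zero.  The total weight of a clique determines the sum of its hash values, so for a clique of weight zero
 the last bucket is known up to fewer than \<open>k\<^sup>2\<close> carries when the others are guessed.  The edges in the
 guessed buckets form an unweighted graph in which few other cliques survive.  A listing program finds all
 of them, and the weight of each is checked.  A word-RAM program cannot compute the real exponents of the
 time bound, hence it also guesses the numbers of buckets, nodes, cliques and steps, all up to constant
 factors powers of two.  Pendant edges adjust the size of the instance and leave no vertex isolated.

 The simulation only pays off if the time bound is not below the size of the input.  This follows from an
 adversary argument: one edge of a large bipartite graph may be replaced by the edge that completes a
 \<open>k\<close>-clique, and a program that does not read that edge does not notice the replacement.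
\<close>

section \<open>Loop programs on the word-RAM\<close>

text \<open>Let n = 2^L and C = k choose 2. With n^\<sigma> buckets per pair of parts there are
  about n^(\<sigma> (C - 1)) guesses; a right one leaves roughly n^(k - \<sigma> C) false cliques
  and n^(2 - \<sigma>) edges per pair. The exponents of the theorem are those for which the number
  of guesses times the claimed time is n^k. The union bound must also cover false cliques that share
  vertices with the hidden one; \<sigma> <= 2 / (k - 1) makes those sharing none the worst case. The
  potentials cannot make all buckets of a clique independent, because they preserve its total
  weight: one linear relation remains, and one factor n^-\<sigma> is lost. The multiplier r regains
  it, as r times a nonzero weight is rarely close to 0 modulo 2^w. Independence is expressed by
  counting: injective shifts of the random table move the buckets freely. The cost of a guess is
  bounded whatever its outcome, and errors are one-sided, so wrong guesses do no harm. Memory is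
  never reused, since the simulated program expects zeroed cells.\<close>

abbreviation "prob M == measure_pmf.prob M"

declare run.simps(2) [simp del]

datatype exp = Lit nat | Var nat | Bin binop exp exp | Mem exp

datatype com =
  Skip
 | Asg nat exp
 | Sto exp exp
 | Rnd nat
 | Seq com com  (infixr ";;" 60)
 | Cond exp com com
 | For nat exp com

type_synonym store = "(nat => nat) \<times> (nat => nat)"

fun eval :: "nat => exp => (nat => nat) => (nat => nat) => nat" where
 "eval w (Lit n) v m = n mod 2 ^ w"
| "eval w (Var r) v m = v r"
| "eval w (Bin f a b) v m = eval_binop w f (eval w a v m) (eval w b v m)"
| "eval w (Mem a) v m = m (eval w a v m)"

text \<open>Expressions do not branch, so this is both the length of the compiled code and the
  number of steps it takes.\<close>

fun esize :: "exp => nat" where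
 "esize (Lit n) = 1"
| "esize (Var r) = 1"
| "esize (Bin f a b) = esize a + esize b + 1"
| "esize (Mem a) = esize a + 1"

fun evars :: "exp => nat set" where
 "evars (Lit n) = {}"
| "evars (Var r) = {r}"
| "evars (Bin f a b) = evars a \<union> evars b"
| "evars (Mem a) = evars a"

text \<open>The loop \<open>For r e c\<close> counts down: \<open>c\<close> sees the index \<open>r\<close> run from \<open>e - 1\<close> to \<open>0\<close>.
 The second component of an outcome is the number of machine steps of the compiled code.\<close>

fun lsem :: "(store => (store \<times> nat) pmf) => nat => nat => store => (store \<times> nat) pmf" where
 "lsem b r 0 s = return_pmf (s, 1)"
| "lsem b r (Suc j) s = bind_pmf (b ((fst s)(r := j), snd s))
   (%(s', k). map_pmf (%(s'', k'). (s'', 4 + k + k')) (lsem b r j s'))"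

fun sem :: "nat => com => store => (store \<times> nat) pmf" where
 "sem w Skip s = return_pmf (s, 0)"
| "sem w (Asg r e) (v, m) = return_pmf ((v(r := eval w e v m), m), esize e + 1)"
| "sem w (Sto a e) (v, m) =
   return_pmf ((v, m(eval w a v m := eval w e v m)), esize a + esize e + 1)"
| "sem w (Rnd r) (v, m) = map_pmf (%x. ((v(r := x), m), 1)) (pmf_of_set {..<2 ^ w})"
| "sem w (c1 ;; c2) s = bind_pmf (sem w c1 s)
   (%(s', k). map_pmf (%(s'', k'). (s'', k + k')) (sem w c2 s'))"
| "sem w (Cond e c1 c2) (v, m) =
   (if eval w e v m = 0 then map_pmf (%(s, k). (s, esize e + 1 + k)) (sem w c2 (v, m))
   else map_pmf (%(s, k). (s, esize e + 2 + k)) (sem w c1 (v, m)))"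
| "sem w (For r e c) (v, m) =
   map_pmf (%(s, k). (s, esize e + 1 + k))
    (lsem (sem w c) r (eval w e v m) (v(r := eval w e v m), m))"

fun writes :: "com => nat set" where
 "writes Skip = {}"
| "writes (Asg r e) = {r}"
| "writes (Sto a e) = {}"
| "writes (Rnd r) = {r}"
| "writes (c1 ;; c2) = writes c1 \<union> writes c2"
| "writes (Cond e c1 c2) = writes c1 \<union> writes c2"
| "writes (For r e c) = insert r (writes c)"

fun cvars :: "com => nat set" where
 "cvars Skip = {}"
| "cvars (Asg r e) = insert r (evars e)"
| "cvars (Sto a e) = evars a \<union> evars e"
| "cvars (Rnd r) = {r}"
| "cvars (c1 ;; c2) = cvars c1 \<union> cvars c2"
| "cvars (Cond e c1 c2) = evars e \<union> cvars c1 \<union> cvars c2"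
| "cvars (For r e c) = insert r (evars e \<union> cvars c)"

text \<open>\<open>lsem\<close> sets the index anew in every round, whereas the compiled loop keeps
  it only in the register \<open>r\<close>. The two agree as long as the body leaves
  \<open>r\<close> alone.\<close>

fun loop_ok :: "com => bool" where
 "loop_ok (c1 ;; c2) = (loop_ok c1 & loop_ok c2)"
| "loop_ok (Cond e c1 c2) = (loop_ok c1 & loop_ok c2)"
| "loop_ok (For r e c) = (r ~: writes c & loop_ok c)"
| "loop_ok _ = True"

lemma lsem_unwritten:
 assumes "(s', k) : set_pmf (lsem b r j s)" "x ~= r"
  and "!!s s' k. (s', k) : set_pmf (b s) ==> fst s' x = fst s x"
 shows "fst s' x = fst s x" using assms(1) proof (induction j arbitrary: s s' k)
 case (Suc j)
 then obtain s1 k1 k2 where 1: "(s1, k1) : set_pmf (b ((fst s)(r := j), snd s))"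
  "(s', k2) : set_pmf (lsem b r j s1)" by (auto split: prod.splits)
 show ?case using Suc.IH[OF 1(2)] assms(3)[OF 1(1)] `x ~= r` by simp
qed simp

lemma sem_unwritten:
 assumes "(s', k) : set_pmf (sem w c s)" "x ~: writes c"
 shows "fst s' x = fst s x" using assms proof (induction c arbitrary: s s' k)
 case (For r e c)
 obtain v m where s: "s = (v, m)" by fastforce
 from For.prems obtain k' where
  "(s', k') : set_pmf (lsem (sem w c) r (eval w e v m) (v(r := eval w e v m), m))" by (auto simp: s)
 from lsem_unwritten[OF this, of x] For show ?case by (auto simp: s)
next
 case (Seq c1 c2)
 then obtain s1 k1 k2 where "(s1, k1) : set_pmf (sem w c1 s)" "(s', k2) : set_pmf (sem w c2 s1)" by (auto split: prod.splits)
 from Seq.IH(1)[OF this(1)] Seq.IH(2)[OF this(2)] Seq.prems show ?case by simp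
next
 case (Cond e c1 c2)
 obtain v m where s: "s = (v, m)" by fastforce
 from Cond show ?case by (auto simp: s split: if_splits)
qed (case_tac s; auto)+

section \<open>Compilation to machine code\<close>

lemma set_pmf_words [simp]: "set_pmf (pmf_of_set {..<2 ^ w :: nat}) = {..<2 ^ w}"
 by (rule set_pmf_of_set) (auto simp: lessThan_empty_iff)

lemma eval_binop_less: "eval_binop w f a b < 2 ^ w" by (cases f) auto

text \<open>The temporaries from \<open>d\<close> on serve as an evaluation stack. A register is
  copied by or-ing it with itself, which is faithful for words below \<open>2 ^ w\<close>.\<close>

fun ecode :: "exp => nat => instr list" where
 "ecode (Lit n) d = [Const d n]"
| "ecode (Var r) d = [Oper Or d r r]"
| "ecode (Bin f a b) d = ecode a d @ ecode b (Suc d) @ [Oper f d d (Suc d)]"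
| "ecode (Mem a) d = ecode a d @ [Load d d]"

lemma length_ecode [simp]: "length (ecode e d) = esize e" by (induction e arbitrary: d) auto

fun csize :: "com => nat" where
 "csize Skip = 0"
| "csize (Asg r e) = esize e + 1"
| "csize (Sto a e) = esize a + esize e + 1"
| "csize (Rnd r) = 1"
| "csize (c1 ;; c2) = csize c1 + csize c2"
| "csize (Cond e c1 c2) = esize e + 2 + csize c1 + csize c2"
| "csize (For r e c) = esize e + 5 + csize c"

text \<open>Variables are the registers below \<open>t\<close>; the registers from \<open>t\<close> on are temporaries.\<close>

fun ccode :: "nat => nat => com => instr list" where
 "ccode t l Skip = []"
| "ccode t l (Asg r e) = ecode e t @ [Oper Or r t t]"
| "ccode t l (Sto a e) = ecode a t @ ecode e (Suc t) @ [Store t (Suc t)]"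
| "ccode t l (Rnd r) = [Rand r]"
| "ccode t l (c1 ;; c2) = ccode t l c1 @ ccode t (l + csize c1) c2"
| "ccode t l (Cond e c1 c2) =
   ecode e t @ [JumpZero t (l + esize e + 2 + csize c1)] @
   ccode t (l + esize e + 1) c1 @ [Jump (l + esize e + 2 + csize c1 + csize c2)] @
   ccode t (l + esize e + 2 + csize c1) c2"
| "ccode t l (For r e c) =
   ecode e t @ [Oper Or r t t, JumpZero r (l + esize e + 5 + csize c),
    Const t 1, Oper Minus r r t] @
   ccode t (l + esize e + 4) c @ [Jump (l + esize e + 1)]"

lemma length_ccode [simp]: "length (ccode t l c) = csize c" by (induction c arbitrary: l) auto

fun code_at :: "program => nat => instr list => bool" where
 "code_at P l [] = True"
| "code_at P l (x # xs) = (l < length P & P ! l = x & code_at P (Suc l) xs)"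

lemma code_at_append: "code_at P l (xs @ ys) = (code_at P l xs & code_at P (l + length xs) ys)"
 by (induction xs arbitrary: l) auto

lemma code_at_infix: "code_at (xs @ cs @ ys) (length xs) cs" proof (induction cs arbitrary: xs)
 case (Cons c cs)
 from Cons[of "xs @ [c]"] show ?case by simp
qed simp

text \<open>Quantified over the remaining time \<open>T\<close>, so that deterministic stretches
  chain without a look at the distribution of the rest of the run.\<close>

definition steps where "steps w P n s s' \<longleftrightarrow> (ALL T. run w P (T + n) s = run w P T s')"

lemma steps_trans: "steps w P i s s' ==> steps w P j s' s'' ==> steps w P (i + j) s s''"
 unfolding steps_def by (metis add.assoc add.commute)

lemma steps_1: "pc s < length P ==> exec_instr w (P ! pc s) s = return_pmf s' ==> steps w P 1 s s'"
 by (simp add: steps_def run.simps step_def halted_def bind_return_pmf)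

text \<open>All contents are kept below \<open>2 ^ w\<close>, on which copying by \<open>Or\<close>
  and the decrement of loop counters rely. Compiled loop code contains no \<open>Out\<close>, so the
  output stays empty.\<close>

definition rel :: "nat => nat => config => store => bool" where
 "rel w t s x \<longleftrightarrow> (ALL r<t. regs s r = fst x r) & mem s = snd x & outp s = [] &
   (ALL r. regs s r < 2 ^ w) & (ALL a. mem s a < 2 ^ w)"

lemma rel_set_reg:
 assumes "rel w t s (v, m)" "x < 2 ^ w"
 shows "rel w t (set_reg r x s) (v(r := x), m)" using assms by (auto simp: rel_def set_reg_def)

lemma rel_pc [simp]: "rel w t (s\<lparr>pc := l\<rparr>) x = rel w t s x" by (simp add: rel_def)

lemma rel_set_temp: "rel w t s x ==> t <= d ==> y < 2 ^ w ==> rel w t (set_reg d y s) x" by (auto simp: rel_def set_reg_def)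

lemma rel_less:
 assumes "rel w t s x"
 shows "regs s r < 2 ^ w" "mem s a < 2 ^ w" using assms unfolding rel_def by blast+

lemma ecode_correct:
 assumes "rel w t s (v, m)" "code_at P (pc s) (ecode e d)" "evars e <= {..<t}" "t <= d"
 obtains s' where "rel w t s' (v, m)" "pc s' = pc s + esize e" "regs s' d = eval w e v m"
  "ALL r<d. regs s' r = regs s r" "steps w P (esize e) s s'" proof -
 have step: "EX s'. rel w t s' (v, m) & pc s' = pc s + n & regs s' d = y & (ALL r<d. regs s' r = regs s r) & steps w P n s s'"
  if "rel w t s1 (v, m)" "pc s + n = Suc (pc s1)" "ALL r<d. regs s1 r = regs s r" "steps w P (n - 1) s s1" "t <= d" "y < 2 ^ w"
   "pc s1 < length P" "exec_instr w (P ! pc s1) s1 = return_pmf (set_reg d y s1)" "1 <= n" for s s1 n y d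
  by (rule exI[of _ "set_reg d y s1"])
   (use that rel_set_temp steps_trans[OF that(4) steps_1[OF that(7,8)]] in "auto simp: set_reg_def")
 have "EX s'. rel w t s' (v, m) & pc s' = pc s + esize e & regs s' d = eval w e v m &
  (ALL r<d. regs s' r = regs s r) & steps w P (esize e) s s'" using assms proof (induction e arbitrary: d s)
  case (Lit n)
  thus ?case by (intro step[of s]) (auto simp: steps_def)
 next
  case (Var r)
  thus ?case using rel_less(1)[OF Var(1), of r] by (intro step[of s]) (auto simp: steps_def rel_def)
 next
  case (Bin f a b)
  hence c: "code_at P (pc s) (ecode a d)" "code_at P (pc s + esize a) (ecode b (Suc d))"
   "pc s + esize a + esize b < length P" "P ! (pc s + esize a + esize b) = Oper f d d (Suc d)" by (auto simp: code_at_append)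
  obtain s1 where s1: "rel w t s1 (v, m)" "pc s1 = pc s + esize a" "regs s1 d = eval w a v m"
   "ALL r<d. regs s1 r = regs s r" "steps w P (esize a) s s1" using Bin.IH(1)[OF Bin.prems(1) c(1)] Bin.prems by auto
  obtain s2 where s2: "rel w t s2 (v, m)" "pc s2 = pc s1 + esize b" "regs s2 (Suc d) = eval w b v m"
   "ALL r<Suc d. regs s2 r = regs s1 r" "steps w P (esize b) s1 s2"
   using Bin.IH(2)[OF s1(1), of "Suc d"] c(2) Bin.prems s1(2) by auto
  show ?case by (rule step[of s2])
   (use c s1 s2 Bin.prems steps_trans[OF s1(5) s2(5)] in "simp_all add: eval_binop_less")
 next
  case (Mem a)
  hence c: "code_at P (pc s) (ecode a d)" "pc s + esize a < length P" "P ! (pc s + esize a) = Load d d"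
   by (auto simp: code_at_append)
  obtain s1 where s1: "rel w t s1 (v, m)" "pc s1 = pc s + esize a" "regs s1 d = eval w a v m"
   "ALL r<d. regs s1 r = regs s r" "steps w P (esize a) s s1" using Mem.IH[OF Mem.prems(1) c(1)] Mem.prems by auto
  show ?case by (rule step[of s1]) (use c s1 Mem.prems rel_less(2)[OF s1(1)] in "simp_all add: rel_def")
 qed
 thus thesis using that by blast
qed

text \<open>From \<open>s\<close>, the machine arrives at \<open>l\<close> with a store and a step count distributed as \<open>D\<close>.
 The function \<open>f\<close> observes the final configuration, which the store does not determine.\<close>

definition reach where "reach w P t f s D l \<longleftrightarrow> (ALL T G. (ALL (x, k):set_pmf D. k <= T &
   (ALL s'. rel w t s' x --> pc s' = l --> map_pmf f (run w P (T - k) s') = G (x, k))) -->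
   map_pmf f (run w P T s) = bind_pmf D G)"

lemma reachD:
 assumes "reach w P t f s D l" "!!x k. (x, k) : set_pmf D ==> k <= T"
  "!!x k s'. (x, k) : set_pmf D ==> rel w t s' x ==> pc s' = l ==> map_pmf f (run w P (T - k) s') = G (x, k)"
 shows "map_pmf f (run w P T s) = bind_pmf D G" using assms unfolding reach_def by blast

lemma reachI:
 assumes "!!T G. (!!x k. (x, k) : set_pmf D ==> k <= T) ==>
  (!!x k s'. (x, k) : set_pmf D ==> rel w t s' x ==> pc s' = l ==> map_pmf f (run w P (T - k) s') = G (x, k)) ==>
  map_pmf f (run w P T s) = bind_pmf D G"
 shows "reach w P t f s D l" using assms unfolding reach_def by blast

lemma reach_return: "rel w t s x ==> pc s = l ==> reach w P t f s (return_pmf (x, 0)) l"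
 by (rule reachI) (auto simp: bind_return_pmf)

lemma reach_bind:
 assumes 1: "reach w P t f s D l"
  and 2: "!!x k s'. (x, k) : set_pmf D ==> rel w t s' x ==> pc s' = l ==> reach w P t f s' (E x) l'"
 shows "reach w P t f s (bind_pmf D (%(x, k). map_pmf (%(y, k'). (y, k + k')) (E x))) l'" (is "reach w P t f s ?D l'")
proof (rule reachI)
 fix T G
 assume T: "!!y k. (y, k) : set_pmf ?D ==> k <= T"
  and G: "!!y k s'. (y, k) : set_pmf ?D ==> rel w t s' y ==> pc s' = l' ==> map_pmf f (run w P (T - k) s') = G (y, k)"
 have D: "(y, k + k') : set_pmf ?D" if "(x, k) : set_pmf D" "(y, k') : set_pmf (E x)" for x y k k' using that by force
 have "map_pmf f (run w P T s) = bind_pmf D (%(x, k). bind_pmf (E x) (%(y, k'). G (y, k + k')))" proof (rule reachD[OF 1])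
  fix x k assume x: "(x, k) : set_pmf D"
  obtain y k' where "(y, k') : set_pmf (E x)" using set_pmf_not_empty[of "E x"] by auto
  from T[OF D[OF x this]] show "k <= T" by simp
  fix s' assume s': "rel w t s' x" "pc s' = l"
  have "map_pmf f (run w P (T - k) s') = bind_pmf (E x) (%(y, k'). G (y, k + k'))" proof (rule reachD[OF 2[OF x s']])
   fix y k' assume y: "(y, k') : set_pmf (E x)"
   from T[OF D[OF x y]] show "k' <= T - k" by simp
   show "map_pmf f (run w P (T - k - k') s'') = (case (y, k') of (y, k') => G (y, k + k'))"
    if "rel w t s'' y" "pc s'' = l'" for s'' using G[OF D[OF x y] that] by simp
  qed
  thus "map_pmf f (run w P (T - k) s') = (case (x, k) of (x, k) => bind_pmf (E x) (%(y, k'). G (y, k + k')))" by simp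
 qed
 thus "map_pmf f (run w P T s) = bind_pmf ?D G" by (simp add: bind_assoc_pmf bind_map_pmf case_prod_unfold)
qed

lemma reach_steps:
 assumes "steps w P n s s'" "reach w P t f s' D l"
 shows "reach w P t f s (map_pmf (%(x, k). (x, n + k)) D) l" proof (rule reachI)
 fix T G
 assume T: "!!y k. (y, k) : set_pmf (map_pmf (%(x, k). (x, n + k)) D) ==> k <= T"
  and G: "!!y k s'. (y, k) : set_pmf (map_pmf (%(x, k). (x, n + k)) D) ==> rel w t s' y ==> pc s' = l ==>
   map_pmf f (run w P (T - k) s') = G (y, k)"
 have D: "(x, n + k) : set_pmf (map_pmf (%(x, k). (x, n + k)) D)" if "(x, k) : set_pmf D" for x k using that by force
 obtain x k where "(x, k) : set_pmf D" using set_pmf_not_empty[of D] by auto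
 from T[OF D[OF this]] have "T = T - n + n" by simp
 hence "map_pmf f (run w P T s) = map_pmf f (run w P (T - n) s')" using assms(1) unfolding steps_def by metis
 also have "... = bind_pmf D (%(x, k). G (x, n + k))" proof (rule reachD[OF assms(2)])
  fix x k assume x: "(x, k) : set_pmf D"
  from T[OF D[OF x]] show "k <= T - n" by simp
  show "map_pmf f (run w P (T - n - k) s') = (case (x, k) of (x, k) => G (x, n + k))"
   if "rel w t s' x" "pc s' = l" for s' using G[OF D[OF x] that] by simp
 qed
 finally show "map_pmf f (run w P T s) = bind_pmf (map_pmf (%(x, k). (x, n + k)) D) G"
  by (simp add: bind_map_pmf case_prod_unfold)
qed

lemma reach_det: "steps w P n s s' ==> rel w t s' x ==> pc s' = l ==> reach w P t f s (return_pmf (x, n)) l"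
 using reach_steps[OF _ reach_return] by (simp add: map_return_pmf)

lemma reach_jump:
 assumes "reach w P t f s D l" "l < length P" "P ! l = Jump l'"
  and "!!x k s'. (x, k) : set_pmf D ==> rel w t s' x ==> pc s' = l' ==> reach w P t f s' (E x) l''"
 shows "reach w P t f s (bind_pmf D (%(x, k). map_pmf (%(y, k'). (y, Suc (k + k'))) (E x))) l''" proof -
 have "reach w P t f s' (map_pmf (%(y, k). (y, 1 + k)) (E x)) l''"
  if "(x, k) : set_pmf D" "rel w t s' x" "pc s' = l" for x k s'
  by (rule reach_steps[OF steps_1[of s' P w "s'\<lparr>pc := l'\<rparr>"] assms(4)[OF that(1)]]) (use that assms(2,3) in simp_all)
 from reach_bind[OF assms(1) this] show ?thesis by (simp add: pmf.map_comp o_def case_prod_unfold)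
qed

text \<open>Structural induction. A loop needs a second induction on its counter, entered at the
  test instruction, to which the closing jump of every round returns; \<open>sem_unwritten\<close>
  ensures that the register still holds the counter there.\<close>

lemma reach_ccode:
 assumes "loop_ok c" "cvars c <= {..<t}" "code_at P (pc s) (ccode t (pc s) c)" "rel w t s x"
 shows "reach w P t f s (sem w c x) (pc s + csize c)" using assms proof (induction c arbitrary: s x)
 case Skip
 thus ?case by (simp add: reach_return)
next
 case (Asg r e)
 obtain v m where x: "x = (v, m)" by fastforce
 have c: "code_at P (pc s) (ecode e t)" "pc s + esize e < length P" "P ! (pc s + esize e) = Oper Or r t t"
  using Asg.prems(3) by (auto simp: code_at_append)
 obtain s1 where s1: "rel w t s1 (v, m)" "pc s1 = pc s + esize e" "regs s1 t = eval w e v m" "steps w P (esize e) s s1"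
  by (rule ecode_correct[OF Asg.prems(4)[unfolded x] c(1)]) (use Asg.prems in auto)
 note lt = rel_less(1)[OF s1(1), of t]
 have "steps w P 1 s1 (set_reg r (regs s1 t) s1)" by (rule steps_1) (use c(2,3) s1(2) lt in auto)
 from reach_det[OF steps_trans[OF s1(4) this] rel_set_reg[OF s1(1) lt] refl] show ?case
  using s1(2,3) by (simp add: x set_reg_def)
next
 case (Sto a e)
 obtain v m where x: "x = (v, m)" by fastforce
 have c: "code_at P (pc s) (ecode a t)" "code_at P (pc s + esize a) (ecode e (Suc t))"
  "pc s + esize a + esize e < length P" "P ! (pc s + esize a + esize e) = Store t (Suc t)"
  using Sto.prems(3) by (auto simp: code_at_append)
 obtain s1 where s1: "rel w t s1 (v, m)" "pc s1 = pc s + esize a" "regs s1 t = eval w a v m" "steps w P (esize a) s s1"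
  by (rule ecode_correct[OF Sto.prems(4)[unfolded x] c(1)]) (use Sto.prems in auto)
 obtain s2 where s2: "rel w t s2 (v, m)" "pc s2 = pc s1 + esize e" "regs s2 (Suc t) = eval w e v m"
  "ALL r<Suc t. regs s2 r = regs s1 r" "steps w P (esize e) s1 s2"
  by (rule ecode_correct[OF s1(1) c(2)[folded s1(2)]]) (use Sto.prems in auto)
 let ?s3 = "s2\<lparr>pc := Suc (pc s2), mem := (mem s2)(regs s2 t := regs s2 (Suc t))\<rparr>"
 have st: "steps w P 1 s2 ?s3" by (rule steps_1) (use c s1 s2 in auto)
 have r: "rel w t ?s3 (v, m(eval w a v m := eval w e v m))"
  using s1 s2 rel_less(1)[OF s2(1), of "Suc t"] by (auto simp: rel_def)
 from reach_det[OF steps_trans[OF steps_trans[OF s1(4) s2(5)] st] r refl] show ?case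
  using s1(2) s2(2) by (simp add: x add.assoc)
next
 case (Rnd r)
 obtain v m where x: "x = (v, m)" by fastforce
 have c: "pc s < length P" "P ! pc s = Rand r" using Rnd.prems(3) by auto
 show ?case proof (rule reachI)
  fix T G
  assume T: "!!y k. (y, k) : set_pmf (sem w (Rnd r) x) ==> k <= T"
   and G: "!!y k s'. (y, k) : set_pmf (sem w (Rnd r) x) ==> rel w t s' y ==> pc s' = pc s + csize (Rnd r) ==>
    map_pmf f (run w P (T - k) s') = G (y, k)"
  obtain T' where T': "T = Suc T'" using T[of "(v(r := 0), m)" 1] by (cases T) (force simp: x)+
  have "map_pmf f (run w P T s) = bind_pmf (pmf_of_set {..<2 ^ w}) (%y. map_pmf f (run w P T' (set_reg r y s)))"
   using c by (simp add: T' run.simps step_def halted_def bind_map_pmf map_bind_pmf)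
  also have "... = bind_pmf (pmf_of_set {..<2 ^ w}) (%y. G ((v(r := y), m), 1))" proof (rule bind_pmf_cong[OF refl])
   fix y assume "y : set_pmf (pmf_of_set {..<2 ^ w :: nat})"
   hence y: "y < 2 ^ w" by simp
   show "map_pmf f (run w P T' (set_reg r y s)) = G ((v(r := y), m), 1)"
    using G[of "(v(r := y), m)" 1 "set_reg r y s"] rel_set_reg[OF Rnd.prems(4)[unfolded x] y] y
    by (force simp: x set_reg_def T')
  qed
  finally show "map_pmf f (run w P T s) = bind_pmf (sem w (Rnd r) x) G" by (simp add: x bind_map_pmf)
 qed
next
 case (Seq c1 c2)
 have c: "code_at P (pc s) (ccode t (pc s) c1)" "code_at P (pc s + csize c1) (ccode t (pc s + csize c1) c2)"
  using Seq.prems(3) by (auto simp: code_at_append)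
 have "reach w P t f s' (sem w c2 x') (pc s + csize (c1 ;; c2))" if "rel w t s' x'" "pc s' = pc s + csize c1" for x' s'
  using Seq.IH(2)[OF _ _ _ that(1)] Seq.prems(1,2) c(2) that(2) by (simp add: add.assoc)
 with Seq.IH(1)[OF _ _ c(1) Seq.prems(4)] show ?case using Seq.prems(1,2) by (auto intro: reach_bind)
next
 case (Cond e c1 c2)
 obtain v m where x: "x = (v, m)" by fastforce
 have c: "code_at P (pc s) (ecode e t)" "pc s + esize e < length P"
  "P ! (pc s + esize e) = JumpZero t (pc s + esize e + 2 + csize c1)"
  "code_at P (pc s + esize e + 1) (ccode t (pc s + esize e + 1) c1)"
  "pc s + esize e + 1 + csize c1 < length P"
  "P ! (pc s + esize e + 1 + csize c1) = Jump (pc s + esize e + 2 + csize c1 + csize c2)"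
  "code_at P (pc s + esize e + 2 + csize c1) (ccode t (pc s + esize e + 2 + csize c1) c2)"
  using Cond.prems(3) by (auto simp: code_at_append)
 obtain s1 where s1: "rel w t s1 (v, m)" "pc s1 = pc s + esize e" "regs s1 t = eval w e v m" "steps w P (esize e) s s1"
  by (rule ecode_correct[OF Cond.prems(4)[unfolded x] c(1)]) (use Cond.prems in auto)
 let ?s2 = "s1\<lparr>pc := if eval w e v m = 0 then pc s + esize e + 2 + csize c1 else pc s + esize e + 1\<rparr>"
 have "steps w P 1 s1 ?s2" by (rule steps_1) (use c(2,3) s1(2,3) in auto)
 note st = reach_steps[OF steps_trans[OF s1(4) this]]
 have r2: "rel w t ?s2 (v, m)" using s1(1) by simp
 show ?case proof (cases "eval w e v m = 0")
  case True
  with st[OF Cond.IH(2)[OF _ _ _ r2]] Cond.prems(1,2) c(7) show ?thesis by (simp add: x algebra_simps)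
 next
  case False
  have "reach w P t f ?s2 (sem w c1 (v, m)) (pc s + esize e + 1 + csize c1)"
   using Cond.IH(1)[OF _ _ _ r2] Cond.prems(1,2) c(4) False by simp
  moreover have "reach w P t f s' (return_pmf (y, 0)) (pc s + csize (Cond e c1 c2))"
   if "rel w t s' y" "pc s' = pc s + esize e + 2 + csize c1 + csize c2" for s' y
   by (rule reach_return[OF that(1)]) (use that in simp)
  ultimately have "reach w P t f ?s2 (bind_pmf (sem w c1 (v, m)) (%(x, k). map_pmf (%(y, k'). (y, Suc (k + k'))) (return_pmf (x, 0))))
    (pc s + csize (Cond e c1 c2))" using c(5,6) by (intro reach_jump)
  from st[OF this] False show ?thesis
   by (simp add: x algebra_simps map_pmf_def bind_assoc_pmf bind_return_pmf case_prod_unfold)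
 qed
next
 case (For r e c)
 obtain v m where x: "x = (v, m)" by fastforce
 let ?n = "eval w e v m" and ?l = "pc s + esize e + 1"
 have c: "code_at P (pc s) (ecode e t)" "pc s + esize e < length P" "P ! (pc s + esize e) = Oper Or r t t"
  "?l < length P" "P ! ?l = JumpZero r (?l + 4 + csize c)" "Suc ?l < length P" "P ! (Suc ?l) = Const t 1"
  "Suc (Suc ?l) < length P" "P ! (Suc (Suc ?l)) = Oper Minus r r t" "code_at P (?l + 3) (ccode t (?l + 3) c)"
  "?l + 3 + csize c < length P" "P ! (?l + 3 + csize c) = Jump ?l"
  using For.prems(3) by (auto simp: code_at_append numeral_eq_Suc)
 obtain s1 where s1: "rel w t s1 (v, m)" "pc s1 = pc s + esize e" "regs s1 t = ?n" "steps w P (esize e) s s1"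
  by (rule ecode_correct[OF For.prems(4)[unfolded x] c(1)]) (use For.prems in auto)
 note lt = rel_less(1)[OF s1(1), of t]
 have st: "steps w P 1 s1 (set_reg r (regs s1 t) s1)" by (rule steps_1) (use c(2,3) s1(2) lt in auto)
 have rt: "r < t" "r ~: writes c" "loop_ok c" "cvars c <= {..<t}" using For.prems by auto
 have loop: "reach w P t f s (lsem (sem w c) r n y) (?l + 4 + csize c)"
  if "rel w t s y" "pc s = ?l" "fst y r = n" for n s y using that proof (induction n arbitrary: s y)
  case 0
  have "steps w P 1 s (s\<lparr>pc := ?l + 4 + csize c\<rparr>)" by (rule steps_1) (use 0 c(4,5) rt in "auto simp: rel_def")
  from reach_det[OF this, of t y _ f] 0(1) show ?case by simp
 next
  case (Suc n)
  let ?y1 = "((fst y)(r := n), snd y)" and ?sa = "s\<lparr>pc := Suc (pc s)\<rparr>"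
  let ?sb = "set_reg t (1 mod 2 ^ w) ?sa"
  let ?sc = "set_reg r n ?sb"
  have regr: "regs s r = Suc n" using Suc.prems(1,3) rt(1) by (simp add: rel_def)
  with rel_less(1)[OF Suc.prems(1), of r] have nw: "Suc n < 2 ^ w" by simp
  hence w: "1 < (2 :: nat) ^ w" and n: "(Suc n + 2 ^ w - 1) mod 2 ^ w = n" by simp_all
  have "steps w P 1 s ?sa" by (rule steps_1) (use Suc.prems(2) c(4,5) regr in auto)
  moreover have "steps w P 1 ?sa ?sb" by (rule steps_1) (use Suc.prems(2) c(6,7) in auto)
  moreover have "steps w P 1 ?sb ?sc" by (rule steps_1) (use Suc.prems(2) c(8,9) regr rt(1) w n in "auto simp: set_reg_def")
  ultimately have st: "steps w P (1 + 1 + 1) s ?sc" using steps_trans by blast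
  have "rel w t ?sb y" by (rule rel_set_temp) (use Suc.prems(1) w in simp_all)
  hence "rel w t ?sc ?y1" using rel_set_reg[of w t ?sb "fst y" "snd y" n r] nw by simp
  from For.IH[OF rt(3,4) _ this] have "reach w P t f ?sc (sem w c ?y1) (?l + 3 + csize c)"
   using c(10) Suc.prems(2) by (simp add: set_reg_def numeral_eq_Suc)
  from reach_steps[OF st reach_jump[OF this c(11,12), of "lsem (sem w c) r n", OF Suc.IH]] show ?case
   using sem_unwritten[OF _ rt(2)] by (simp add: map_bind_pmf pmf.map_comp o_def case_prod_unfold numeral_eq_Suc)
 qed
 have "reach w P t f (set_reg r (regs s1 t) s1) (lsem (sem w c) r ?n (v(r := ?n), m)) (?l + 4 + csize c)"
  using loop[OF rel_set_reg[OF s1(1) lt, of r]] s1(2,3) by (simp add: set_reg_def)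
 from reach_steps[OF steps_trans[OF s1(4) st] this] show ?case by (simp add: x numeral_eq_Suc add.assoc)
qed

section \<open>Triples for running times and success probabilities\<close>

definition hoare where "hoare w P c t Q \<longleftrightarrow> (ALL v m. P v m -->
   (ALL v' m' k. ((v', m'), k) : set_pmf (sem w c (v, m)) --> Q v' m' & k <= t))"

lemma hoareD:
 "hoare w P c t Q ==> P v m ==> ((v', m'), k) : set_pmf (sem w c (v, m)) ==> Q v' m' & k <= t" unfolding hoare_def by blast

lemma hoare_conseq:
 assumes "hoare w P c t Q" "!!v m. P' v m ==> P v m" "!!v m. Q v m ==> Q' v m" "t <= t'"
 shows "hoare w P' c t' Q'" using assms unfolding hoare_def by (meson le_trans)

lemma hoare_all:
 assumes "!!z. hoare w (P z) c t (Q z)"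
 shows "hoare w (%v m. EX z. P z v m) c t (%v m. EX z. Q z v m)" using assms unfolding hoare_def by blast

text \<open>Freezing the initial store makes it a pair of constants, on which a locale can then be
  interpreted.\<close>

lemma hoare_pre:
 assumes "!!v0 m0. P v0 m0 ==> hoare w (%v m. v = v0 & m = m0) c t Q"
 shows "hoare w P c t Q" using assms unfolding hoare_def by blast

lemma hoare_unwritten:
 assumes "hoare w P c t Q"
  and "!!v v' m. F v ==> (!!x. x ~: writes c ==> v' x = v x) ==> F v'"
 shows "hoare w (%v m. P v m & F v) c t (%v m. Q v m & F v)" unfolding hoare_def proof (intro allI impI)
 fix v m v' m' k
 assume 1: "P v m & F v" "((v', m'), k) : set_pmf (sem w c (v, m))"
 have "v' x = v x" if "x ~: writes c" for x using sem_unwritten[OF 1(2) that] by simp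
 thus "(Q v' m' & F v') & k <= t" using hoareD[OF assms(1) _ 1(2)] 1(1) assms(2)[of v v'] by blast
qed

lemma hoare_seq:
 assumes "hoare w P c1 t1 R" "hoare w R c2 t2 Q" "t1 + t2 <= t"
 shows "hoare w P (c1 ;; c2) t Q" unfolding hoare_def proof (intro allI impI)
 fix v m v' m' k
 assume 1: "P v m" "((v', m'), k) : set_pmf (sem w (c1 ;; c2) (v, m))"
 from 1(2) obtain v1 m1 k1 k2 where 2: "((v1, m1), k1) : set_pmf (sem w c1 (v, m))"
  "((v', m'), k2) : set_pmf (sem w c2 (v1, m1))" "k = k1 + k2" by (auto split: prod.splits)
 from hoareD[OF assms(1) 1(1) 2(1)] hoareD[OF assms(2) _ 2(2)] 2(3) assms(3)
 show "Q v' m' & k <= t" by auto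
qed

lemma hoare_cond:
 assumes "hoare w (%v m. P v m & eval w e v m ~= 0) c1 t1 Q"
  and "hoare w (%v m. P v m & eval w e v m = 0) c2 t1 Q" "esize e + 2 + t1 <= t"
 shows "hoare w P (Cond e c1 c2) t Q" unfolding hoare_def proof (intro allI impI)
 fix v m v' m' k
 assume 1: "P v m" "((v', m'), k) : set_pmf (sem w (Cond e c1 c2) (v, m))"
 show "Q v' m' & k <= t" proof (cases "eval w e v m = 0")
  case True
  with 1(2) obtain k2 where 2: "((v', m'), k2) : set_pmf (sem w c2 (v, m))" "k = esize e + 1 + k2" by auto
  with hoareD[OF assms(2) _ 2(1)] True 1(1) assms(3) show ?thesis by auto
 next
  case False
  with 1(2) obtain k2 where 2: "((v', m'), k2) : set_pmf (sem w c1 (v, m))" "k = esize e + 2 + k2" by auto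
  with hoareD[OF assms(1) _ 2(1)] False 1(1) assms(3) show ?thesis by auto
 qed
qed

lemma lsem_hoare:
 assumes "!!j v m. j < n ==> I (Suc j) v m ==> B j (v(r := j)) m"
  and "!!j. j < n ==> hoare w (B j) c t (I j)"
  and "I n v m" "((v', m'), k) : set_pmf (lsem (sem w c) r n (v, m))"
 shows "I 0 v' m' & k <= n * (t + 4) + 1" using assms proof (induction n arbitrary: v m k)
 case (Suc n)
 from Suc.prems(4) obtain v1 m1 k1 k2 where 2: "((v1, m1), k1) : set_pmf (sem w c (v(r := n), m))"
  "((v', m'), k2) : set_pmf (lsem (sem w c) r n (v1, m1))" "k = 4 + k1 + k2" by (auto split: prod.splits)
 have 3: "I n v1 m1 & k1 <= t" using hoareD[OF Suc.prems(2) _ 2(1)] Suc.prems(1,3) by blast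
 have "I 0 v' m' & k2 <= n * (t + 4) + 1" by (rule Suc.IH) (use Suc.prems 2 3 in auto)
 with 2 3 show ?case by auto
qed simp

lemma hoare_for:
 assumes "!!v m. P v m ==> eval w e v m = n & I n (v(r := n)) m"
  and "!!j v m. j < n ==> I (Suc j) v m ==> B j (v(r := j)) m"
  and "!!j. j < n ==> hoare w (B j) c t (I j)"
  and "!!v m. I 0 v m ==> Q v m"
  and "esize e + 2 + n * (t + 4) <= T"
 shows "hoare w P (For r e c) T Q" unfolding hoare_def proof (intro allI impI)
 fix v m v' m' k
 assume 1: "P v m" "((v', m'), k) : set_pmf (sem w (For r e c) (v, m))"
 with assms(1)[OF 1(1)] obtain k2 where
  "((v', m'), k2) : set_pmf (lsem (sem w c) r n (v(r := n), m))" "k = esize e + 1 + k2" by auto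
 with lsem_hoare[OF assms(2,3) _ this(1)] assms(1)[OF 1(1)] assms(4,5) show "Q v' m' & k <= T" by fastforce
qed

text \<open>Loops get \<open>False\<close>, as they are treated by \<open>hoare_for\<close> with
  explicit invariants; what remains is computed by simplification.\<close>

fun wp :: "nat => com => ((nat => nat) => (nat => nat) => bool) => (nat => nat) => (nat => nat) => bool" where
 "wp w Skip Q v m = Q v m"
| "wp w (Asg r e) Q v m = Q (v(r := eval w e v m)) m"
| "wp w (Sto a e) Q v m = Q v (m(eval w a v m := eval w e v m))"
| "wp w (Rnd r) Q v m = (ALL x<2 ^ w. Q (v(r := x)) m)"
| "wp w (c1 ;; c2) Q v m = wp w c1 (wp w c2 Q) v m"
| "wp w (Cond e c1 c2) Q v m = (if eval w e v m = 0 then wp w c2 Q v m else wp w c1 Q v m)"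
| "wp w (For r e c) Q v m = False"

text \<open>An upper bound only: both branches of a conditional are added up. The value 0 for a loop
  is sound because the precondition \<open>wp\<close> of a loop is \<open>False\<close>.\<close>

fun maxtime :: "com => nat" where
 "maxtime Skip = 0"
| "maxtime (Asg r e) = esize e + 1"
| "maxtime (Sto a e) = esize a + esize e + 1"
| "maxtime (Rnd r) = 1"
| "maxtime (c1 ;; c2) = maxtime c1 + maxtime c2"
| "maxtime (Cond e c1 c2) = esize e + 2 + maxtime c1 + maxtime c2"
| "maxtime (For r e c) = 0"

lemma wp_sound: "hoare w (wp w c Q) c (maxtime c) Q" proof (induction c arbitrary: Q)
 case (Seq c1 c2)
 show ?case by (rule hoare_conseq[OF hoare_seq[OF Seq.IH(1) Seq.IH(2) order_refl]]) auto
next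
 case (Cond e c1 c2)
 show ?case by (rule hoare_cond[of w _ e c1 "maxtime c1 + maxtime c2"])
    (auto intro: hoare_conseq[OF Cond.IH(1)] hoare_conseq[OF Cond.IH(2)])
qed (auto simp: hoare_def)

lemma hoare_wp:
 assumes "!!v m. P v m ==> wp w c Q v m" "maxtime c <= t"
 shows "hoare w P c t Q" using hoare_conseq[OF wp_sound] assms by blast

definition seqs where "seqs cs = foldr (;;) cs Skip"

lemma seqs_simps [simp]: "seqs [] = Skip" "seqs (c # cs) = c ;; seqs cs" by (simp_all add: seqs_def)

lemma writes_seqs: "writes (seqs cs) = (\<Union>c\<in>set cs. writes c)" by (induction cs) auto

lemma cvars_seqs: "cvars (seqs cs) = (\<Union>c\<in>set cs. cvars c)" by (induction cs) auto

lemma loop_ok_seqs: "loop_ok (seqs cs) \<longleftrightarrow> (ALL c:set cs. loop_ok c)" by (induction cs) auto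

lemma hoare_seqs:
 assumes "!!i. i < length cs ==> hoare w (I i) (cs ! i) t (I (Suc i))"
  and "!!v m. P v m ==> I 0 v m" "!!v m. I (length cs) v m ==> Q v m" "length cs * t <= T"
 shows "hoare w P (seqs cs) T Q" proof -
 have "hoare w (I 0) (seqs cs) (length cs * t) (I (length cs))" using assms(1) proof (induction cs arbitrary: I)
  case Nil
  thus ?case by (simp add: hoare_def)
 next
  case (Cons c cs)
  have "hoare w (I (Suc 0)) (seqs cs) (length cs * t) (I (Suc (length cs)))"
   by (rule Cons.IH[of "%i. I (Suc i)"]) (use Cons.prems in force)
  moreover have "hoare w (I 0) c t (I (Suc 0))" using Cons.prems[of 0] by simp
  ultimately show ?case by (auto intro!: hoare_seq)
 qed
 thus ?thesis by (rule hoare_conseq) (use assms in auto)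
qed

section \<open>Success probabilities of loop programs\<close>

definition outd where "outd w c s = map_pmf fst (sem w c s)"

fun ldist :: "(store => store pmf) => nat => nat => store => store pmf" where
 "ldist b r 0 s = return_pmf s"
| "ldist b r (Suc j) s = bind_pmf (b ((fst s)(r := j), snd s)) (ldist b r j)"

lemma map_fst_lsem: "map_pmf fst (lsem (sem w c) r n s) = ldist (outd w c) r n s" proof (induction n arbitrary: s)
 case (Suc n)
 have "bind_pmf (outd w c x) f = bind_pmf (sem w c x) (%y. f (fst y))" for x and f :: "store => store pmf"
  by (simp add: outd_def bind_map_pmf)
 thus ?case by (simp add: map_bind_pmf case_prod_unfold pmf.map_comp o_def Suc.IH)
qed simp

lemma outd_simps:
 "outd w Skip s = return_pmf s"
 "outd w (Asg r e) (v, m) = return_pmf (v(r := eval w e v m), m)"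
 "outd w (Sto a e) (v, m) = return_pmf (v, m(eval w a v m := eval w e v m))"
 "outd w (Rnd r) (v, m) = map_pmf (%x. (v(r := x), m)) (pmf_of_set {..<2 ^ w})"
 "outd w (c1 ;; c2) s = bind_pmf (outd w c1 s) (outd w c2)"
 "outd w (Cond e c1 c2) (v, m) = (if eval w e v m = 0 then outd w c2 (v, m) else outd w c1 (v, m))"
 "outd w (For r e c) (v, m) = ldist (outd w c) r (eval w e v m) (v(r := eval w e v m), m)" proof -
 show "outd w (For r e c) (v, m) = ldist (outd w c) r (eval w e v m) (v(r := eval w e v m), m)"
  by (simp add: outd_def[of w "For r e c"] pmf.map_comp o_def case_prod_unfold map_fst_lsem)
qed (simp_all add: outd_def pmf.map_comp o_def map_bind_pmf bind_map_pmf case_prod_unfold)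

lemma hoare_outd:
 assumes "hoare w P c t Q" "P v m" "x : set_pmf (outd w c (v, m))"
 shows "Q (fst x) (snd x)" proof -
 from assms(3) obtain k where "((fst x, snd x), k) : set_pmf (sem w c (v, m))" by (auto simp: outd_def)
 from hoareD[OF assms(1,2) this] show ?thesis by simp
qed

text \<open>Says nothing about time: worst-case time comes from \<open>hoare\<close>, and
  \<open>phoare_hoare\<close> joins the two.\<close>

definition phoare where "phoare w P c p Q \<longleftrightarrow> (ALL v m. P v m -->
   p <= prob (outd w c (v, m)) {x. Q (fst x) (snd x)})"

lemma prob_bind_pmf:
 "prob (bind_pmf M f) B = measure_pmf.expectation M (%x. prob (f x) B)" proof -
 have "prob (bind_pmf M f) B =
   enn2real (\<integral>\<^sup>+x. ennreal (prob (f x) B) \<partial>measure_pmf M)"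
  unfolding measure_def[of "measure_pmf (bind_pmf M f)"] emeasure_bind_pmf by (simp add: measure_pmf.emeasure_eq_measure)
 also have "... = measure_pmf.expectation M (%x. prob (f x) B)" by (intro integral_eq_nn_integral[symmetric]) auto
 finally show ?thesis .
qed

text \<open>Conditioning on \<open>A\<close>: a success probability \<open>q'\<close> on
  \<open>A\<close> and \<open>q\<close> elsewhere average to q + (q' - q) P(A), which grows with
  P(A). Sequencing is the case q = 0, q' = 1 or less; amplification is the case q' = 1.\<close>

lemma prob_bind_pmf_ge:
 assumes "p <= measure_pmf.prob M A" "0 <= q" "q <= q'"
  and "!!x. x : set_pmf M ==> q <= prob (f x) B"
  and "!!x. x : set_pmf M ==> x : A ==> q' <= prob (f x) B"
 shows "q + (q' - q) * p <= prob (bind_pmf M f) B" proof -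
 have "q + (q' - q) * p <= q + (q' - q) * measure_pmf.prob M A" using assms(1,3) by (simp add: mult_left_mono)
 also have "... = measure_pmf.expectation M (%x. q + (q' - q) * indicator A x)" by (subst Bochner_Integration.integral_add)
    (auto intro!: integrable_mult_right integrable_real_indicator simp: less_top[symmetric])
 also have "... <= measure_pmf.expectation M (%x. prob (f x) B)" proof (rule integral_mono_AE)
  show "AE x in measure_pmf M. q + (q' - q) * indicator A x <= prob (f x) B"
   using assms(4,5) by (auto simp: AE_measure_pmf_iff indicator_def)
  show "integrable (measure_pmf M) (%x. q + (q' - q) * indicator A x)"
   by (rule measure_pmf.integrable_const_bound[where B = "\<bar>q\<bar> + \<bar>q' - q\<bar>"]) (auto simp: indicator_def)
  show "integrable (measure_pmf M) (%x. prob (f x) B)" by (rule measure_pmf.integrable_const_bound[where B = 1]) auto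
 qed
 finally show ?thesis by (simp add: prob_bind_pmf)
qed

lemma phoare_conseq:
 assumes "phoare w P c p Q" "!!v m. P' v m ==> P v m" "!!v m. Q v m ==> Q' v m" "p' <= p"
 shows "phoare w P' c p' Q'" unfolding phoare_def proof (intro allI impI)
 fix v m assume "P' v m"
 hence "p <= prob (outd w c (v, m)) {x. Q (fst x) (snd x)}" using assms(1,2) unfolding phoare_def by blast
 also have "... <= prob (outd w c (v, m)) {x. Q' (fst x) (snd x)}"
  by (rule measure_pmf.finite_measure_mono) (use assms(3) in auto)
 finally show "p' <= prob (outd w c (v, m)) {x. Q' (fst x) (snd x)}" using assms(4) by simp
qed

lemma prob_eq_1I:
 assumes "!!x. x : set_pmf M ==> x : A"
 shows "measure_pmf.prob M A = 1" using assms by (simp add: measure_pmf.prob_eq_1 AE_measure_pmf_iff)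

lemma phoare_of_hoare:
 assumes "hoare w P c t Q"
 shows "phoare w P c 1 Q" unfolding phoare_def proof (intro allI impI)
 fix v m assume P: "P v m"
 have "Q (fst x) (snd x)" if "x : set_pmf (outd w c (v, m))" for x by (rule hoare_outd[OF assms P that])
 hence "prob (outd w c (v, m)) {x. Q (fst x) (snd x)} = 1" by (intro prob_eq_1I) simp
 thus "1 <= prob (outd w c (v, m)) {x. Q (fst x) (snd x)}" by simp
qed

lemma phoare_hoare:
 assumes "phoare w P c p Q" "hoare w P c t R"
 shows "phoare w P c p (%v m. Q v m & R v m)" unfolding phoare_def proof (intro allI impI)
 fix v m assume P: "P v m"
 have R: "R (fst x) (snd x)" if "x : set_pmf (outd w c (v, m))" for x by (rule hoare_outd[OF assms(2) P that])
 from P have "p <= prob (outd w c (v, m)) {x. Q (fst x) (snd x)}" using assms(1) unfolding phoare_def by blast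
 also have "... <= prob (outd w c (v, m)) {x. Q (fst x) (snd x) & R (fst x) (snd x)}"
  by (rule measure_pmf.finite_measure_mono_AE)
    (use R in "auto simp: AE_measure_pmf_iff")
 finally show "p <= prob (outd w c (v, m)) {x. Q (fst x) (snd x) & R (fst x) (snd x)}" .
qed

lemma phoare_seq:
 assumes "phoare w P c1 p R" "phoare w R c2 q Q" "0 <= q" "r <= p * q"
 shows "phoare w P (c1 ;; c2) r Q" unfolding phoare_def proof (intro allI impI)
 fix v m assume P: "P v m"
 have "0 + (q - 0) * p <= prob (outd w (c1 ;; c2) (v, m)) {x. Q (fst x) (snd x)}"
  unfolding outd_simps proof (rule prob_bind_pmf_ge)
  show "p <= prob (outd w c1 (v, m)) {x. R (fst x) (snd x)}" using assms(1) P unfolding phoare_def by blast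
  fix x assume "x : {x. R (fst x) (snd x)}"
  hence "R (fst x) (snd x)" by simp
  thus "q <= prob (outd w c2 x) {x. Q (fst x) (snd x)}" using assms(2) unfolding phoare_def by (metis prod.collapse)
 qed (use assms in auto)
 with assms(4) show "r <= prob (outd w (c1 ;; c2) (v, m)) {x. Q (fst x) (snd x)}" by (simp add: mult.commute)
qed

lemma ldist_hoare:
 assumes "!!j v m. j < n ==> I (Suc j) v m ==> B j (v(r := j)) m"
  and "!!j. j < n ==> hoare w (B j) c t (I j)"
  and "I n v m" "x : set_pmf (ldist (outd w c) r n (v, m))"
 shows "I 0 (fst x) (snd x)" proof -
 from assms(4) obtain k where "((fst x, snd x), k) : set_pmf (lsem (sem w c) r n (v, m))" by (auto simp flip: map_fst_lsem)
 from lsem_hoare[OF assms(1,2,3) this] show ?thesis by blast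
qed

text \<open>One good index suffices. The bound \<open>p\<close> for round \<open>i\<close> holds
  from every store that satisfies the invariant, so earlier rounds cannot spoil it, and once
  \<open>G\<close> holds, the later rounds preserve it.\<close>

lemma phoare_for_once:
 assumes "!!v m. P v m ==> eval w e v m = n & I n (v(r := n)) m"
  and "!!j v m. j < n ==> I (Suc j) v m ==> B j (v(r := j)) m"
  and "!!j v m. G v m ==> G (v(r := j)) m"
  and "!!j. j < n ==> hoare w (B j) c t (I j)"
  and "!!j. j < n ==> hoare w (%v m. B j v m & G v m) c t (%v m. I j v m & G v m)"
  and "i < n" "phoare w (B i) c p G" "0 <= p"
  and "!!v m. I 0 v m ==> G v m ==> Q v m"
 shows "phoare w P (For r e c) p Q" unfolding phoare_def proof (intro allI impI)
 fix v m assume P: "P v m"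
 have G1: "I 0 (fst x) (snd x) & G (fst x) (snd x)"
  if "j <= n" "I j v m" "G v m" "x : set_pmf (ldist (outd w c) r j (v, m))" for j v m x
  by (rule ldist_hoare[of j "%j v m. I j v m & G v m" "%j v m. B j v m & G v m" r w c t])
    (use that assms in auto)
 have "p <= prob (ldist (outd w c) r j (v, m)) {x. Q (fst x) (snd x)}"
  if "i < j" "j <= n" "I j v m" for j v m using that proof (induction j arbitrary: v m)
  case (Suc j)
  let ?Q = "{x. Q (fst x) (snd x)}"
  have B: "B j (v(r := j)) m" using Suc.prems assms(2) by auto
  have I: "I j (fst x) (snd x)" if "x : set_pmf (outd w c (v(r := j), m))" for x
   using hoare_outd[OF assms(4) B that] Suc.prems by simp
  show ?case proof (cases "j = i")
   case True
   have "0 + (1 - 0) * p <= prob (ldist (outd w c) r (Suc j) (v, m)) ?Q" unfolding ldist.simps proof (rule prob_bind_pmf_ge)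
    show "p <= prob (outd w c ((fst (v, m))(r := j), snd (v, m))) {x. G (fst x) (snd x)}"
     using assms(7) B True unfolding phoare_def by simp
    fix x assume x: "x : set_pmf (outd w c ((fst (v, m))(r := j), snd (v, m)))"
     "x : {x. G (fst x) (snd x)}"
    have "y : ?Q" if "y : set_pmf (ldist (outd w c) r j x)" for y
     using G1[of j "fst x" "snd x" y] that x I[of x] Suc.prems assms(9) by auto
    thus "1 <= prob (ldist (outd w c) r j x) ?Q" by (simp add: prob_eq_1I)
   qed auto
   thus ?thesis by simp
  next
   case False
   have "p + (p - p) * 0 <= prob (ldist (outd w c) r (Suc j) (v, m)) ?Q" unfolding ldist.simps proof (rule prob_bind_pmf_ge)
    fix x assume x: "x : set_pmf (outd w c ((fst (v, m))(r := j), snd (v, m)))"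
    thus "p <= prob (ldist (outd w c) r j x) ?Q" using Suc.IH[of "fst x" "snd x"] I[of x] Suc.prems False by auto
    thus "p <= prob (ldist (outd w c) r j x) ?Q" .
   qed (use assms(8) in auto)
   thus ?thesis by simp
  qed
 qed simp
 from this[of n "v(r := n)" m] assms(1)[OF P] assms(6)
 show "p <= prob (outd w (For r e c) (v, m)) {x. Q (fst x) (snd x)}" by (simp add: outd_simps)
qed

text \<open>Each round halves the failure probability, because its success bound 1/2 holds from
  every store that satisfies the invariant, whatever happened before.\<close>

lemma phoare_for_repeat:
 assumes "!!v m. P v m ==> eval w e v m = n & I n (v(r := n)) m"
  and "!!j v m. j < n ==> I (Suc j) v m ==> B j (v(r := j)) m"
  and "!!j v m. G v m ==> G (v(r := j)) m"
  and "!!j. j < n ==> hoare w (B j) c t (I j)"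
  and "!!j. j < n ==> hoare w (%v m. B j v m & G v m) c t (%v m. I j v m & G v m)"
  and "!!j. j < n ==> phoare w (B j) c (1/2) G"
  and "!!v m. I 0 v m ==> G v m ==> Q v m"
 shows "phoare w P (For r e c) (1 - 1 / 2 ^ n) Q" unfolding phoare_def proof (intro allI impI)
 fix v m assume P: "P v m"
 have G1: "I 0 (fst x) (snd x) & G (fst x) (snd x)"
  if "j <= n" "I j v m" "G v m" "x : set_pmf (ldist (outd w c) r j (v, m))" for j v m x
  by (rule ldist_hoare[of j "%j v m. I j v m & G v m" "%j v m. B j v m & G v m" r w c t])
    (use that assms in auto)
 have "1 - 1 / 2 ^ j <= prob (ldist (outd w c) r j (v, m)) {x. Q (fst x) (snd x)}"
  if "j <= n" "I j v m" for j v m using that proof (induction j arbitrary: v m)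
  case (Suc j)
  let ?Q = "{x. Q (fst x) (snd x)}"
  have B: "B j (v(r := j)) m" using Suc.prems assms(2) by auto
  have I: "I j (fst x) (snd x)" if "x : set_pmf (outd w c (v(r := j), m))" for x
   using hoare_outd[OF assms(4) B that] Suc.prems by simp
  have "(1 - 1 / 2 ^ j) + (1 - (1 - 1 / 2 ^ j)) * (1 / 2) <=
    prob (ldist (outd w c) r (Suc j) (v, m)) ?Q" unfolding ldist.simps proof (rule prob_bind_pmf_ge)
   show "1 / 2 <= prob (outd w c ((fst (v, m))(r := j), snd (v, m))) {x. G (fst x) (snd x)}"
    using assms(6)[of j] B Suc.prems unfolding phoare_def by simp
   fix x assume x: "x : set_pmf (outd w c ((fst (v, m))(r := j), snd (v, m)))"
   thus "1 - 1 / 2 ^ j <= prob (ldist (outd w c) r j x) ?Q" using Suc.IH[of "fst x" "snd x"] I[of x] Suc.prems by auto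
   assume "x : {x. G (fst x) (snd x)}"
   hence "y : ?Q" if "y : set_pmf (ldist (outd w c) r j x)" for y
    using G1[of j "fst x" "snd x" y] that x I[of x] Suc.prems assms(7) by auto
   thus "1 <= prob (ldist (outd w c) r j x) ?Q" by (simp add: prob_eq_1I)
  qed (auto simp: field_simps)
  thus ?case by (simp add: field_simps)
 qed simp
 from this[of n "v(r := n)" m] assms(1)[OF P]
 show "1 - 1 / 2 ^ n <= prob (outd w (For r e c) (v, m)) {x. Q (fst x) (snd x)}" by (simp add: outd_simps)
qed

definition fill where "fill b r e z = For r e (Rnd z ;; Sto (Bin Plus (Var b) (Var r)) (Var z))"

text \<open>The loop counts down and round \<open>j\<close> writes cell \<open>j\<close> only. A
  written cell is therefore final, and the cells are independent words.\<close>

lemma fill_dist: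
 assumes "b ~= r" "b ~= z" "r ~= z" "eval w e v m = n" "v b + n <= 2 ^ w"
 shows "map_pmf (%x i. if i < n then snd x (v b + i) else 0) (outd w (fill b r e z) (v, m)) =
  Pi_pmf {..<n} 0 (%_. pmf_of_set {..<2 ^ w})" proof -
 let ?c = "Rnd z ;; Sto (Bin Plus (Var b) (Var r)) (Var z)"
 let ?U = "pmf_of_set {..<2 ^ w :: nat}"
 have body: "outd w ?c (u(r := j), m) = map_pmf (%x. (u(r := j, z := x), m(u b + j := x))) ?U"
  if "j < n" "u b = v b" for u m j using that assms
  by (simp add: outd_simps bind_map_pmf map_pmf_def bind_return_pmf bind_assoc_pmf)
 have keep: "snd x (v b + i) = m (v b + i)"
  if "x : set_pmf (ldist (outd w ?c) r j (u, m))" "j <= i" "i < n" "u b = v b" for x j u m i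
  using that proof (induction j arbitrary: u m)
  case (Suc j)
  then obtain y where "x : set_pmf (ldist (outd w ?c) r j (u(r := j, z := y), m(v b + j := y)))" using body[of j u m] by auto
  from Suc.IH[OF this] Suc.prems assms show ?case by simp
 qed simp
 have "map_pmf (%x i. if i < j then snd x (v b + i) else 0) (ldist (outd w ?c) r j (u, m)) =
   Pi_pmf {..<j} 0 (%_. ?U)" if "j <= n" "u b = v b" for j u m using that proof (induction j arbitrary: u m)
  case 0
  thus ?case by simp
 next
  case (Suc j)
  let ?s = "%y. (u(r := j, z := y), m(v b + j := y))"
  have "map_pmf (%x i. if i < Suc j then snd x (v b + i) else 0) (ldist (outd w ?c) r (Suc j) (u, m)) =
    bind_pmf ?U (%y. map_pmf (%x i. if i < Suc j then snd x (v b + i) else 0)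
     (ldist (outd w ?c) r j (?s y)))" using body[of j u m] Suc.prems by (simp add: bind_map_pmf map_bind_pmf)
  also have "... = bind_pmf ?U (%y. map_pmf (%f. f(j := y))
    (map_pmf (%x i. if i < j then snd x (v b + i) else 0) (ldist (outd w ?c) r j (?s y))))"
  proof (rule bind_pmf_cong[OF refl])
   fix y
   show "map_pmf (%x i. if i < Suc j then snd x (v b + i) else 0) (ldist (outd w ?c) r j (?s y)) =
    map_pmf (%f. f(j := y))
     (map_pmf (%x i. if i < j then snd x (v b + i) else 0) (ldist (outd w ?c) r j (?s y)))"
    unfolding pmf.map_comp proof (rule map_pmf_cong[OF refl])
    fix x assume "x : set_pmf (ldist (outd w ?c) r j (?s y))"
    from keep[OF this, of j] Suc.prems assms
    show "(%i. if i < Suc j then snd x (v b + i) else 0) =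
     ((%f. f(j := y)) \<circ> (%x i. if i < j then snd x (v b + i) else 0)) x" by (auto simp: fun_eq_iff less_Suc_eq)
   qed
  qed
  also have "... = bind_pmf ?U (%y. map_pmf (%f. f(j := y)) (Pi_pmf {..<j} 0 (%_. ?U)))"
   using Suc.IH Suc.prems assms by (intro bind_pmf_cong refl arg_cong2[where f = map_pmf]) auto
  also have "... = Pi_pmf (insert j {..<j}) 0 (%_. ?U)" by (subst Pi_pmf_insert') (auto simp: map_pmf_def)
  also have "insert j {..<j} = {..<Suc j}" by auto
  finally show ?case .
 qed
 from this[of n "v(r := n)" m] assms show ?thesis by (simp add: fill_def outd_simps)
qed

text \<open>Turns a probability into a count of tables, so that the estimates for the hashing are
  finite counting.\<close>

lemma fill_prob:
 assumes "b ~= r" "b ~= z" "r ~= z" "eval w e v m = n" "v b + n <= 2 ^ w"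
  and "A <= PiE_dflt {..<n} 0 (%_. {..<2 ^ w})" "p * real ((2 ^ w) ^ n) <= real (card A)"
 shows "p <= prob (outd w (fill b r e z) (v, m))
  {x. (%i. if i < n then snd x (v b + i) else 0) : A}" proof -
 let ?X = "PiE_dflt {..<n} 0 (%_. {..<2 ^ w :: nat})"
 have fin: "finite ?X" by (intro finite_PiE_dflt) auto
 have ne: "?X ~= {}" by (auto simp: PiE_dflt_def intro!: exI[of _ "%_. 0"])
 have card: "card ?X = (2 ^ w) ^ n" by (subst card_PiE_dflt) auto
 have "p <= real (card A) / real (card ?X)" using assms(7) by (simp add: card field_simps)
 also have "... = prob (pmf_of_set ?X) A" using measure_pmf_of_set[OF ne fin, of A] assms(6) by (simp add: Int_absorb1)
 also have "pmf_of_set ?X = map_pmf (%x i. if i < n then snd x (v b + i) else 0) (outd w (fill b r e z) (v, m))"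
  using fill_dist[OF assms(1-5)] by (subst (asm) Pi_pmf_of_set) (auto simp: lessThan_empty_iff)
 finally show ?thesis by (simp add: vimage_def)
qed

section \<open>Random potentials\<close>

lemma card_nat_interval_le:
 fixes R :: "nat set" and c d :: int
 assumes "0 < c" "0 < d" "!!x y. x : R ==> y : R ==> c * (int x - int y) < d"
 shows "finite R & c * int (card R) < d + c" proof (cases "R = {}")
 case False
 define x where "x = (LEAST x. x : R)"
 have x: "x : R" "!!y. y : R ==> x <= y" using False unfolding x_def by (auto intro: LeastI Least_le)
 define D where "D = nat ((d - 1) div c)"
 have "R <= {x..x + D}" proof
  fix y assume y: "y : R"
  hence "c * (int y - int x) <= d - 1" using assms(3) x by fastforce
  from zdiv_mono1[OF this `0 < c`] have "int y - int x <= (d - 1) div c" using `0 < c` by simp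
  thus "y : {x..x + D}" using x(2)[OF y] by (auto simp: D_def)
 qed
 hence fin: "finite R" and "card R <= D + 1" using finite_subset card_mono[of "{x..x + D}" R] by auto
 hence "c * int (card R) <= c * (int D + 1)" using `0 < c` by (intro mult_left_mono) auto
 also have "c * ((d - 1) div c) = d - 1 - (d - 1) mod c" by (simp add: minus_mod_eq_mult_div)
 hence "c * int D <= d - 1"
  using assms(1,2) pos_mod_sign[of c "d - 1"] by (simp add: D_def pos_imp_zdiv_nonneg_iff del: pos_mod_sign)
 hence "c * (int D + 1) < d + c" by (simp add: algebra_simps)
 finally show ?thesis using fin by simp
qed (use assms in auto)

text \<open>Let b = |c|. The values r b stay in [0, b M), so they come near at most b + 1 multiples
  of \<open>M\<close>, and near each of them for at most about 2 X / b + 1 values of r. With b <= X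
  the product is at most 6 X. If X > M the trivial bound \<open>M\<close> is enough.\<close>

lemma card_multiples_near_0:
 fixes X M c :: int
 assumes c: "c ~= 0" "\<bar>c\<bar> <= X" and M: "0 < M"
 shows "int (card {r. int r < M & (EX q. \<bar>int r * c - q * M\<bar> < X)}) <= 6 * X" proof (cases "X <= M")
 case False
 have "{r. int r < M & (EX q. \<bar>int r * c - q * M\<bar> < X)} <= {..<nat M}" by auto
 from card_mono[OF _ this] M False show ?thesis by simp
next
 case True
 define b where "b = \<bar>c\<bar>"
 have b: "0 < b" "b <= X" using c by (auto simp: b_def)
 define R where "R q = {r. \<bar>int r * b - q * M\<bar> < X}" for q
 have R: "finite (R q) & b * int (card (R q)) < 2 * X + b" for q
  by (rule card_nat_interval_le) (use b in "auto simp: R_def algebra_simps abs_less_iff")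
 have "{r. int r < M & (EX q. \<bar>int r * c - q * M\<bar> < X)} <= (\<Union>q\<in>{0..b}. R q)" proof
  fix r assume "r : {r. int r < M & (EX q. \<bar>int r * c - q * M\<bar> < X)}"
  then obtain q where r: "int r < M" "\<bar>int r * c - q * M\<bar> < X" by auto
  then obtain q' where q: "\<bar>int r * b - q' * M\<bar> < X" proof (cases "c >= 0")
   case False
   hence "\<bar>int r * b - (- q) * M\<bar> < X" using r by (auto simp: b_def algebra_simps)
   thus ?thesis using that by blast
  qed (auto simp: b_def)
  have "0 <= q'" proof (rule ccontr)
   assume "~ 0 <= q'"
   hence "q' * M <= - 1 * M" using M by (intro mult_right_mono) auto
   moreover have "0 <= int r * b" using b by simp
   ultimately show False using q True by linarith
  qed
  moreover have "q' <= b" proof (rule ccontr)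
   assume "~ q' <= b"
   hence "(b + 1) * M <= q' * M" using M by (intro mult_right_mono) auto
   moreover have "int r * b <= M * b" using b r by (intro mult_right_mono) auto
   ultimately show False using q True by (simp add: algebra_simps)
  qed
  ultimately show "r : (\<Union>q\<in>{0..b}. R q)" using q by (auto simp: R_def)
 qed
 hence "card {r. int r < M & (EX q. \<bar>int r * c - q * M\<bar> < X)} <= card (\<Union>q\<in>{0..b}. R q)"
  using R by (intro card_mono) auto
 also have "... <= (SUM q:{0..b}. card (R q))" by (rule card_UN_le) simp
 finally have "b * int (card {r. int r < M & (EX q. \<bar>int r * c - q * M\<bar> < X)}) <=
   b * int (SUM q:{0..b}. card (R q))" using b by (intro mult_left_mono) (simp_all only: of_nat_le_iff)
 also have "... = (SUM q:{0..b}. b * int (card (R q)))" by (simp add: sum_distrib_left)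
 also have "... <= (SUM q:{0..b}. 2 * X + b)" using R by (intro sum_mono) (auto intro: less_imp_le)
 also have "... = (b + 1) * (2 * X + b)" using b by simp
 also have "... <= (2 * b) * (3 * X)" using b by (intro mult_mono) auto
 finally have "b * int (card {r. int r < M & (EX q. \<bar>int r * c - q * M\<bar> < X)}) <= b * (6 * X)"
  by (simp add: algebra_simps)
 thus ?thesis using b by simp
qed

definition prs :: "nat => (nat \<times> nat) set" where
 "prs k = {(p, l). l < p & p < k}"

lemma finite_prs [simp]: "finite (prs k)" by (rule finite_subset[of _ "{..<k} \<times> {..<k}"]) (auto simp: prs_def)

lemma sum_prs: "(SUM (p, l):prs k. f p l) = (SUM p<k. SUM l<p. f p l)" proof -
 have "prs k = Sigma {..<k} lessThan" by (auto simp: prs_def)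
 thus ?thesis by (simp add: sum.Sigma)
qed

lemma sum_prs_both:
 fixes f :: "nat => nat => 'a :: comm_monoid_add"
 shows "(SUM (p, l):prs k. f p l + f l p) = (SUM p<k. SUM l:{..<k} - {p}. f p l)" proof -
 let ?S = "{(p, l). p < k & l < k & l ~= p}"
 have fin: "finite ?S" by (rule finite_subset[of _ "{..<k} \<times> {..<k}"]) auto
 have 1: "?S = prs k \<union> prod.swap ` prs k" by (auto simp: prs_def image_iff)
 have "(SUM p<k. SUM l:{..<k} - {p}. f p l) = (SUM (p, l):Sigma {..<k} (%p. {..<k} - {p}). f p l)" by (simp add: sum.Sigma)
 also have "Sigma {..<k} (%p. {..<k} - {p}) = ?S" by auto
 also have "(SUM (p, l):?S. f p l) = (SUM (p, l):prs k. f p l) + (SUM (p, l):prod.swap ` prs k. f p l)"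
  unfolding 1 by (rule sum.union_disjoint) (simp_all, auto simp: prs_def)
 also have "(SUM (p, l):prod.swap ` prs k. f p l) = (SUM (p, l):prs k. f l p)"
  by (subst sum.reindex) (auto intro!: inj_onI sum.cong)
 finally show ?thesis by (simp add: sum.distrib case_prod_unfold)
qed

lemma card_prs: "card (prs k) = k choose 2" proof -
 have "card (prs k) = (SUM (p, l):prs k. 1)" by (simp add: case_prod_unfold)
 also have "... = (SUM p<k. p)" unfolding sum_prs by simp
 also have "... = k choose 2" by (induction k) (auto simp: numeral_2_eq_2)
 finally show ?thesis .
qed

text \<open>
 \<open>Y om p l u\<close> is the random potential of the copy of vertex \<open>u\<close> in part \<open>p\<close> towards part \<open>l\<close>.
 The potentials of a copy sum to zero over \<open>l\<close>, so they do not change the total weight of a clique.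
\<close>

locale hash =
 fixes W k a n :: nat and wt :: "nat => nat => int"
 assumes k: "3 <= k" and aW: "a <= W" and n: "0 < n"
begin

text \<open>Layout of the random table: cell 0 is the multiplier of the weights, and the potentials
  follow.\<close>

definition gi where "gi p l u = 1 + (p * k + l) * n + u"

definition len where "len = 1 + k * k * n"

text \<open>The part towards which the potential of a copy is not free but makes the sum over all
  other parts vanish. In \<open>Y\<close> the random word of that entry cancels against
  itself.\<close>

definition j0 :: "nat => nat" where
 "j0 p = (if p = 0 then 1 else 0)"

definition Y where "Y om p l u = int (om (gi p l u)) -
   (if l = j0 p then \<Sum>l'\<in>{..<k} - {p}. int (om (gi p l' u)) else 0)"

definition Z where "Z om p l u v = int (om 0) * wt u v + Y om p l u + Y om l p v"

text \<open>The leading \<open>a\<close> bits of \<open>z\<close> as a \<open>W\<close>-bit word,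
  with negative numbers in two's complement.\<close>

definition bkt where "bkt z = nat (z div 2 ^ (W - a) mod 2 ^ a)"

definition weight where "weight x = (SUM (p, l):prs k. wt (x p) (x l))"

definition \<Omega> :: "(nat => nat) set" where
 "\<Omega> = PiE_dflt {..<len} 0 (%_. {..<2 ^ W})"

lemma finite_\<Omega> [simp]: "finite \<Omega>" unfolding \<Omega>_def by (intro finite_PiE_dflt) auto

lemma card_\<Omega>: "card \<Omega> = (2 ^ W) ^ len" unfolding \<Omega>_def by (subst card_PiE_dflt) auto

lemma sum_Y:
 assumes "p < k"
 shows "(SUM l:{..<k} - {p}. Y om p l u) = 0" proof -
 have "j0 p : {..<k} - {p}" using k assms by (auto simp: j0_def)
 thus ?thesis by (simp add: Y_def sum_subtractf)
qed

text \<open>Each chosen copy meets every other part exactly once, so its potentials enter with their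
  full sum, which is zero.\<close>

lemma sum_Z: "(SUM (p, l):prs k. Z om p l (x p) (x l)) = int (om 0) * weight x" proof -
 have "(SUM (p, l):prs k. Z om p l (x p) (x l)) =
   int (om 0) * weight x + (SUM (p, l):prs k. Y om p l (x p) + Y om l p (x l))"
  by (simp add: Z_def weight_def sum.distrib sum_distrib_left case_prod_unfold)
 also have "(SUM (p, l):prs k. Y om p l (x p) + Y om l p (x l)) = 0" by (subst sum_prs_both) (simp add: sum_Y)
 finally show ?thesis by simp
qed

lemma bkt_less: "bkt z < 2 ^ a" by (simp add: bkt_def nat_less_iff)

lemma bkt_cong:
 assumes "[z = z'] (mod 2 ^ W)"
 shows "bkt z = bkt z'" proof -
 have W: "(2 :: int) ^ W = 2 ^ (W - a) * 2 ^ a" using aW by (simp flip: power_add)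
 have "z div 2 ^ (W - a) mod 2 ^ a = (z mod 2 ^ W) div 2 ^ (W - a)" for z :: int unfolding W by (subst zmod_zmult2_eq) auto
 thus ?thesis using assms by (simp add: bkt_def cong_def)
qed

lemma bkt_shift: "bkt (z + int d * 2 ^ (W - a)) = (bkt z + d) mod 2 ^ a" proof -
 have "(z div 2 ^ (W - a) + int d) mod 2 ^ a = (int (bkt z) + int d) mod 2 ^ a" by (simp add: bkt_def mod_simps)
 also have "... = int ((bkt z + d) mod 2 ^ a)" by (simp add: zmod_int)
 also have "(z div 2 ^ (W - a) + int d) = (z + int d * 2 ^ (W - a)) div 2 ^ (W - a)" by simp
 finally show ?thesis unfolding bkt_def[of "z + int d * 2 ^ (W - a)"] by simp
qed

lemma bkt_decomp:
 obtains x where "0 <= x" "x < 2 ^ (W - a)" "[z = int (bkt z) * 2 ^ (W - a) + x] (mod 2 ^ W)" proof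
 let ?x = "z mod 2 ^ (W - a)"
 have W: "(2 :: int) ^ W = 2 ^ (W - a) * 2 ^ a" using aW by (simp flip: power_add)
 show "0 <= ?x" "?x < 2 ^ (W - a)" by auto
 have "z = z div 2 ^ (W - a) * 2 ^ (W - a) + ?x" by (simp only: div_mult_mod_eq)
 moreover have "[z div 2 ^ (W - a) * 2 ^ (W - a) = int (bkt z) * 2 ^ (W - a)] (mod 2 ^ W)" proof -
  have "(y * 2 ^ (W - a)) mod 2 ^ W = 2 ^ (W - a) * (y mod 2 ^ a)" for y :: int
   unfolding W mult.commute[of y] by (rule mult_mod_right[symmetric])
  thus ?thesis by (simp add: cong_def bkt_def)
 qed
 ultimately show "[z = int (bkt z) * 2 ^ (W - a) + ?x] (mod 2 ^ W)" by (metis cong_add_rcancel)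
qed

definition gp where "gp i = (i - 1) div n div k"
definition gl where "gl i = (i - 1) div n mod k"
definition gu where "gu i = (i - 1) mod n"

lemma gi_inverse [simp]:
 assumes "p < k" "l < k" "u < n"
 shows "gp (gi p l u) = p" "gl (gi p l u) = l" "gu (gi p l u) = u" "0 < gi p l u" "gi p l u < len" proof -
 have 1: "((p * k + l) * n + u) div n = p * k + l" using assms by simp
 show "gp (gi p l u) = p" "gl (gi p l u) = l" "gu (gi p l u) = u" "0 < gi p l u"
  using assms unfolding gp_def gl_def gu_def gi_def by (simp_all add: 1)
 have "p * k + l + 1 <= p * k + k" using assms by simp
 also have "... = Suc p * k" by simp
 also have "... <= k * k" using assms by (intro mult_right_mono) auto
 finally have "(p * k + l + 1) * n <= k * k * n" by (rule mult_right_mono) simp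
 thus "gi p l u < len" using assms by (simp add: gi_def len_def)
qed

text \<open>Adds \<open>y p l\<close> to the potentials of the copies \<open>x p\<close> with
  \<open>p\<close> in \<open>A\<close> and touches nothing else. As an addition modulo
  \<open>2 ^ W\<close> it is injective on the tables, which is what replaces independence.\<close>

definition sh where "sh A x y om = (%i. if 0 < i & i < len & gp i : A & gu i = x (gp i) & gl i ~= gp i
   then nat ((int (om i) + y (gp i) (gl i)) mod 2 ^ W) else om i)"

lemma sh_0 [simp]: "sh A x y om 0 = om 0" by (simp add: sh_def)

lemma sh_in_\<Omega>: "om : \<Omega> ==> sh A x y om : \<Omega>"
 by (auto simp: \<Omega>_def PiE_dflt_def sh_def nat_less_iff)

lemma sh_inj:
 assumes "om : \<Omega>" "om' : \<Omega>" "sh A x y om = sh A x y om'"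
 shows "om = om'" proof
 fix i
 show "om i = om' i" proof (cases "0 < i & i < len & gp i : A & gu i = x (gp i) & gl i ~= gp i")
  case True
  hence "(int (om i) + y (gp i) (gl i)) mod 2 ^ W = (int (om' i) + y (gp i) (gl i)) mod 2 ^ W"
   using fun_cong[OF assms(3), of i] by (simp add: sh_def eq_nat_nat_iff)
  hence "int (om i) mod 2 ^ W = int (om' i) mod 2 ^ W"
   using cong_add_rcancel[of "int (om i)" "y (gp i) (gl i)" "int (om' i)" "2 ^ W"] by (simp add: cong_def)
  moreover have "int (om i) < 2 ^ W" "int (om' i) < 2 ^ W" using True assms(1,2) by (auto simp: \<Omega>_def PiE_dflt_def)
  ultimately show ?thesis by simp
 qed (use fun_cong[OF assms(3), of i] in "auto simp: sh_def")
qed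

lemma sh_gi:
 assumes "p < k" "l < k" "u < n" "l ~= p"
 shows "[int (sh A x y om (gi p l u)) =
  int (om (gi p l u)) + (if p : A & u = x p then y p l else 0)] (mod 2 ^ W)" using assms by (simp add: sh_def cong_def)

text \<open>The dependent entry \<open>j0 p\<close> also shifts by exactly \<open>y\<close>, because
  the sum that it subtracts changes by the sum of the \<open>y p l\<close>, which is zero.\<close>

lemma Y_sh:
 assumes "p < k" "l < k" "u < n" "l ~= p"
  and 0: "!!p. p : A ==> (SUM l:{..<k} - {p}. y p l) = 0"
 shows "[Y (sh A x y om) p l u = Y om p l u + (if p : A & u = x p then y p l else 0)] (mod 2 ^ W)" proof -
 let ?d = "%l. if p : A & u = x p then y p l else 0"
 have "[(\<Sum>l'\<in>{..<k} - {p}. int (sh A x y om (gi p l' u))) =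
   (\<Sum>l'\<in>{..<k} - {p}. int (om (gi p l' u)) + ?d l')] (mod 2 ^ W)" by (rule cong_sum) (use assms sh_gi in auto)
 also have "(\<Sum>l'\<in>{..<k} - {p}. int (om (gi p l' u)) + ?d l') = (\<Sum>l'\<in>{..<k} - {p}. int (om (gi p l' u)))"
  using 0 by (cases "p : A & u = x p") (auto simp: sum.distrib)
 finally have 1: "[(\<Sum>l'\<in>{..<k} - {p}. int (sh A x y om (gi p l' u))) =
   (\<Sum>l'\<in>{..<k} - {p}. int (om (gi p l' u)))] (mod 2 ^ W)" .
 have "[(if l = j0 p then \<Sum>l'\<in>{..<k} - {p}. int (sh A x y om (gi p l' u)) else 0) =
   (if l = j0 p then \<Sum>l'\<in>{..<k} - {p}. int (om (gi p l' u)) else 0)] (mod 2 ^ W)" using 1 by (auto split: if_splits)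
 from cong_diff[OF sh_gi[OF assms(1-4), of A x y om] this]
 show ?thesis by (simp add: Y_def algebra_simps)
qed

lemma Z_sh:
 assumes "p < k" "l < k" "u < n" "v < n" "l ~= p"
  and 0: "!!p. p : A ==> (SUM l:{..<k} - {p}. y p l) = 0"
 shows "[Z (sh A x y om) p l u v = Z om p l u v + ((if p : A & u = x p then y p l else 0) +
  (if l : A & v = x l then y l p else 0))] (mod 2 ^ W)" proof -
 have "[Y (sh A x y om) p l u + Y (sh A x y om) l p v =
   (Y om p l u + (if p : A & u = x p then y p l else 0)) +
   (Y om l p v + (if l : A & v = x l then y l p else 0))] (mod 2 ^ W)" by (rule cong_add[OF Y_sh Y_sh]) (use assms in auto)
 hence "[int (om 0) * wt u v + (Y (sh A x y om) p l u + Y (sh A x y om) l p v) =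
   int (om 0) * wt u v + ((Y om p l u + (if p : A & u = x p then y p l else 0)) +
   (Y om l p v + (if l : A & v = x l then y l p else 0)))] (mod 2 ^ W)" by (rule cong_add[OF cong_refl])
 thus ?thesis by (simp add: Z_def algebra_simps)
qed

text \<open>For every choice \<delta> of bucket offsets on \<open>F\<close>, the shift moves the
  bucket of each edge of \<open>x\<close> by \<delta> and leaves those of \<open>s\<close>, since
  \<open>x\<close> and \<open>s\<close> differ on \<open>A\<close>. On \<open>B\<close> the two
  buckets agreed, so \<delta> can be read off the shifted table. Thus
  \<open>2 ^ (a * card F)\<close> disjoint copies of \<open>B\<close> fit among the tables;
  \<open>Q\<close> survives because cell 0 is not shifted.\<close>

lemma shift_count:
 assumes x: "!!p. p < k ==> x p < n" and s: "!!p. p < k ==> s p < n"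
  and A: "!!p. p : A ==> x p ~= s p"
  and F: "F <= prs k"
  and 0: "!!\<delta> p. p : A ==> (SUM l:{..<k} - {p}. y \<delta> p l) = 0"
  and y: "!!\<delta> p l. (p, l) : F ==> (if p : A then y \<delta> p l else 0) + (if l : A then y \<delta> l p else 0) =
   int (\<delta> (p, l)) * 2 ^ (W - a)"
  and B: "!!om. om : B ==> om : \<Omega> & Q (om 0)"
   "!!om p l. om : B ==> (p, l) : F ==> bkt (Z om p l (x p) (x l)) = bkt (Z om p l (s p) (s l))"
 shows "card B * 2 ^ (a * card F) <= card {om : \<Omega>. Q (om 0)}" proof -
 let ?\<Delta> = "F \<rightarrow>\<^sub>E {..<2 ^ a :: nat}"
 let ?f = "%(\<delta>, om). sh A x (y \<delta>) om"
 have fF: "finite F" using F by (rule finite_subset) simp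
 have "inj_on ?f (?\<Delta> \<times> B)" proof (rule inj_onI, clarify)
  fix \<delta> om \<delta>' om'
  assume 1: "\<delta> : ?\<Delta>" "\<delta>' : ?\<Delta>" "om : B" "om' : B" and eq: "sh A x (y \<delta>) om = sh A x (y \<delta>') om'"
  have rec: "(bkt (Z (sh A x (y \<delta>) om) p l (s p) (s l)) + \<delta> (p, l)) mod 2 ^ a =
    bkt (Z (sh A x (y \<delta>) om) p l (x p) (x l))"
   if pl: "(p, l) : F" and om: "om : B" for p l \<delta> om proof -
   have pl': "p < k" "l < k" "l ~= p" using pl F by (auto simp: prs_def)
   have no: "~ (p : A & s p = x p)" "~ (l : A & s l = x l)" using A[of p] A[of l] by auto
   have "[Z (sh A x (y \<delta>) om) p l (s p) (s l) = Z om p l (s p) (s l) +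
     ((if p : A & s p = x p then y \<delta> p l else 0) + (if l : A & s l = x l then y \<delta> l p else 0))] (mod 2 ^ W)"
    by (rule Z_sh) (use pl' s 0 in auto)
   hence "[Z (sh A x (y \<delta>) om) p l (s p) (s l) = Z om p l (s p) (s l)] (mod 2 ^ W)"
    unfolding if_not_P[OF no(1)] if_not_P[OF no(2)] by simp
   moreover have "[Z (sh A x (y \<delta>) om) p l (x p) (x l) =
     Z om p l (x p) (x l) + int (\<delta> (p, l)) * 2 ^ (W - a)] (mod 2 ^ W)"
    using Z_sh[of p l "x p" "x l" A "y \<delta>" x om] pl' x 0 y[OF pl] by simp
   ultimately show ?thesis using B(2)[OF om pl] by (simp add: bkt_cong bkt_shift)
  qed
  have "\<delta> e = \<delta>' e" if "e : F" for e proof -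
   obtain p l where e: "e = (p, l)" by fastforce
   let ?b = "bkt (Z (sh A x (y \<delta>) om) p l (s p) (s l))"
   have "(?b + \<delta> e) mod 2 ^ a = (?b + \<delta>' e) mod 2 ^ a"
    using rec[of p l om \<delta>] rec[of p l om' \<delta>'] that 1 e eq by simp
   hence "\<delta> e mod 2 ^ a = \<delta>' e mod 2 ^ a"
    using cong_add_lcancel_nat[of ?b "\<delta> e" "\<delta>' e" "2 ^ a"] by (simp add: cong_def)
   moreover have "\<delta> e < 2 ^ a" "\<delta>' e < 2 ^ a" using 1 that by (auto dest: PiE_mem)
   ultimately show ?thesis by simp
  qed
  hence "\<delta> = \<delta>'" using 1 by (auto intro: PiE_ext)
  moreover have "om = om'" using sh_inj eq 1 B(1) `\<delta> = \<delta>'` by blast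
  ultimately show "\<delta> = \<delta>' & om = om'" by simp
 qed
 moreover have "?f ` (?\<Delta> \<times> B) <= {om : \<Omega>. Q (om 0)}" using B(1) sh_in_\<Omega> by auto
 ultimately have "card (?\<Delta> \<times> B) <= card {om : \<Omega>. Q (om 0)}" by (intro card_inj_on_le) auto
 thus ?thesis using fF by (simp add: card_PiE power_mult mult.commute card_cartesian_product)
qed

definition edges_at where "edges_at A = {(p, l) : prs k. p : A \<or> l : A}"

lemma finite_edges_at [simp]: "finite (edges_at A)" by (rule finite_subset[of _ "prs k"]) (auto simp: edges_at_def)

text \<open>Put each prescribed change on one endpoint in \<open>A\<close> (\<open>y0\<close>). Row
  \<open>p\<close> then has some excess \<open>R p\<close>, which is moved along the pair of
  \<open>p\<close> and \<rho> to row \<rho>; this keeps all pair sums. Row \<rho> finally holds the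
  total excess, the sum of \<open>D\<close>, which is zero.\<close>

lemma potentials_exist:
 fixes D :: "nat \<times> nat => int"
 assumes A: "A <= {..<k}" "\<rho> : A" and D: "(SUM e:edges_at A. D e) = 0"
 shows "EX y. (ALL p:A. (SUM l:{..<k} - {p}. y p l) = 0) &
  (ALL (p, l):edges_at A. (if p : A then y p l else 0) + (if l : A then y l p else 0) = D (p, l))" proof -
 define y0 where "y0 p l = (if l < p then D (p, l) else if l ~: A then D (l, p) else 0)" for p l
 define R where "R p = (SUM l:{..<k} - {p}. y0 p l)" for p
 define y where "y p l = y0 p l - (if l = \<rho> then R p else 0) + (if p = \<rho> & l : A then R l else 0)" for p l
 have finA: "finite A" using A finite_subset by blast
 have "(SUM p:A. R p) = (SUM p<k. if p : A then R p else 0)" using A by (simp add: sum.If_cases Int_absorb1)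
 also have "... = (SUM p<k. SUM l:{..<k} - {p}. if p : A then y0 p l else 0)" unfolding R_def by (intro sum.cong) auto
 also have "... = (SUM (p, l):prs k. (if p : A then y0 p l else 0) + (if l : A then y0 l p else 0))"
  by (simp add: sum_prs_both)
 also have "... = (SUM e:prs k. if e : edges_at A then D e else 0)"
  by (rule sum.cong) (auto simp: y0_def edges_at_def prs_def split: if_splits)
 also have "... = (SUM e:edges_at A. D e)" by (subst sum.If_cases) (auto intro!: sum.cong simp: edges_at_def)
 finally have R: "(SUM p:A. R p) = 0" using D by simp
 have "(SUM l:{..<k} - {p}. y p l) = 0" if p: "p : A" for p proof (cases "p = \<rho>")
  case False
  hence "(SUM l:{..<k} - {p}. y p l) = R p - R p" using A p unfolding y_def R_def by (simp add: sum_subtractf subset_iff)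
  thus ?thesis by simp
 next
  case True
  have "(SUM l:{..<k} - {p}. y p l) = R p + (SUM l:{..<k} - {p}. if l : A then R l else 0)"
   unfolding y_def R_def[of p] sum.distrib[symmetric] using True by (intro sum.cong) auto
  also have "(SUM l:{..<k} - {p}. if l : A then R l else 0) = (SUM l:A - {p}. R l)"
   using A by (subst sum.If_cases) (auto intro!: sum.cong)
  also have "R p + (SUM l:A - {p}. R l) = (SUM l:A. R l)" using p finA by (simp add: sum.remove)
  finally show ?thesis using R by simp
 qed
 moreover have "(if p : A then y p l else 0) + (if l : A then y l p else 0) = D (p, l)"
  if "(p, l) : edges_at A" for p l using that A by (auto simp: y_def y0_def edges_at_def prs_def)
 ultimately show ?thesis by blast
qed

lemma card_\<Omega>_word0:
 "card {om : \<Omega>. Q (om 0)} * 2 ^ W = card {r. r < 2 ^ W & Q r} * card \<Omega>" proof -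
 let ?R = "{r. r < (2 :: nat) ^ W & Q r}"
 have "{om : \<Omega>. Q (om 0)} = PiE_dflt {..<len} 0 (%i. if i = 0 then ?R else {..<2 ^ W})"
  by (auto simp: \<Omega>_def PiE_dflt_def len_def split: if_splits)
 also have "card ... = (\<Prod>i<len. card (if i = 0 then ?R else {..<2 ^ W}))" by (subst card_PiE_dflt) auto
 also have "... = card ?R * (2 ^ W) ^ (k * k * n)" by (simp add: len_def prod.lessThan_Suc_shift del: prod.lessThan_Suc)
 finally show ?thesis by (simp add: card_\<Omega> len_def)
qed

text \<open>Summing \<open>Z\<close> over all pairs eliminates the potentials. Equal buckets leave a
  difference of less than one bucket width per pair, and \<open>s\<close> contributes nothing
  because its weight is zero.\<close>

lemma same_buckets_weight_near_0:
 assumes "weight s = 0"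
  and "!!p l. (p, l) : prs k ==> bkt (Z om p l (x p) (x l)) = bkt (Z om p l (s p) (s l))"
 shows "EX q. \<bar>int (om 0) * weight x - q * 2 ^ W\<bar> < int (k choose 2) * 2 ^ (W - a)" proof -
 let ?B = "2 ^ (W - a) :: int"
 have "EX d. \<bar>d\<bar> < ?B & [Z om p l (x p) (x l) - Z om p l (s p) (s l) = d] (mod 2 ^ W)"
  if pl: "(p, l) : prs k" for p l proof -
  obtain d1 where d1: "0 <= d1" "d1 < ?B"
   "[Z om p l (x p) (x l) = int (bkt (Z om p l (x p) (x l))) * ?B + d1] (mod 2 ^ W)" by (rule bkt_decomp)
  obtain d2 where d2: "0 <= d2" "d2 < ?B"
   "[Z om p l (s p) (s l) = int (bkt (Z om p l (s p) (s l))) * ?B + d2] (mod 2 ^ W)" by (rule bkt_decomp)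
  from cong_diff[OF d1(3) d2(3)] assms(2)[OF pl] d1 d2 show ?thesis by (intro exI[of _ "d1 - d2"]) auto
 qed
 hence "ALL e:prs k. EX d. \<bar>d\<bar> < ?B & [case e of (p, l) => Z om p l (x p) (x l) - Z om p l (s p) (s l) = d] (mod 2 ^ W)"
  by auto
 from bchoice[OF this] obtain d where d: "!!e. e : prs k ==> \<bar>d e\<bar> < ?B"
  "!!p l. (p, l) : prs k ==> [Z om p l (x p) (x l) - Z om p l (s p) (s l) = d (p, l)] (mod 2 ^ W)" by fastforce
 have "int (om 0) * weight x = (SUM (p, l):prs k. Z om p l (x p) (x l)) - (SUM (p, l):prs k. Z om p l (s p) (s l))"
  using assms(1) by (simp add: sum_Z)
 also have "... = (SUM (p, l):prs k. Z om p l (x p) (x l) - Z om p l (s p) (s l))"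
  by (simp add: sum_subtractf case_prod_unfold)
 finally have "[int (om 0) * weight x = (SUM e:prs k. d e)] (mod 2 ^ W)" using d(2) by (auto intro!: cong_sum)
 then obtain q where "int (om 0) * weight x = (SUM e:prs k. d e) + 2 ^ W * q" by (metis cong_iff_lin cong_sym)
 moreover have "(1, 0) : prs k" using k by (simp add: prs_def)
 hence "(SUM e:prs k. \<bar>d e\<bar>) < (SUM e:prs k. ?B)" using d(1) by (intro sum_strict_mono) auto
 hence "\<bar>SUM e:prs k. d e\<bar> < int (k choose 2) * ?B" by (intro le_less_trans[OF sum_abs]) (simp add: card_prs)
 ultimately show ?thesis by (intro exI[of _ q]) (simp add: card_prs algebra_simps)
qed

text \<open>Shifts preserve the total weight, so only all but one of the pairs at the differing
  parts can be moved freely. The missing factor \<open>2 ^ a\<close> comes from the multiplier: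
  agreement on all pairs forces its product with \<open>weight x\<close> to be close to 0 modulo
  \<open>2 ^ W\<close>.\<close>

lemma card_same_buckets:
 assumes x: "!!p. p < k ==> x p < n" and s: "!!p. p < k ==> s p < n"
  and ws: "weight s = 0" and wx: "weight x ~= 0"
  and wb: "\<bar>weight x\<bar> <= int (k choose 2) * 2 ^ (W - a)"
 shows "card {om : \<Omega>. ALL (p, l):prs k. bkt (Z om p l (x p) (x l)) = bkt (Z om p l (s p) (s l))} *
  2 ^ (a * card (edges_at {p. p < k & x p ~= s p})) <= 6 * (k choose 2) * card \<Omega>" (is "card ?B * _ <= _") proof -
 let ?A = "{p. p < k & x p ~= s p}" and ?X = "int (k choose 2) * 2 ^ (W - a)"
 define Q where "Q r \<longleftrightarrow> (EX q. \<bar>int r * weight x - q * 2 ^ W\<bar> < ?X)" for r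
 have "?A ~= {}" proof
  assume "?A = {}"
  hence "weight x = weight s" unfolding weight_def by (intro sum.cong) (auto simp: prs_def)
  with ws wx show False by simp
 qed
 then obtain \<rho> where \<rho>: "\<rho> : ?A" by blast
 define e0 where "e0 = (if \<rho> = 0 then (1, 0) else (\<rho>, 0 :: nat))"
 have e0: "e0 : edges_at ?A" using \<rho> k by (auto simp: e0_def edges_at_def prs_def)
 define F where "F = edges_at ?A - {e0}"
 \<comment> \<open>The offset at \<open>e0\<close> is dictated by the others, as
   \<open>potentials_exist\<close> requires total 0.\<close>
 define D where "D \<delta> e = (if e = e0 then - (SUM e:F. int (\<delta> e) * 2 ^ (W - a)) else int (\<delta> e) * 2 ^ (W - a))"
  for \<delta> :: "nat \<times> nat => nat" and e
 have "(SUM e:edges_at ?A. D \<delta> e) = 0" for \<delta> proof -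
  have "(SUM e:F. D \<delta> e) = (SUM e:F. int (\<delta> e) * 2 ^ (W - a))" by (intro sum.cong) (auto simp: D_def F_def)
  thus ?thesis using e0 by (subst sum.remove[of _ e0]) (auto simp: F_def[symmetric] D_def)
 qed
 hence "ALL \<delta>. EX y. (ALL p:?A. (SUM l:{..<k} - {p}. y p l) = 0) &
  (ALL (p, l):edges_at ?A. (if p : ?A then y p l else 0) + (if l : ?A then y l p else 0) = D \<delta> (p, l))"
  using \<rho> by (intro allI potentials_exist) auto
 from choice[OF this] obtain y where y: "!!\<delta> p. p : ?A ==> (SUM l:{..<k} - {p}. y \<delta> p l) = 0"
  "!!\<delta> p l. (p, l) : edges_at ?A ==>
   (if p : ?A then y \<delta> p l else 0) + (if l : ?A then y \<delta> l p else 0) = D \<delta> (p, l)" by fast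
 have F1: "F <= prs k" by (auto simp: F_def edges_at_def)
 have F2: "(if p : ?A then y \<delta> p l else 0) + (if l : ?A then y \<delta> l p else 0) = int (\<delta> (p, l)) * 2 ^ (W - a)"
  if "(p, l) : F" for \<delta> p l proof -
  have "(p, l) : edges_at ?A" "(p, l) ~= e0" using that by (simp_all add: F_def)
  with y(2)[OF this(1), of \<delta>] show ?thesis unfolding D_def by (simp only: if_False)
 qed
 have B1: "om : \<Omega> & Q (om 0)" if "om : ?B" for om proof
  show "om : \<Omega>" using that by simp
  have "bkt (Z om p l (x p) (x l)) = bkt (Z om p l (s p) (s l))" if "(p, l) : prs k" for p l using `om : ?B` that by blast
  from same_buckets_weight_near_0[OF ws this] show "Q (om 0)" unfolding Q_def .
 qed
 have B2: "bkt (Z om p l (x p) (x l)) = bkt (Z om p l (s p) (s l))" if "om : ?B" "(p, l) : F" for om p l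
  using that F1 by blast
 have A: "x p ~= s p" if "p : ?A" for p using that by simp
 have "card ?B * 2 ^ (a * card F) <= card {om : \<Omega>. Q (om 0)}"
  by (rule shift_count[where A = ?A and x = x and s = s and y = y and B = ?B and Q = Q and F = F,
     OF x s A F1 y(1) F2 B1 B2])
 from mult_right_mono[OF this, of "2 ^ W"]
 have "card ?B * 2 ^ (a * card F) * 2 ^ W <= card {r. r < 2 ^ W & Q r} * card \<Omega>" unfolding card_\<Omega>_word0 by simp
 also have "... <= (6 * ((k choose 2) * 2 ^ (W - a))) * card \<Omega>" proof (rule mult_right_mono)
  have "int (card {r. int r < 2 ^ W & (EX q. \<bar>int r * weight x - q * 2 ^ W\<bar> < ?X)}) <= 6 * ?X"
   by (rule card_multiples_near_0) (use wx wb in auto)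
  also have "{r. int r < 2 ^ W & (EX q. \<bar>int r * weight x - q * 2 ^ W\<bar> < ?X)} = {r. r < 2 ^ W & Q r}"
   by (auto simp: Q_def)
  finally have "int (card {r. r < 2 ^ W & Q r}) <= int (6 * ((k choose 2) * 2 ^ (W - a)))" by simp
  thus "card {r. r < 2 ^ W & Q r} <= 6 * ((k choose 2) * 2 ^ (W - a))" by (simp only: of_nat_le_iff)
 qed simp
 finally have "card ?B * 2 ^ (a * card F) * 2 ^ W * 2 ^ a <= (6 * ((k choose 2) * 2 ^ (W - a))) * card \<Omega> * 2 ^ a"
  by (rule mult_right_mono) simp
 also have "... = 6 * (k choose 2) * card \<Omega> * (2 ^ (W - a) * 2 ^ a)" by (simp add: mult_ac)
 also have "(2 :: nat) ^ (W - a) * 2 ^ a = 2 ^ W" using aW by (simp flip: power_add)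
 finally have "card ?B * (2 ^ (a * card F) * 2 ^ a) <= 6 * (k choose 2) * card \<Omega>" by (simp add: mult_ac)
 also have "(2 :: nat) ^ (a * card F) * 2 ^ a = 2 ^ (a * card (edges_at ?A))"
  using e0 card_Suc_Diff1[of "edges_at ?A" e0] by (simp add: F_def flip: power_add mult_Suc_right)
   (metis add.commute mult_Suc_right)
 finally show ?thesis .
qed

text \<open>A third part \<open>q\<close>, which exists as \<open>k\<close> is at least 3, absorbs
  the compensation: a differing endpoint changes its potential towards the other endpoint and by the
  opposite amount towards \<open>q\<close>. So the bucket of this one edge moves freely.\<close>

lemma card_same_bucket_edge:
 assumes s: "!!p. p < k ==> s p < n" and pl: "(p, l) : prs k" and uv: "u < n" "v < n" "u ~= s p \<or> v ~= s l"
 shows "card {om : \<Omega>. bkt (Z om p l u v) = bkt (Z om p l (s p) (s l))} * 2 ^ a <= card \<Omega>"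
  (is "card ?B * _ <= _") proof -
 have pl': "p < k" "l < k" "p ~= l" using pl by (auto simp: prs_def)
 obtain p' l' where p': "{p', l'} = {p, l}" "(s(p := u, l := v)) p' ~= s p'" "p' < k" "l' < k" "p' ~= l'"
 proof (cases "u ~= s p")
  case True
  thus ?thesis using that[of p l] pl' by auto
 next
  case False
  thus ?thesis using that[of l p] pl' uv by auto
 qed
 have "card {..<k} - card {p', l'} <= card ({..<k} - {p', l'})" by (rule diff_card_le_card_Diff) simp
 hence "card ({..<k} - {p', l'}) > 0" using k p'(5) by simp
 then obtain q where q: "q < k" "q ~= p'" "q ~= l'" by (auto simp: card_gt_0_iff)
 define y where "y \<delta> i j = (if j = l' then int (\<delta> (p, l)) * 2 ^ (W - a) else
  if j = q then - (int (\<delta> (p, l)) * 2 ^ (W - a)) else 0)" for \<delta> :: "nat \<times> nat => nat" and i :: nat and j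
 have "card ?B * 2 ^ (a * card {(p, l)}) <= card {om : \<Omega>. True}"
 proof (rule shift_count[where A = "{p'}" and x = "s(p := u, l := v)" and s = s and y = y and Q = "%_. True"
    and B = ?B and F = "{(p, l)}"])
  show "(SUM l:{..<k} - {i}. y \<delta> i l) = 0" if "i : {p'}" for \<delta> i proof -
   have "(SUM l:{..<k} - {i}. y \<delta> i l) = (SUM l:{l', q}. y \<delta> i l)"
    using that p' q by (intro sum.mono_neutral_right) (auto simp: y_def)
   thus ?thesis using q by (simp add: y_def)
  qed
  show "(if i : {p'} then y \<delta> i j else 0) + (if j : {p'} then y \<delta> j i else 0) = int (\<delta> (i, j)) * 2 ^ (W - a)"
   if "(i, j) : {(p, l)}" for \<delta> i j using that p' by (auto simp: y_def doubleton_eq_iff)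
 qed (use s pl pl' uv p' in auto)
 thus ?thesis by simp
qed

end

section \<open>Expected numbers of false tuples and of colliding edges\<close>

lemma card_prs_within:
 assumes "B <= {..<k}"
 shows "card {(p, l) : prs k. p : B & l : B} = card B choose 2" proof -
 have fin: "finite B" using assms finite_subset by blast
 have "bij_betw (%(p, l). {p, l}) {(p, l) : prs k. p : B & l : B} {X. X <= B & card X = 2}" proof (rule bij_betw_imageI)
  show "inj_on (%(p, l). {p, l}) {(p, l) : prs k. p : B & l : B}" by (rule inj_onI) (auto simp: prs_def doubleton_eq_iff)
  have "X : (%(p, l). {p, l}) ` {(p, l) : prs k. p : B & l : B}"
   if X: "X <= B" "card X = 2" for X proof -
   from X(2) obtain x y where xy: "X = {x, y}" "x ~= y" by (meson card_2_iff)
   show ?thesis proof (cases "y < x")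
    case True
    thus ?thesis using X xy assms by (intro image_eqI[of _ _ "(x, y)"]) (auto simp: prs_def)
   next
    case False
    thus ?thesis using X xy assms by (intro image_eqI[of _ _ "(y, x)"]) (auto simp: prs_def)
   qed
  qed
  thus "(%(p, l). {p, l}) ` {(p, l) : prs k. p : B & l : B} = {X. X <= B & card X = 2}" by (auto simp: prs_def card_2_iff)
 qed
 from bij_betw_same_card[OF this] show ?thesis using n_subsets[OF fin, of 2] by simp
qed

lemma markov_card:
 assumes "finite A"
 shows "t * card {x : A. t <= f x} <= (SUM x:A. f x :: nat)" proof -
 have "t * card {x : A. t <= f x} = (SUM x:{x : A. t <= f x}. t)" by simp
 also have "... <= (SUM x:{x : A. t <= f x}. f x)" by (intro sum_mono) auto
 also have "... <= (SUM x:A. f x)" using assms by (intro sum_mono2) auto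
 finally show ?thesis .
qed

lemma sum_card_swap:
 assumes "finite A" "finite B"
 shows "(SUM x:A. card {y : B. P x y}) = (SUM y:B. card {x : A. P x y})" proof -
 have "(SUM x:A. card {y : B. P x y}) = (SUM x:A. SUM y:B. if P x y then 1 else 0)"
  using assms by (intro sum.cong refl) (simp add: sum.If_cases Int_def)
 also have "... = (SUM y:B. SUM x:A. if P x y then 1 else 0)" by (rule sum.swap)
 also have "... = (SUM y:B. card {x : A. P x y})" using assms by (intro sum.cong refl) (simp add: sum.If_cases Int_def)
 finally show ?thesis .
qed

context hash
begin

lemma card_edges_at:
 assumes "A <= {..<k}"
 shows "card (edges_at A) = (k choose 2) - ((k - card A) choose 2)" proof -
 have "edges_at A = prs k - {(p, l) : prs k. p : {..<k} - A & l : {..<k} - A}" by (auto simp: edges_at_def prs_def)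
 also have "card ... = card (prs k) - card {(p, l) : prs k. p : {..<k} - A & l : {..<k} - A}"
  by (rule card_Diff_subset) (auto intro: finite_subset[OF _ finite_prs])
 also have "card {(p, l) : prs k. p : {..<k} - A & l : {..<k} - A} = (k - card A) choose 2"
  using assms by (subst card_prs_within) (auto simp: card_Diff_subset finite_subset)
 finally show ?thesis by (simp add: card_prs)
qed

definition tuples where "tuples = {..<k} \<rightarrow>\<^sub>E {..<n}"

definition same where
 "same s om x \<longleftrightarrow> (ALL (p, l):prs k. bkt (Z om p l (x p) (x l)) = bkt (Z om p l (s p) (s l)))"

text \<open>Tuples instead of cliques: bounding this larger set keeps the counting independent of
  the graph.\<close>

definition false_tuples where "false_tuples s om = {x : tuples. weight x ~= 0 & same s om x}"

definition same_edges where
 "same_edges s om = {((p, l), u, v) : prs k \<times> {..<n} \<times> {..<n}. bkt (Z om p l u v) = bkt (Z om p l (s p) (s l))}"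

lemma finite_tuples [simp]: "finite tuples" unfolding tuples_def by (intro finite_PiE) auto

text \<open>The sum factorises over the parts: each contributes 1 for the entry \<open>s p\<close>
  and at most n * (1 / n) for all others.\<close>

lemma sum_inverse_distance_le:
 assumes s: "!!p. p < k ==> s p < n"
 shows "(SUM x:tuples. 1 / real n ^ card {p. p < k & x p ~= s p}) <= 2 ^ k" proof -
 have "(SUM x:tuples. 1 / real n ^ card {p. p < k & x p ~= s p}) =
   (SUM x:tuples. \<Prod>p<k. if x p = s p then 1 else 1 / real n)" proof (rule sum.cong[OF refl])
  fix x
  have "(\<Prod>p<k. if x p = s p then 1 else 1 / real n) =
    (\<Prod>p\<in>{p. p < k & x p ~= s p}. 1 / real n)" by (rule prod.mono_neutral_cong_right) auto
  thus "1 / real n ^ card {p. p < k & x p ~= s p} = (\<Prod>p<k. if x p = s p then 1 else 1 / real n)"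
   by (simp add: power_one_over)
 qed
 also have "... = (\<Prod>p<k. SUM u<n. if u = s p then 1 else 1 / real n)" unfolding tuples_def by (subst prod_sum_PiE) auto
 also have "... <= (\<Prod>p<k. 2)" proof (rule prod_mono)
  fix p assume "p : {..<k}"
  hence "s p : {..<n}" using s by simp
  hence "(SUM u<n. if u = s p then 1 else 1 / real n) = 1 + (SUM u:{..<n} - {s p}. 1 / real n)"
   by (subst sum.remove[of _ "s p"]) (auto intro!: sum.cong)
  also have "(SUM u:{..<n} - {s p}. 1 / real n) <= (SUM u<n. 1 / real n)" by (intro sum_mono2) auto
  also have "... = 1" using n by simp
  finally show "0 <= (SUM u<n. if u = s p then 1 else 1 / real n) & (SUM u<n. if u = s p then 1 else 1 / real n) <= 2"
   by (auto intro!: sum_nonneg)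
 qed
 finally show ?thesis by simp
qed

text \<open>A union bound graded by the number \<open>j\<close> of parts where a tuple differs from
  \<open>s\<close>. The condition on \<open>t\<close> bounds the survival rate of such a tuple by t
  / (8 * 2^k * n^j), and the weights 1 / n^j sum to at most 2^k. The constant 48 is this 8 times the
  6 of \<open>card_multiples_near_0\<close>.\<close>

lemma sum_card_false_tuples:
 assumes s: "!!p. p < k ==> s p < n" and ws: "weight s = 0"
  and U: "!!u v. \<bar>wt u v\<bar> <= 2 ^ (W - a)"
  and t: "!!j. 1 <= j ==> j <= k ==>
   48 * 2 ^ k * (k choose 2) * n ^ j <= t * 2 ^ (a * ((k choose 2) - ((k - j) choose 2)))"
 shows "8 * (SUM om:\<Omega>. card (false_tuples s om)) <= t * card \<Omega>" proof -
 have each: "8 * 2 ^ k * real (card {om : \<Omega>. same s om x}) <=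
   real t * real (card \<Omega>) * (1 / real n ^ card {p. p < k & x p ~= s p})"
  if x: "x : tuples" and wx: "weight x ~= 0" for x proof -
  define A where "A = {p. p < k & x p ~= s p}"
  have A: "A <= {..<k}" by (auto simp: A_def)
  have "A ~= {}" proof
   assume "A = {}"
   hence "weight x = weight s" unfolding weight_def A_def by (intro sum.cong) (auto simp: prs_def)
   with ws wx show False by simp
  qed
  hence cA: "1 <= card A" "card A <= k" using A card_mono[OF _ A] finite_subset[OF A] by (auto simp: Suc_le_eq card_gt_0_iff)
  have "\<bar>weight x\<bar> <= (SUM (p, l):prs k. \<bar>wt (x p) (x l)\<bar>)"
   unfolding weight_def by (rule order_trans[OF sum_abs]) (simp add: case_prod_unfold)
  also have "... <= (SUM (p, l):prs k. 2 ^ (W - a))" using U by (intro sum_mono) auto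
  finally have wb: "\<bar>weight x\<bar> <= int (k choose 2) * 2 ^ (W - a)" by (simp add: case_prod_unfold card_prs)
  let ?e = "2 ^ (a * card (edges_at A)) :: nat"
  let ?B = "card {om : \<Omega>. same s om x}"
  have "?B * ?e <= 6 * (k choose 2) * card \<Omega>" using card_same_buckets[of x s] x s ws wx wb
   unfolding same_def A_def tuples_def by (auto dest: PiE_mem)
  hence "(8 * 2 ^ k * n ^ card A) * (?B * ?e) <= (8 * 2 ^ k * n ^ card A) * (6 * (k choose 2) * card \<Omega>)"
   by (rule mult_left_mono) simp
  also have "... = (48 * 2 ^ k * (k choose 2) * n ^ card A) * card \<Omega>" by simp
  also have "... <= (t * ?e) * card \<Omega>" using t[OF cA] by (intro mult_right_mono) (simp_all add: card_edges_at[OF A])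
  finally have "(8 * 2 ^ k * n ^ card A * ?B) * ?e <= (t * card \<Omega>) * ?e" by (simp add: mult_ac)
  hence "8 * 2 ^ k * n ^ card A * ?B <= t * card \<Omega>" by simp
  hence "real (8 * 2 ^ k * n ^ card A * ?B) <= real (t * card \<Omega>)" by (simp only: of_nat_le_iff)
  thus ?thesis using n by (simp add: field_simps A_def)
 qed
 have "(SUM om:\<Omega>. card (false_tuples s om)) = (SUM x:{x : tuples. weight x ~= 0}. card {om : \<Omega>. same s om x})"
  unfolding false_tuples_def
  using sum_card_swap[of \<Omega> "{x : tuples. weight x ~= 0}" "same s"] by (simp add: conj_assoc)
 hence "8 * 2 ^ k * real (SUM om:\<Omega>. card (false_tuples s om)) =
   (SUM x:{x : tuples. weight x ~= 0}. 8 * 2 ^ k * real (card {om : \<Omega>. same s om x}))" by (simp add: sum_distrib_left)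
 also have "... <= (SUM x:{x : tuples. weight x ~= 0}.
   real t * real (card \<Omega>) * (1 / real n ^ card {p. p < k & x p ~= s p}))" by (intro sum_mono each) auto
 also have "... <= (SUM x:tuples. real t * real (card \<Omega>) * (1 / real n ^ card {p. p < k & x p ~= s p}))"
  by (intro sum_mono2) auto
 also have "... = real t * real (card \<Omega>) * (SUM x:tuples. 1 / real n ^ card {p. p < k & x p ~= s p})"
  by (simp add: sum_distrib_left)
 also have "... <= real t * real (card \<Omega>) * 2 ^ k" by (intro mult_left_mono sum_inverse_distance_le s) auto
 finally have "2 ^ k * real (8 * (SUM om:\<Omega>. card (false_tuples s om))) <= 2 ^ k * real (t * card \<Omega>)"
  by (simp add: mult_ac)
 hence "real (8 * (SUM om:\<Omega>. card (false_tuples s om))) <= real (t * card \<Omega>)"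
  by (subst (asm) mult_le_cancel_left_pos) auto
 thus ?thesis by (simp only: of_nat_le_iff)
qed

text \<open>For each pair of parts the edge of \<open>s\<close> always collides with itself, which
  gives the summand \<open>2 ^ a\<close>; each of the others collides at rate at most 1 /
  2^a.\<close>

lemma sum_card_same_edges:
 assumes s: "!!p. p < k ==> s p < n"
 shows "(SUM om:\<Omega>. card (same_edges s om)) * 2 ^ a <= (k choose 2) * (2 ^ a + n\<^sup>2) * card \<Omega>" proof -
 let ?E = "prs k \<times> {..<n} \<times> {..<n}"
 let ?P = "%om (e :: (nat \<times> nat) \<times> nat \<times> nat). bkt (Z om (fst (fst e)) (snd (fst e)) (fst (snd e)) (snd (snd e))) =
   bkt (Z om (fst (fst e)) (snd (fst e)) (s (fst (fst e))) (s (snd (fst e))))"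
 have "(SUM om:\<Omega>. card (same_edges s om)) * 2 ^ a = (SUM om:\<Omega>. card {e : ?E. ?P om e}) * 2 ^ a"
  unfolding same_edges_def by (intro arg_cong2[where f = "(*)"] sum.cong arg_cong[where f = card]) auto
 also have "... = (SUM e:?E. card {om : \<Omega>. ?P om e} * 2 ^ a)" by (subst sum_card_swap) (auto simp: sum_distrib_right)
 also have "... = (SUM (p, l):prs k. SUM e:{..<n} \<times> {..<n}. card {om : \<Omega>. ?P om ((p, l), e)} * 2 ^ a)"
  by (simp add: sum.cartesian_product case_prod_unfold)
 also have "... <= (SUM (p, l):prs k. (2 ^ a + n\<^sup>2) * card \<Omega>)" proof (rule sum_mono, clarify)
  fix p l assume pl: "(p, l) : prs k"
  hence sp: "(s p, s l) : {..<n} \<times> {..<n}" using s by (auto simp: prs_def)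
  have "(SUM e:{..<n} \<times> {..<n}. card {om : \<Omega>. ?P om ((p, l), e)} * 2 ^ a) =
    card {om : \<Omega>. ?P om ((p, l), s p, s l)} * 2 ^ a +
    (SUM e:{..<n} \<times> {..<n} - {(s p, s l)}. card {om : \<Omega>. ?P om ((p, l), e)} * 2 ^ a)"
   by (rule sum.remove) (use sp in auto)
  also have "... <= card \<Omega> * 2 ^ a + (SUM e:{..<n} \<times> {..<n} - {(s p, s l)}. card \<Omega>)"
  proof (rule add_mono[OF _ sum_mono])
   fix e assume "e : {..<n} \<times> {..<n} - {(s p, s l)}"
   hence "card {om : \<Omega>. bkt (Z om p l (fst e) (snd e)) = bkt (Z om p l (s p) (s l))} * 2 ^ a <= card \<Omega>"
    using s pl by (intro card_same_bucket_edge) auto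
   thus "card {om : \<Omega>. ?P om ((p, l), e)} * 2 ^ a <= card \<Omega>" by simp
  qed simp
  also have "(SUM e:{..<n} \<times> {..<n} - {(s p, s l)}. card \<Omega>) <= (SUM e:{..<n} \<times> {..<n}. card \<Omega>)"
   by (intro sum_mono2) auto
  also have "card \<Omega> * 2 ^ a + (SUM e:{..<n} \<times> {..<n}. card \<Omega>) = (2 ^ a + n\<^sup>2) * card \<Omega>"
   by (simp add: algebra_simps power2_eq_square)
  finally show "(SUM e:{..<n} \<times> {..<n}. card {om : \<Omega>. ?P om ((p, l), e)} * 2 ^ a) <= (2 ^ a + n\<^sup>2) * card \<Omega>" by simp
 qed
 also have "... = (k choose 2) * (2 ^ a + n\<^sup>2) * card \<Omega>" by (simp add: card_prs case_prod_unfold)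
 finally show ?thesis .
qed

text \<open>By Markov's inequality each of the two bad events takes at most 1/8 of the
  tables.\<close>

theorem card_good_tables:
 assumes s: "!!p. p < k ==> s p < n" and ws: "weight s = 0"
  and U: "!!u v. \<bar>wt u v\<bar> <= 2 ^ (W - a)"
  and t: "!!j. 1 <= j ==> j <= k ==>
   48 * 2 ^ k * (k choose 2) * n ^ j <= t * 2 ^ (a * ((k choose 2) - ((k - j) choose 2)))"
  and M: "8 * (k choose 2) * (2 ^ a + n\<^sup>2) <= M * 2 ^ a"
 shows "3 * card \<Omega> <= 4 * card {om : \<Omega>. card (false_tuples s om) < t & card (same_edges s om) <= M}" proof -
 have C2: "0 < k choose 2" using k by (simp add: zero_less_binomial)
 let ?B1 = "{om : \<Omega>. t <= card (false_tuples s om)}"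
 let ?B2 = "{om : \<Omega>. M <= card (same_edges s om)}"
 let ?G = "{om : \<Omega>. card (false_tuples s om) < t & card (same_edges s om) <= M}"
 have "0 < t" proof (rule ccontr)
  assume "~ 0 < t"
  with t[of 1] k C2 n show False by simp
 qed
 have "8 * (t * card ?B1) <= t * card \<Omega>"
  using markov_card[OF finite_\<Omega>, of t "%om. card (false_tuples s om)"] sum_card_false_tuples[OF s ws U t] by linarith
 hence "t * (8 * card ?B1) <= t * card \<Omega>" by (simp only: mult.left_commute[of t 8])
 hence 1: "8 * card ?B1 <= card \<Omega>" using `0 < t` by (simp only: mult_le_cancel1)
 have "0 < M" proof (rule ccontr)
  assume "~ 0 < M"
  with M C2 n show False by simp
 qed
 have "8 * ((SUM om:\<Omega>. card (same_edges s om)) * 2 ^ a) <= 8 * ((k choose 2) * (2 ^ a + n\<^sup>2) * card \<Omega>)"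
  by (intro mult_left_mono sum_card_same_edges s) auto
 also have "... = (8 * (k choose 2) * (2 ^ a + n\<^sup>2)) * card \<Omega>" by simp
 also have "... <= (M * 2 ^ a) * card \<Omega>" by (intro mult_right_mono M) simp
 finally have "(8 * (SUM om:\<Omega>. card (same_edges s om))) * 2 ^ a <= (M * card \<Omega>) * 2 ^ a" by (simp add: mult_ac)
 hence "8 * (SUM om:\<Omega>. card (same_edges s om)) <= M * card \<Omega>" by simp
 with markov_card[OF finite_\<Omega>, of M "%om. card (same_edges s om)"]
 have "8 * (M * card ?B2) <= M * card \<Omega>" by linarith
 hence "M * (8 * card ?B2) <= M * card \<Omega>" by (simp only: mult.left_commute[of M 8])
 hence 2: "8 * card ?B2 <= card \<Omega>" using `0 < M` by (simp only: mult_le_cancel1)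
 have "card \<Omega> <= card (?G \<union> (?B1 \<union> ?B2))" by (rule card_mono) auto
 also have "... <= card ?G + (card ?B1 + card ?B2)" by (meson card_Un_le add_left_mono order_trans)
 finally show ?thesis using 1 2 by simp
qed

end

context hash
begin

text \<open>The values \<open>Z\<close> of \<open>s\<close> sum to 0 modulo \<open>2 ^ W\<close>.
  Split each into its bucket times the bucket width and a remainder: the remainders then sum to a
  multiple \<open>r\<close> of the width, and they are fewer than the \<open>r\<close> needs to
  reach \<open>k choose 2\<close>.\<close>

lemma zero_weight_digits:
 assumes "weight s = 0"
 shows "EX r<k choose 2. 2 ^ a dvd (SUM (p, l):prs k. bkt (Z om p l (s p) (s l))) + r" proof -
 let ?B = "2 ^ (W - a) :: int"
 have W: "(2 :: int) ^ W = ?B * 2 ^ a" using aW by (simp flip: power_add)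
 define b where "b e = bkt (Z om (fst e) (snd e) (s (fst e)) (s (snd e)))" for e
 have "ALL e:prs k. EX x. 0 <= x & x < ?B & [Z om (fst e) (snd e) (s (fst e)) (s (snd e)) = int (b e) * ?B + x] (mod 2 ^ W)"
  unfolding b_def by (meson bkt_decomp)
 from bchoice[OF this] obtain x where x: "!!e. e : prs k ==> 0 <= x e" "!!e. e : prs k ==> x e < ?B"
  "!!e. e : prs k ==> [Z om (fst e) (snd e) (s (fst e)) (s (snd e)) = int (b e) * ?B + x e] (mod 2 ^ W)" by blast
 have "[(SUM e:prs k. Z om (fst e) (snd e) (s (fst e)) (s (snd e))) = (SUM e:prs k. int (b e) * ?B + x e)] (mod 2 ^ W)"
  by (rule cong_sum) (rule x(3))
 moreover have "(SUM e:prs k. Z om (fst e) (snd e) (s (fst e)) (s (snd e))) = 0"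
  using sum_Z[of om s] assms by (simp add: case_prod_unfold)
 moreover have "(SUM e:prs k. int (b e) * ?B + x e) = (SUM e:prs k. int (b e)) * ?B + (SUM e:prs k. x e)"
  by (simp add: sum.distrib sum_distrib_right)
 ultimately have "2 ^ W dvd (SUM e:prs k. int (b e)) * ?B + (SUM e:prs k. x e)" by (simp add: cong_def dvd_eq_mod_eq_0)
 then obtain q where q: "(SUM e:prs k. int (b e)) * ?B + (SUM e:prs k. x e) = ?B * 2 ^ a * q"
  unfolding W by (auto elim: dvdE)
 define r where "r = 2 ^ a * q - (SUM e:prs k. int (b e))"
 have xr: "(SUM e:prs k. x e) = ?B * r" using q by (simp add: r_def algebra_simps)
 have "0 <= ?B * r" unfolding xr[symmetric] using x(1) by (rule sum_nonneg)
 hence r0: "0 <= r" by (simp add: zero_le_mult_iff)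
 have "(1, 0) : prs k" using k by (simp add: prs_def)
 hence "(SUM e:prs k. x e) < (SUM e:prs k. ?B)" using x(2) by (intro sum_strict_mono) auto
 hence "?B * r < ?B * int (k choose 2)" by (simp add: xr card_prs mult.commute)
 hence r1: "r < int (k choose 2)" by simp
 have "int (SUM e:prs k. b e) + r = 2 ^ a * q" by (simp add: r_def)
 hence "int (2 ^ a) dvd int ((SUM e:prs k. b e) + nat r)" using r0 by simp
 hence "2 ^ a dvd (SUM e:prs k. b e) + nat r" by (simp only: of_nat_dvd_iff)
 thus ?thesis using r0 r1 by (intro exI[of _ "nat r"]) (auto simp: b_def case_prod_unfold nat_less_iff)
qed

end

section \<open>Unweighted instances\<close>

lemma tuple_clique_weight:
 assumes E: "simple_graph N E"
  and adj: "!!p l. l < p ==> p < k ==> {x p, x l} : E"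
 shows "inj_on x {..<k}" "x ` {..<k} : cliques k N E \<or> k < 2"
  "clique_weight E w (x ` {..<k}) = (SUM (p, l):prs k. w {x p, x l})" proof -
 have adj': "{x p, x l} : E" if "p < k" "l < k" "p ~= l" for p l
  using adj[of p l] adj[of l p] that by (cases "p < l") (auto simp: insert_commute)
 show inj: "inj_on x {..<k}" proof (rule inj_onI, rule ccontr)
  fix p l assume "p : {..<k}" "l : {..<k}" "x p = x l" "p ~= l"
  hence "{x p} : E" using adj'[of p l] by simp
  thus False using E by (auto simp: simple_graph_def)
 qed
 show "x ` {..<k} : cliques k N E \<or> k < 2" proof (cases "k < 2")
  case False
  have "x p < N" if "p < k" for p proof -
   define l where "l = (if p = 0 then 1 else 0 :: nat)"
   have "l < k" "l ~= p" using False by (auto simp: l_def)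
   hence "{x p, x l} : E" using adj' that by blast
   thus ?thesis using E by (auto simp: simple_graph_def)
  qed
  thus ?thesis using inj adj' by (auto simp: cliques_def card_image)
 qed simp
 have "bij_betw (%(p, l). {x p, x l}) (prs k) {e : E. e <= x ` {..<k}}" proof (rule bij_betw_imageI)
  show "inj_on (%(p, l). {x p, x l}) (prs k)" proof (rule inj_onI, clarify)
   fix p l p' l' assume 1: "(p, l) : prs k" "(p', l') : prs k" "{x p, x l} = {x p', x l'}"
   hence "l < p" "l' < p'" "p < k" "l < k" "p' < k" "l' < k" by (auto simp: prs_def)
   thus "p = p' & l = l'" using 1(3) inj by (auto simp: doubleton_eq_iff inj_on_eq_iff)
  qed
  show "(%(p, l). {x p, x l}) ` prs k = {e : E. e <= x ` {..<k}}" proof (intro equalityI subsetI)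
   fix e assume "e : {e : E. e <= x ` {..<k}}"
   hence e: "e : E" "e <= x ` {..<k}" by auto
   hence "card e = 2" using E by (auto simp: simple_graph_def)
   then obtain y z where "e = {y, z}" "y ~= z" by (meson card_2_iff)
   with e obtain p l where pl: "e = {x p, x l}" "p < k" "l < k" "p ~= l" by auto
   show "e : (%(p, l). {x p, x l}) ` prs k" proof (cases "l < p")
    case True
    thus ?thesis using pl by (intro image_eqI[of _ _ "(p, l)"]) (auto simp: prs_def)
   next
    case False
    thus ?thesis using pl by (intro image_eqI[of _ _ "(l, p)"]) (auto simp: prs_def)
   qed
  qed (auto simp: prs_def adj)
 qed
 from sum.reindex_bij_betw[OF this, of w]
 show "clique_weight E w (x ` {..<k}) = (SUM (p, l):prs k. w {x p, x l})" by (simp add: clique_weight_def case_prod_unfold)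
qed

locale inst = hash W k a "2 ^ L" "%u v. if {u, v} : E then w {u, v} else 0"
 for W k a L :: nat and E :: "nat set set" and w :: "nat set => int" +
 fixes N kap mu :: nat
 assumes E: "simple_graph N E" and NL: "N <= 2 ^ L" and kap: "k <= 2 ^ kap"
begin

definition code :: "nat => nat => nat" where
 "code p u = p * 2 ^ L + u"

definition R :: nat where
 "R = 2 ^ (L + kap)"

text \<open>Leaf \<open>R + j\<close> hangs on node \<open>j mod R\<close>. Going round the nodes
  reaches all of them once \<open>R <= 2 ^ mu\<close>, and a leaf lies in no triangle.\<close>

definition pads where "pads = map (%j. (j mod R, R + j)) [0..<2 ^ mu]"

definition bucket_edges where
 "bucket_edges om e b = {(u, v). u < 2 ^ L & v < 2 ^ L & {u, v} : E & bkt (Z om (fst e) (snd e) u v) = b}"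

definition inst_edges where "inst_edges om \<beta> = (%j. {j mod R, R + j}) ` {..<2 ^ mu} \<union>
   {{code p u, code l v} |p l u v. (p, l) : prs k & (u, v) : bucket_edges om (p, l) (\<beta> (p, l))}"

lemma code_less: "p < k ==> u < 2 ^ L ==> code p u < R" proof -
 assume "p < k" "u < 2 ^ L"
 hence "p * 2 ^ L + u < (p + 1) * 2 ^ L" by simp
 also have "... <= 2 ^ kap * 2 ^ L" using `p < k` kap by (intro mult_right_mono) auto
 finally show ?thesis by (simp add: code_def R_def power_add mult.commute)
qed

lemma code_div_mod [simp]: "u < 2 ^ L ==> code p u div 2 ^ L = p" "u < 2 ^ L ==> code p u mod 2 ^ L = u"
 by (simp_all add: code_def)

lemma code_eq_iff: "u < 2 ^ L ==> v < 2 ^ L ==> code p u = code l v \<longleftrightarrow> p = l & u = v"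
 by (metis code_div_mod)

lemma R_pos: "0 < R" by (simp add: R_def)

lemma pads_edge_list: "distinct (map (%(u, v). {u, v}) pads)"
 "set (map (%(u, v). {u, v}) pads) = (%j. {j mod R, R + j}) ` {..<2 ^ mu}" proof -
 have "i = j" if "{i mod R, R + i} = {j mod R, R + j}" for i j proof -
  have "i mod R < R" "j mod R < R" using R_pos by simp_all
  thus ?thesis using that by (auto simp: doubleton_eq_iff)
 qed
 hence "inj (%j. {j mod R, R + j})" by (rule injI)
 thus "distinct (map (%(u, v). {u, v}) pads)"
  using inj_on_subset[OF _ subset_UNIV] by (simp add: pads_def distinct_map o_def)
 show "set (map (%(u, v). {u, v}) pads) = (%j. {j mod R, R + j}) ` {..<2 ^ mu}" by (auto simp: pads_def)
qed

lemma bucket_edgesD: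
 assumes "(u, v) : bucket_edges om e b"
 shows "u < 2 ^ L" "v < 2 ^ L" "{u, v} : E" "u ~= v" using assms E by (auto simp: bucket_edges_def simple_graph_def)

lemma inst_simple: "simple_graph (R + 2 ^ mu) (inst_edges om \<beta>)" proof -
 have "{j mod R, R + j} <= {..<R + 2 ^ mu} & card {j mod R, R + j} = 2" if "j < 2 ^ mu" for j proof -
  have "j mod R < R" using R_pos by simp
  thus ?thesis using that by (auto simp: card_insert_if)
 qed
 moreover have "{code p u, code l v} <= {..<R + 2 ^ mu} & card {code p u, code l v} = 2"
  if "(p, l) : prs k" "(u, v) : bucket_edges om (p, l) (\<beta> (p, l))" for p l u v proof -
  have "code p u < R" "code l v < R" "code p u ~= code l v"
   using that bucket_edgesD[OF that(2)] by (auto intro!: code_less simp: prs_def code_eq_iff)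
  thus ?thesis by (auto simp: card_insert_if)
 qed
 ultimately show ?thesis unfolding simple_graph_def inst_edges_def by blast
qed

lemma inst_no_isolated:
 assumes "L + kap <= mu"
 shows "no_isolated (R + 2 ^ mu) (inst_edges om \<beta>)" proof -
 have 1: "\<Union> (inst_edges om \<beta>) <= {..<R + 2 ^ mu}"
  using inst_simple[of om \<beta>] by (auto simp: simple_graph_def)
 have 2: "x : \<Union> (inst_edges om \<beta>)" if "x < R + 2 ^ mu" for x proof (cases "x < R")
  case True
  have "R <= 2 ^ mu" using assms by (simp add: R_def)
  hence "x : {..<2 ^ mu}" using True by simp
  hence "{x mod R, R + x} : inst_edges om \<beta>" unfolding inst_edges_def by blast
  thus ?thesis using True by auto
 next
  case False
  hence "{(x - R) mod R, R + (x - R)} : inst_edges om \<beta>" using that by (auto simp: inst_edges_def)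
  thus ?thesis using False by auto
 qed
 show ?thesis unfolding no_isolated_def using 2 by (intro equalityI[OF 1] subsetI) simp
qed

lemma inst_edge_list:
 assumes ps: "distinct ps" "set ps = prs k"
  and b: "!!e. e : prs k ==> distinct (bl e) & set (bl e) = bucket_edges om e (\<beta> e)"
 shows "edge_list (inst_edges om \<beta>)
  (pads @ concat (map (%e. map (%(u, v). (code (fst e) u, code (snd e) v)) (bl e)) ps))" (is "edge_list _ (pads @ ?r)")
proof -
 let ?s = "%(u, v). {u, v} :: nat set"
 let ?cd = "%(e, u, v). {code (fst e) u, code (snd e) v}"
 let ?T = "concat (map (%e. map (Pair e) (bl e)) ps)"
 have r: "map ?s ?r = map ?cd ?T" by (simp add: map_concat o_def case_prod_unfold)
 have T: "e : prs k & (u, v) : bucket_edges om e (\<beta> e)" if "(e, u, v) : set ?T" for e u v using that b ps by auto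
 have dT: "distinct ?T" using ps(1) b unfolding ps(2)[symmetric] by (induction ps) (auto simp: distinct_map inj_on_def)
 have "inj_on ?cd (set ?T)" proof (rule inj_onI)
  fix x y assume xy: "x : set ?T" "y : set ?T" and eq': "?cd x = ?cd y"
  obtain p l u v p' l' u' v' where x: "x = ((p, l), u, v)" and y: "y = ((p', l'), u', v')" by (metis surj_pair)
  note 1 = xy[unfolded x y]
  have eq: "{code p u, code l v} = {code p' u', code l' v'}" using eq' by (simp add: x y)
  have "u < 2 ^ L" "v < 2 ^ L" "u' < 2 ^ L" "v' < 2 ^ L" "l < p" "l' < p'"
   using T[OF 1(1)] T[OF 1(2)] by (auto simp: prs_def dest: bucket_edgesD)
  with eq show "x = y" unfolding x y by (auto simp: doubleton_eq_iff code_eq_iff)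
 qed
 with dT have d2: "distinct (map ?s ?r)" unfolding r by (simp add: distinct_map)
 have s2: "set (map ?s ?r) = {{code p u, code l v} |p l u v. (p, l) : prs k & (u, v) : bucket_edges om (p, l) (\<beta> (p, l))}"
  (is "_ = ?X") proof -
  have "set ?T = {(e, u, v). e : prs k & (u, v) : bucket_edges om e (\<beta> e)}" using b ps(2) by auto
  thus ?thesis unfolding r by (force simp: image_iff)
 qed
 have "set (map ?s pads) \<inter> set (map ?s ?r) = {}" proof -
  have "False" if "(p, l) : prs k" "(u, v) : bucket_edges om (p, l) b" "{j mod R, R + j} = {code p u, code l v}" for p l u v b j
  proof -
   have "code p u < R" "code l v < R" using that bucket_edgesD[OF that(2)] by (auto intro!: code_less simp: prs_def)
   thus False using that(3) by (auto simp: doubleton_eq_iff)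
  qed
  thus ?thesis unfolding s2 pads_edge_list(2) by blast
 qed
 thus ?thesis using d2 pads_edge_list(1) by (simp only: edge_list_def inst_edges_def map_append set_append distinct_append
    pads_edge_list(2) s2 simp_thms)
qed

lemma card_inst_edges:
 assumes \<beta>: "!!p l. (p, l) : prs k ==> \<beta> (p, l) = bkt (Z om p l (s p) (s l))"
 shows "2 ^ mu <= card (inst_edges om \<beta>)" "card (inst_edges om \<beta>) <= 2 ^ mu + card (same_edges s om)" proof -
 let ?P = "(%j. {j mod R, R + j}) ` {..<2 ^ mu}"
 let ?X = "{{code p u, code l v} |p l u v. (p, l) : prs k & (u, v) : bucket_edges om (p, l) (\<beta> (p, l))}"
 have fS: "finite (same_edges s om)"
  by (rule finite_subset[of _ "prs k \<times> {..<2 ^ L} \<times> {..<2 ^ L}"]) (auto simp: same_edges_def)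
 have X: "?X <= (%((p, l), u, v). {code p u, code l v}) ` same_edges s om"
  using \<beta> by (fastforce simp: same_edges_def bucket_edges_def image_iff)
 have fX: "finite ?X" by (rule finite_subset[OF X]) (use fS in simp)
 have "card ?P = length (map (%(u, v). {u, v}) pads)"
  using distinct_card[OF pads_edge_list(1)] by (simp only: pads_edge_list(2))
 hence P: "card ?P = 2 ^ mu" by (simp add: pads_def)
 have "card ?P <= card (inst_edges om \<beta>)" unfolding inst_edges_def by (rule card_mono) (use fX in simp_all)
 thus "2 ^ mu <= card (inst_edges om \<beta>)" by (simp only: P)
 have "card (inst_edges om \<beta>) <= card ?P + card ?X" unfolding inst_edges_def by (rule card_Un_le)
 also have "card ?X <= card (same_edges s om)"
  using card_mono[OF _ X] card_image_le[OF fS, of "%((p, l), u, v). {code p u, code l v}"] fS by simp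
 finally show "card (inst_edges om \<beta>) <= 2 ^ mu + card (same_edges s om)" by (simp add: P)
qed

text \<open>A leaf has a single neighbour, too few for \<open>k >= 3\<close>. All other edges join
  different parts, so the \<open>k\<close> members lie one in each part.\<close>

lemma clique_tuple:
 assumes K: "K : cliques k (R + 2 ^ mu) (inst_edges om \<beta>)"
 obtains x where "x : tuples" "K = (%p. code p (x p)) ` {..<k}"
  "!!p l. (p, l) : prs k ==> (x p, x l) : bucket_edges om (p, l) (\<beta> (p, l))" proof -
 have cK: "card K = k" and adj: "!!y z. y : K ==> z : K ==> y ~= z ==> {y, z} : inst_edges om \<beta>"
  using K by (auto simp: cliques_def)
 have fK: "finite K" using cK k by (intro card_ge_0_finite) simp
 have real: "u < R & v < R" if "(p, l) : prs k" "(u', v') : bucket_edges om (p, l) b"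
  "{u, v} = {code p u', code l v'}" for p l u v u' v' b
  using that(1,3) bucket_edgesD[OF that(2)] by (auto simp: doubleton_eq_iff prs_def intro!: code_less)
 have less: "y < R" if y: "y : K" for y proof (rule ccontr)
  assume "~ y < R"
  have "z = (y - R) mod R" if "z : K - {y}" for z proof -
   have "{y, z} : inst_edges om \<beta>" using adj y that by auto
   then obtain j where "{y, z} = {j mod R, R + j}" using real `~ y < R` unfolding inst_edges_def by blast
   moreover have "j mod R < R" using R_pos by simp
   ultimately show ?thesis using `~ y < R` by (auto simp: doubleton_eq_iff)
  qed
  hence "K - {y} <= {(y - R) mod R}" by blast
  from card_mono[OF _ this] have "card (K - {y}) <= 1" by simp
  moreover have "card (K - {y}) = k - 1" using y cK fK by simp
  ultimately show False using k by simp
 qed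
 have edge: "EX p l u v. (p, l) : prs k & (u, v) : bucket_edges om (p, l) (\<beta> (p, l)) & {y, z} = {code p u, code l v}"
  if "y : K" "z : K" "y ~= z" for y z proof -
  have "{y, z} ~= {j mod R, R + j}" for j using less[OF that(1)] less[OF that(2)] by (auto simp: doubleton_eq_iff)
  thus ?thesis using adj[OF that] unfolding inst_edges_def by blast
 qed
 have div: "y div 2 ^ L < k & z div 2 ^ L < k & y div 2 ^ L ~= z div 2 ^ L" if "y : K" "z : K" "y ~= z" for y z proof -
  note yz = edge[OF that]
  obtain p l u v where "(p, l) : prs k" "(u, v) : bucket_edges om (p, l) (\<beta> (p, l))" "{y, z} = {code p u, code l v}"
   using yz by blast
  with bucket_edgesD[OF this(2)] show ?thesis by (auto simp: doubleton_eq_iff prs_def)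
 qed
 have divk: "y div 2 ^ L < k" if "y : K" for y proof -
  have "card (K - {y}) = k - 1" using that cK fK by simp
  hence "card (K - {y}) ~= 0" using k by simp
  hence "K - {y} ~= {}" by (intro notI) simp
  thus ?thesis using div[OF that] by blast
 qed
 have inj: "inj_on (%y. y div 2 ^ L) K" using div by (meson inj_onI)
 hence "(%y. y div 2 ^ L) ` K = {..<k}" using divk cK by (intro card_subset_eq) (auto simp: card_image)
 with inj have bij: "bij_betw (%y. y div 2 ^ L) K {..<k}" by (simp add: bij_betw_def)
 define g where "g = the_inv_into K (%y. y div 2 ^ L)"
 have g: "g p : K" "g p div 2 ^ L = p" if "p < k" for p
  using bij that the_inv_into_into[of "%y. y div 2 ^ L" K p K] f_the_inv_into_f[of "%y. y div 2 ^ L" K p]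
  by (auto simp: g_def bij_betw_def)
 have gK: "g ` {..<k} = K" using bij_betw_the_inv_into[OF bij] by (simp add: bij_betw_def g_def)
 define x where "x = (\<lambda>p\<in>{..<k}. g p mod 2 ^ L)"
 have gx: "g p = code p (x p)" if "p < k" for p
  using g(2)[OF that] that div_mult_mod_eq[of "g p" "2 ^ L"] by (simp add: x_def code_def)
 show thesis proof (rule that[of x])
  show "x : tuples" by (auto simp: tuples_def x_def)
  show "K = (%p. code p (x p)) ` {..<k}" unfolding gK[symmetric] using gx by auto
  fix p l assume pl: "(p, l) : prs k"
  hence pl': "l < p" "p < k" by (auto simp: prs_def)
  hence "g p ~= g l" using g[of p] g[of l] by auto
  then obtain p' l' u v where e: "(p', l') : prs k" "(u, v) : bucket_edges om (p', l') (\<beta> (p', l'))"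
   "{g p, g l} = {code p' u, code l' v}" using edge g pl' by (metis order_less_trans)
  have lt: "x p < 2 ^ L" "x l < 2 ^ L" "u < 2 ^ L" "v < 2 ^ L" "l' < p'"
   using pl' e(1) bucket_edgesD[OF e(2)] by (auto simp: x_def prs_def)
  from e(3) have "{code p (x p), code l (x l)} = {code p' u, code l' v}" using gx pl' by simp
  hence "p' = p" "u = x p" "l' = l" "v = x l" using lt pl' by (auto simp: doubleton_eq_iff code_eq_iff)
  with e(2) show "(x p, x l) : bucket_edges om (p, l) (\<beta> (p, l))" by simp
 qed
qed

lemma tuple_clique:
 assumes "!!p l. (p, l) : prs k ==> (x p, x l) : bucket_edges om (p, l) (\<beta> (p, l))"
 shows "(%p. code p (x p)) ` {..<k} : cliques k (R + 2 ^ mu) (inst_edges om \<beta>)" proof -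
 have xL: "x p < 2 ^ L" if "p < k" for p proof (cases "p = 0")
  case True
  thus ?thesis using assms[of 1 0] k by (auto simp: prs_def dest: bucket_edgesD)
 next
  case False
  thus ?thesis using assms[of p 0] that by (auto simp: prs_def dest: bucket_edgesD)
 qed
 have "inj_on (%p. code p (x p)) {..<k}" using xL by (intro inj_onI) (auto simp: code_eq_iff)
 hence "card ((%p. code p (x p)) ` {..<k}) = k" by (simp add: card_image)
 moreover have "code p (x p) < R" if "p < k" for p using code_less that xL by simp
 moreover have one: "{code p (x p), code l (x l)} : inst_edges om \<beta>" if "l < p" "p < k" for p l
  using assms[of p l] that unfolding inst_edges_def prs_def by blast
 have "{code p (x p), code l (x l)} : inst_edges om \<beta>" if "p < k" "l < k" "p ~= l" for p l proof (cases "l < p")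
  case False
  thus ?thesis using one[of p l] that by (subst insert_commute) simp
 qed (use one[of l p] that in simp)
 ultimately show ?thesis unfolding cliques_def by (fastforce intro: trans_less_add1)
qed

lemma concat_nth_block:
 assumes "!!K. K : set Ks ==> length K = k" "i < length Ks" "p < k"
 shows "concat Ks ! (i * k + p) = Ks ! i ! p" "Suc i * k <= length (concat Ks)" proof -
 have "concat Ks ! (i * k + p) = Ks ! i ! p & Suc i * k <= length (concat Ks)" using assms proof (induction Ks arbitrary: i)
  case (Cons K Ks)
  show ?case proof (cases i)
   case 0
   thus ?thesis using Cons.prems by (simp add: nth_append)
  next
   case (Suc j)
   have IH: "concat Ks ! (j * k + p) = Ks ! j ! p & Suc j * k <= length (concat Ks)"
    by (rule Cons.IH) (use Cons.prems Suc in auto)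
   have "length K = k" using Cons.prems by simp
   with IH Suc show ?thesis by (simp add: nth_append)
  qed
 qed simp
 thus "concat Ks ! (i * k + p) = Ks ! i ! p" "Suc i * k <= length (concat Ks)" by auto
qed

text \<open>Phrased for sequences of vertices, which is what the program can check entry by entry.
  Adjacency in a simple graph already makes the entries distinct.\<close>

definition zero_clique where
 "zero_clique y \<longleftrightarrow> (ALL (p, l):prs k. {y p, y l} : E) & (SUM (p, l):prs k. w {y p, y l}) = 0"

lemma zero_clique_sound:
 assumes "zero_clique y"
 shows "EX S:cliques k N E. clique_weight E w S = 0" proof -
 have "{y p, y l} : E" if "l < p" "p < k" for p l using assms that by (auto simp: zero_clique_def prs_def)
 note * = tuple_clique_weight[where x = y and k = k, OF E this]
 from *(2) k have "y ` {..<k} : cliques k N E" by simp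
 moreover have "clique_weight E w (y ` {..<k}) = 0" using *(3)[of w] assms by (simp add: zero_clique_def)
 ultimately show ?thesis by blast
qed

lemma zero_clique_complete:
 assumes "S : cliques k N E" "clique_weight E w S = 0"
 obtains s where "zero_clique s" "!!p. p < k ==> s p < 2 ^ L" proof -
 have S: "card S = k" using assms(1) by (simp add: cliques_def)
 hence fS: "finite S" using k by (intro card_ge_0_finite) simp
 obtain s where "bij_betw s {0..<card S} S" using ex_bij_betw_nat_finite[OF fS] by blast
 hence s: "inj_on s {..<k}" "s ` {..<k} = S" by (auto simp: S bij_betw_def atLeast0LessThan)
 have adj: "{s p, s l} : E" if "l < p" "p < k" for p l proof -
  have "s p : S" "s l : S" using s(2) that by auto
  moreover have "s p ~= s l" using s(1) that by (auto dest!: inj_onD)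
  ultimately show ?thesis using assms(1) by (auto simp: cliques_def)
 qed
 have "zero_clique s" using tuple_clique_weight(3)[where x = s and k = k and w = w, OF E adj] assms(2) s(2) adj
  by (auto simp: zero_clique_def prs_def)
 moreover have "s p < 2 ^ L" if "p < k" for p proof -
  have "s p : S" using s(2) that by auto
  hence "s p < N" using assms(1) by (auto simp: cliques_def)
  thus ?thesis using NL by simp
 qed
 ultimately show thesis using that by blast
qed

lemma zero_clique_weight: "zero_clique s ==> weight s = 0" proof -
 assume s: "zero_clique s"
 hence "weight s = (SUM (p, l):prs k. w {s p, s l})" unfolding weight_def by (intro sum.cong) (auto simp: zero_clique_def)
 with s show ?thesis by (simp add: zero_clique_def)
qed

text \<open>If no listed clique had weight zero, all of them would be false tuples, hence fewer than
  \<open>t\<close>. The list would then be complete and contain the clique of \<open>s\<close>,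
  whose weight is zero.\<close>

theorem listing_finds_zero_clique:
 assumes s: "zero_clique s" "!!p. p < k ==> s p < 2 ^ L"
  and \<beta>: "!!p l. (p, l) : prs k ==> \<beta> (p, l) = bkt (Z om p l (s p) (s l))"
  and t: "card (false_tuples s om) < t"
  and out: "out : listing_answers k (R + 2 ^ mu) (inst_edges om \<beta>) t"
 shows "EX i. Suc i * k <= length out & zero_clique (%p. out ! (i * k + p) mod 2 ^ L)" proof -
 let ?C = "cliques k (R + 2 ^ mu) (inst_edges om \<beta>)"
 obtain Ks where Ks: "out = concat Ks" "!!K. K : set Ks ==> length K = k" "!!K. K : set Ks ==> set K : ?C"
  "distinct (map set Ks)" "length Ks = min t (card ?C)" using out by (auto simp: listing_answers_def)
 have "ALL C:?C. EX x. x : tuples & C = (%p. code p (x p)) ` {..<k} &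
   (ALL p l. (p, l) : prs k --> (x p, x l) : bucket_edges om (p, l) (\<beta> (p, l)))" proof
  fix C assume "C : ?C"
  then obtain x where "x : tuples" "C = (%p. code p (x p)) ` {..<k}"
   "!!p l. (p, l) : prs k ==> (x p, x l) : bucket_edges om (p, l) (\<beta> (p, l))" by (rule clique_tuple) (rule that)
  thus "EX x. x : tuples & C = (%p. code p (x p)) ` {..<k} &
   (ALL p l. (p, l) : prs k --> (x p, x l) : bucket_edges om (p, l) (\<beta> (p, l)))" by blast
 qed
 from bchoice[OF this] obtain f where f0: "ALL C:?C. f C : tuples & C = (%p. code p (f C p)) ` {..<k} &
   (ALL p l. (p, l) : prs k --> (f C p, f C l) : bucket_edges om (p, l) (\<beta> (p, l)))" ..
 hence f: "!!C. C : ?C ==> f C : tuples"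
  "!!C. C : ?C ==> C = (%p. code p (f C p)) ` {..<k}"
  "!!C p l. C : ?C ==> (p, l) : prs k ==> (f C p, f C l) : bucket_edges om (p, l) (\<beta> (p, l))" using f0 by blast+
 show ?thesis proof (cases "EX K:set Ks. weight (f (set K)) = 0")
  case True
  then obtain K where K: "K : set Ks" "weight (f (set K)) = 0" by blast
  from K(1) obtain i where "i < length Ks" "Ks ! i = K" by (auto simp: in_set_conv_nth)
  with K(2) have i: "i < length Ks" "weight (f (set (Ks ! i))) = 0" by simp_all
  define K x where "K = Ks ! i" and "x = f (set K)"
  have K: "K : set Ks" using i by (simp add: K_def)
  note KC = Ks(3)[OF K]
  have lenK: "length K = k" by (rule Ks(2)[OF K])
  have "card (set K) = k" using KC by (simp add: cliques_def)
  hence dK: "distinct K" using lenK by (intro card_distinct) simp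
  let ?y = "%p. out ! (i * k + p) mod 2 ^ L"
  have y: "?y p = K ! p mod 2 ^ L" if "p < k" for p using concat_nth_block(1)[of Ks i p] Ks(1,2) i that by (simp add: K_def)
  have xadj: "{x p, x l} : E" if "l < p" "p < k" for p l
   using f(3)[OF KC, of p l] that by (auto simp: x_def prs_def dest: bucket_edgesD)
  have xadj': "{x p, x l} : E" if "l ~= p" "p < k" "l < k" for p l
   using xadj[of l p] xadj[of p l] that by (cases "l < p") (simp_all add: insert_commute)
  have xL: "x p < 2 ^ L" if "p < k" for p using f(1)[OF KC] that by (auto simp: x_def tuples_def dest: PiE_mem)
  have setK: "set K = (%p. code p (x p)) ` {..<k}" using f(2)[OF KC] by (simp add: x_def)
  have yadj: "{?y p, ?y l} : E" if "l < p" "p < k" for p l proof -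
   have Kpl: "K ! p : set K" "K ! l : set K" "K ! p ~= K ! l" using that lenK dK by (auto simp: nth_eq_iff_index_eq)
   obtain p' l' where pl': "K ! p = code p' (x p')" "K ! l = code l' (x l')" "p' < k" "l' < k"
    using Kpl(1,2) unfolding setK by blast
   moreover have "p' ~= l'" using Kpl(3) pl' by auto
   ultimately show ?thesis using that y xL xadj' by simp
  qed
  have "set K = (%p. K ! p) ` {..<k}" using lenK by (auto simp: set_conv_nth)
  moreover have "?y ` {..<k} = (%p. K ! p mod 2 ^ L) ` {..<k}" using y by (intro image_cong) auto
  ultimately have "?y ` {..<k} = (%c. c mod 2 ^ L) ` set K" by (simp add: image_image)
  also have "... = x ` {..<k}" unfolding setK using xL by (auto simp: image_image)
  finally have img: "?y ` {..<k} = x ` {..<k}" .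
  \<comment> \<open>The output may enumerate the clique in any order, so \<open>?y\<close> is a
    rearrangement of \<open>x\<close>; the weight depends on the vertex set only.\<close>
  have "(SUM (p, l):prs k. w {?y p, ?y l}) = clique_weight E w (x ` {..<k})"
   using tuple_clique_weight(3)[where x = ?y and k = k and w = w, OF E yadj] img by simp
  also have "... = (SUM (p, l):prs k. w {x p, x l})"
   using tuple_clique_weight(3)[where x = x and k = k and w = w, OF E xadj] by simp
  also have "... = weight x" unfolding weight_def by (intro sum.cong refl) (use xadj in "auto simp: prs_def")
  also have "... = 0" using i by (simp add: x_def K_def)
  finally have "zero_clique ?y" using yadj by (auto simp: zero_clique_def prs_def)
  moreover have "Suc i * k <= length out" using concat_nth_block(2)[of Ks i 0] Ks(1,2) i k by simp
  ultimately show ?thesis by blast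
 next
  case False
  have "inj_on f ?C" by (rule inj_onI) (metis f(2))
  moreover have sub: "set ` set Ks <= ?C" using Ks(3) by blast
  ultimately have "card (f ` set ` set Ks) = card (set ` set Ks)" by (metis card_image inj_on_subset)
  hence lKs: "length Ks = card (f ` set ` set Ks)" using distinct_card[OF Ks(4)] by simp
  have "f ` set ` set Ks <= false_tuples s om"
   using False f(1,3) Ks(3) \<beta> by (auto simp: false_tuples_def same_def bucket_edges_def)
  hence "card (f ` set ` set Ks) <= card (false_tuples s om)" by (rule card_mono[rotated]) (simp add: false_tuples_def)
  with lKs have "length Ks < t" using t by simp
  hence "card ?C = card (set ` set Ks)" using Ks(5) distinct_card[OF Ks(4)] by simp
  moreover have "finite ?C" unfolding cliques_def by simp
  ultimately have "set ` set Ks = ?C" using sub by (intro card_subset_eq) auto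
  moreover have "(%p. code p (s p)) ` {..<k} : ?C"
   by (rule tuple_clique) (use s \<beta> in "auto simp: zero_clique_def bucket_edges_def prs_def")
  ultimately have "(%p. code p (s p)) ` {..<k} : set ` set Ks" by simp
  then obtain K where K: "K : set Ks" "set K = (%p. code p (s p)) ` {..<k}" by (metis imageE)
  note KC = Ks(3)[OF K(1)]
  have "f (set K) p = s p" if p: "p < k" for p proof -
   have "code p (s p) : (%p. code p (f (set K) p)) ` {..<k}" using f(2)[OF KC] K(2) p by auto
   then obtain q where q0: "code p (s p) = code q (f (set K) q)" "q : {..<k}" by (rule imageE)
   hence q: "q < k" "code p (s p) = code q (f (set K) q)" by simp_all
   moreover have "f (set K) q < 2 ^ L" using f(1)[OF KC] q by (auto simp: tuples_def dest: PiE_mem)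
   ultimately have "p = q & s p = f (set K) q" using s(2)[OF p] code_eq_iff by blast
   thus ?thesis by auto
  qed
  hence "weight (f (set K)) = weight s" unfolding weight_def by (intro sum.cong) (auto simp: prs_def)
  thus ?thesis using False K zero_clique_weight[OF s(1)] by auto
 qed
qed

end

section \<open>Simulation of the listing program\<close>

abbreviation plus_exp (infixl "[+]" 65) where "a [+] b == Bin Plus a b"
abbreviation minus_exp (infixl "[-]" 65) where "a [-] b == Bin Minus a b"
abbreviation times_exp (infixl "[*]" 70) where "a [*] b == Bin Times a b"
abbreviation mod_exp (infixl "[mod]" 70) where "a [mod] b == Bin Mod a b"
abbreviation shl_exp (infixl "[<<]" 72) where "a [<<] b == Bin Shl a b"
abbreviation shr_exp (infixl "[>>]" 72) where "a [>>] b == Bin Shr a b"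

text \<open>
 Registers of the reduction.  \<open>vPL\<close> and \<open>vPA\<close> hold \<open>2 ^ vL\<close> and \<open>2 ^ vA\<close>.  Memory is allotted in blocks
 of \<open>vH\<close> cells, of which \<open>vFP\<close> are in use.  The loops over \<open>vA\<close>, \<open>vMu\<close>, \<open>vB\<close>, \<open>vF\<close> and \<open>vI\<close>
 guess; the answer is collected in \<open>vFlag\<close>.  The simulated machine has its memory at \<open>vBase\<close>, its output at \<open>vOb\<close>,
 words below \<open>vW\<close>, program counter \<open>vPc\<close> and output length \<open>vOc\<close>.
\<close>

abbreviation (input) "vN == 0 :: nat"
abbreviation (input) "vEc == 1 :: nat"
abbreviation (input) "vL == 2 :: nat"
abbreviation (input) "vPL == 3 :: nat"
abbreviation (input) "vH == 4 :: nat"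
abbreviation (input) "vFP == 5 :: nat"
abbreviation (input) "vFlag == 6 :: nat"
abbreviation (input) "vRep == 7 :: nat"
abbreviation (input) "vA == 8 :: nat"
abbreviation (input) "vMu == 9 :: nat"
abbreviation (input) "vB == 10 :: nat"
abbreviation (input) "vF == 11 :: nat"
abbreviation (input) "vI == 12 :: nat"
abbreviation (input) "vG == 13 :: nat"
abbreviation (input) "vPA == 14 :: nat"
abbreviation (input) "vSh == 15 :: nat"
abbreviation (input) "vBB == 16 :: nat"
abbreviation (input) "vBase == 17 :: nat"
abbreviation (input) "vOb == 18 :: nat"
abbreviation (input) "vM == 19 :: nat"
abbreviation (input) "vW == 20 :: nat"
abbreviation (input) "vPc == 21 :: nat"
abbreviation (input) "vOc == 22 :: nat"
abbreviation (input) "vU == 23 :: nat"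
abbreviation (input) "vV == 24 :: nat"
abbreviation (input) "vZ == 25 :: nat"
abbreviation (input) "vK == 26 :: nat"
abbreviation (input) "vLen == 27 :: nat"
abbreviation (input) "vJ == 28 :: nat"
abbreviation (input) "vS == 29 :: nat"
abbreviation (input) "vFu == 30 :: nat"
abbreviation (input) "vD == 31 :: nat"
abbreviation (input) "vR3 == 32 :: nat"

definition vreg :: "nat => nat" where "vreg r = 40 + r"

lemma vreg_eq [simp]: "vreg r = vreg r' \<longleftrightarrow> r = r'" by (simp add: vreg_def)

lemma vreg_neq [simp]:
 assumes "x < 40" shows "vreg r ~= x" "x ~= vreg r" using assms by (auto simp: vreg_def)

fun instr_target :: "instr => nat" where
 "instr_target (Jump l) = l"
| "instr_target (JumpZero r l) = l"
| "instr_target _ = 0"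

fun instr_regs :: "instr => nat list" where
 "instr_regs (Const r x) = [r]"
| "instr_regs (Oper f r a b) = [r, a, b]"
| "instr_regs (Load r a) = [r, a]"
| "instr_regs (Store a r) = [a, r]"
| "instr_regs (Jump l) = []"
| "instr_regs (JumpZero r l) = [r]"
| "instr_regs (Rand r) = [r]"
| "instr_regs (Out r) = [r]"

text \<open>The sums in \<open>pc_bound\<close> and \<open>reg_bound\<close> are convenient upper
  bounds for every jump target and every register that the program mentions.\<close>

definition pc_bound where "pc_bound P = Suc (length P + sum_list (map instr_target P))"

definition reg_bound where "reg_bound P = Suc (sum_list (concat (map instr_regs P)))"

lemma instr_target_less: "i : set P ==> instr_target i < pc_bound P"
 using member_le_sum_list[of "instr_target i" "map instr_target P"] by (simp add: pc_bound_def)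

lemma instr_regs_less:
 assumes "i : set P" "r : set (instr_regs i)"
 shows "r < reg_bound P" using member_le_sum_list[of r "concat (map instr_regs P)"] assms
 by (force simp: reg_bound_def less_Suc_eq_le)

abbreviation next_pc :: com where "next_pc == Asg vPc (Var vPc [+] Lit 1)"

text \<open>One step of a program for words of \<open>wp\<close> bits, where \<open>vW\<close> contains \<open>2 ^ wp\<close>.  Its memory
 starts at the address in \<open>vBase\<close> and its output is appended to an array at the address in \<open>vOb\<close>.\<close>

fun sim_instr :: "instr => com" where
 "sim_instr (Const r x) = Asg (vreg r) (Lit x [mod] Var vW) ;; next_pc"
| "sim_instr (Oper f r a b) =
   Asg (vreg r) (Bin f (Var (vreg a)) (Var (vreg b)) [mod] Var vW) ;; next_pc"
| "sim_instr (Load r a) =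
   Asg (vreg r) (Mem (Var vBase [+] Var (vreg a)) [mod] Var vW) ;; next_pc"
| "sim_instr (Store a r) = Sto (Var vBase [+] Var (vreg a)) (Var (vreg r)) ;; next_pc"
| "sim_instr (Jump l) = Asg vPc (Lit l)"
| "sim_instr (JumpZero r l) = Cond (Var (vreg r)) next_pc (Asg vPc (Lit l))"
| "sim_instr (Rand r) = Rnd (vreg r) ;; Asg (vreg r) (Var (vreg r) [mod] Var vW) ;; next_pc"
| "sim_instr (Out r) = Sto (Var vOb [+] Var vOc) (Var (vreg r)) ;; Asg vOc (Var vOc [+] Lit 1) ;; next_pc"

fun dispatch :: "nat => instr list => com" where
 "dispatch l [] = Skip"
| "dispatch l (i # is) = Cond (Bin Equal (Var vPc) (Lit l)) (sim_instr i) (dispatch (Suc l) is)"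

lemma mod_2_power_cancel: "wl <= w ==> (x :: nat) mod 2 ^ w mod 2 ^ wl = x mod 2 ^ wl"
 by (simp add: mod_mod_cancel le_imp_power_dvd)

text \<open>On narrow operands the wide and the narrow operation differ only in the final reduction,
  except for \<open>Minus\<close>, where the offsets \<open>2 ^ w\<close> and \<open>2 ^ wl\<close>
  differ by a multiple of \<open>2 ^ wl\<close>.\<close>

lemma eval_binop_mod:
 assumes "wl <= w" "a < 2 ^ wl" "b < 2 ^ wl" "0 < wl"
 shows "eval_binop w f a b mod 2 ^ wl = eval_binop wl f a b" proof (cases f)
 case Minus
 have "2 ^ w = 2 ^ wl * (2 :: nat) ^ (w - wl)" using assms by (simp flip: power_add)
 hence "a + 2 ^ w - b = (a + 2 ^ wl - b) + 2 ^ wl * (2 ^ (w - wl) - 1)" using assms by (simp add: diff_mult_distrib2)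
 thus ?thesis using Minus by (simp add: mod_2_power_cancel[OF assms(1)])
qed (use assms in "simp_all add: mod_2_power_cancel")

text \<open>Each residue has exactly \<open>2 ^ (w - wl)\<close> preimages, so a long random word
  yields an exactly uniform short one.\<close>

lemma map_mod_words:
 assumes "wl <= w"
 shows "map_pmf (%x. x mod 2 ^ wl) (pmf_of_set {..<2 ^ w :: nat}) = pmf_of_set {..<2 ^ wl}" proof (rule pmf_eqI)
 fix y :: nat
 let ?A = "{..<2 ^ w :: nat}"
 have A: "?A ~= {}" by (auto simp: lessThan_empty_iff)
 have w: "(2 :: nat) ^ w = 2 ^ wl * 2 ^ (w - wl)" using assms by (simp flip: power_add)
 have "pmf (map_pmf (%x. x mod 2 ^ wl) (pmf_of_set ?A)) y =
   real (card (?A \<inter> {x. x mod 2 ^ wl = y})) / 2 ^ w" using A by (simp add: pmf_map vimage_def measure_pmf_of_set)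
 also have "... = indicator {..<2 ^ wl} y / 2 ^ wl" proof (cases "y < 2 ^ wl")
  case True
  have "bij_betw (%q. y + 2 ^ wl * q) {..<2 ^ (w - wl)} (?A \<inter> {x. x mod 2 ^ wl = y})"
  proof (rule bij_betw_byWitness[where f' = "%x. x div 2 ^ wl"])
   show "(%q. y + 2 ^ wl * q) ` {..<2 ^ (w - wl)} <= ?A \<inter> {x. x mod 2 ^ wl = y}" proof (rule image_subsetI)
    fix q :: nat assume "q : {..<2 ^ (w - wl)}"
    hence "2 ^ wl * (q + 1) <= 2 ^ wl * 2 ^ (w - wl)" by (intro mult_left_mono) auto
    hence "y + 2 ^ wl * q < 2 ^ w" using True unfolding w by simp
    thus "y + 2 ^ wl * q : ?A \<inter> {x. x mod 2 ^ wl = y}" using True by simp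
   qed
   show "(%x. x div 2 ^ wl) ` (?A \<inter> {x. x mod 2 ^ wl = y}) <= {..<2 ^ (w - wl)}"
    unfolding w by (auto simp: less_mult_imp_div_less mult.commute)
  qed (use True in "auto")
  from bij_betw_same_card[OF this] have "card (?A \<inter> {x. x mod 2 ^ wl = y}) = 2 ^ (w - wl)" by simp
  moreover have "(2 :: real) ^ w = 2 ^ wl * 2 ^ (w - wl)" using assms by (simp flip: power_add)
  ultimately show ?thesis using True by simp
 next
  case False
  hence "?A \<inter> {x. x mod 2 ^ wl = y} = {}" by (auto intro: mod_less_divisor)
  thus ?thesis using False by simp
 qed
 also have "... = pmf (pmf_of_set {..<2 ^ wl}) y" by (subst pmf_of_set) (auto simp: lessThan_empty_iff)
 finally show "pmf (map_pmf (%x. x mod 2 ^ wl) (pmf_of_set ?A)) y = pmf (pmf_of_set {..<2 ^ wl}) y" .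
qed

section \<open>Simulation of a program with shorter words inside a larger memory\<close>

locale sim =
 fixes w wl base ob X :: nat and P :: program and m0 :: "nat => nat"
 assumes wl: "0 < wl" "wl < w" and base: "base + 2 ^ wl <= ob" and ob: "ob + X < 2 ^ w"
  and pcb: "Suc (pc_bound P) < 2 ^ w"
begin

text \<open>\<open>x\<close> counts the simulated steps. A step outputs at most one word, so outside
  the memory window only the \<open>x\<close> cells from \<open>ob\<close> on can have
  changed.\<close>

definition sinv where
 "sinv x v m \<longleftrightarrow> v vW = 2 ^ wl & v vBase = base & v vOb = ob & (ALL r<reg_bound P. v (vreg r) < 2 ^ wl) &
   v vPc <= pc_bound P & v vOc <= x & (ALL y. y < base \<or> base + 2 ^ wl <= y & y < ob \<or> ob + x <= y --> m y = m0 y)"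

text \<open>The simulated configuration that a store represents. Registers that \<open>P\<close>
  does not mention keep their initial value 0; cells are read modulo \<open>2 ^ wl\<close>, in
  accordance with the simulation of \<open>Load\<close>.\<close>

definition absc where "absc s = \<lparr>pc = fst s vPc, regs = (%r. if r < reg_bound P then fst s (vreg r) else 0),
   mem = (%y. if y < 2 ^ wl then snd s (base + y) mod 2 ^ wl else 0),
   outp = map (%i. snd s (ob + i)) [0..<fst s vOc]\<rparr>"

lemma absc_simp:
 "absc (v, m) = \<lparr>pc = v vPc, regs = (%r. if r < reg_bound P then v (vreg r) else 0),
   mem = (%y. if y < 2 ^ wl then m (base + y) mod 2 ^ wl else 0),
   outp = map (%i. m (ob + i)) [0..<v vOc]\<rparr>" unfolding absc_def fst_conv snd_conv by (rule refl)

lemma wl_less: "2 ^ wl < (2 :: nat) ^ w" using wl by simp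

lemma w_pos: "0 < w" using wl by simp

lemma sim_instr_inv:
 assumes i: "i : set P" and x: "Suc x <= X" and s: "sinv x v m" and pc: "v vPc < length P"
 shows "wp w (sim_instr i) (sinv (Suc x)) v m" proof -
 have pc1: "Suc (v vPc) <= pc_bound P" "Suc (v vPc) < 2 ^ w" using pc pcb by (simp_all add: pc_bound_def)
 have r: "v (vreg r) < 2 ^ wl" if "r : set (instr_regs i)" for r using s instr_regs_less[OF i that] by (simp add: sinv_def)
 have t: "instr_target i < 2 ^ w" "instr_target i <= pc_bound P" using instr_target_less[OF i] pcb by simp_all
 have W: "v vW = 2 ^ wl" "v vBase = base" "v vOb = ob" "v vOc <= x" using s by (simp_all add: sinv_def)
 have bb: "z < 2 ^ wl ==> base + z < 2 ^ w" for z :: nat using base ob by simp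
 have modlt: "z mod 2 ^ wl mod 2 ^ w < 2 ^ wl" for z :: nat by (rule le_less_trans[OF mod_less_eq_dividend]) simp
 show ?thesis proof (cases i)
  case (Store a r')
  hence "v (vreg a) < 2 ^ wl" using r by simp
  thus ?thesis using Store s pc1 x W bb[of "v (vreg a)"] base by (auto simp: sinv_def)
 next
  case (Out r')
  thus ?thesis using s pc1 x W ob base by (auto simp: sinv_def)
 qed (use s pc1 t W modlt in "auto simp: sinv_def")
qed

lemma sim_instr_absc:
 assumes i: "i : set P" and x: "Suc x <= X" and s: "sinv x v m" and pc: "v vPc < length P"
 shows "map_pmf absc (outd w (sim_instr i) (v, m)) = exec_instr wl i (absc (v, m))" proof -
 have pc1: "Suc (v vPc) < 2 ^ w" using pc pcb by (simp_all add: pc_bound_def)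
 have rb: "r < reg_bound P" if "r : set (instr_regs i)" for r by (rule instr_regs_less[OF i that])
 have r: "v (vreg r) < 2 ^ wl" if "r : set (instr_regs i)" for r using s rb[OF that] by (simp add: sinv_def)
 have t: "instr_target i < 2 ^ w" using instr_target_less[OF i] pcb by simp_all
 have W: "v vW = 2 ^ wl" "v vBase = base" "v vOb = ob" "v vOc <= x" using s by (simp_all add: sinv_def)
 have bb: "z < 2 ^ wl ==> (base + z) mod 2 ^ w = base + z" for z :: nat using base ob by simp
 have modlt: "z mod 2 ^ wl mod 2 ^ w = z mod 2 ^ wl" for z :: nat by (rule mod_less) (rule less_trans[OF _ wl_less], simp)
 have modc: "z mod 2 ^ w mod 2 ^ wl = z mod 2 ^ wl" for z :: nat using wl by (intro mod_2_power_cancel) simp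
 have upd: "(%r. if r < reg_bound P then (v(vreg r' := z, vPc := y)) (vreg r) else 0) =
   (%r. if r < reg_bound P then v (vreg r) else 0)(r' := z)" if "r' : set (instr_regs i)" for r' z y
  using rb[OF that] by (auto simp: fun_eq_iff)
 have upd0: "(%r. if r < reg_bound P then (v(vPc := y)) (vreg r) else 0) = (%r. if r < reg_bound P then v (vreg r) else 0)"
  "(%r. if r < reg_bound P then (v(vOc := z, vPc := y)) (vreg r) else 0) = (%r. if r < reg_bound P then v (vreg r) else 0)"
  for y z by (auto simp: fun_eq_iff)
 show ?thesis proof (cases i)
  case (Const r' z)
  thus ?thesis using upd[of r'] pc1 W by (simp add: w_pos outd_simps bind_return_pmf absc_simp set_reg_def modc modlt)
 next
  case (Oper f r' a b)
  hence op: "eval_binop w f (v (vreg a)) (v (vreg b)) mod 2 ^ wl = eval_binop wl f (v (vreg a)) (v (vreg b))"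
   using r wl by (intro eval_binop_mod) auto
  thus ?thesis using upd[of r'] pc1 W rb Oper by (simp add: w_pos outd_simps bind_return_pmf absc_simp set_reg_def modlt op
     mod_less[OF less_trans[OF eval_binop_less wl_less]])
 next
  case (Load r' a)
  thus ?thesis using upd[of r'] pc1 W rb r bb by (simp add: w_pos outd_simps bind_return_pmf absc_simp set_reg_def modlt)
 next
  case (Store a r')
  have "(%y. if y < 2 ^ wl then (m(base + v (vreg a) := v (vreg r'))) (base + y) mod 2 ^ wl else 0) =
   (%y. if y < 2 ^ wl then m (base + y) mod 2 ^ wl else 0)(v (vreg a) := v (vreg r'))"
   using r Store by (auto simp: fun_eq_iff)
  moreover have "map (%i. (m(base + v (vreg a) := v (vreg r'))) (ob + i)) [0..<v vOc] = map (%i. m (ob + i)) [0..<v vOc]"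
   using base r[of a] Store by auto
  ultimately show ?thesis using Store pc1 W rb r[of a] bb by (simp add: w_pos outd_simps bind_return_pmf absc_simp upd0)
 next
  case (Jump l)
  thus ?thesis using t by (simp add: w_pos outd_simps absc_simp upd0)
 next
  case (JumpZero r' l)
  thus ?thesis using t pc1 rb by (simp add: w_pos outd_simps absc_simp upd0)
 next
  case (Rand r')
  have "map_pmf absc (outd w (sim_instr i) (v, m)) =
    map_pmf (%z. set_reg r' z (absc (v, m))) (map_pmf (%z. z mod 2 ^ wl) (pmf_of_set {..<2 ^ w}))" using Rand pc1 W rb
   by (simp add: w_pos outd_simps bind_map_pmf map_pmf_def bind_return_pmf bind_assoc_pmf absc_simp set_reg_def modlt upd)
  thus ?thesis using Rand wl by (simp add: map_mod_words)
 next
  case (Out r')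
  have "(ob + v vOc) mod 2 ^ w = ob + v vOc" "Suc (v vOc) mod 2 ^ w = Suc (v vOc)" using ob x W by simp_all
  moreover have "(%y. if y < 2 ^ wl then (m(ob + v vOc := v (vreg r'))) (base + y) mod 2 ^ wl else 0) =
   (%y. if y < 2 ^ wl then m (base + y) mod 2 ^ wl else 0)" using base by (auto simp: fun_eq_iff)
  moreover have "map (%i. (m(ob + v vOc := v (vreg r'))) (ob + i)) [0..<v vOc] = map (%i. m (ob + i)) [0..<v vOc]" by auto
  ultimately show ?thesis using Out pc1 W rb by (simp add: w_pos outd_simps bind_return_pmf absc_simp upd0)
 qed
qed

lemma outd_dispatch:
 assumes "l + length is < 2 ^ w" "l <= v vPc"
 shows "outd w (dispatch l is) (v, m) =
  (if v vPc < l + length is then outd w (sim_instr (is ! (v vPc - l))) (v, m) else return_pmf (v, m))"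
 using assms proof (induction "is" arbitrary: l)
 case (Cons i "is")
 thus ?case using w_pos by (auto simp: outd_simps nth_Cons' Suc_diff_Suc)
qed (simp add: w_pos outd_simps)

lemma wp_dispatch:
 assumes "l + length is < 2 ^ w" "l <= v vPc"
 shows "wp w (dispatch l is) Q v m =
  (if v vPc < l + length is then wp w (sim_instr (is ! (v vPc - l))) Q v m else Q v m)" using assms
proof (induction "is" arbitrary: l)
 case (Cons i "is")
 thus ?case using w_pos by (auto simp: nth_Cons' Suc_diff_Suc)
qed simp

lemma length_less: "length P < 2 ^ w" using pcb by (simp add: pc_bound_def)

lemma sinv_mono: "sinv x v m ==> x <= y ==> sinv y v m" by (auto simp: sinv_def)

lemma hoare_dispatch:
 assumes "Suc x <= X"
 shows "hoare w (sinv x) (dispatch 0 P) (maxtime (dispatch 0 P)) (sinv (Suc x))" proof (rule hoare_wp)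
 fix v m assume s: "sinv x v m"
 show "wp w (dispatch 0 P) (sinv (Suc x)) v m"
  using wp_dispatch[of 0 P v "sinv (Suc x)" m] length_less sim_instr_inv[OF _ assms s] sinv_mono[OF s] by simp
qed simp

lemma absc_dispatch:
 assumes "Suc x <= X" "sinv x v m"
 shows "map_pmf absc (outd w (dispatch 0 P) (v, m)) = step wl P (absc (v, m))" proof -
 have "pc (absc (v, m)) = v vPc" by (simp add: absc_simp)
 thus ?thesis using outd_dispatch[of 0 P v m] length_less sim_instr_absc[OF _ assms]
  by (simp add: step_def halted_def not_less)
qed

lemma sinv_vFu [simp]: "sinv x (v(vFu := j)) m = sinv x v m" by (simp add: sinv_def)

lemma absc_vFu [simp]: "absc (v(vFu := j), m) = absc (v, m)" by (simp add: absc_simp fun_eq_iff)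

text \<open>An identity of distributions, not only of possible outcomes, so that success
  probabilities of the simulated program carry over.\<close>

lemma absc_loop:
 assumes "x + n <= X" "sinv x v m"
 shows "map_pmf absc (ldist (outd w (dispatch 0 P)) vFu n (v, m)) = run wl P n (absc (v, m))"
 using assms proof (induction n arbitrary: x v m)
 case (Suc n)
 let ?d = "outd w (dispatch 0 P) (v(vFu := n), m)"
 have s: "sinv x (v(vFu := n)) m" using Suc.prems by simp
 have "map_pmf absc (ldist (outd w (dispatch 0 P)) vFu (Suc n) (v, m)) =
   bind_pmf ?d (%y. map_pmf absc (ldist (outd w (dispatch 0 P)) vFu n y))" by (simp add: map_bind_pmf)
 also have "... = bind_pmf ?d (%y. run wl P n (absc y))" proof (rule bind_pmf_cong[OF refl])
  fix y assume "y : set_pmf ?d"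
  from hoare_outd[OF hoare_dispatch s this] Suc.prems have "sinv (Suc x) (fst y) (snd y)" by simp
  from Suc.IH[OF _ this] Suc.prems show "map_pmf absc (ldist (outd w (dispatch 0 P)) vFu n y) = run wl P n (absc y)" by simp
 qed
 also have "... = bind_pmf (map_pmf absc ?d) (run wl P n)" by (simp add: bind_map_pmf)
 also have "map_pmf absc ?d = step wl P (absc (v, m))" using absc_dispatch[OF _ s] Suc.prems by simp
 finally show ?case by (simp add: run.simps)
qed simp

end

text \<open>The values are required for every memory that agrees with \<open>m0\<close> outside the
  block being written, so the source may be read from memory while the block fills up.\<close>

lemma pair_loop:
 assumes "eval w e v0 m0 = n"
  and ev: "!!j m. j < n ==> (!!x. x < B \<or> B + 2 * n <= x ==> m x = m0 x) ==>
   eval w A1 (v0(r := j)) m = B + 2 * j & eval w A2 (v0(r := j)) m = Suc (B + 2 * j) &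
   eval w e1 (v0(r := j)) m = g1 j & eval w e2 (v0(r := j)) m = g2 j"
  and t: "esize e + 2 + n * (esize A1 + esize A2 + esize e1 + esize e2 + 6) <= t"
 shows "hoare w (%v m. v = v0 & m = m0) (For r e (Sto A1 e1 ;; Sto A2 e2)) t
  (%v m. v = v0(r := 0) & (ALL j<n. m (B + 2 * j) = g1 j & m (Suc (B + 2 * j)) = g2 j) &
    (ALL x. x < B \<or> B + 2 * n <= x --> m x = m0 x))" proof -
 let ?I = "%i v m. v = v0(r := i) & (ALL j<n. i <= j --> m (B + 2 * j) = g1 j & m (Suc (B + 2 * j)) = g2 j) &
    (ALL x. x < B \<or> B + 2 * n <= x --> m x = m0 x)"
 let ?J = "%i v m. v = v0(r := i) & (ALL j<n. Suc i <= j --> m (B + 2 * j) = g1 j & m (Suc (B + 2 * j)) = g2 j) &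
    (ALL x. x < B \<or> B + 2 * n <= x --> m x = m0 x)"
 show ?thesis proof (rule hoare_for[where I = ?I and B = ?J and t = "esize A1 + esize A2 + esize e1 + esize e2 + 2"])
  fix i assume i: "i < n"
  show "hoare w (?J i) (Sto A1 e1 ;; Sto A2 e2) (esize A1 + esize A2 + esize e1 + esize e2 + 2) (?I i)" proof (rule hoare_wp)
   fix v m assume J: "?J i v m"
   hence v: "v = v0(r := i)" by simp
   have 1: "eval w A1 v m = B + 2 * i" "eval w e1 v m = g1 i" using ev[OF i, of m] J unfolding v by simp_all
   let ?m = "m(B + 2 * i := g1 i)"
   have m: "?m x = m0 x" if "x < B \<or> B + 2 * n <= x" for x using J i that by auto
   from ev[of i ?m, OF i m] have 2: "eval w A2 v ?m = Suc (B + 2 * i)" "eval w e2 v ?m = g2 i" unfolding v by simp_all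
   have "?I i v (?m(Suc (B + 2 * i) := g2 i))" using J i by (auto simp: le_eq_less_or_eq Suc_le_eq)
   thus "wp w (Sto A1 e1 ;; Sto A2 e2) (?I i) v m" unfolding wp.simps 1 2 .
  qed simp
 qed (use assms(1) t in "auto simp: ac_simps")
qed

text \<open>A syntactic guarantee that a raised answer flag is never lowered. It lets success
  persist through all later guesses, as \<open>phoare_for_once\<close> demands.\<close>

fun sticky :: "com => bool" where
 "sticky (Asg r e) \<longleftrightarrow> (r = vFlag --> e = Lit 1)"
| "sticky (Rnd r) \<longleftrightarrow> r ~= vFlag"
| "sticky (c1 ;; c2) \<longleftrightarrow> sticky c1 & sticky c2"
| "sticky (Cond e c1 c2) \<longleftrightarrow> sticky c1 & sticky c2"
| "sticky (For r e c) \<longleftrightarrow> r ~= vFlag & sticky c"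
| "sticky _ = True"

lemma sticky_seqs: "sticky (seqs cs) \<longleftrightarrow> (ALL c:set cs. sticky c)" by (induction cs) auto

lemma sem_sticky:
 assumes "(s', t) : set_pmf (sem w c s)" "sticky c" "0 < w" "fst s vFlag ~= 0"
 shows "fst s' vFlag ~= 0" using assms proof (induction c arbitrary: s s' t)
 case (For r e c)
 obtain v m where s: "s = (v, m)" by fastforce
 have loop: "fst s' vFlag ~= 0" if "(s', t) : set_pmf (lsem (sem w c) r n s)" "fst s vFlag ~= 0" for n s s' t
  using that proof (induction n arbitrary: s t)
  case (Suc n)
  then obtain s1 t1 t2 where 1: "(s1, t1) : set_pmf (sem w c ((fst s)(r := n), snd s))"
   "(s', t2) : set_pmf (lsem (sem w c) r n s1)" by (auto split: prod.splits)
  have "fst s1 vFlag ~= 0" by (rule For.IH[OF 1(1)]) (use For.prems Suc.prems in auto)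
  thus ?case by (rule Suc.IH[OF 1(2)])
 qed simp
 from For.prems(1) obtain t' where
  "(s', t') : set_pmf (lsem (sem w c) r (eval w e v m) (v(r := eval w e v m), m))" by (auto simp: s)
 from loop[OF this] For.prems show ?case by (simp add: s)
next
 case (Seq c1 c2)
 then obtain s1 t1 t2 where 1: "(s1, t1) : set_pmf (sem w c1 s)" "(s', t2) : set_pmf (sem w c2 s1)"
  by (auto split: prod.splits)
 have "fst s1 vFlag ~= 0" by (rule Seq.IH(1)[OF 1(1)]) (use Seq.prems in auto)
 thus ?case by (rule Seq.IH(2)[OF 1(2), rotated 2]) (use Seq.prems in auto)
next
 case (Cond e c1 c2)
 obtain v m where s: "s = (v, m)" by fastforce
 from Cond show ?case by (auto simp: s split: if_splits)
qed (case_tac s; auto)+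

lemma hoare_sticky:
 assumes "hoare w P c t Q" "sticky c" "0 < w"
 shows "hoare w (%v m. P v m & v vFlag ~= 0) c t (%v m. Q v m & v vFlag ~= 0)" unfolding hoare_def proof (intro allI impI)
 fix v m v' m' k
 assume 1: "P v m & v vFlag ~= 0" "((v', m'), k) : set_pmf (sem w c (v, m))"
 from sem_sticky[OF 1(2) assms(2,3)] hoareD[OF assms(1) _ 1(2)] 1(1)
 show "(Q v' m' & v' vFlag ~= 0) & k <= t" by simp
qed

section \<open>The reduction as a program\<close>

text \<open>Negative weights are stored in two's complement; addition, subtraction and
  multiplication of the machine respect this.\<close>

definition word where "word w z = nat (z mod 2 ^ w)"

lemma word_less [simp]: "word w z < 2 ^ w" by (simp add: word_def nat_less_iff)

lemma int_word: "int (word w z) = z mod 2 ^ w" by (simp add: word_def)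

lemma word_plus: "eval_binop w Plus (word w y) (word w z) = word w (y + z)" proof -
 have "int ((word w y + word w z) mod 2 ^ w) = (y + z) mod 2 ^ w" by (simp add: int_word zmod_int mod_add_eq)
 thus ?thesis by (simp add: word_def nat_eq_iff2)
qed

lemma word_times: "eval_binop w Times (word w y) (word w z) = word w (y * z)" proof -
 have "int ((word w y * word w z) mod 2 ^ w) = (y * z) mod 2 ^ w" by (simp add: int_word zmod_int mod_mult_eq)
 thus ?thesis by (simp add: word_def nat_eq_iff2)
qed

lemma word_minus: "eval_binop w Minus (word w y) (word w z) = word w (y - z)" proof -
 have "word w z <= word w y + 2 ^ w" using word_less[of w z] by linarith
 hence "int ((word w y + 2 ^ w - word w z) mod 2 ^ w) = (y mod 2 ^ w + 2 ^ w - z mod 2 ^ w) mod 2 ^ w"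
  by (simp add: int_word zmod_int of_nat_diff)
 also have "y mod 2 ^ w + 2 ^ w - z mod 2 ^ w = (y mod 2 ^ w - z mod 2 ^ w) + 2 ^ w" by simp
 also have "... mod 2 ^ w = (y - z) mod 2 ^ w" by (simp only: mod_add_self2 mod_diff_eq)
 finally show ?thesis by (simp add: word_def nat_eq_iff2)
qed

lemma word_of_nat: "x < 2 ^ w ==> word w (int x) = x" by (simp add: word_def)

definition prl where "prl k = concat (map (%p. map (Pair p) [0..<p]) [0..<k])"

lemma set_prl: "set (prl k) = prs k" by (auto simp: prl_def prs_def)

lemma distinct_prl: "distinct (prl k)" proof (induction k)
 case (Suc k)
 thus ?case by (auto simp: prl_def distinct_map inj_on_def)
qed (simp add: prl_def)

lemma length_prl: "length (prl k) = k choose 2" using distinct_card[OF distinct_prl, of k] by (simp add: set_prl card_prs)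

text \<open>The constants of the reduction, for \<open>n <= 2 ^ L\<close> nodes. \<open>c\<close> is
  the word-length factor of the listing program \<open>P\<close>; exponents are guessed below
  \<open>K * L\<close>; the work is capped at 2 to about (k - 1/q) L + \<open>C0\<close>;
  \<open>2 ^ kap\<close> will exceed \<open>k * k\<close>; memory blocks have
  \<open>2 ^ (ch * L)\<close> cells and words \<open>cw * L\<close> bits.\<close>

locale prog =
 fixes k :: nat and P :: program and c K q C0 kap ch cw :: nat
begin

abbreviation C2 :: nat where "C2 == k choose 2"
abbreviation DD :: nat where "DD == C2 - 1"

definition digit_com where "digit_com e =
   Asg vD (if e < DD then Var vI [>>] (Var vA [*] Lit e) [mod] Var vPA
   else (Lit 0 [-] Var vS [-] (Var vI [>>] (Var vA [*] Lit DD))) [mod] Var vPA) ;;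
   Asg vS (Var vS [+] Var vD)"

text \<open>A bucket holds up to \<open>2 ^ L * 2 ^ L\<close> edges of two words each, and its
  length; slots of four times that number of cells are enough.\<close>

definition slot_exp where "slot_exp x = Var vBB [+] x [*] (Lit 4 [*] (Var vPL [*] Var vPL))"

definition R_exp where "R_exp = Lit 1 [<<] (Var vL [+] Lit kap)"

definition copy_body where
 "copy_body = Sto (Var vBase [+] (Lit 3 [+] Lit 2 [*] (Var vM [+] Var vJ))) (Mem (Var vK [+] (Lit 1 [+] Lit 2 [*] Var vJ))) ;;
   Sto (Var vBase [+] (Lit 4 [+] Lit 2 [*] (Var vM [+] Var vJ))) (Mem (Var vK [+] (Lit 2 [+] Lit 2 [*] Var vJ)))"

definition copy_loop where "copy_loop = For vJ (Var vLen) copy_body"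

text \<open>A bucket with more than \<open>2 ^ f\<close> edges is skipped. This keeps every trial
  within a multiple of \<open>2 ^ f\<close> steps, even for a wrong guess.\<close>

definition copy_com where "copy_com e = (digit_com e ;;
   Asg vK (slot_exp (Lit e [*] Var vPA [+] Var vD)) ;;
   Asg vLen (Mem (Var vK))) ;;
   Cond (Bin Less (Var vLen) ((Lit 1 [<<] Var vF) [+] Lit 1))
    (copy_loop ;; Asg vM (Var vM [+] Var vLen))
    Skip"

definition pads_body where "pads_body = Sto (Var vBase [+] (Lit 3 [+] Lit 2 [*] Var vJ)) (Var vJ [mod] R_exp) ;;
   Sto (Var vBase [+] (Lit 4 [+] Lit 2 [*] Var vJ)) (R_exp [+] Var vJ)"

definition pads_com where "pads_com = For vJ (Lit 1 [<<] Var vMu) pads_body"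

text \<open>Every trial takes two fresh blocks, one for the memory and one for the output of the
  simulated program. Clearing an old block would cost far more than the trial.\<close>

definition alloc_com where "alloc_com = Asg vBase (Var vFP [*] Var vH) ;;
   Asg vOb ((Var vFP [+] Lit 1) [*] Var vH) ;;
   Asg vFP (Var vFP [+] Lit 2)"

definition header_com where "header_com = Sto (Var vBase) (R_exp [+] (Lit 1 [<<] Var vMu)) ;;
   Sto (Var vBase [+] Lit 1) (Var vM) ;;
   Sto (Var vBase [+] Lit 2) (Lit 1 [<<] Var vB)"

definition build_com where "build_com = alloc_com ;; pads_com ;;
   (Asg vM (Lit 1 [<<] Var vMu) ;; Asg vS (Lit 0)) ;;
   seqs (map copy_com [0..<C2]) ;; header_com"

text \<open>A guess \<open>i\<close> encodes in base \<open>2 ^ a\<close> the buckets of all pairs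
  but the last, and on top of them the carry of \<open>zero_weight_digits\<close>. These determine
  the last bucket.\<close>

fun dig :: "nat => nat => nat => nat" where
 "dig a i e = (if e < DD then i div 2 ^ (a * e) mod 2 ^ a
   else nat ((- int (SUM e<DD. i div 2 ^ (a * e) mod 2 ^ a) - int (i div 2 ^ (a * DD))) mod 2 ^ a))"

declare dig.simps [simp del]

lemma dig_less: "dig a i e < 2 ^ a" by (simp add: dig.simps nat_less_iff)

end

definition barr where "barr m B xs \<longleftrightarrow> m B = length xs &
   (ALL j<length xs. m (B + 1 + 2 * j) = fst (xs ! j) & m (B + 2 + 2 * j) = snd (xs ! j))"

text \<open>\<open>ch\<close> is large enough for one block to hold the whole simulated memory of up
  to \<open>2 ^ (c * K * L)\<close> cells, and also an instance, all bucket slots or the random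
  table. \<open>cw\<close> makes words long enough for block sizes and for jump targets, for the
  total weight of a clique without overflow, and for bucket widths that exceed every weight.\<close>

locale red = prog k P c K q C0 kap ch cw
 for k :: nat and P :: program and c K q C0 kap ch cw :: nat +
 fixes L N :: nat and E :: "nat set set" and wt :: "nat set => int"
 assumes k: "3 <= k" and L: "1 <= L" and NL: "N <= 2 ^ L" and E: "simple_graph N E"
  and c: "1 <= c" and K: "1 <= K" and kap: "k * k <= 2 ^ kap"
  and ch: "ch = c * K + 4 * K + 3 * kap + 10"
  and cw: "ch + K + 1 <= cw" "pc_bound P + 2 <= 2 ^ cw" "100 * k + K + kap + 1 <= cw"
  and wt: "!!e. e : E ==> \<bar>wt e\<bar> <= 2 ^ (100 * k * L)"
begin

definition w where "w = cw * L"
definition H :: nat where "H = 2 ^ (ch * L)"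

lemma le_H: "e <= ch * L ==> x <= 2 ^ e ==> x <= H" unfolding H_def by (meson le_trans one_le_numeral power_increasing)

lemma H_less: "H < 2 ^ w" proof -
 have "ch * L < cw * L" using cw L by simp
 thus ?thesis by (simp add: H_def w_def)
qed

lemma C2_le: "C2 <= 2 ^ kap" proof -
 have "C2 <= k * k" unfolding choose_two by (rule order_trans[OF div_le_dividend]) simp
 thus ?thesis using kap by simp
qed

lemma C2_pos: "0 < C2" using k by (simp add: zero_less_binomial)

lemma chL: "c * (K * L) + 4 * (K * L) + 3 * kap + 10 * L <= ch * L" proof -
 have "kap * 1 <= kap * L" using L by (intro mult_left_mono) auto
 moreover have "ch * L = c * (K * L) + 4 * (K * L) + 3 * (kap * L) + 10 * L" by (simp add: ch algebra_simps)
 ultimately show ?thesis by linarith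
qed

lemma L_le: "L <= K * L" "1 <= K * L" using K L by simp_all

lemma w_pos: "0 < w" using cw L by (simp add: w_def)

lemma len_le_H:
 assumes "mu < K * L" "f < K * L"
 shows "3 + 2 * (2 ^ mu + C2 * 2 ^ f) <= H" proof (rule le_H)
 define X where "X = (2 :: nat) ^ (kap + K * L)"
 have "(2 :: nat) ^ f <= 2 ^ (K * L)" using assms by simp
 hence "C2 * 2 ^ f <= X" unfolding X_def power_add using C2_le by (intro mult_mono) auto
 moreover have "(2 :: nat) ^ mu <= X" unfolding X_def using assms by (intro power_increasing) auto
 moreover have "1 <= X" by (simp add: X_def)
 ultimately have "3 + 2 * (2 ^ mu + C2 * 2 ^ f) <= 3 * X + 2 * (X + X)" by (intro add_mono mult_left_mono) auto
 also have "... <= 2 ^ (3 + (kap + K * L))" by (simp add: X_def power_add)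
 finally show "3 + 2 * (2 ^ mu + C2 * 2 ^ f) <= 2 ^ (3 + (kap + K * L))" .
 show "3 + (kap + K * L) <= ch * L" using chL L by linarith
qed

lemma slot_le_H:
 assumes "a < K * L"
 shows "(C2 * 2 ^ a) * (4 * (2 ^ L * 2 ^ L)) <= H" proof (rule le_H)
 have "(2 :: nat) ^ a <= 2 ^ (K * L)" using assms by simp
 hence "C2 * 2 ^ a <= 2 ^ kap * 2 ^ (K * L)" using C2_le by (intro mult_mono) auto
 hence "(C2 * 2 ^ a) * (4 * (2 ^ L * 2 ^ L)) <= (2 ^ kap * 2 ^ (K * L)) * (4 * (2 ^ L * 2 ^ L))"
  by (rule mult_right_mono) simp
 also have "... = 2 ^ (kap + K * L + (2 + 2 * L))" by (simp add: power_add mult_2)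
 finally show "(C2 * 2 ^ a) * (4 * (2 ^ L * 2 ^ L)) <= 2 ^ (kap + K * L + (2 + 2 * L))" .
 show "kap + K * L + (2 + 2 * L) <= ch * L" using chL L by linarith
qed

lemma R_le_H: "2 ^ (L + kap) <= H" by (rule le_H[of "L + kap"]) (use chL L in linarith)+

lemma pow_KL_le_H: "x < K * L ==> 2 ^ x <= H" by (rule le_H[of x]) (use chL in linarith)+

lemma R_pow_le_H: "mu < K * L ==> 2 ^ (L + kap) + 2 ^ mu <= H" proof -
 assume mu: "mu < K * L"
 have "(2 :: nat) ^ (L + kap) <= 2 ^ (L + kap + K * L)" "(2 :: nat) ^ mu <= 2 ^ (L + kap + K * L)"
  using mu by (auto intro!: power_increasing)
 hence "(2 :: nat) ^ (L + kap) + 2 ^ mu <= 2 ^ (L + kap + K * L) + 2 ^ (L + kap + K * L)" by (rule add_mono)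
 hence "(2 :: nat) ^ (L + kap) + 2 ^ mu <= 2 ^ (L + kap + K * L + 1)" by simp
 thus ?thesis by (rule le_H[rotated]) (use chL L in linarith)
qed

end

text \<open>One guess, started in the fixed store \<open>v0\<close>, \<open>m0\<close>.
  \<open>F0\<close> is the first free block, and the bucket lists \<open>bl\<close> have been laid
  out from address \<open>BB\<close> on.\<close>

locale trial = red k P c K q C0 kap ch cw L N E wt
 for k :: nat and P :: program and c K q C0 kap ch cw L N :: nat and E :: "nat set set" and wt :: "nat set => int" +
 fixes a mu b f i F0 BB :: nat and bl :: "nat => nat => (nat \<times> nat) list" and v0 m0 :: "nat => nat"
 assumes a: "a < K * L" and mu: "mu < K * L" and b: "b < K * L" and f: "f < K * L" and muf: "mu <= f"
  and i: "i < 2 ^ w"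
  and F0: "(F0 + 2) * H < 2 ^ w" and BB: "BB + H <= F0 * H"
  and v0: "v0 vL = L" "v0 vPL = 2 ^ L" "v0 vH = H" "v0 vFP = F0" "v0 vA = a" "v0 vMu = mu" "v0 vB = b"
   "v0 vF = f" "v0 vI = i" "v0 vPA = 2 ^ a" "v0 vBB = BB"
  and bl: "!!e d. e < C2 ==> d < 2 ^ a ==>
   barr m0 (BB + (e * 2 ^ a + d) * (4 * (2 ^ L * 2 ^ L))) (bl e d) & length (bl e d) <= 2 ^ L * 2 ^ L"
begin

abbreviation base :: nat where "base == F0 * H"
definition ob where "ob = (F0 + 1) * H"

definition chosen where "chosen e = (if length (bl e (dig a i e)) <= 2 ^ f then bl e (dig a i e) else [])"

definition pad_list where "pad_list = map (%j. (j mod 2 ^ (L + kap), 2 ^ (L + kap) + j)) [0..<2 ^ mu]"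

definition edges_upto where "edges_upto e = pad_list @ concat (map chosen [0..<e])"

definition frame where
 "frame v \<longleftrightarrow> (ALL x. x ~: {vFP, vBase, vOb, vM, vS, vD, vK, vLen, vJ} --> v x = v0 x) &
   v vFP = F0 + 2 & v vBase = base & v vOb = ob"

definition holds where
 "holds es m \<longleftrightarrow> (ALL j<length es. m (base + 3 + 2 * j) = fst (es ! j) & m (base + 4 + 2 * j) = snd (es ! j)) &
   (ALL y. y < base + 3 \<or> base + 3 + 2 * length es <= y --> m y = m0 y)"

lemma frameD:
 assumes "frame v"
 shows "v vL = L" "v vPL = 2 ^ L" "v vH = H" "v vA = a" "v vMu = mu" "v vB = b"
   "v vF = f" "v vI = i" "v vPA = 2 ^ a" "v vBB = BB" "v vFP = F0 + 2" "v vBase = base" "v vOb = ob"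
 using assms v0 by (auto simp: frame_def)

lemma base_less: "y <= H ==> base + y < 2 ^ w" proof -
 assume "y <= H"
 moreover have "base + H + H < 2 ^ w" using F0 by (simp add: algebra_simps)
 ultimately show ?thesis by linarith
qed

lemma small: "y <= H ==> y < 2 ^ w" using H_less by simp

lemma le_mult: "0 < y ==> x <= x * y" for x y :: nat by simp

lemma alloc_correct:
 "hoare w (%v m. v = v0 & m = m0) alloc_com (maxtime alloc_com) (%v m. frame v & m = m0)" proof (rule hoare_wp)
 have 1: "F0 * H < 2 ^ w" "(F0 + 1) * H < 2 ^ w" using base_less[of 0] base_less[of H] by simp_all
 have "F0 + 2 <= (F0 + 2) * H" by (rule le_mult) (simp add: H_def)
 hence 2: "F0 + 2 < 2 ^ w" using F0 by simp
 hence 3: "F0 + 1 < 2 ^ w" "1 < (2 :: nat) ^ w" "2 < (2 :: nat) ^ w" by linarith+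
 show "wp w alloc_com (%v m. frame v & m = m0) v m" if "v = v0 & m = m0" for v m
  using that 1 2 3 w_pos by (simp add: alloc_com_def frame_def v0 ob_def mod_simps)
qed simp

lemma eval_R: "v vL = L ==> eval w R_exp v m = 2 ^ (L + kap)" proof -
 assume v: "v vL = L"
 have "L + kap < 2 ^ (L + kap)" by (rule less_exp)
 hence "L + kap < 2 ^ w" "(2 :: nat) ^ (L + kap) < 2 ^ w" using small[OF R_le_H] by linarith+
 moreover from this have "kap < 2 ^ w" "1 < (2 :: nat) ^ w" using L by linarith+
 ultimately show ?thesis using v by (simp add: R_exp_def push_bit_eq_mult mod_simps)
qed

lemma eval_shl1: "x < K * L ==> v r = x ==> eval w (Lit 1 [<<] Var r) v m = 2 ^ x"
 using small[OF pow_KL_le_H] w_pos by (simp add: push_bit_eq_mult mod_simps)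

lemma Suc_four: "Suc (base + 3 + x) = base + 4 + x" by simp

lemma pads_correct:
 "hoare w (%v m. frame v & m = m0) pads_com (esize (Lit 1 [<<] Var vMu) + 2 + 2 ^ mu * (maxtime pads_body + 4)) (%v m. frame v & holds pad_list m)"
proof (rule hoare_pre)
 fix v1 m1 assume 1: "frame v1 & m1 = m0"
 have len: "3 + 2 * 2 ^ mu <= H" using len_le_H[OF mu f] by simp
 have "hoare w (%v m. v = v1 & m = m0) pads_com (esize (Lit 1 [<<] Var vMu) + 2 + 2 ^ mu * (maxtime pads_body + 4))
  (%v m. v = v1(vJ := 0) & (ALL j<2 ^ mu. m (base + 3 + 2 * j) = j mod 2 ^ (L + kap) & m (Suc (base + 3 + 2 * j)) = 2 ^ (L + kap) + j) &
    (ALL x. x < base + 3 \<or> base + 3 + 2 * 2 ^ mu <= x --> m x = m0 x))"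
  unfolding pads_com_def pads_body_def proof (rule pair_loop)
  show "eval w (Lit 1 [<<] Var vMu) v1 m0 = 2 ^ mu" using 1 by (intro eval_shl1 mu) (auto dest: frameD)
  fix j m assume j: "j < (2 :: nat) ^ mu"
  have v: "(v1(vJ := j)) vL = L" "(v1(vJ := j)) vBase = base" "(v1(vJ := j)) vJ = j" using 1 by (simp_all add: frameD)
  have le: "4 + 2 * j <= H" using len j by linarith
  have "base + (4 + 2 * j) < 2 ^ w" by (rule base_less[OF le])
  hence lt: "base + (3 + 2 * j) < 2 ^ w" "base + (4 + 2 * j) < 2 ^ w" "j < 2 ^ w" by linarith+
  have "2 ^ (L + kap) + j <= H" using R_pow_le_H[OF mu] j by linarith
  hence lt2: "2 ^ (L + kap) + j < 2 ^ w" by (rule small)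
  have "j mod 2 ^ (L + kap) <= j" by simp
  hence lt3: "j mod 2 ^ (L + kap) < 2 ^ w" using lt by linarith
  show "eval w (Var vBase [+] (Lit 3 [+] Lit 2 [*] Var vJ)) (v1(vJ := j)) m = base + 3 + 2 * j &
    eval w (Var vBase [+] (Lit 4 [+] Lit 2 [*] Var vJ)) (v1(vJ := j)) m = Suc (base + 3 + 2 * j) &
    eval w (Var vJ [mod] R_exp) (v1(vJ := j)) m = j mod 2 ^ (L + kap) &
    eval w (R_exp [+] Var vJ) (v1(vJ := j)) m = 2 ^ (L + kap) + j" using v lt lt2 lt3 by (simp add: mod_simps eval_R)
 qed simp
 thus "hoare w (%v m. v = v1 & m = m1) pads_com (esize (Lit 1 [<<] Var vMu) + 2 + 2 ^ mu * (maxtime pads_body + 4)) (%v m. frame v & holds pad_list m)"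
  by (rule hoare_conseq)
    (use 1 in "auto simp: frame_def holds_def pad_list_def simp flip: Suc_four")
qed

definition slot where "slot e = BB + (e * 2 ^ a + dig a i e) * (4 * (2 ^ L * 2 ^ L))"

definition cinv where "cinv e v m \<longleftrightarrow> frame v & holds (edges_upto e) m & v vM = length (edges_upto e) &
   v vS = (SUM e<e. dig a i e)"

lemma length_edges_upto: "length (edges_upto e) <= 2 ^ mu + e * 2 ^ f" proof (induction e)
 case (Suc e)
 thus ?case by (simp add: edges_upto_def chosen_def)
qed (simp add: edges_upto_def pad_list_def)

lemma edges_upto_Suc: "edges_upto (Suc e) = edges_upto e @ chosen e" by (simp add: edges_upto_def)

lemma slot_bound:
 assumes "e < C2"
 shows "slot e + 2 + 2 * (2 ^ L * 2 ^ L) <= BB + H" proof -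
 let ?X = "2 ^ L * 2 ^ L :: nat"
 have "e * 2 ^ a + dig a i e + 1 <= e * 2 ^ a + 2 ^ a" using dig_less[of a i e] by simp
 also have "... = (e + 1) * 2 ^ a" by simp
 also have "... <= C2 * 2 ^ a" using assms by (intro mult_right_mono) auto
 finally have "(e * 2 ^ a + dig a i e + 1) * (4 * ?X) <= (C2 * 2 ^ a) * (4 * ?X)" by (rule mult_right_mono) simp
 also have "... <= H" by (rule slot_le_H[OF a])
 finally have "(e * 2 ^ a + dig a i e) * (4 * ?X) + 4 * ?X <= H" by (simp only: distrib_right mult_1)
 moreover have "1 <= ?X" by simp
 ultimately show ?thesis unfolding slot_def by linarith
qed

lemma sum_dig_le: "e <= C2 ==> (SUM e<e. dig a i e) <= H" proof -
 assume e: "e <= C2"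
 have "(SUM e<e. dig a i e) <= (SUM e<e. 2 ^ a)" using dig_less by (intro sum_mono) (auto intro: less_imp_le)
 also have "... = e * 2 ^ a" by simp
 also have "... <= C2 * 2 ^ a" using e by (rule mult_right_mono) simp
 also have "... <= (C2 * 2 ^ a) * (4 * (2 ^ L * 2 ^ L))" by (rule le_mult) simp
 also have "... <= H" by (rule slot_le_H[OF a])
 finally show ?thesis .
qed

lemma shift_amount:
 assumes "e < C2"
 shows "a * e < 2 ^ w" "e < 2 ^ w" "e * 2 ^ a < 2 ^ w" proof -
 have "e * 2 ^ a <= C2 * 2 ^ a" using assms by (intro mult_right_mono) auto
 also have "... <= (C2 * 2 ^ a) * (4 * (2 ^ L * 2 ^ L))" by (rule le_mult) simp
 also have "... <= H" by (rule slot_le_H[OF a])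
 finally show 1: "e * 2 ^ a < 2 ^ w" by (rule small)
 have "a <= 2 ^ a" using less_exp[of a] by simp
 hence "a * e <= e * 2 ^ a" by (subst mult.commute) (rule mult_left_mono, simp_all)
 with 1 show "a * e < 2 ^ w" by (rule le_less_trans[rotated])
 have "e <= e * 2 ^ a" by (rule le_mult) simp
 with 1 show "e < 2 ^ w" by (rule le_less_trans[rotated])
qed

lemma a_le_w: "a <= w" proof -
 have "2 ^ a <= H" by (rule pow_KL_le_H[OF a])
 hence "(2 :: nat) ^ a < 2 ^ w" using H_less by linarith
 thus ?thesis by simp
qed

lemma word_mod: "word w z mod 2 ^ a = nat (z mod 2 ^ a)" proof -
 have "int (word w z mod 2 ^ a) = z mod 2 ^ w mod 2 ^ a" by (simp add: zmod_int int_word)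
 also have "... = z mod 2 ^ a" using a_le_w by (simp add: mod_mod_cancel le_imp_power_dvd)
 finally show ?thesis by simp
qed

lemma eval_minus3: "eval w (A [-] B [-] X) v m =
  eval_binop w Minus (eval_binop w Minus (eval w A v m) (eval w B v m)) (eval w X v m)" by (simp only: eval.simps)

lemma eval_Lit0: "eval w (Lit 0) v m = word w 0" by (simp add: word_def)

lemma wp_digit:
 assumes e: "e < C2" and v: "frame v" "v vS = (SUM e<e. dig a i e)"
 shows "wp w (digit_com e) Q v m = Q (v(vD := dig a i e, vS := (SUM e<Suc e. dig a i e))) m" proof -
 note fr = frameD[OF v(1)]
 have S: "(SUM e<Suc e. dig a i e) < 2 ^ w" "(SUM e<e. dig a i e) < 2 ^ w"
  using sum_dig_le[of "Suc e"] sum_dig_le[of e] e small by auto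
 have lt: "dig a i e < 2 ^ w" using S by simp
 have idiv: "i div 2 ^ x < 2 ^ w" for x by (rule le_less_trans[OF div_le_dividend i])
 have "eval w (if e < DD then Var vI [>>] (Var vA [*] Lit e) [mod] Var vPA
   else (Lit 0 [-] Var vS [-] (Var vI [>>] (Var vA [*] Lit DD))) [mod] Var vPA) v m = dig a i e" proof (cases "e < DD")
  case True
  have "i div 2 ^ (a * e) mod 2 ^ a < 2 ^ w" by (rule le_less_trans[OF mod_less_eq_dividend idiv])
  thus ?thesis using True shift_amount[OF e] fr idiv by (simp add: dig.simps drop_bit_eq_div mod_simps)
 next
  case False
  hence eD: "e = DD" using e by simp
  have dsum: "(SUM e<e. dig a i e) = (SUM e<DD. i div 2 ^ (a * e) mod 2 ^ a)"
   unfolding eD by (rule sum.cong) (auto simp: dig.simps)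
  let ?s = "SUM e<e. dig a i e" and ?x = "i div 2 ^ (a * e)"
  have shr: "eval w (Var vI [>>] (Var vA [*] Lit DD)) v m = word w (int ?x)"
   using shift_amount[OF e] fr idiv eD by (simp add: drop_bit_eq_div word_of_nat mod_simps)
  have s: "eval w (Var vS) v m = word w (int ?s)" using S v by (simp add: word_of_nat del: of_nat_sum)
  \<comment> \<open>The subtraction wraps around modulo \<open>2 ^ w\<close>, a multiple of
    \<open>2 ^ a\<close>, so the last digit still comes out right.\<close>
  have "eval w (Lit 0 [-] Var vS [-] (Var vI [>>] (Var vA [*] Lit DD))) v m = word w (0 - int ?s - int ?x)"
   unfolding eval_minus3 shr s by (simp only: word_minus eval_Lit0)
  hence "eval w ((Lit 0 [-] Var vS [-] (Var vI [>>] (Var vA [*] Lit DD))) [mod] Var vPA) v m =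
    word w (0 - int ?s - int ?x) mod 2 ^ a mod 2 ^ w"
   using fr by (simp only: eval.simps(3)[of w Mod] eval_binop.simps eval.simps(2))
  also have "... = word w (0 - int ?s - int ?x) mod 2 ^ a"
   by (intro mod_less le_less_trans[OF mod_less_eq_dividend word_less])
  also have "... = dig a i e" using False dsum eD by (simp add: word_mod dig.simps)
  finally show ?thesis using False by simp
 qed
 moreover have "eval w (Var vS [+] Var vD) (v(vD := dig a i e)) m = (SUM e<Suc e. dig a i e)" using S v by simp
 ultimately show ?thesis unfolding digit_com_def wp.simps by (simp only:)
qed

definition copy_time where "copy_time e = maxtime (copy_com e) + (maxtime copy_body + 7) * 2 ^ f"

lemma le_arith:
 fixes A B C F l h :: nat
 shows "3 + 2 * (A + C) <= h ==> B + F <= C ==> l <= A + B ==> 3 + 2 * (l + F) <= h" by arith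

lemma copy_correct:
 assumes e: "e < C2"
 shows "hoare w (cinv e) (copy_com e) (copy_time e) (cinv (Suc e))" proof (rule hoare_pre)
 fix v1 m1 assume c1: "cinv e v1 m1"
 hence fr1: "frame v1" and h1: "holds (edges_upto e) m1" and M1: "v1 vM = length (edges_upto e)"
  and S1: "v1 vS = (SUM e<e. dig a i e)" by (auto simp: cinv_def)
 note fr = frameD[OF fr1]
 let ?g = "Bin Less (Var vLen) ((Lit 1 [<<] Var vF) [+] Lit 1)" and ?d = "dig a i e" and ?l = "length (bl e (dig a i e))" and ?es = "edges_upto e"
 define v2 where "v2 = v1(vD := ?d, vS := (SUM e<Suc e. dig a i e), vK := slot e, vLen := ?l)"
 have bl1: "barr m0 (slot e) (bl e ?d)" "?l <= 2 ^ L * 2 ^ L" using bl[OF e dig_less] by (simp_all add: slot_def)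
 have sb: "slot e + 2 + 2 * (2 ^ L * 2 ^ L) <= base" using slot_bound[OF e] BB by linarith
 have m1: "m1 y = m0 y" if "y < base" for y using h1 that by (simp add: holds_def)
 have "m1 (slot e) = m0 (slot e)" by (rule m1) (use sb in simp)
 hence mslot: "m1 (slot e) = ?l" using bl1 by (simp add: barr_def)
 have base0: "base < 2 ^ w" using base_less[of 0] by simp
 have lts: "slot e < 2 ^ w" using sb base0 by linarith
 have esz: "eval w (slot_exp (Lit e [*] Var vPA [+] Var vD)) (v1(vD := ?d, vS := S)) m1 = slot e" for S
  using fr lts by (simp add: slot_exp_def slot_def mod_simps)
 have pre: "hoare w (%v m. v = v1 & m = m1) (digit_com e ;; Asg vK (slot_exp (Lit e [*] Var vPA [+] Var vD)) ;;
   Asg vLen (Mem (Var vK))) (maxtime (digit_com e ;; Asg vK (slot_exp (Lit e [*] Var vPA [+] Var vD)) ;;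
   Asg vLen (Mem (Var vK)))) (%v m. v = v2 & m = m1)"
  by (rule hoare_wp) (simp_all add: wp_digit[OF e fr1 S1] esz mslot v2_def)
 have fr2: "frame v2" using fr1 by (simp add: frame_def v2_def)
 note fr2' = frameD[OF fr2]
 have v2: "v2 vM = length ?es" "v2 vK = slot e" "v2 vLen = ?l" using M1 by (simp_all add: v2_def)
 have "2 ^ f <= H" by (rule pow_KL_le_H[OF f])
 have "3 + 2 * (2 ^ mu + C2 * 2 ^ f) <= H" by (rule len_le_H[OF mu f])
 moreover have le: "e * 2 ^ f + 2 ^ f <= C2 * 2 ^ f" proof -
  have "Suc e * 2 ^ f <= C2 * 2 ^ f" using e by (intro mult_right_mono) auto
  thus ?thesis by simp
 qed
 ultimately have leH: "3 + 2 * (length ?es + 2 ^ f) <= H" using length_edges_upto[of e] by (rule le_arith)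
 have f1: "2 ^ f + 1 < (2 :: nat) ^ w" using leH by (intro small) arith
 have cond: "eval w ?g v2 m1 = (if ?l <= 2 ^ f then 1 else 0)" proof -
  have "eval w (Lit 1 [<<] Var vF) v2 m1 = 2 ^ f" by (rule eval_shl1[OF f]) (use fr2' in simp)
  hence "eval w ((Lit 1 [<<] Var vF) [+] Lit 1) v2 m1 = 2 ^ f + 1" using f1 w_pos by (simp add: mod_simps)
  thus ?thesis using v2 w_pos by (simp add: less_Suc_eq_le)
 qed
 show "hoare w (%v m. v = v1 & m = m1) (copy_com e) (copy_time e) (cinv (Suc e))"
  unfolding copy_com_def proof (rule hoare_seq[OF pre hoare_cond[OF _ _ order_refl]])
  show "hoare w (%v m. (v = v2 & m = m1) & eval w ?g v m = 0) Skip
    (maxtime (Asg vM (Var vM [+] Var vLen)) + (maxtime copy_body + 7) * 2 ^ f) (cinv (Suc e))" proof (rule hoare_wp)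
   fix v m assume vm: "(v = v2 & m = m1) & eval w ?g v m = 0"
   hence "~ ?l <= 2 ^ f" using cond by auto
   hence "chosen e = []" by (simp add: chosen_def)
   thus "wp w Skip (cinv (Suc e)) v m" using vm fr2 h1 M1 by (simp add: cinv_def edges_upto_Suc v2_def)
  qed simp
  let ?B = "base + 3 + 2 * length ?es"
  have loop: "hoare w (%v m. v = v2 & m = m1) copy_loop
   (3 + ?l * (maxtime copy_body + 4))
   (%v m. v = v2(vJ := 0) & (ALL j<?l. m (?B + 2 * j) = fst (bl e ?d ! j) & m (Suc (?B + 2 * j)) = snd (bl e ?d ! j)) &
    (ALL x. x < ?B \<or> ?B + 2 * ?l <= x --> m x = m1 x))" if l: "?l <= 2 ^ f"
   unfolding copy_loop_def copy_body_def proof (rule pair_loop)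
   show "eval w (Var vLen) v2 m1 = ?l" using v2 by simp
   fix j m assume j: "j < ?l" and m: "!!x. x < ?B \<or> ?B + 2 * ?l <= x ==> m x = m1 x"
   let ?v = "v2(vJ := j)"
   have v: "?v vBase = base" "?v vM = length ?es" "?v vK = slot e" "?v vJ = j" using fr2' v2 by simp_all
   have "4 + 2 * (length ?es + j) <= H" using leH j l by arith
   from base_less[OF this] have lt: "base + (4 + 2 * (length ?es + j)) < 2 ^ w" "base + (3 + 2 * (length ?es + j)) < 2 ^ w"
    by linarith+
   have sl: "slot e + (2 + 2 * j) < base" using sb bl1(2) j by linarith
   hence lt2: "slot e + (2 + 2 * j) < 2 ^ w" "slot e + (1 + 2 * j) < 2 ^ w" using base0 by linarith+
   have rd: "m (slot e + (1 + 2 * j)) = fst (bl e ?d ! j)" "m (slot e + (2 + 2 * j)) = snd (bl e ?d ! j)" proof -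
    have "m (slot e + (1 + 2 * j)) = m0 (slot e + (1 + 2 * j))" "m (slot e + (2 + 2 * j)) = m0 (slot e + (2 + 2 * j))"
     using m m1 sl by simp_all
    moreover have "m0 (slot e + 1 + 2 * j) = fst (bl e ?d ! j)" "m0 (slot e + 2 + 2 * j) = snd (bl e ?d ! j)"
     using bl1(1) j unfolding barr_def by blast+
    ultimately show "m (slot e + (1 + 2 * j)) = fst (bl e ?d ! j)" "m (slot e + (2 + 2 * j)) = snd (bl e ?d ! j)"
     by (simp_all only: add.assoc)
   qed
   have "eval w (Var vK [+] (Lit 1 [+] Lit 2 [*] Var vJ)) ?v m = slot e + (1 + 2 * j)"
    "eval w (Var vK [+] (Lit 2 [+] Lit 2 [*] Var vJ)) ?v m = slot e + (2 + 2 * j)"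
    using v lt2 w_pos by (simp_all add: mod_simps)
   with rd have mem: "eval w (Mem (Var vK [+] (Lit 1 [+] Lit 2 [*] Var vJ))) ?v m = fst (bl e ?d ! j)"
    "eval w (Mem (Var vK [+] (Lit 2 [+] Lit 2 [*] Var vJ))) ?v m = snd (bl e ?d ! j)" by (simp_all only: eval.simps(4))
   have "eval w (Var vBase [+] (Lit 3 [+] Lit 2 [*] (Var vM [+] Var vJ))) ?v m = ?B + 2 * j &
     eval w (Var vBase [+] (Lit 4 [+] Lit 2 [*] (Var vM [+] Var vJ))) ?v m = Suc (?B + 2 * j)"
    using v lt by (simp add: mod_simps algebra_simps)
   with mem show "eval w (Var vBase [+] (Lit 3 [+] Lit 2 [*] (Var vM [+] Var vJ))) ?v m = ?B + 2 * j &
     eval w (Var vBase [+] (Lit 4 [+] Lit 2 [*] (Var vM [+] Var vJ))) ?v m = Suc (?B + 2 * j) &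
     eval w (Mem (Var vK [+] (Lit 1 [+] Lit 2 [*] Var vJ))) ?v m = fst (bl e ?d ! j) &
     eval w (Mem (Var vK [+] (Lit 2 [+] Lit 2 [*] Var vJ))) ?v m = snd (bl e ?d ! j)" by (simp only: simp_thms)
  qed simp
  show "hoare w (%v m. (v = v2 & m = m1) & eval w ?g v m ~= 0)
   (copy_loop ;; Asg vM (Var vM [+] Var vLen)) (maxtime (Asg vM (Var vM [+] Var vLen)) + (maxtime copy_body + 7) * 2 ^ f) (cinv (Suc e))"
  proof (cases "?l <= 2 ^ f")
   case False
   thus ?thesis using cond by (auto simp: hoare_def)
  next
   case True
   hence ch: "chosen e = bl e ?d" by (simp add: chosen_def)
   show ?thesis proof (rule hoare_seq[OF hoare_conseq[OF loop[OF True]] hoare_wp[OF _ order_refl]])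
    fix v m
    assume vm: "v = v2(vJ := 0) & (ALL j<?l. m (?B + 2 * j) = fst (bl e ?d ! j) & m (Suc (?B + 2 * j)) = snd (bl e ?d ! j)) &
     (ALL x. x < ?B \<or> ?B + 2 * ?l <= x --> m x = m1 x)"
    have "length ?es + ?l < 2 ^ w" by (rule small) (use leH True in arith)
    hence M: "eval w (Var vM [+] Var vLen) v m = length ?es + ?l" using vm v2 by simp
    have "frame (v(vM := length ?es + ?l))" using vm fr2 by (simp add: frame_def)
    moreover have "holds (edges_upto (Suc e)) m" unfolding holds_def edges_upto_Suc ch proof (intro conjI allI impI)
     fix j assume j: "j < length (?es @ bl e ?d)"
     have "m (base + 3 + 2 * j) = fst ((?es @ bl e ?d) ! j) & m (base + 4 + 2 * j) = snd ((?es @ bl e ?d) ! j)"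
     proof (cases "j < length ?es")
      case True
      hence "m (base + 3 + 2 * j) = m1 (base + 3 + 2 * j)" "m (base + 4 + 2 * j) = m1 (base + 4 + 2 * j)"
       using vm by simp_all
      thus ?thesis using True h1 by (simp add: holds_def nth_append)
     next
      case False
      define j' where "j' = j - length ?es"
      have j': "j = length ?es + j'" "j' < ?l" using False j by (auto simp: j'_def)
      have eq: "base + 3 + 2 * j = ?B + 2 * j'" "base + 4 + 2 * j = Suc (?B + 2 * j')" by (simp_all add: j')
      have "m (?B + 2 * j') = fst (bl e ?d ! j')" "m (Suc (?B + 2 * j')) = snd (bl e ?d ! j')" using vm j'(2) by blast+
      thus ?thesis unfolding eq by (simp add: nth_append j'(1))
     qed
     thus "m (base + 3 + 2 * j) = fst ((?es @ bl e ?d) ! j)" "m (base + 4 + 2 * j) = snd ((?es @ bl e ?d) ! j)" by simp_all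
    next
     fix y assume y: "y < base + 3 \<or> base + 3 + 2 * length (?es @ bl e ?d) <= y"
     hence "m y = m1 y" using vm by auto
     moreover have "m1 y = m0 y" using h1 y by (auto simp: holds_def)
     ultimately show "m y = m0 y" by simp
    qed
    ultimately show "wp w (Asg vM (Var vM [+] Var vLen)) (cinv (Suc e)) v m"
     unfolding wp.simps M using vm by (simp add: cinv_def edges_upto_Suc ch v2_def)
   next
    have le3: "3 <= 3 * (2 :: nat) ^ f" by simp
    have le4: "?l * (maxtime copy_body + 4) <= 2 ^ f * (maxtime copy_body + 4)" using True by (rule mult_right_mono) simp
    have "(maxtime copy_body + 7) * 2 ^ f = 3 * 2 ^ f + 2 ^ f * (maxtime copy_body + 4)" by (simp add: algebra_simps)
    thus "3 + ?l * (maxtime copy_body + 4) <= (maxtime copy_body + 7) * 2 ^ f" using add_mono[OF le3 le4] by (simp only:)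
   qed auto
  qed
  show "maxtime (digit_com e ;; Asg vK (slot_exp (Lit e [*] Var vPA [+] Var vD)) ;; Asg vLen (Mem (Var vK))) +
   (esize ?g + 2 +
    (maxtime (Asg vM (Var vM [+] Var vLen)) + (maxtime copy_body + 7) * 2 ^ f)) <= copy_time e"
   by (simp add: copy_time_def copy_com_def copy_loop_def)
 qed
qed

end

section \<open>The simulated listing run and the verification of its output\<close>

lemma concat_pairs_nth:
 assumes "j < length es"
 shows "concat (map (%(u, v). [u, v]) es) ! (2 * j) = fst (es ! j)"
  "concat (map (%(u, v). [u, v]) es) ! Suc (2 * j) = snd (es ! j)" proof -
 have "concat (map (%(u, v). [u, v]) es) ! (2 * j) = fst (es ! j) &
  concat (map (%(u, v). [u, v]) es) ! Suc (2 * j) = snd (es ! j)" using assms proof (induction es arbitrary: j)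
  case (Cons x xs)
  thus ?case by (cases j) (auto simp: case_prod_unfold)
 qed simp
 thus "concat (map (%(u, v). [u, v]) es) ! (2 * j) = fst (es ! j)"
  "concat (map (%(u, v). [u, v]) es) ! Suc (2 * j) = snd (es ! j)" by auto
qed

lemma length_concat_pairs [simp]: "length (concat (map (%(u, v). [u, v]) es)) = 2 * length es" by (induction es) auto

lemma length_listing_input [simp]: "length (listing_input n es t) = 3 + 2 * length es" by (simp add: listing_input_def)

lemma listing_input_nth:
 "listing_input n es t ! 0 = n" "listing_input n es t ! 1 = length es" "listing_input n es t ! 2 = t"
 "j < length es ==> listing_input n es t ! (3 + 2 * j) = fst (es ! j)"
 "j < length es ==> listing_input n es t ! (4 + 2 * j) = snd (es ! j)"
 using concat_pairs_nth[of j es] by (simp_all add: listing_input_def numeral_eq_Suc)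

lemma writes_dispatch: "writes (dispatch l is) <= {vPc, vOc} \<union> range vreg" proof (induction "is" arbitrary: l)
 case (Cons i "is")
 have "writes (sim_instr i) <= {vPc, vOc} \<union> range vreg" by (cases i) auto
 with Cons show ?case by auto
qed simp

lemma hoare_seq_assoc:
 assumes "hoare w A ((c1 ;; c2) ;; c3) t B"
 shows "hoare w A (c1 ;; c2 ;; c3) t B" proof -
 have "sem w (c1 ;; c2 ;; c3) s = sem w ((c1 ;; c2) ;; c3) s" for s
  by (simp add: bind_assoc_pmf bind_map_pmf map_bind_pmf case_prod_unfold pmf.map_comp o_def add.assoc)
 thus ?thesis using assms by (simp add: hoare_def del: sem.simps)
qed

lemma phoare_seq_assoc:
 assumes "phoare w A ((c1 ;; c2) ;; c3) p B"
 shows "phoare w A (c1 ;; c2 ;; c3) p B" proof -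
 have "outd w (c2 ;; c3) = (%s. bind_pmf (outd w c2 s) (outd w c3))" by (rule ext) (rule outd_simps)
 hence "outd w (c1 ;; c2 ;; c3) s = outd w ((c1 ;; c2) ;; c3) s" for s by (simp add: outd_simps bind_assoc_pmf)
 thus ?thesis using assms by (simp add: phoare_def)
qed

lemma phoare_pre:
 assumes "!!v0 m0. A v0 m0 ==> phoare w (%v m. v = v0 & m = m0) c p B"
 shows "phoare w A c p B" using assms unfolding phoare_def by blast

lemma phoare_seq_hoare:
 assumes "hoare w A c1 t B" "phoare w B c2 p Q"
 shows "phoare w A (c1 ;; c2) p Q" proof (cases "0 <= p")
 case True
 show ?thesis by (rule phoare_seq[OF phoare_of_hoare[OF assms(1)] assms(2) True]) simp
next
 case False
 show ?thesis unfolding phoare_def proof (intro allI impI)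
  fix v m
  have "0 <= prob (outd w (c1 ;; c2) (v, m)) {x. Q (fst x) (snd x)}" by simp
  thus "p <= prob (outd w (c1 ;; c2) (v, m)) {x. Q (fst x) (snd x)}" using False by linarith
 qed
qed

context prog
begin

text \<open>An instance has \<open>2 ^ (L + kap) + 2 ^ mu\<close> nodes. For
  \<open>L + kap <= mu\<close> the logarithm of this rounds up to \<open>mu + 1\<close>, so
  \<open>P\<close> expects words of \<open>c * (mu + 1)\<close> bits.\<close>

definition init_com where
 "init_com = Asg vW (Lit 1 [<<] (Lit c [*] (Var vMu [+] Lit 1))) ;; Asg vPc (Lit 0) ;; Asg vOc (Lit 0)"

text \<open>The registers of the simulated machine may still hold values of the previous
  trial.\<close>

definition zero_regs_com where "zero_regs_com = seqs (map (%r. Asg (vreg r) (Lit 0)) [0..<reg_bound P])"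

definition sim_loop where "sim_loop = For vFu (Lit 1 [<<] Var vF) (dispatch 0 P)"

definition y_exp where "y_exp p = Mem (Var vOb [+] (Var vJ [*] Lit k [+] Lit p)) [mod] Var vPL"

text \<open>Block 1 holds the adjacency matrix of the weighted graph and block 2 its weights, both
  in rows of length \<open>2 ^ L\<close>.\<close>

definition adj_exp where "adj_exp x y = Var vH [+] (x [*] Var vPL [+] y)"

definition wt_exp where "wt_exp x y = Lit 2 [*] Var vH [+] (x [*] Var vPL [+] y)"

definition ok_exp where "ok_exp = foldr (%(p, l) e. Mem (adj_exp (y_exp p) (y_exp l)) [*] e) (prl k) (Lit 1)"

definition sum_exp where "sum_exp = foldr (%(p, l) e. Mem (wt_exp (y_exp p) (y_exp l)) [+] e) (prl k) (Lit 0)"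

definition check_body where "check_body = Cond ok_exp (Cond sum_exp Skip (Asg vFlag (Lit 1))) Skip"

definition check_com where "check_com = For vJ (Bin Div (Var vOc) (Lit k)) check_body"

definition trial_com where "trial_com = build_com ;; (init_com ;; zero_regs_com ;; sim_loop) ;; check_com"

end

context red
begin

definition tabs where
 "tabs m \<longleftrightarrow> (ALL x<2 ^ L. ALL y<2 ^ L. m (H + (x * 2 ^ L + y)) = (if {x, y} : E then 1 else 0) &
   ({x, y} : E --> m (2 * H + (x * 2 ^ L + y)) = word w (wt {x, y})))"

definition has_zero_clique where "has_zero_clique \<longleftrightarrow> (EX S:cliques k N E. clique_weight E wt S = 0)"

lemma vertex_index_le_H:
 assumes "x < 2 ^ L" "y < 2 ^ L"
 shows "x * 2 ^ L + y < H" proof -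
 have "x * 2 ^ L + y < (x + 1) * 2 ^ L" using assms by simp
 also have "... <= 2 ^ L * 2 ^ L" using assms by (intro mult_right_mono) auto
 also have "... = 2 ^ (2 * L)" by (simp add: mult_2 power_add)
 also have "... <= H" by (rule le_H[of "2 * L"]) (use chL in linarith, simp)
 finally show ?thesis .
qed

end

context trial
begin

sublocale I: inst w k a L E wt N kap mu proof unfold_locales
 have "k <= k * k" by (cases k) auto
 thus "k <= 2 ^ kap" using kap by (rule order_trans)
qed (use k a_le_w E NL in auto)

definition ES where "ES = edges_upto C2"

definition inp where "inp = listing_input (2 ^ (L + kap) + 2 ^ mu) ES (2 ^ b)"

definition input_mem where "input_mem m \<longleftrightarrow> (ALL y<length inp. m (base + y) = inp ! y) &
   (ALL y. y < base \<or> base + length inp <= y --> m y = m0 y)"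

lemma length_inp: "length inp <= H" proof -
 have "length inp <= 3 + 2 * (2 ^ mu + C2 * 2 ^ f)" using length_edges_upto[of C2] by (simp add: inp_def ES_def)
 also have "... <= H" by (rule len_le_H[OF mu f])
 finally show ?thesis .
qed

definition build_time where
 "build_time = maxtime alloc_com + (esize (Lit 1 [<<] Var vMu) + 2 + 2 ^ mu * (maxtime pads_body + 4)) +
   maxtime (Asg vM (Lit 1 [<<] Var vMu) ;; Asg vS (Lit 0)) +
   C2 * ((SUM e<C2. maxtime (copy_com e)) + (maxtime copy_body + 7) * 2 ^ f) + maxtime header_com"

lemma build_correct:
 "hoare w (%v m. v = v0 & m = m0) build_com build_time (%v m. frame v & input_mem m)" proof -
 have 1: "hoare w (%v m. frame v & holds pad_list m) (Asg vM (Lit 1 [<<] Var vMu) ;; Asg vS (Lit 0))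
   (maxtime (Asg vM (Lit 1 [<<] Var vMu) ;; Asg vS (Lit 0))) (cinv 0)" proof (rule hoare_wp)
  fix v m assume vm: "frame v & holds pad_list m"
  have "eval w (Lit 1 [<<] Var vMu) v m = 2 ^ mu" by (rule eval_shl1[OF mu]) (use vm in "auto dest: frameD")
  thus "wp w (Asg vM (Lit 1 [<<] Var vMu) ;; Asg vS (Lit 0)) (cinv 0) v m"
   unfolding wp.simps using vm by (simp add: cinv_def edges_upto_def frame_def pad_list_def)
 qed simp
 have 2: "hoare w (cinv 0) (seqs (map copy_com [0..<C2]))
   (C2 * ((SUM e<C2. maxtime (copy_com e)) + (maxtime copy_body + 7) * 2 ^ f)) (cinv C2)"
 proof (rule hoare_seqs[where I = cinv])
  fix e assume "e < length (map copy_com [0..<C2])"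
  hence e: "e < C2" by simp
  have "maxtime (copy_com e) <= (SUM e<C2. maxtime (copy_com e))" using e by (intro member_le_sum) auto
  thus "hoare w (cinv e) (map copy_com [0..<C2] ! e)
    ((SUM e<C2. maxtime (copy_com e)) + (maxtime copy_body + 7) * 2 ^ f) (cinv (Suc e))"
   using e by (auto intro!: hoare_conseq[OF copy_correct[OF e]] simp: copy_time_def)
 qed auto
 have 3: "hoare w (cinv C2) header_com (maxtime header_com) (%v m. frame v & input_mem m)" proof (rule hoare_wp)
  fix v m assume vm: "cinv C2 v m"
  hence fr: "frame v" and h: "holds ES m" and M: "v vM = length ES" by (simp_all add: cinv_def ES_def)
  have lt: "base < 2 ^ w" "base + 1 < 2 ^ w" "base + 2 < 2 ^ w" using base_less[of 2] length_inp by (auto simp: inp_def)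
  have R: "eval w (R_exp [+] (Lit 1 [<<] Var vMu)) v m' = 2 ^ (L + kap) + 2 ^ mu" for m' proof -
   have "eval w (Lit 1 [<<] Var vMu) v m' = 2 ^ mu" by (rule eval_shl1[OF mu]) (use fr in "auto dest: frameD")
   moreover have "eval w R_exp v m' = 2 ^ (L + kap)" by (rule eval_R) (use fr in "auto dest: frameD")
   ultimately show ?thesis using small[OF R_pow_le_H[OF mu]] by simp
  qed
  have B: "eval w (Lit 1 [<<] Var vB) v m' = 2 ^ b" for m' by (rule eval_shl1[OF b]) (use fr in "auto dest: frameD")
  have A: "eval w (Var vBase) v m' = base" "eval w (Var vBase [+] Lit 1) v m' = base + 1"
   "eval w (Var vBase [+] Lit 2) v m' = base + 2" "eval w (Var vM) v m' = length ES" for m'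
   using lt frameD[OF fr] M w_pos by (simp_all add: mod_simps)
  let ?m = "m(base := 2 ^ (L + kap) + 2 ^ mu, base + 1 := length ES, base + 2 := 2 ^ b)"
  have "input_mem ?m" unfolding input_mem_def proof (intro conjI allI impI)
   fix y assume y: "y < length inp"
   show "?m (base + y) = inp ! y" proof (cases "y < 3")
    case True
    then consider "y = 0" | "y = 1" | "y = 2" by linarith
    thus ?thesis by cases (simp_all add: inp_def listing_input_nth[simplified])
   next
    case False
    have "y = 3 + 2 * ((y - 3) div 2) \<or> y = 4 + 2 * ((y - 3) div 2)" using False by presburger
    then obtain j where j: "y = 3 + 2 * j \<or> y = 4 + 2 * j" by blast
    hence jl: "j < length ES" using y by (auto simp: inp_def)
    have "m (base + 3 + 2 * j) = fst (ES ! j)" "m (base + 4 + 2 * j) = snd (ES ! j)" using h jl by (auto simp: holds_def)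
    hence "m (base + (3 + 2 * j)) = fst (ES ! j)" "m (base + (4 + 2 * j)) = snd (ES ! j)" by (simp_all only: add.assoc)
    moreover have "?m (base + y) = m (base + y)" using False by auto
    ultimately show ?thesis using j jl by (auto simp: inp_def listing_input_nth simp del: One_nat_def)
   qed
  next
   fix y assume y: "y < base \<or> base + length inp <= y"
   hence "m y = m0 y" using h by (auto simp: holds_def inp_def)
   moreover have "?m y = m y" using y by (auto simp: inp_def)
   ultimately show "?m y = m0 y" by simp
  qed
  thus "wp w header_com (%v m. frame v & input_mem m) v m" unfolding header_com_def wp.simps R B A using fr by simp
 qed simp
 show ?thesis unfolding build_com_def
  by (rule hoare_seq[OF alloc_correct hoare_seq[OF pads_correct hoare_seq[OF 1 hoare_seq[OF 2 3 order_refl] order_refl] order_refl]])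
    (simp add: build_time_def)
qed

definition wl where "wl = c * (mu + 1)"

lemma wl_le: "2 ^ wl <= H" "0 < wl" "wl < w" proof -
 have "c * (mu + 1) <= c * (K * L)" using mu by (intro mult_left_mono) auto
 hence le: "wl <= ch * L" unfolding wl_def using chL by linarith
 thus "2 ^ wl <= H" by (rule le_H) simp
 show "0 < wl" using c by (simp add: wl_def)
 have "ch * L < w" using cw L by (simp add: w_def)
 with le show "wl < w" by simp
qed

lemma sim_locale: "sim w wl base ob (2 ^ f) P" proof
 show "0 < wl" "wl < w" using wl_le by auto
 show "base + 2 ^ wl <= ob" using wl_le by (simp add: ob_def)
 have "2 ^ f <= H" by (rule pow_KL_le_H[OF f])
 moreover have "ob + H < 2 ^ w" using F0 by (simp add: ob_def algebra_simps)
 ultimately show "ob + 2 ^ f < 2 ^ w" by linarith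
 have "(2 :: nat) ^ cw <= 2 ^ w" unfolding w_def using L by (intro power_increasing) auto
 thus "Suc (pc_bound P) < 2 ^ w" using cw by linarith
qed

sublocale sim w wl base ob "2 ^ f" P m1 for m1 by (rule sim_locale)

definition frame2 where
 "frame2 v \<longleftrightarrow> (ALL x. x ~: {vFP, vBase, vOb, vM, vS, vD, vK, vLen, vJ, vW, vPc, vOc, vFu, vFlag} -->
    x ~: range vreg --> v x = v0 x) &
   v vFP = F0 + 2 & v vBase = base & v vOb = ob"

lemma frame2D:
 assumes "frame2 v"
 shows "v vL = L" "v vPL = 2 ^ L" "v vH = H" "v vA = a" "v vMu = mu" "v vB = b"
   "v vF = f" "v vI = i" "v vPA = 2 ^ a" "v vBB = BB" "v vFP = F0 + 2" "v vBase = base" "v vOb = ob"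
 using assms v0 unfolding frame2_def by (auto simp: image_iff)

lemma frame_frame2: "frame v ==> frame2 v" by (simp add: frame_def frame2_def)

definition ready :: "(nat => nat) => (nat => nat) => (nat => nat) => bool" where
 "ready m1 v m \<longleftrightarrow> frame2 v & m = m1 & v vW = 2 ^ wl & v vPc = 0 & v vOc = 0 & v vFlag = v0 vFlag"

definition init_time where "init_time = maxtime init_com + reg_bound P * 2"

lemma init_correct:
 "hoare w (%v m. frame v & m = m1) (init_com ;; zero_regs_com) init_time
   (%v m. ready m1 v m & (ALL r<reg_bound P. v (vreg r) = 0))" proof (rule hoare_seq)
 show "hoare w (%v m. frame v & m = m1) init_com (maxtime init_com) (ready m1)" proof (rule hoare_wp)
  fix v m assume vm: "frame v & m = m1"
  have lt: "2 ^ wl < (2 :: nat) ^ w" using wl_le by simp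
  have "wl < 2 ^ wl" by (rule less_exp)
  hence wl_lt: "wl < 2 ^ w" using lt by linarith
  have "1 * (mu + 1) <= c * (mu + 1)" using c by (rule mult_right_mono) simp
  from le_less_trans[OF this wl_lt[unfolded wl_def]] have "mu + 1 < 2 ^ w" by (simp only: mult_1)
  have "c * 1 <= c * (mu + 1)" by (rule mult_left_mono) simp_all
  from le_less_trans[OF this wl_lt[unfolded wl_def]] have "c < 2 ^ w" by (simp only: mult_1_right)
  have "eval w (Lit 1 [<<] (Lit c [*] (Var vMu [+] Lit 1))) v m = 2 ^ wl"
   using vm lt wl_lt `mu + 1 < 2 ^ w` `c < 2 ^ w` w_pos unfolding wl_def by (simp add: push_bit_eq_mult mod_simps frameD)
  thus "wp w init_com (ready m1) v m" unfolding init_com_def wp.simps using vm frame_frame2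
   by (auto simp: ready_def frame2_def frame_def)
 qed simp
 show "hoare w (ready m1) zero_regs_com (reg_bound P * 2)
   (%v m. ready m1 v m & (ALL r<reg_bound P. v (vreg r) = 0))" unfolding zero_regs_com_def
 proof (rule hoare_seqs[where I = "%j v m. ready m1 v m & (ALL r<j. v (vreg r) = 0)" and t = 2])
  fix j assume j: "j < length (map (%r. Asg (vreg r) (Lit 0)) [0..<reg_bound P])"
  have "hoare w (%v m. ready m1 v m & (ALL r<j. v (vreg r) = 0)) (Asg (vreg j) (Lit 0)) 2
   (%v m. ready m1 v m & (ALL r<Suc j. v (vreg r) = 0))" by (rule hoare_wp) (auto simp: ready_def frame2_def less_Suc_eq)
  thus "hoare w (%v m. ready m1 v m & (ALL r<j. v (vreg r) = 0))
   (map (%r. Asg (vreg r) (Lit 0)) [0..<reg_bound P] ! j) 2 (%v m. ready m1 v m & (ALL r<Suc j. v (vreg r) = 0))"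
   using j by simp
 qed auto
qed (simp add: init_time_def)

lemma ready_sinv: "ready m1 v m ==> (ALL r<reg_bound P. v (vreg r) = 0) ==> sinv m1 0 v m"
 by (auto simp: ready_def sinv_def frame2D)

definition loop_time where "loop_time = esize (Lit 1 [<<] Var vF) + 2 + 2 ^ f * (maxtime (dispatch 0 P) + 4)"

lemma sim_loop_correct:
 "hoare w (%v m. ready m1 v m & (ALL r<reg_bound P. v (vreg r) = 0)) sim_loop loop_time
   (%v m. sinv m1 (2 ^ f) v m & frame2 v & v vFlag = v0 vFlag)" unfolding sim_loop_def
proof (rule hoare_for[where n = "2 ^ f" and t = "maxtime (dispatch 0 P)"
   and I = "%j v m. sinv m1 (2 ^ f - j) v m & frame2 v & v vFlag = v0 vFlag"
   and B = "%j v m. sinv m1 (2 ^ f - Suc j) v m & frame2 v & v vFlag = v0 vFlag"])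
 fix v m assume r: "ready m1 v m & (ALL r<reg_bound P. v (vreg r) = 0)"
 hence fr: "frame2 v" by (simp add: ready_def)
 have "eval w (Lit 1 [<<] Var vF) v m = 2 ^ f" by (rule eval_shl1[OF f]) (use fr frame2D in auto)
 moreover have "sinv m1 0 (v(vFu := 2 ^ f)) m" using ready_sinv r by simp
 moreover have "frame2 (v(vFu := 2 ^ f))" using fr by (simp add: frame2_def)
 ultimately show "eval w (Lit 1 [<<] Var vF) v m = 2 ^ f & sinv m1 (2 ^ f - 2 ^ f) (v(vFu := 2 ^ f)) m &
   frame2 (v(vFu := 2 ^ f)) & (v(vFu := 2 ^ f)) vFlag = v0 vFlag" using r by (simp add: ready_def)
next
 fix j assume j: "j < (2 :: nat) ^ f"
 hence "Suc (2 ^ f - Suc j) = 2 ^ f - j" by simp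
 moreover have "Suc (2 ^ f - Suc j) <= (2 :: nat) ^ f" using j by simp
 ultimately have "hoare w (sinv m1 (2 ^ f - Suc j)) (dispatch 0 P) (maxtime (dispatch 0 P)) (sinv m1 (2 ^ f - j))"
  using hoare_dispatch[of "2 ^ f - Suc j" m1] by simp
 thus "hoare w (%v m. sinv m1 (2 ^ f - Suc j) v m & frame2 v & v vFlag = v0 vFlag) (dispatch 0 P)
   (maxtime (dispatch 0 P)) (%v m. sinv m1 (2 ^ f - j) v m & frame2 v & v vFlag = v0 vFlag)" proof (rule hoare_unwritten)
  fix v v' :: "nat => nat"
  assume 1: "frame2 v & v vFlag = v0 vFlag" and 2: "!!x. x ~: writes (dispatch 0 P) ==> v' x = v x"
  have "v' x = v x" if "x ~= vPc" "x ~= vOc" "x ~: range vreg" for x using 2[of x] that writes_dispatch[of 0 P] by blast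
  moreover have "x ~: range vreg" if "x < 40" for x using that by (auto simp: vreg_def)
  ultimately show "frame2 v' & v' vFlag = v0 vFlag" using 1 by (simp add: frame2_def)
 qed
next
 fix j v m
 assume "j < (2 :: nat) ^ f" "sinv m1 (2 ^ f - Suc j) v m & frame2 v & v vFlag = v0 vFlag"
 thus "sinv m1 (2 ^ f - Suc j) (v(vFu := j)) m & frame2 (v(vFu := j)) & (v(vFu := j)) vFlag = v0 vFlag"
  by (simp add: frame2_def)
qed (auto simp: loop_time_def)

text \<open>The window at \<open>base\<close> shows the input followed by zeros, so the loop runs
  \<open>P\<close> from its initial configuration; once \<open>P\<close> has halted, the remaining
  rounds are idle. Halting is dropped from the postcondition, because the output is verified
  anyway.\<close>

lemma sim_loop_prob:
 assumes "input_mem m1" and fresh: "!!y. base <= y ==> m0 y = 0"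
  and fits: "input_fits wl inp" and p: "p <= success_prob wl P inp (2 ^ f) Y"
 shows "phoare w (%v m. ready m1 v m & (ALL r<reg_bound P. v (vreg r) = 0)) sim_loop p
   (%v m. outp (absc (v, m)) : Y)" unfolding phoare_def proof (intro allI impI)
 fix v m assume r: "ready m1 v m & (ALL r<reg_bound P. v (vreg r) = 0)"
 hence fr: "frame2 v" and m: "m = m1" by (simp_all add: ready_def)
 have s: "sinv m1 0 (v(vFu := 2 ^ f)) m" using ready_sinv r by simp
 have "(if y < 2 ^ wl then m1 (base + y) mod 2 ^ wl else 0) = (if y < length inp then inp ! y else 0)" for y
 proof (cases "y < length inp")
  case True
  hence "y < 2 ^ wl" "inp ! y < 2 ^ wl" using fits by (auto simp: input_fits_def)
  thus ?thesis using True assms(1) by (simp add: input_mem_def)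
 next
  case False
  hence "m1 (base + y) = 0" using assms(1) fresh[of "base + y"] by (simp add: input_mem_def)
  thus ?thesis using False by simp
 qed
 hence init: "absc (v(vFu := 2 ^ f), m) = init_config inp" using r m by (auto simp: absc_simp init_config_def ready_def)
 have "eval w (Lit 1 [<<] Var vF) v m = 2 ^ f" by (rule eval_shl1[OF f]) (use fr frame2D in auto)
 hence "map_pmf absc (outd w sim_loop (v, m)) = run wl P (2 ^ f) (init_config inp)"
  using absc_loop[OF _ s, of "2 ^ f"] init by (simp add: sim_loop_def outd_simps)
 hence run: "run wl P (2 ^ f) (init_config inp) = map_pmf absc (outd w sim_loop (v, m))" ..
 have "success_prob wl P inp (2 ^ f) Y =
   prob (outd w sim_loop (v, m)) {x. halted P (absc x) & outp (absc x) : Y}"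
  unfolding success_prob_def run measure_map_pmf by (simp add: vimage_def)
 also have "... <= prob (outd w sim_loop (v, m)) {x. outp (absc (fst x, snd x)) : Y}"
  by (rule measure_pmf.finite_measure_mono) auto
 finally show "p <= prob (outd w sim_loop (v, m)) {x. outp (absc (fst x, snd x)) : Y}" using p by simp
qed

definition yv :: "(nat => nat) => nat => nat => nat" where
 "yv m j p = m (ob + (j * k + p)) mod 2 ^ L"

lemma L_less_w: "(2 :: nat) ^ L < 2 ^ w" proof -
 have "2 ^ L <= H" by (rule le_H[of L]) (use chL in linarith, simp)
 thus ?thesis by (rule small)
qed

lemma eval_y:
 assumes v: "v vOb = ob" "v vPL = 2 ^ L" "v vJ = j" and p: "p < k" "j * k + p < 2 ^ f"
 shows "eval w (y_exp p) v m = yv m j p" proof -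
 have "2 ^ f <= H" by (rule pow_KL_le_H[OF f])
 moreover have "ob + H < 2 ^ w" using F0 by (simp add: ob_def algebra_simps)
 ultimately have "ob + (j * k + p) < 2 ^ w" using p by linarith
 moreover have "m (ob + (j * k + p)) mod 2 ^ L < 2 ^ w" by (rule less_trans[OF _ L_less_w]) simp
 ultimately show ?thesis using v by (simp add: y_exp_def yv_def mod_simps)
qed

lemma foldr_ok:
 assumes "!!p l. (p, l) : set ps ==> eval w (Mem (A p l)) v m = (if B p l then 1 else 0)"
 shows "eval w (foldr (%(p, l) e. Mem (A p l) [*] e) ps (Lit 1)) v m = (if ALL (p, l):set ps. B p l then 1 else 0)"
 using assms proof (induction ps)
 case Nil
 thus ?case using w_pos by simp
next
 case (Cons x ps)
 obtain p l where x: "x = (p, l)" by fastforce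
 have "eval w (foldr (%(p, l) e. Mem (A p l) [*] e) ps (Lit 1)) v m = (if ALL (p, l):set ps. B p l then 1 else 0)"
  by (rule Cons.IH) (use Cons.prems in auto)
 moreover have "eval w (Mem (A p l)) v m = (if B p l then 1 else 0)" using Cons.prems x by simp
 ultimately show ?case using w_pos by (simp add: x)
qed

lemma foldr_sum:
 assumes "!!p l. (p, l) : set ps ==> eval w (Mem (A p l)) v m = word w (z p l)"
 shows "eval w (foldr (%(p, l) e. Mem (A p l) [+] e) ps (Lit 0)) v m = word w (\<Sum>(p, l)\<leftarrow>ps. z p l)"
 using assms proof (induction ps)
 case Nil
 thus ?case by (simp add: word_def)
next
 case (Cons x ps)
 obtain p l where x: "x = (p, l)" by fastforce
 have "eval w (foldr (%(p, l) e. Mem (A p l) [+] e) ps (Lit 0)) v m = word w (\<Sum>(p, l)\<leftarrow>ps. z p l)"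
  by (rule Cons.IH) (use Cons.prems in auto)
 moreover have "eval w (Mem (A p l)) v m = word w (z p l)" using Cons.prems x by simp
 ultimately show ?case by (simp add: x word_plus del: eval_binop.simps)
qed

text \<open>Words are long enough for the total weight of a clique to lie strictly between -(2^w)
  and 2^w, where 0 is the only multiple of \<open>2 ^ w\<close>.\<close>

lemma word_sum_0:
 assumes "!!p l. (p, l) : prs k ==> {y p, y l} : E"
 shows "word w (SUM (p, l):prs k. wt {y p, y l}) = 0 \<longleftrightarrow> (SUM (p, l):prs k. wt {y p, y l}) = 0" proof -
 let ?s = "SUM (p, l):prs k. wt {y p, y l}"
 have "\<bar>?s\<bar> <= (SUM (p, l):prs k. \<bar>wt {y p, y l}\<bar>)"
  by (rule order_trans[OF sum_abs]) (simp add: case_prod_unfold)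
 also have "... <= (SUM (p, l):prs k. 2 ^ (100 * k * L))" using wt assms by (intro sum_mono) auto
 also have "... = int C2 * 2 ^ (100 * k * L)" by (simp add: card_prs case_prod_unfold)
 also have "... <= int (2 ^ kap) * 2 ^ (100 * k * L)" using C2_le by (intro mult_right_mono) (simp_all only: of_nat_le_iff, simp)
 also have "... = 2 ^ (kap + 100 * k * L)" by (simp add: power_add)
 also have "... < 2 ^ w" proof (rule power_strict_increasing)
  have "(100 * k + K + kap + 1) * L <= w" unfolding w_def using cw(3) by (rule mult_right_mono) simp
  moreover have "(100 * k + K + kap + 1) * L = 100 * k * L + K * L + kap * L + L" by (simp add: algebra_simps)
  moreover have "kap * 1 <= kap * L" using L by (intro mult_left_mono) auto
  ultimately show "kap + 100 * k * L < w" using L by linarith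
 qed simp
 finally have s: "\<bar>?s\<bar> < 2 ^ w" .
 have "word w ?s = 0 \<longleftrightarrow> ?s mod 2 ^ w = 0" by (simp add: word_def nat_eq_iff)
 also have "... \<longleftrightarrow> ?s = 0" proof
  assume "?s mod 2 ^ w = 0"
  hence "2 ^ w dvd ?s" by (simp only: dvd_eq_mod_eq_0)
  thus "?s = 0" using s zdvd_imp_le[of "2 ^ w" "\<bar>?s\<bar>"] by (metis abs_ge_zero dvd_abs_iff leD order_le_less zero_less_abs_iff abs_zero)
 qed simp
 finally show ?thesis .
qed

lemma wp_check_body:
 assumes tabs: "tabs m0" and F4: "3 <= F0" and fr: "frame2 v" and j: "v vJ = j" "Suc j * k <= 2 ^ f"
  and m: "!!y. y < base ==> m y = m0 y"
 shows "wp w check_body Q v m = Q (if I.zero_clique (yv m j) then v(vFlag := 1) else v) m" proof -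
 let ?y = "yv m j"
 let ?i = "%p l. ?y p * 2 ^ L + ?y l"
 have yL: "?y p < 2 ^ L" for p by (simp add: yv_def)
 have base3: "3 * H <= base" using F4 by (rule mult_right_mono) simp
 have base0: "base < 2 ^ w" using base_less[of 0] by simp
 have ev: "eval w (y_exp p) v m = ?y p" if "p < k" for p proof -
  have "j * k + p < Suc j * k" using that by simp
  thus ?thesis using eval_y[of v j p m] frame2D[OF fr] j that by linarith
 qed
 have addr: "eval w (adj_exp (y_exp p) (y_exp l)) v m = H + (?i p l)"
  "eval w (wt_exp (y_exp p) (y_exp l)) v m = 2 * H + (?i p l)"
  "H + (?i p l) < base" "2 * H + (?i p l) < base" if "p < k" "l < k" for p l proof -
  have lt: "?y p * 2 ^ L + ?y l < H" by (rule vertex_index_le_H[OF yL yL])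
  thus lts: "H + (?i p l) < base" "2 * H + (?i p l) < base" using base3 by linarith+
  hence lt3: "H + (?i p l) < 2 ^ w" "2 * H + (?i p l) < 2 ^ w" using base0 by linarith+
  have "2 <= H" by (rule le_H[of 1]) (use chL L in linarith, simp)
  show "eval w (adj_exp (y_exp p) (y_exp l)) v m = H + (?i p l)"
   "eval w (wt_exp (y_exp p) (y_exp l)) v m = 2 * H + (?i p l)"
   using lt3 frame2D[OF fr] that w_pos by (simp_all add: adj_exp_def wt_exp_def ev mod_simps)
 qed
 have adj: "eval w (Mem (adj_exp (y_exp p) (y_exp l))) v m = (if {?y p, ?y l} : E then 1 else 0)"
  and wts: "{?y p, ?y l} : E ==> eval w (Mem (wt_exp (y_exp p) (y_exp l))) v m = word w (wt {?y p, ?y l})"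
  if "(p, l) : set (prl k)" for p l proof -
  have pl: "p < k" "l < k" using that by (auto simp: set_prl prs_def)
  have "m0 (H + (?i p l)) = (if {?y p, ?y l} : E then 1 else 0) &
   ({?y p, ?y l} : E --> m0 (2 * H + (?i p l)) = word w (wt {?y p, ?y l}))" using tabs yL unfolding tabs_def by blast
  thus "eval w (Mem (adj_exp (y_exp p) (y_exp l))) v m = (if {?y p, ?y l} : E then 1 else 0)"
   "{?y p, ?y l} : E ==> eval w (Mem (wt_exp (y_exp p) (y_exp l))) v m = word w (wt {?y p, ?y l})"
   unfolding eval.simps(4) addr(1,2)[OF pl] using m addr(3,4)[OF pl] by auto
 qed
 have ok: "eval w ok_exp v m = (if ALL (p, l):prs k. {?y p, ?y l} : E then 1 else 0)"
  unfolding ok_exp_def set_prl[symmetric] by (rule foldr_ok[OF adj])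
 show ?thesis proof (cases "ALL (p, l):prs k. {?y p, ?y l} : E")
  case True
  have "eval w sum_exp v m = word w (\<Sum>(p, l)\<leftarrow>prl k. wt {?y p, ?y l})"
   unfolding sum_exp_def by (rule foldr_sum, rule wts) (use True in "auto simp: set_prl")
  also have "(\<Sum>(p, l)\<leftarrow>prl k. wt {?y p, ?y l}) = (SUM (p, l):prs k. wt {?y p, ?y l})"
   unfolding set_prl[symmetric] by (rule sum_list_distinct_conv_sum_set[OF distinct_prl])
  finally have "eval w sum_exp v m = 0 \<longleftrightarrow> (SUM (p, l):prs k. wt {?y p, ?y l}) = 0"
   using word_sum_0[of ?y] True by auto
  moreover have "eval w (Lit 1) v m = 1" using w_pos by simp
  ultimately show ?thesis using True ok unfolding check_body_def wp.simps I.zero_clique_def by (simp del: eval.simps)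
 next
  case False
  hence "eval w ok_exp v m = 0" "~ I.zero_clique ?y" unfolding I.zero_clique_def ok by (simp_all only: if_False simp_thms)
  thus ?thesis unfolding check_body_def wp.simps by simp
 qed
qed

definition check_time where "check_time = esize (Bin Div (Var vOc) (Lit k)) + 2 + 2 ^ f * (maxtime check_body + 4)"

abbreviation checked where
 "checked m2 n h v m == frame2 v & m = m2 & (v vFlag ~= 0 --> v0 vFlag ~= 0 \<or> has_zero_clique) &
   (ALL j<n. h <= j --> I.zero_clique (yv m2 j) --> v vFlag ~= 0)"

lemma check_correct:
 assumes tabs: "tabs m0" and F4: "3 <= F0" and m2: "!!y. y < base ==> m2 y = m0 y" and oc: "oc <= 2 ^ f"
 shows "hoare w (%v m. frame2 v & v vFlag = v0 vFlag & v vOc = oc & m = m2) check_com check_time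
   (%v m. checked m2 (oc div k) 0 v m)" unfolding check_com_def
proof (rule hoare_for[where n = "oc div k" and t = "maxtime check_body" and
   I = "%i v m. checked m2 (oc div k) i v m" and
   B = "%i v m. v vJ = i & checked m2 (oc div k) (Suc i) v m"])
 have fH: "2 ^ f <= H" by (rule pow_KL_le_H[OF f])
 have kk: "k <= H" proof -
  have "2 ^ kap <= (2 :: nat) ^ (L + kap)" by (intro power_increasing) auto
  moreover have "k <= 2 ^ kap" by (rule I.kap)
  ultimately show ?thesis using R_le_H by linarith
 qed
 have divle: "oc div k <= 2 ^ f" using oc div_le_dividend[of oc k] by linarith
 fix v m assume vm: "frame2 v & v vFlag = v0 vFlag & v vOc = oc & m = m2"
 have "k < 2 ^ w" using kk by (rule small)
 moreover have "oc div k < 2 ^ w" by (rule small) (use divle fH in linarith)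
 ultimately show "eval w (Bin Div (Var vOc) (Lit k)) v m = oc div k & checked m2 (oc div k) (oc div k) (v(vJ := oc div k)) m"
  using vm by (simp add: frame2_def)
next
 fix i assume i: "i < oc div k"
 have "Suc i * k <= oc div k * k" using i by (intro mult_right_mono) auto
 also have "... <= oc" by simp
 finally have ik: "Suc i * k <= 2 ^ f" using oc by simp
 show "hoare w (%v m. v vJ = i & checked m2 (oc div k) (Suc i) v m) check_body (maxtime check_body)
   (%v m. checked m2 (oc div k) i v m)" proof (rule hoare_wp)
  fix v m
  assume vm: "v vJ = i & checked m2 (oc div k) (Suc i) v m"
  hence mb: "m y = m0 y" if "y < base" for y using m2 that by simp
  have Z: "has_zero_clique" if "I.zero_clique (yv m2 i)" unfolding has_zero_clique_def by (rule I.zero_clique_sound[OF that])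
  have fr: "frame2 v" and vi: "v vJ = i" using vm by auto
  have "frame2 (v(vFlag := 1))" using fr by (simp add: frame2_def)
  moreover have "wp w check_body Q v m = Q (if I.zero_clique (yv m i) then v(vFlag := 1) else v) m" for Q
   by (rule wp_check_body[OF tabs F4 fr vi ik mb])
  ultimately show "wp w check_body (%v m. checked m2 (oc div k) i v m) v m" using vm Z by (auto simp: Suc_le_eq le_less)
 qed simp
next
 fix i v m
 assume "checked m2 (oc div k) (Suc i) v m"
 thus "(v(vJ := i)) vJ = i & checked m2 (oc div k) (Suc i) (v(vJ := i)) m" by (simp add: frame2_def)
next
 have "oc div k <= 2 ^ f" using oc div_le_dividend[of oc k] by linarith
 hence "oc div k * (maxtime check_body + 4) <= 2 ^ f * (maxtime check_body + 4)" by (rule mult_right_mono) simp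
 thus "esize (Bin Div (Var vOc) (Lit k)) + 2 + oc div k * (maxtime check_body + 4) <= check_time"
  by (simp only: check_time_def add_le_cancel_left)
qed auto

definition trial_time where "trial_time = build_time + (init_time + loop_time) + check_time"

definition after_sim where "after_sim v m \<longleftrightarrow> frame2 v & v vFlag = v0 vFlag & v vOc <= 2 ^ f &
   (ALL y. y < base \<or> base + 2 * H <= y --> m y = m0 y)"

lemma sim_after:
 "hoare w (%v m. frame v & input_mem m) (init_com ;; zero_regs_com ;; sim_loop) (init_time + loop_time) after_sim"
proof (rule hoare_pre)
 fix v1 m1 assume 1: "frame v1 & input_mem m1"
 have "hoare w (%v m. frame v & m = m1) ((init_com ;; zero_regs_com) ;; sim_loop) (init_time + loop_time)
   (%v m. sinv m1 (2 ^ f) v m & frame2 v & v vFlag = v0 vFlag)"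
  by (rule hoare_seq[OF init_correct sim_loop_correct order_refl])
 hence "hoare w (%v m. frame v & m = m1) (init_com ;; zero_regs_com ;; sim_loop) (init_time + loop_time)
   (%v m. sinv m1 (2 ^ f) v m & frame2 v & v vFlag = v0 vFlag)" by (rule hoare_seq_assoc)
 thus "hoare w (%v m. v = v1 & m = m1) (init_com ;; zero_regs_com ;; sim_loop) (init_time + loop_time) after_sim"
 proof (rule hoare_conseq)
  fix v m assume 2: "sinv m1 (2 ^ f) v m & frame2 v & v vFlag = v0 vFlag"
  have "m y = m0 y" if y: "y < base \<or> base + 2 * H <= y" for y proof -
   have fH: "2 ^ f <= H" by (rule pow_KL_le_H[OF f])
   have "y < base \<or> ob + 2 ^ f <= y" using y fH by (auto simp: ob_def)
   hence "m y = m1 y" using 2 unfolding sinv_def by blast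
   moreover have "y < base \<or> base + length inp <= y" using y length_inp by linarith
   hence "m1 y = m0 y" using 1 unfolding input_mem_def by blast
   ultimately show ?thesis by simp
  qed
  thus "after_sim v m" using 2 by (simp add: after_sim_def sinv_def)
 qed (use 1 in auto)
qed

text \<open>Sound for every guess and every output of \<open>P\<close>: the flag is raised only for
  a block that passes the check.\<close>

theorem trial_correct:
 assumes tabs: "tabs m0" and F4: "3 <= F0"
 shows "hoare w (%v m. v = v0 & m = m0) trial_com trial_time
   (%v m. frame2 v & (v vFlag ~= 0 --> v0 vFlag ~= 0 \<or> has_zero_clique) &
    (ALL y. y < base \<or> base + 2 * H <= y --> m y = m0 y))"
 (is "hoare w _ _ _ ?Q") proof -
 have "hoare w after_sim check_com check_time ?Q" proof (rule hoare_pre)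
  fix v2 m2 assume 2: "after_sim v2 m2"
  hence "!!y. y < base ==> m2 y = m0 y" "v2 vOc <= 2 ^ f" by (simp_all add: after_sim_def)
  from check_correct[OF tabs F4 this]
  show "hoare w (%v m. v = v2 & m = m2) check_com check_time
   ?Q" by (rule hoare_conseq) (use 2 in "auto simp: after_sim_def")
 qed
 from hoare_seq[OF build_correct hoare_seq[OF sim_after this order_refl]]
 show ?thesis unfolding trial_com_def trial_time_def by simp
qed

theorem trial_finds:
 assumes tabs: "tabs m0" and F4: "3 <= F0" and fresh: "!!y. base <= y ==> m0 y = 0"
  and fits: "input_fits wl inp" and p: "p <= success_prob wl P inp (2 ^ f) Y"
  and Y: "!!out. out : Y ==> EX j. Suc j * k <= length out & I.zero_clique (%p. out ! (j * k + p) mod 2 ^ L)"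
 shows "phoare w (%v m. v = v0 & m = m0) trial_com p (%v m. v vFlag ~= 0)" proof -
 have sim: "phoare w (%v m. frame v & input_mem m) (init_com ;; zero_regs_com ;; sim_loop) p
   (%v m. outp (absc (v, m)) : Y & after_sim v m)" proof (rule phoare_hoare[OF _ sim_after], rule phoare_pre)
  fix v1 m1 assume 1: "frame v1 & input_mem m1"
  have "phoare w (%v m. frame v & m = m1) ((init_com ;; zero_regs_com) ;; sim_loop) p (%v m. outp (absc (v, m)) : Y)"
   by (rule phoare_seq_hoare[OF init_correct sim_loop_prob]) (use 1 fresh fits p in auto)
  hence "phoare w (%v m. frame v & m = m1) (init_com ;; zero_regs_com ;; sim_loop) p (%v m. outp (absc (v, m)) : Y)"
   by (rule phoare_seq_assoc)
  thus "phoare w (%v m. v = v1 & m = m1) (init_com ;; zero_regs_com ;; sim_loop) p (%v m. outp (absc (v, m)) : Y)"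
   by (rule phoare_conseq) (use 1 in auto)
 qed
 have check: "hoare w (%v m. outp (absc (v, m)) : Y & after_sim v m) check_com check_time (%v m. v vFlag ~= 0)"
 proof (rule hoare_pre)
  fix v2 m2 assume 2: "outp (absc (v2, m2)) : Y & after_sim v2 m2"
  hence a: "!!y. y < base ==> m2 y = m0 y" "v2 vOc <= 2 ^ f" by (simp_all add: after_sim_def)
  let ?out = "outp (absc (v2, m2))"
  obtain j where j: "Suc j * k <= length ?out" "I.zero_clique (%p. ?out ! (j * k + p) mod 2 ^ L)" using Y 2 by blast
  have len: "length ?out = v2 vOc" by (simp add: absc_simp)
  have jlt: "j < v2 vOc div k" proof -
   have "Suc j * k div k <= v2 vOc div k" using j(1) len by (intro div_le_mono) simp
   thus ?thesis using k by simp
  qed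
  have out: "?out ! (j * k + p) mod 2 ^ L = yv m2 j p" if "p < k" for p proof -
   have "j * k + p < v2 vOc" using j(1) len that by simp
   thus ?thesis by (simp add: absc_simp yv_def)
  qed
  have z: "I.zero_clique (yv m2 j)" proof -
   have "(SUM (p, l):prs k. wt {?out ! (j * k + p) mod 2 ^ L, ?out ! (j * k + l) mod 2 ^ L}) =
     (SUM (p, l):prs k. wt {yv m2 j p, yv m2 j l})" using out by (intro sum.cong) (auto simp: prs_def)
   moreover have "(ALL (p, l):prs k. {yv m2 j p, yv m2 j l} : E)" using j(2) out by (auto simp: I.zero_clique_def prs_def)
   ultimately show ?thesis using j(2) by (simp add: I.zero_clique_def)
  qed
  show "hoare w (%v m. v = v2 & m = m2) check_com check_time (%v m. v vFlag ~= 0)"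
   by (rule hoare_conseq[OF check_correct[OF tabs F4 a]]) (use 2 jlt z in "auto simp: after_sim_def")
 qed
 have sc: "phoare w (%v m. frame v & input_mem m) ((init_com ;; zero_regs_com ;; sim_loop) ;; check_com) p (%v m. v vFlag ~= 0)"
  by (rule phoare_seq[OF sim phoare_of_hoare[OF check]]) auto
 show ?thesis unfolding trial_com_def by (rule phoare_seq_hoare[OF build_correct sc])
qed

end

section \<open>Distribution of the edges into buckets\<close>

lemma barr_append:
 assumes A: "!!s. s < S ==> barr m (B + s * T) (A s) & 3 + 2 * length (A s) <= T" and s0: "s0 < S"
 defines "K == B + s0 * T"
 defines "l == length (A s0)"
 shows "!!s. s < S ==> barr (m(K + (1 + 2 * l) := x, K + (2 + 2 * l) := y, K := l + 1)) (B + s * T) ((A(s0 := A s0 @ [(x, y)])) s)"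
  "!!z. z < B \<or> B + S * T <= z ==> (m(K + (1 + 2 * l) := x, K + (2 + 2 * l) := y, K := l + 1)) z = m z" proof -
 let ?m = "m(K + (1 + 2 * l) := x, K + (2 + 2 * l) := y, K := l + 1)"
 have l: "3 + 2 * l <= T" using A[OF s0] by (simp add: l_def)
 have out: "?m z = m z" if "z < K \<or> K + T <= z" for z using that l by auto
 have ST: "s * T + T <= S * T" if "s < S" for s proof -
  have "Suc s * T <= S * T" using that by (intro mult_right_mono) auto
  thus ?thesis by simp
 qed
 show "?m z = m z" if "z < B \<or> B + S * T <= z" for z by (rule out) (use that ST[OF s0] in "auto simp: K_def")
 show "barr ?m (B + s * T) ((A(s0 := A s0 @ [(x, y)])) s)" if s: "s < S" for s proof (cases "s = s0")
  case True
  have b: "m (K + 1 + 2 * j) = fst (A s0 ! j)" "m (K + 2 + 2 * j) = snd (A s0 ! j)" if "j < l" for j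
   using A[OF s0] that unfolding barr_def K_def l_def by blast+
  have "?m (K + 1 + 2 * j) = fst ((A s0 @ [(x, y)]) ! j) & ?m (K + 2 + 2 * j) = snd ((A s0 @ [(x, y)]) ! j)"
   if "j < Suc l" for j proof (cases "j < l")
   case True
   hence "(A s0 @ [(x, y)]) ! j = A s0 ! j" by (simp add: nth_append l_def)
   thus ?thesis using b[OF True] True by simp
  next
   case False
   hence "j = l" using that by simp
   thus ?thesis by (simp add: nth_append l_def)
  qed
  thus ?thesis using True by (simp add: barr_def K_def[symmetric] l_def[symmetric])
 next
  case False
  have disj: "B + s * T + z < K \<or> K + T <= B + s * T + z" if "z < T" for z proof (cases "s < s0")
   case True
   have "Suc s * T <= s0 * T" using True by (intro mult_right_mono) auto
   thus ?thesis using that by (simp add: K_def)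
  next
   case False
   hence "Suc s0 * T <= s * T" using `s ~= s0` by (intro mult_right_mono) auto
   thus ?thesis by (simp add: K_def)
  qed
  have len: "3 + 2 * length (A s) <= T" and b: "barr m (B + s * T) (A s)" using A[OF s] by auto
  have eq: "?m (B + s * T + z) = m (B + s * T + z)" if "z < T" for z by (rule out) (rule disj[OF that])
  have "?m (B + s * T + 1 + 2 * j) = m (B + s * T + 1 + 2 * j)" "?m (B + s * T + 2 + 2 * j) = m (B + s * T + 2 + 2 * j)"
   if "j < length (A s)" for j using eq[of "1 + 2 * j"] eq[of "2 + 2 * j"] that len by (simp_all only: add.assoc)
  moreover have "?m (B + s * T) = m (B + s * T)" using eq[of 0] len by simp
  ultimately show ?thesis using b False unfolding barr_def by (simp only: fun_upd_other) auto
 qed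
qed

context prog
begin

definition g_exp where "g_exp p l x = Mem (Var vR3 [+] (Lit 1 [+] Lit (p * k + l) [*] Var vPL [+] x))"

definition Y_exp where "Y_exp p l x = (if l = hash.j0 p
   then g_exp p l x [-] foldr (%l' e. g_exp p l' x [+] e) (filter (%l'. l' ~= p) [0..<k]) (Lit 0)
   else g_exp p l x)"

definition z_exp where
 "z_exp p l = Mem (Var vR3) [*] Mem (wt_exp (Var vU) (Var vV)) [+] Y_exp p l (Var vU) [+] Y_exp l p (Var vV)"

definition append_com where "append_com e = (let (p, l) = prl k ! e in
   Asg vK (slot_exp (Lit e [*] Var vPA [+] (z_exp p l [>>] Var vSh))) ;;
   Asg vLen (Mem (Var vK)) ;;
   Sto (Var vK [+] (Lit 1 [+] Lit 2 [*] Var vLen)) (Lit p [*] Var vPL [+] Var vU) ;;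
   Sto (Var vK [+] (Lit 2 [+] Lit 2 [*] Var vLen)) (Lit l [*] Var vPL [+] Var vV) ;;
   Sto (Var vK) (Var vLen [+] Lit 1))"

definition pair_com where "pair_com = Cond (Mem (adj_exp (Var vU) (Var vV))) (seqs (map append_com [0..<C2])) Skip"

definition prep_com where "prep_com = Asg vPA (Lit 1 [<<] Var vA) ;; Asg vSh (Lit cw [*] Var vL [-] Var vA) ;;
   Asg vBB (Var vFP [*] Var vH) ;; Asg vFP (Var vFP [+] Lit 1)"

definition buckets_com where "buckets_com = prep_com ;; For vU (Var vPL) (For vV (Var vPL) pair_com)"

end

context red
begin

text \<open>The hash function needs a weight for every pair of vertices, so non-edges get 0;
  \<open>in_bucket\<close> keeps them out of the buckets.\<close>

abbreviation wtf :: "nat => nat => int" where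
 "wtf u v == if {u, v} : E then wt {u, v} else 0"

definition rtab :: "(nat => nat) => (nat => nat) => bool" where
 "rtab om m \<longleftrightarrow> (ALL i<hash.len k (2 ^ L). m (3 * H + i) = om i & om i < 2 ^ w)"

definition env where
 "env v \<longleftrightarrow> v vL = L & v vPL = 2 ^ L & v vH = H & v vR3 = 3 * H & v vG = ((k * q - 1) * L) div q + C0"

definition in_bucket where "in_bucket om a e d x \<longleftrightarrow> {fst x, snd x} : E &
   hash.bkt w a (hash.Z k (2 ^ L) wtf om (fst (prl k ! e)) (snd (prl k ! e)) (fst x) (snd x)) = d"

definition code_pair where "code_pair e x = (fst (prl k ! e) * 2 ^ L + fst x, snd (prl k ! e) * 2 ^ L + snd x)"

definition bfl where "bfl om a xs e d = map (code_pair e) (filter (in_bucket om a e d) xs)"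

text \<open>Both loops count down: these are the pairs already visited when the inner counter stands
  at \<open>v\<close> during round \<open>u\<close> of the outer loop.\<close>

definition upto_pair where
 "upto_pair u v = concat (map (%u. map (Pair u) (rev [0..<2 ^ L])) (rev [Suc u..<2 ^ L])) @ map (Pair u) (rev [v..<2 ^ L])"

definition all_pairs where "all_pairs = concat (map (%u. map (Pair u) (rev [0..<2 ^ L])) (rev [0..<2 ^ L]))"

lemma upto_pair_step: "v < 2 ^ L ==> upto_pair u v = upto_pair u (Suc v) @ [(u, v)]"
 by (simp add: upto_pair_def upt_conv_Cons)

lemma upto_pair_start: "upto_pair u (2 ^ L) = concat (map (%u. map (Pair u) (rev [0..<2 ^ L])) (rev [Suc u..<2 ^ L]))"
 by (simp add: upto_pair_def)

lemma upto_pair_end: "u < 2 ^ L ==> upto_pair u 0 = concat (map (%u. map (Pair u) (rev [0..<2 ^ L])) (rev [u..<2 ^ L]))"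
 by (simp add: upto_pair_def upt_conv_Cons)

lemma upto_pair_props:
 assumes "u < 2 ^ L"
 shows "distinct (upto_pair u v)" "set (upto_pair u v) <= {..<2 ^ L} \<times> {..<2 ^ L}" proof -
 have d: "distinct (concat (map (%u. map (Pair u) (rev [0..<2 ^ L])) xs))" if "distinct xs" for xs :: "nat list"
  using that by (induction xs) (auto simp: distinct_map inj_on_def)
 show "distinct (upto_pair u v)"
  unfolding upto_pair_def using d[of "rev [Suc u..<2 ^ L]"] by (auto simp: distinct_map inj_on_def)
 show "set (upto_pair u v) <= {..<2 ^ L} \<times> {..<2 ^ L}" using assms by (auto simp: upto_pair_def)
qed

lemma all_pairs_props: "distinct all_pairs" "set all_pairs = {..<2 ^ L} \<times> {..<2 ^ L}" proof -
 have "all_pairs = upto_pair 0 0" by (simp only: upto_pair_end zero_less_power zero_less_numeral all_pairs_def)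
 thus "distinct all_pairs" using upto_pair_props(1)[of 0 0] by simp
 show "set all_pairs = {..<2 ^ L} \<times> {..<2 ^ L}" by (auto simp: all_pairs_def)
qed

lemma length_upto_pair:
 assumes "u < 2 ^ L" "v < 2 ^ L"
 shows "length (upto_pair u (Suc v)) < 2 ^ L * 2 ^ L" proof -
 have "length (upto_pair u v) = card (set (upto_pair u v))" using distinct_card[OF upto_pair_props(1)[OF assms(1)]] by simp
 also have "... <= card ({..<2 ^ L :: nat} \<times> {..<2 ^ L :: nat})"
  by (rule card_mono) (use upto_pair_props(2)[OF assms(1)] in auto)
 finally show ?thesis using upto_pair_step[OF assms(2)] by simp
qed

lemma length_bfl: "length (bfl om a xs e d) <= length xs" by (simp add: bfl_def)

lemma rtab_len: "hash.len k (2 ^ L) <= H" proof -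
 have "1 + k * k * 2 ^ L <= 2 ^ kap * 2 ^ L + 2 ^ kap * 2 ^ L" using kap by (intro add_mono mult_right_mono) auto
 also have "... = 2 ^ (1 + kap + L)" by (simp add: power_add)
 finally have "1 + k * k * 2 ^ L <= H" by (rule le_H[rotated]) (use chL L in linarith)
 thus ?thesis using hash.len_def[of w k 0 "2 ^ L"] k by (simp add: hash_def)
qed

definition pair_time where
 "pair_time = esize (Mem (adj_exp (Var vU) (Var vV))) + 2 + C2 * (SUM e<C2. maxtime (append_com e))"

definition buckets_time where "buckets_time = maxtime prep_com + (3 + 2 ^ L * (3 + 2 ^ L * (pair_time + 4) + 4))"

end

locale buckets = red k P c K q C0 kap ch cw L N E wt
 for k :: nat and P :: program and c K q C0 kap ch cw L N :: nat and E :: "nat set set" and wt :: "nat set => int" +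
 fixes a F1 :: nat and om v0 m0 :: "nat => nat"
 assumes a: "a < K * L" and F1: "(F1 + 1) * H < 2 ^ w" and F4: "4 <= F1"
  and v0: "env v0" "v0 vA = a" "v0 vFP = F1"
  and tabs: "tabs m0" and rtab: "rtab om m0" and fresh: "!!y. F1 * H <= y ==> m0 y = 0"
begin

abbreviation BB :: nat where "BB == F1 * H"
abbreviation ST :: nat where "ST == 4 * (2 ^ L * 2 ^ L)"

lemma v0': "v0 vL = L" "v0 vPL = 2 ^ L" "v0 vH = H" "v0 vR3 = 3 * H" using v0 by (auto simp: env_def)

lemma aw: "a <= w" proof -
 have "2 ^ a <= H" by (rule pow_KL_le_H[OF a])
 hence "(2 :: nat) ^ a < 2 ^ w" using H_less by linarith
 thus ?thesis by simp
qed

sublocale h: hash w k a "2 ^ L" wtf by unfold_locales (use k aw in auto)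

definition bframe where "bframe v \<longleftrightarrow> (ALL x. x ~: {vPA, vSh, vBB, vFP, vU, vV, vK, vLen} --> v x = v0 x) &
   v vPA = 2 ^ a & v vSh = w - a & v vBB = BB & v vFP = F1 + 1"

lemma bframeD:
 assumes "bframe v"
 shows "v vL = L" "v vPL = 2 ^ L" "v vH = H" "v vR3 = 3 * H" "v vPA = 2 ^ a" "v vSh = w - a" "v vBB = BB"
  "v vFP = F1 + 1" using assms v0' by (auto simp: bframe_def)

lemma bframe_upd [simp]: "bframe (v(vU := x)) = bframe v" "bframe (v(vV := x)) = bframe v" by (simp_all add: bframe_def)

text \<open>Slot \<open>s\<close> stands for bucket \<open>s mod 2 ^ a\<close> of pair number
  \<open>s div 2 ^ a\<close>. The pair \<open>x\<close> of vertices has so far been entered for the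
  first \<open>e\<close> pairs of parts.\<close>

definition A_of where "A_of xs x e s = (if s div 2 ^ a < e then bfl om a (xs @ [x]) (s div 2 ^ a) (s mod 2 ^ a)
   else bfl om a xs (s div 2 ^ a) (s mod 2 ^ a))"

definition minv where
 "minv A m \<longleftrightarrow> (ALL s<C2 * 2 ^ a. barr m (BB + s * ST) (A s)) & (ALL y. y < BB \<or> BB + H <= y --> m y = m0 y)"

lemma BB_less: "y <= H ==> BB + y < 2 ^ w" using F1 by (simp add: algebra_simps)

lemma H4: "4 * H <= BB" using F4 by (rule mult_right_mono) simp

lemma H4_less: "y < 4 * H ==> y < 2 ^ w" using H4 BB_less[of 0] by linarith

lemma m_low: "minv A m ==> y < 4 * H ==> m y = m0 y" using H4 unfolding minv_def by (meson less_le_trans)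

lemma eval_g:
 assumes v: "bframe v" and m: "minv A m" and p: "p < k" "l < k" and x: "eval w x v m = u" "u < 2 ^ L"
 shows "eval w (g_exp p l x) v m = word w (int (om (h.gi p l u)))" proof -
 have g: "h.gi p l u < h.len" using p x by simp
 hence gH: "3 * H + h.gi p l u < 4 * H" using rtab_len by linarith
 hence lt: "3 * H + h.gi p l u < 2 ^ w" by (rule H4_less)
 have "eval w (Var vR3 [+] (Lit 1 [+] Lit (p * k + l) [*] Var vPL [+] x)) v m = (3 * H + h.gi p l u) mod 2 ^ w"
  using bframeD[OF v] x by (simp add: h.gi_def mod_simps algebra_simps)
 hence "eval w (g_exp p l x) v m = m (3 * H + h.gi p l u)" using lt by (simp add: g_exp_def)
 also have "... = m0 (3 * H + h.gi p l u)" by (rule m_low[OF m gH])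
 also have "... = om (h.gi p l u)" using rtab g by (auto simp: rtab_def)
 finally have "eval w (g_exp p l x) v m = om (h.gi p l u)" .
 moreover have "om (h.gi p l u) < 2 ^ w" using rtab g by (auto simp: rtab_def)
 ultimately show ?thesis using `om (h.gi p l u) < 2 ^ w` by (simp add: word_of_nat)
qed

lemma eval_Y:
 assumes v: "bframe v" and m: "minv A m" and p: "p < k" "l < k" and x: "eval w x v m = u" "u < 2 ^ L"
 shows "eval w (Y_exp p l x) v m = word w (h.Y om p l u)" proof -
 have sum: "eval w (foldr (%l' e. g_exp p l' x [+] e) ls (Lit 0)) v m = word w (\<Sum>l'\<leftarrow>ls. int (om (h.gi p l' u)))"
  if "set ls <= {..<k}" for ls using that proof (induction ls)
  case Nil
  thus ?case by (simp add: word_def)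
 next
  case (Cons l' ls)
  thus ?case using eval_g[OF v m p(1) _ x, of l'] by (simp add: word_plus del: eval_binop.simps)
 qed
 have "set (filter (%l'. l' ~= p) [0..<k]) <= {..<k}" by auto
 note s = sum[OF this]
 have "(\<Sum>l'\<leftarrow>filter (%l'. l' ~= p) [0..<k]. int (om (h.gi p l' u))) = (\<Sum>l'\<in>{..<k} - {p}. int (om (h.gi p l' u)))"
  by (subst sum_list_distinct_conv_sum_set) (auto intro!: sum.cong)
 with s have s': "eval w (foldr (%l' e. g_exp p l' x [+] e) (filter (%l'. l' ~= p) [0..<k]) (Lit 0)) v m =
   word w (\<Sum>l'\<in>{..<k} - {p}. int (om (h.gi p l' u)))" by (simp only:)
 show ?thesis proof (cases "l = h.j0 p")
  case True
  have "eval w (Y_exp p l x) v m = eval_binop w Minus (word w (int (om (h.gi p l u))))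
    (word w (\<Sum>l'\<in>{..<k} - {p}. int (om (h.gi p l' u))))"
   unfolding Y_exp_def if_P[OF True] eval.simps(3)[of w Minus] s' eval_g[OF v m p x] ..
  thus ?thesis unfolding word_minus using True by (simp add: h.Y_def)
 next
  case False
  thus ?thesis using eval_g[OF v m p x] by (simp add: Y_exp_def h.Y_def)
 qed
qed

lemma eval_z:
 assumes v: "bframe v" "v vU = u" "v vV = u'" and u: "u < 2 ^ L" "u' < 2 ^ L" "{u, u'} : E" and m: "minv A m"
  and p: "p < k" "l < k"
 shows "eval w (z_exp p l) v m = word w (h.Z om p l u u')" proof -
 have lt: "u * 2 ^ L + u' < H" by (rule vertex_index_le_H[OF u(1,2)])
 hence lt4: "2 * H + (u * 2 ^ L + u') < 4 * H" by linarith
 hence ltw: "2 * H + (u * 2 ^ L + u') < 2 ^ w" by (rule H4_less)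
 have "eval w (wt_exp (Var vU) (Var vV)) v m = 2 * H + (u * 2 ^ L + u')"
  using bframeD[OF v(1)] v ltw w_pos by (simp add: wt_exp_def mod_simps)
 hence W: "eval w (Mem (wt_exp (Var vU) (Var vV))) v m = word w (wt {u, u'})"
  using m_low[OF m lt4] tabs u by (simp add: tabs_def)
 have "0 < h.len" by (simp add: h.len_def)
 hence r: "m0 (3 * H + 0) = om 0" "om 0 < 2 ^ w" using rtab unfolding rtab_def by blast+
 have "eval w (Mem (Var vR3)) v m = word w (int (om 0))"
  using bframeD[OF v(1)] m_low[OF m, of "3 * H"] r by (simp add: word_of_nat H_def)
 moreover have "eval w (Y_exp p l (Var vU)) v m = word w (h.Y om p l u)" by (rule eval_Y[OF v(1) m p]) (use v u in auto)
 moreover have "eval w (Y_exp l p (Var vV)) v m = word w (h.Y om l p u')"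
  by (rule eval_Y[OF v(1) m p(2,1)]) (use v u in auto)
 ultimately show ?thesis using W u by (simp add: z_exp_def h.Z_def word_plus word_times del: eval_binop.simps eval.simps(4))
qed

lemma word_shift: "word w z div 2 ^ (w - a) = h.bkt z" proof -
 have "int (word w z div 2 ^ (w - a)) = z mod 2 ^ w div 2 ^ (w - a)" by (simp add: zdiv_int int_word)
 also have "(2 :: int) ^ w = 2 ^ (w - a) * 2 ^ a" using aw by (simp flip: power_add)
 also have "z mod (2 ^ (w - a) * 2 ^ a) div 2 ^ (w - a) = z div 2 ^ (w - a) mod 2 ^ a" by (simp add: zmod_zmult2_eq)
 finally have "nat (int (word w z div 2 ^ (w - a))) = nat (z div 2 ^ (w - a) mod 2 ^ a)" by (rule arg_cong)
 thus ?thesis unfolding h.bkt_def nat_int .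
qed

definition bucket_lists where "bucket_lists xs s = bfl om a xs (s div 2 ^ a) (s mod 2 ^ a)"

definition ainv where "ainv xs u u' e v m \<longleftrightarrow> bframe v & v vU = u & v vV = u' & minv (A_of xs (u, u') e) m"

lemma A_of_Suc:
 assumes "{u, u'} : E" "prl k ! e = (p, l)"
 defines "s0 == e * 2 ^ a + h.bkt (h.Z om p l u u')"
 shows "A_of xs (u, u') (Suc e) = (A_of xs (u, u') e)(s0 := A_of xs (u, u') e s0 @ [code_pair e (u, u')])" proof
 fix s
 have bl: "h.bkt z < 2 ^ a" for z by (rule h.bkt_less)
 have s0: "s0 div 2 ^ a = e" "s0 mod 2 ^ a = h.bkt (h.Z om p l u u')" using bl by (simp_all add: s0_def)
 have eq: "s = s0" if "s div 2 ^ a = e" "s mod 2 ^ a = h.bkt (h.Z om p l u u')"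
  using div_mult_mod_eq[of s "2 ^ a"] that unfolding s0_def by (simp only:)
 show "A_of xs (u, u') (Suc e) s = ((A_of xs (u, u') e)(s0 := A_of xs (u, u') e s0 @ [code_pair e (u, u')])) s"
 proof (cases "s = s0")
  case True
  have "in_bucket om a e (s mod 2 ^ a) (u, u')" unfolding True s0(2) in_bucket_def using assms(1,2) by simp
  thus ?thesis using s0(1) True by (simp add: A_of_def bfl_def)
 next
  case False
  have "~ in_bucket om a (s div 2 ^ a) (s mod 2 ^ a) (u, u')" if "s div 2 ^ a = e" proof
   assume "in_bucket om a (s div 2 ^ a) (s mod 2 ^ a) (u, u')"
   hence "s mod 2 ^ a = h.bkt (h.Z om p l u u')"
    unfolding that in_bucket_def assms(2) fst_conv snd_conv by (rule sym[OF conjunct2])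
   with eq[OF that] False show False by blast
  qed
  thus ?thesis using False by (auto simp: A_of_def bfl_def less_Suc_eq)
 qed
qed

lemma append_correct:
 assumes u: "u < 2 ^ L" "u' < 2 ^ L" "{u, u'} : E" and e: "e < C2" and xs: "length xs < 2 ^ L * 2 ^ L"
 shows "hoare w (ainv xs u u' e) (append_com e) (maxtime (append_com e)) (ainv xs u u' (Suc e))" proof (rule hoare_wp)
 fix v m assume i: "ainv xs u u' e v m"
 hence fr: "bframe v" and vu: "v vU = u" "v vV = u'" and mi: "minv (A_of xs (u, u') e) m" by (simp_all add: ainv_def)
 note fr' = bframeD[OF fr]
 obtain p l where pl: "prl k ! e = (p, l)" by fastforce
 have "(p, l) : prs k" using e pl by (metis length_prl nth_mem set_prl)
 hence p: "p < k" "l < k" by (auto simp: prs_def)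
 define d where "d = h.bkt (h.Z om p l u u')"
 define s0 where "s0 = e * 2 ^ a + d"
 define n where "n = length (A_of xs (u, u') e s0)"
 define K0 where "K0 = BB + s0 * ST"
 have d: "d < 2 ^ a" unfolding d_def by (rule h.bkt_less)
 have "(e + 1) * 2 ^ a <= C2 * 2 ^ a" using e by (intro mult_right_mono) auto
 hence s0: "s0 < C2 * 2 ^ a" using d by (simp add: s0_def)
 have "(s0 + 1) * ST <= (C2 * 2 ^ a) * ST" using s0 by (intro mult_right_mono) auto
 also have "... <= H" by (rule slot_le_H[OF a])
 finally have sH: "s0 * ST + ST <= H" by simp
 have "(2 :: nat) ^ 1 <= 2 ^ L" using L by (intro power_increasing) auto
 hence "2 * 1 <= 2 ^ L * (2 ^ L :: nat)" by (intro mult_mono) auto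
 hence ST: "3 + 2 * x <= ST" if "x <= 2 ^ L * 2 ^ L" for x using that by linarith
 have "length (A_of xs (u, u') e s) <= 2 ^ L * 2 ^ L" for s
  using length_bfl[of om a xs "s div 2 ^ a" "s mod 2 ^ a"] length_bfl[of om a "xs @ [(u, u')]" "s div 2 ^ a" "s mod 2 ^ a"] xs
  by (auto simp: A_of_def)
 hence len: "3 + 2 * length (A_of xs (u, u') e s) <= ST" for s by (rule ST)
 hence n: "3 + 2 * n <= ST" by (simp add: n_def)
 have K0: "K0 + y < 2 ^ w" if "y <= ST" for y using BB_less[of "s0 * ST + y"] sH that by (simp add: K0_def)
 have z: "eval w (z_exp p l) v m = word w (h.Z om p l u u')" by (rule eval_z[OF fr vu u mi p])
 have "d = word w (h.Z om p l u u') div 2 ^ (w - a)" unfolding d_def word_shift ..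
 hence zs: "eval w (z_exp p l [>>] Var vSh) v m = d"
  using z fr' le_less_trans[OF div_le_dividend word_less] by (simp add: drop_bit_eq_div)
 have Keq: "eval w (slot_exp (Lit e [*] Var vPA [+] (z_exp p l [>>] Var vSh))) v m = K0" proof -
  have "eval w (slot_exp (Lit e [*] Var vPA [+] (z_exp p l [>>] Var vSh))) v m =
   (BB + (e * 2 ^ a + eval w (z_exp p l [>>] Var vSh) v m) * ST) mod 2 ^ w"
   using fr' by (simp add: slot_exp_def mod_simps del: eval_binop.simps(10))
  thus ?thesis using K0[of 0] unfolding zs by (simp add: K0_def s0_def)
 qed
 have "p * 2 ^ L + u < 2 ^ (L + kap)" "l * 2 ^ L + u' < 2 ^ (L + kap)" proof -
  have "k <= k * k" by (cases k) auto
  hence k1: "k <= 2 ^ kap" using kap by (rule order_trans)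
  have *: "p' * 2 ^ L + y < 2 ^ (L + kap)" if "p' < k" "y < 2 ^ L" for p' y proof -
   have "p' * 2 ^ L + y < (p' + 1) * 2 ^ L" using that by simp
   also have "... <= 2 ^ kap * 2 ^ L" using that k1 by (intro mult_right_mono) auto
   finally show ?thesis by (simp add: power_add mult.commute)
  qed
  show "p * 2 ^ L + u < 2 ^ (L + kap)" "l * 2 ^ L + u' < 2 ^ (L + kap)" by (rule *[OF p(1) u(1)], rule *[OF p(2) u(2)])
 qed
 hence cd: "p * 2 ^ L + u < 2 ^ w" "l * 2 ^ L + u' < 2 ^ w" using R_le_H H_less by linarith+
 have mK: "m K0 = n" proof -
  have "barr m K0 (A_of xs (u, u') e s0)" using mi s0 by (simp add: minv_def K0_def)
  thus ?thesis by (simp add: barr_def n_def)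
 qed
 let ?m = "m(K0 + (1 + 2 * n) := p * 2 ^ L + u, K0 + (2 + 2 * n) := l * 2 ^ L + u', K0 := n + 1)"
 let ?v = "v(vK := K0, vLen := n)"
 have ev: "eval w (Var vK [+] (Lit 1 [+] Lit 2 [*] Var vLen)) ?v m' = K0 + (1 + 2 * n)"
  "eval w (Var vK [+] (Lit 2 [+] Lit 2 [*] Var vLen)) ?v m' = K0 + (2 + 2 * n)"
  "eval w (Lit p [*] Var vPL [+] Var vU) ?v m' = p * 2 ^ L + u"
  "eval w (Lit l [*] Var vPL [+] Var vV) ?v m' = l * 2 ^ L + u'"
  "eval w (Var vLen [+] Lit 1) ?v m' = n + 1" "eval w (Var vK) ?v m' = K0" for m'
  using K0[of "1 + 2 * n"] K0[of "2 + 2 * n"] n cd fr' vu w_pos by (simp_all add: mod_simps)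
 have "minv (A_of xs (u, u') (Suc e)) ?m" unfolding minv_def proof (intro conjI allI impI)
  have pre: "barr m (BB + s * ST) (A_of xs (u, u') e s) & 3 + 2 * length (A_of xs (u, u') e s) <= ST"
   if "s < C2 * 2 ^ a" for s using mi that len by (simp add: minv_def)
  note ap = barr_append[where A = "A_of xs (u, u') e" and S = "C2 * 2 ^ a", OF pre s0, folded K0_def n_def]
  have cp: "code_pair e (u, u') = (p * 2 ^ L + u, l * 2 ^ L + u')" by (simp add: code_pair_def pl)
  have A: "A_of xs (u, u') (Suc e) = (A_of xs (u, u') e)(s0 := A_of xs (u, u') e s0 @ [(p * 2 ^ L + u, l * 2 ^ L + u')])"
   using A_of_Suc[OF u(3) pl, of xs] unfolding cp s0_def d_def .
  show "barr ?m (BB + s * ST) (A_of xs (u, u') (Suc e) s)" if "s < C2 * 2 ^ a" for s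
   unfolding A by (rule ap(1)) (use that in auto)
  fix y assume y: "y < BB \<or> BB + H <= y"
  hence "y < BB \<or> BB + C2 * 2 ^ a * ST <= y" using slot_le_H[OF a] by linarith
  from ap(2)[OF _ this] mi y show "?m y = m0 y" by (simp only: minv_def)
 qed
 moreover have "bframe ?v" using fr by (simp add: bframe_def)
 ultimately have "ainv xs u u' (Suc e) ?v ?m" using vu by (simp add: ainv_def)
 moreover have "eval w (Mem (Var vK)) (v(vK := K0)) m = n" by (simp add: mK)
 ultimately show "wp w (append_com e) (ainv xs u u' (Suc e)) v m"
  unfolding append_com_def pl Let_def prod.case wp.simps Keq by (simp only: ev)
qed simp

definition pinv where "pinv u u' xs v m \<longleftrightarrow> bframe v & v vU = u & v vV = u' & minv (bucket_lists xs) m"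

lemma pair_correct:
 assumes u: "u < 2 ^ L" "u' < 2 ^ L" and xs: "length xs < 2 ^ L * 2 ^ L"
 shows "hoare w (pinv u u' xs) pair_com pair_time (pinv u u' (xs @ [(u, u')]))" proof -
 have adj: "eval w (Mem (adj_exp (Var vU) (Var vV))) v m = (if {u, u'} : E then 1 else 0)" if i: "pinv u u' xs v m" for v m
 proof -
  have fr: "bframe v" and vu: "v vU = u" "v vV = u'" and mi: "minv (bucket_lists xs) m" using i by (simp_all add: pinv_def)
  have lt4: "H + (u * 2 ^ L + u') < 4 * H" using vertex_index_le_H[OF u] by linarith
  have "eval w (adj_exp (Var vU) (Var vV)) v m = H + (u * 2 ^ L + u')"
   using bframeD[OF fr] vu H4_less[OF lt4] by (simp add: adj_exp_def mod_simps)
  thus ?thesis using m_low[OF mi lt4] tabs u by (simp add: tabs_def)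
 qed
 show ?thesis unfolding pair_com_def proof (rule hoare_cond[where ?t1.0 = "C2 * (SUM e<C2. maxtime (append_com e))"])
  show "hoare w (%v m. pinv u u' xs v m & eval w (Mem (adj_exp (Var vU) (Var vV))) v m ~= 0)
    (seqs (map append_com [0..<C2])) (C2 * (SUM e<C2. maxtime (append_com e))) (pinv u u' (xs @ [(u, u')]))"
  proof (cases "{u, u'} : E")
   case True
   show ?thesis proof (rule hoare_seqs[where I = "ainv xs u u'"])
    fix e assume "e < length (map append_com [0..<C2])"
    hence e: "e < C2" by simp
    have "maxtime (append_com e) <= (SUM e<C2. maxtime (append_com e))" using e by (intro member_le_sum) auto
    thus "hoare w (ainv xs u u' e) (map append_com [0..<C2] ! e) (SUM e<C2. maxtime (append_com e)) (ainv xs u u' (Suc e))"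
     using e by (auto intro!: hoare_conseq[OF append_correct[OF u True e xs]])
   next
    fix v m assume "ainv xs u u' (length (map append_com [0..<C2])) v m"
    hence i: "ainv xs u u' C2 v m" by simp
    have "s div 2 ^ a < C2" if "s < C2 * 2 ^ a" for s using that by (simp add: less_mult_imp_div_less)
    hence "A_of xs (u, u') C2 s = bucket_lists (xs @ [(u, u')]) s" if "s < C2 * 2 ^ a" for s
     using that by (simp add: A_of_def bucket_lists_def)
    thus "pinv u u' (xs @ [(u, u')]) v m" using i by (simp add: ainv_def pinv_def minv_def)
   next
    have "A_of xs (u, u') 0 = bucket_lists xs" by (rule ext) (simp add: A_of_def bucket_lists_def)
    thus "ainv xs u u' 0 v m" if "pinv u u' xs v m & eval w (Mem (adj_exp (Var vU) (Var vV))) v m ~= 0" for v m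
     using that by (simp add: ainv_def pinv_def)
   qed simp
  next
   case False
   show ?thesis proof (rule hoare_pre)
    fix v m assume "pinv u u' xs v m & eval w (Mem (adj_exp (Var vU) (Var vV))) v m ~= 0"
    hence False using adj[of v m] False by simp
    thus "hoare w (%v' m'. v' = v & m' = m) (seqs (map append_com [0..<C2]))
      (C2 * (SUM e<C2. maxtime (append_com e))) (pinv u u' (xs @ [(u, u')]))" ..
   qed
  qed
  show "hoare w (%v m. pinv u u' xs v m & eval w (Mem (adj_exp (Var vU) (Var vV))) v m = 0)
    Skip (C2 * (SUM e<C2. maxtime (append_com e))) (pinv u u' (xs @ [(u, u')]))" proof (rule hoare_wp)
   fix v m assume i: "pinv u u' xs v m & eval w (Mem (adj_exp (Var vU) (Var vV))) v m = 0"
   hence "{u, u'} ~: E" using adj by (metis zero_neq_one)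
   hence "bucket_lists (xs @ [(u, u')]) = bucket_lists xs" by (intro ext) (simp add: bucket_lists_def bfl_def in_bucket_def)
   thus "wp w Skip (pinv u u' (xs @ [(u, u')])) v m" using i by (simp add: pinv_def)
  qed simp
 qed (simp add: pair_time_def)
qed

lemma vV_loop:
 assumes u: "u < 2 ^ L"
 shows "hoare w (%v m. bframe v & v vU = u & minv (bucket_lists (upto_pair u (2 ^ L))) m)
  (For vV (Var vPL) pair_com) (3 + 2 ^ L * (pair_time + 4))
  (%v m. bframe v & v vU = u & minv (bucket_lists (upto_pair u 0)) m)"
proof (rule hoare_for[where n = "2 ^ L" and I = "%j v m. bframe v & v vU = u & minv (bucket_lists (upto_pair u j)) m"
   and B = "%j. pinv u j (upto_pair u (Suc j))"])
 fix j assume j: "j < (2 :: nat) ^ L"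
 show "hoare w (pinv u j (upto_pair u (Suc j))) pair_com pair_time
   (%v m. bframe v & v vU = u & minv (bucket_lists (upto_pair u j)) m)"
  by (rule hoare_conseq[OF pair_correct[OF u j length_upto_pair[OF u j]]])
   (auto simp: pinv_def upto_pair_step[OF j])
qed (auto dest: bframeD(2) simp: pinv_def)

theorem buckets_correct:
 "hoare w (%v m. v = v0 & m = m0) buckets_com buckets_time
  (%v m. bframe v & (ALL y. y < BB \<or> BB + H <= y --> m y = m0 y) &
   (ALL e<C2. ALL d<2 ^ a. barr m (BB + (e * 2 ^ a + d) * ST) (bfl om a all_pairs e d)))" proof -
 define Q where "Q = (%u. upto_pair u (2 ^ L))"
 have Q: "upto_pair u 0 = (if u = 0 then all_pairs else Q (u - 1))" if "u < 2 ^ L" for u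
  using that by (cases u) (simp_all only: upto_pair_end all_pairs_def Q_def upto_pair_start, simp_all)
 \<comment> \<open>The rows from \<open>u\<close> on, that is, what has been visited when the outer
   counter stands at \<open>u\<close>.\<close>
 define R where "R u = (if u = 0 then all_pairs else Q (u - 1))" for u
 have prep: "hoare w (%v m. v = v0 & m = m0) prep_com (maxtime prep_com) (%v m. bframe v & minv (bucket_lists []) m)"
 proof (rule hoare_wp)
  fix v m assume vm: "v = v0 & m = m0"
  have A: "(2 :: nat) ^ a < 2 ^ w" using pow_KL_le_H[OF a] H_less by linarith
  have "a <= 2 ^ a" using less_exp[of a] by simp
  hence a_less: "a < 2 ^ w" using A by linarith
  have "w < 2 ^ w" by (rule less_exp)
  hence ww: "cw * L < 2 ^ w" by (simp add: w_def)
  have sh: "(w + 2 ^ w - a) mod 2 ^ w = w - a" proof -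
   have "w + 2 ^ w - a = (w - a) + 2 ^ w" using aw by simp
   thus ?thesis using `w < 2 ^ w` by (simp only: mod_add_self2) (simp add: less_imp_diff_less)
  qed
  have F1: "BB < 2 ^ w" "F1 + 1 < 2 ^ w" proof -
   show "BB < 2 ^ w" using BB_less[of 0] by simp
   have "(F1 + 1) * 1 <= (F1 + 1) * H" by (rule mult_left_mono) (simp_all add: H_def)
   thus "F1 + 1 < 2 ^ w" using F1 by simp
  qed
  have "barr m0 (BB + s * ST) []" for s using fresh by (simp add: barr_def)
  hence "minv (bucket_lists []) m0" by (simp add: minv_def bucket_lists_def bfl_def)
  thus "wp w prep_com (%v m. bframe v & minv (bucket_lists []) m) v m" using vm A a_less ww sh F1 v0 v0' w_pos
   by (simp add: prep_com_def bframe_def push_bit_eq_mult mod_simps w_def)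
 qed simp
 have loop: "hoare w (%v m. bframe v & minv (bucket_lists []) m) (For vU (Var vPL) (For vV (Var vPL) pair_com))
   (3 + 2 ^ L * (3 + 2 ^ L * (pair_time + 4) + 4)) (%v m. bframe v & minv (bucket_lists all_pairs) m)"
 proof (rule hoare_for[where n = "2 ^ L" and I = "%j v m. bframe v & minv (bucket_lists (R j)) m"
   and B = "%j v m. bframe v & v vU = j & minv (bucket_lists (upto_pair j (2 ^ L))) m"])
  fix v m assume "bframe v & minv (bucket_lists []) m"
  moreover have "Q (2 ^ L - 1) = []" by (simp add: Q_def upto_pair_start)
  ultimately show "eval w (Var vPL) v m = 2 ^ L & bframe (v(vU := 2 ^ L)) & minv (bucket_lists (R (2 ^ L))) m"
   by (auto dest: bframeD(2) simp: R_def)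
 next
  fix j assume j: "j < (2 :: nat) ^ L"
  show "hoare w (%v m. bframe v & v vU = j & minv (bucket_lists (upto_pair j (2 ^ L))) m) (For vV (Var vPL) pair_com)
   (3 + 2 ^ L * (pair_time + 4)) (%v m. bframe v & minv (bucket_lists (R j)) m)"
   by (rule hoare_conseq[OF vV_loop[OF j]]) (auto simp: Q[OF j] R_def)
 qed (auto simp: R_def Q_def)
 show ?thesis unfolding buckets_com_def proof (rule hoare_conseq[OF hoare_seq[OF prep loop order_refl]])
  fix v m assume vm: "bframe v & minv (bucket_lists all_pairs) m"
  have "barr m (BB + (e * 2 ^ a + d) * ST) (bfl om a all_pairs e d)" if "e < C2" "d < 2 ^ a" for e d proof -
   have "(e + 1) * 2 ^ a <= C2 * 2 ^ a" using that by (intro mult_right_mono) auto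
   hence "e * 2 ^ a + d < C2 * 2 ^ a" using that by simp
   hence "barr m (BB + (e * 2 ^ a + d) * ST) (bucket_lists all_pairs (e * 2 ^ a + d))" using vm unfolding minv_def by blast
   moreover have "(e * 2 ^ a + d) div 2 ^ a = e" "(e * 2 ^ a + d) mod 2 ^ a = d" using that by simp_all
   ultimately show ?thesis unfolding bucket_lists_def by (simp only:)
  qed
  thus "bframe v & (ALL y. y < BB \<or> BB + H <= y --> m y = m0 y) &
   (ALL e<C2. ALL d<2 ^ a. barr m (BB + (e * 2 ^ a + d) * ST) (bfl om a all_pairs e d))" using vm unfolding minv_def by blast
 qed (auto simp: buckets_time_def)
qed

end

section \<open>The loops over all guesses\<close>

lemma grow_for:
 assumes "!!B v m. S B v m ==> eval w e v m = n" "!!B v m x. S B v m ==> S B (v(r := x)) m"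
  and "!!j B. j < n ==> B + D <= X ==> hoare w (%v m. S B v m & v r = j) c t (S (B + D))"
  and "B + n * D <= (X :: nat)" "esize e + 2 + n * (t + 4) <= T"
 shows "hoare w (S B) (For r e c) T (S (B + n * D))"
proof (rule hoare_for[where n = n and I = "%j. S (B + (n - j) * D)" and B = "%j v m. S (B + (n - Suc j) * D) v m & v r = j"])
 fix j assume j: "j < n"
 hence eq: "n - j = Suc (n - Suc j)" by simp
 have "Suc (n - Suc j) * D <= n * D" using j by (intro mult_right_mono) auto
 thus "hoare w (%v m. S (B + (n - Suc j) * D) v m & v r = j) c t (S (B + (n - j) * D))"
  using assms(3)[OF j, of "B + (n - Suc j) * D"] assms(4) unfolding eq by (simp add: ac_simps)
qed (use assms in auto)

text \<open>In the applications \<open>B\<close> bounds the memory blocks in use: every round may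
  take \<open>D\<close> more of them within the budget \<open>X\<close>, while only round
  \<open>i\<close> has to succeed.\<close>

lemma grow_for_prob:
 assumes "!!B v m. S B v m ==> eval w e v m = n" "!!B v m x. S B v m ==> S B (v(r := x)) m"
  and "!!j B. j < n ==> B + D <= X ==> hoare w (%v m. S B v m & v r = j) c t (S (B + D))"
  and "B + n * D <= (X :: nat)" and "sticky c" "0 < w" "r ~= vFlag"
  and "i < n" "!!B. B + D <= X ==> phoare w (%v m. S B v m & v r = i) c p (%v m. v vFlag ~= 0)" "0 <= p"
 shows "phoare w (S B) (For r e c) p (%v m. v vFlag ~= 0)"
proof (rule phoare_for_once[where n = n and I = "%j. S (B + (n - j) * D)" and B = "%j v m. S (B + (n - Suc j) * D) v m & v r = j"
   and G = "%v m. v vFlag ~= 0" and i = i and t = t])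
 have le: "B + (n - Suc j) * D + D <= X" if "j < n" for j proof -
  have "Suc (n - Suc j) * D <= n * D" using that by (intro mult_right_mono) auto
  thus ?thesis using assms(4) by simp
 qed
 show body: "hoare w (%v m. S (B + (n - Suc j) * D) v m & v r = j) c t (S (B + (n - j) * D))" if j: "j < n" for j proof -
  have eq: "n - j = Suc (n - Suc j)" using j by simp
  show ?thesis using assms(3)[OF j le[OF j]] unfolding eq by (simp add: ac_simps)
 qed
 show "hoare w (%v m. (S (B + (n - Suc j) * D) v m & v r = j) & v vFlag ~= 0) c t
   (%v m. S (B + (n - j) * D) v m & v vFlag ~= 0)" if "j < n" for j by (rule hoare_sticky[OF body[OF that] assms(5,6)])
 show "phoare w (%v m. S (B + (n - Suc i) * D) v m & v r = i) c p (%v m. v vFlag ~= 0)"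
  by (rule assms(9)[OF le[OF assms(8)]])
qed (use assms in auto)

lemma barr_cong:
 assumes "barr m B xs" "!!y. y < B + 3 + 2 * length xs ==> m' y = m y"
 shows "barr m' B xs" using assms unfolding barr_def by simp

context prog
begin

definition KL_exp where "KL_exp = Lit K [*] Var vL"

text \<open>Besides the buckets of \<open>DD\<close> pairs, the \<open>kap\<close> extra bits guess
  the carry, which is below \<open>C2 <= 2 ^ kap\<close>.\<close>

definition tries_com where "tries_com = For vI (Lit 1 [<<] (Var vA [*] Lit DD [+] Lit kap)) trial_com"

text \<open>About \<open>2 ^ (a * DD)\<close> bucket guesses at \<open>2 ^ f\<close> simulated steps
  each: the first condition caps their product at 2 to the power of \<open>vG\<close>, whichever
  exponents are guessed. The second is there because writing the pendant edges alone takes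
  \<open>2 ^ mu\<close> rounds.\<close>

definition guard where
 "guard = Bin Less (Var vA [*] Lit DD [+] Var vF) (Var vG [+] Lit 1) [*] Bin Less (Var vMu) (Var vF [+] Lit 1)"

definition f_com where "f_com = For vF KL_exp (Cond guard tries_com Skip)"

definition mu_com where "mu_com = For vMu KL_exp (For vB KL_exp f_com)"

definition a_com where "a_com = For vA KL_exp (buckets_com ;; mu_com)"

definition draw_com where "draw_com = fill vR3 vJ (Lit (k * k) [*] Var vPL [+] Lit 1) vZ"

text \<open>\<open>L\<close> repetitions with fresh random tables push the error to at most 1 / 2^L,
  hence below the allowed 1 / N.\<close>

definition rep_com where "rep_com = For vRep (Var vL) (draw_com ;; a_com)"

definition trial_coeff where "trial_coeff = maxtime alloc_com + (esize (Lit 1 [<<] Var vMu) + 2 + (maxtime pads_body + 4)) +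
   maxtime (Asg vM (Lit 1 [<<] Var vMu) ;; Asg vS (Lit 0)) +
   C2 * ((SUM e<C2. maxtime (copy_com e)) + (maxtime copy_body + 7)) + maxtime header_com +
   ((maxtime init_com + reg_bound P * 2) + (esize (Lit 1 [<<] Var vF) + 2 + (maxtime (dispatch 0 P) + 4))) +
   (esize (Bin Div (Var vOc) (Lit k)) + 2 + (maxtime check_body + 4))"

lemma sticky_trial: "sticky trial_com" proof -
 have "sticky (sim_instr x)" for x by (cases x) (auto simp: vreg_def)
 hence "sticky (dispatch j xs)" for j xs by (induction xs arbitrary: j) auto
 thus ?thesis
  by (auto simp: trial_com_def build_com_def init_com_def zero_regs_com_def sim_loop_def check_com_def check_body_def
    alloc_com_def pads_com_def pads_body_def header_com_def copy_com_def digit_com_def copy_loop_def copy_body_def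
    sticky_seqs vreg_def)
qed

lemma sticky_buckets: "sticky buckets_com"
 by (auto simp: buckets_com_def prep_com_def pair_com_def append_com_def sticky_seqs Let_def split: prod.splits)

lemma sticky_loops:
 "sticky tries_com" "sticky f_com" "sticky mu_com" "sticky a_com" "sticky draw_com" using sticky_trial sticky_buckets
 by (simp_all add: tries_com_def f_com_def mu_com_def a_com_def draw_com_def fill_def)

end

lemma le_scaled: "(x :: nat) <= y ==> 1 <= F ==> x <= y * F" by (metis mult.right_neutral mult_le_mono)

text \<open>Every loop of a trial has at most \<open>2 ^ f\<close> rounds: there are
  \<open>2 ^ mu <= 2 ^ f\<close> pendant edges, longer buckets are skipped, and \<open>P\<close>
  outputs at most one word per step, which bounds the blocks to be checked.\<close>

lemma (in trial) trial_time_le: "trial_time <= trial_coeff * 2 ^ f" proof -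
 define F where "F = (2 :: nat) ^ f"
 have 1: "1 <= F" by (simp add: F_def)
 have M: "2 ^ mu <= F" unfolding F_def using muf by (intro power_increasing) auto
 have A: "x + x' <= (y + y') * F" if "x <= y * F" "x' <= y' * F" for x x' y y'
  using add_mono[OF that] by (simp only: distrib_right)
 have B: "2 ^ mu * y <= y * F" "F * y <= y * F" for y using mult_right_mono[OF M, of y] by (simp_all add: mult.commute)
 have "x + y * F <= (x + y) * F" for x y by (intro A le_scaled[OF order_refl 1]) simp
 hence C: "C2 * (x + y * F) <= (C2 * (x + y)) * F" for x y by (subst mult.assoc) (rule mult_left_mono, simp_all)
 show ?thesis
  unfolding trial_time_def build_time_def init_time_def loop_time_def check_time_def trial_coeff_def F_def[symmetric]
  by (intro A B C le_scaled[OF order_refl 1])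
qed

context red
begin

definition G where "G = ((k * q - 1) * L) div q + C0"

definition buckets_at where "buckets_at om a B m \<longleftrightarrow> (ALL e<C2. ALL d<2 ^ a.
   barr m (B + (e * 2 ^ a + d) * (4 * (2 ^ L * 2 ^ L))) (bfl om a all_pairs e d))"

lemma length_bfl_all: "length (bfl om a all_pairs e d) <= 2 ^ L * 2 ^ L" proof -
 have "length all_pairs = card ({..<2 ^ L :: nat} \<times> {..<2 ^ L :: nat})"
  using distinct_card[OF all_pairs_props(1)] all_pairs_props(2) by simp
 thus ?thesis using length_bfl[of om a all_pairs e d] by simp
qed

lemma buckets_at_cong:
 assumes "buckets_at om a B m" "a < K * L" "!!y. y < B + H ==> m' y = m y"
 shows "buckets_at om a B m'" unfolding buckets_at_def proof (intro allI impI)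
 fix e d assume e: "e < C2" and d: "d < (2 :: nat) ^ a"
 let ?xs = "bfl om a all_pairs e d" and ?X = "2 ^ L * 2 ^ L :: nat" and ?s = "e * 2 ^ a + d"
 have "(e + 1) * 2 ^ a <= C2 * 2 ^ a" using e by (intro mult_right_mono) auto
 hence "?s + 1 <= C2 * 2 ^ a" using d by simp
 hence "(?s + 1) * (4 * ?X) <= (C2 * 2 ^ a) * (4 * ?X)" by (rule mult_right_mono) simp
 also have "... <= H" by (rule slot_le_H[OF assms(2)])
 finally have sH: "?s * (4 * ?X) + 4 * ?X <= H" by simp
 have "(2 :: nat) ^ 1 <= 2 ^ L" using L by (intro power_increasing) auto
 hence "2 * 2 <= 2 ^ L * (2 ^ L :: nat)" by (intro mult_mono) auto
 hence "?s * (4 * ?X) + 3 + 2 * length ?xs <= H" using sH length_bfl_all[of om a e d] by linarith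
 hence le: "B + ?s * (4 * ?X) + 3 + 2 * length ?xs <= B + H" by linarith
 have "barr m (B + ?s * (4 * ?X)) ?xs" using assms(1) e d unfolding buckets_at_def by blast
 thus "barr m' (B + ?s * (4 * ?X)) ?xs" by (rule barr_cong) (rule assms(3), use le in linarith)
qed

text \<open>The invariant of the outer loops. All cells from the allocation pointer on are zero, so
  every newly taken block is clean; \<open>B\<close> limits the pointer.\<close>

definition st where "st B v m \<longleftrightarrow> env v & tabs m & (v vFlag ~= 0 --> has_zero_clique) &
   4 <= v vFP & v vFP <= B & (ALL y>=v vFP * H. m y = 0)"

definition stw where "stw om B v m \<longleftrightarrow> st B v m & rtab om m"

definition stb where "stb om a B v m \<longleftrightarrow> stw om B v m & v vA = a & v vPA = 2 ^ a &
   (EX F1. v vBB = F1 * H & F1 + 1 <= v vFP & buckets_at om a (F1 * H) m)"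

definition stm where "stm om a mu b f B v m \<longleftrightarrow> stb om a B v m & v vMu = mu & v vB = b & v vF = f"

definition chosen_bucket where
 "chosen_bucket om a f i e = (if length (bfl om a all_pairs e (dig a i e)) <= 2 ^ f then bfl om a all_pairs e (dig a i e) else [])"

definition inst_input where "inst_input om a mu b f i = listing_input (2 ^ (L + kap) + 2 ^ mu)
   (map (%j. (j mod 2 ^ (L + kap), 2 ^ (L + kap) + j)) [0..<2 ^ mu] @ concat (map (chosen_bucket om a f i) [0..<C2])) (2 ^ b)"

text \<open>Mentions neither the hidden clique nor the instance graph: it is enough that some set
  \<open>Y\<close> of outputs has probability 3/4 and that each of them displays a zero
  clique.\<close>

definition hits where "hits om a mu b f i \<longleftrightarrow> input_fits (c * (mu + 1)) (inst_input om a mu b f i) &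
   (EX Y. 3 / 4 <= success_prob (c * (mu + 1)) P (inst_input om a mu b f i) (2 ^ f) Y &
    (ALL out:Y. EX j. Suc j * k <= length out & inst.zero_clique k E wt (%p. out ! (j * k + p) mod 2 ^ L)))"

lemma H_pos: "0 < H" by (simp add: H_def)

lemma tabs_cong:
 assumes "tabs m" "!!y. y < 3 * H ==> m' y = m y"
 shows "tabs m'" unfolding tabs_def proof (intro allI impI)
 fix x y assume xy: "x < (2 :: nat) ^ L" "y < (2 :: nat) ^ L"
 have "H + (x * 2 ^ L + y) < 3 * H" "2 * H + (x * 2 ^ L + y) < 3 * H" using vertex_index_le_H[OF xy] by linarith+
 from this[THEN assms(2)] have "m' (H + (x * 2 ^ L + y)) = m (H + (x * 2 ^ L + y))"
  "m' (2 * H + (x * 2 ^ L + y)) = m (2 * H + (x * 2 ^ L + y))" .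
 thus "m' (H + (x * 2 ^ L + y)) = (if {x, y} : E then 1 else 0) &
   ({x, y} : E --> m' (2 * H + (x * 2 ^ L + y)) = word w (wt {x, y}))" using assms(1) xy unfolding tabs_def by simp
qed

lemma rtab_cong:
 assumes "rtab om m" "!!y. y < 4 * H ==> m' y = m y"
 shows "rtab om m'" unfolding rtab_def proof (intro allI impI)
 fix i assume i: "i < hash.len k (2 ^ L)"
 hence "3 * H + i < 4 * H" using rtab_len by linarith
 hence "m' (3 * H + i) = m (3 * H + i)" by (rule assms(2))
 thus "m' (3 * H + i) = om i & om i < 2 ^ w" using assms(1) i unfolding rtab_def by simp
qed

end

text \<open>The assumption keeps every address of the whole run below \<open>2 ^ w\<close>. It
  counts 4 fixed blocks and, in every repetition, one block of buckets for each \<open>a\<close> and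
  two blocks for each trial.\<close>

locale main = red k P c K q C0 kap ch cw L N E wt
 for k :: nat and P :: program and c K q C0 kap ch cw L N :: nat and E :: "nat set set" and wt :: "nat set => int" +
 assumes room: "(4 + L * (K * L * (1 + K * L * (K * L * (K * L * (2 ^ (G + kap) * 2))))) + 2) * H < 2 ^ w"
begin

abbreviation BM :: nat where
 "BM == 4 + L * (K * L * (1 + K * L * (K * L * (K * L * (2 ^ (G + kap) * 2)))))"

lemma room': "B <= BM ==> (B + 2) * H < 2 ^ w" by (rule le_less_trans[OF _ room]) (intro mult_right_mono, auto)

lemma trial_locale:
 assumes "a < K * L" "mu < K * L" "b < K * L" "f < K * L" "mu <= f" "i < 2 ^ w" "B + 2 <= BM"
  and st: "stm om a mu b f B v0 m0" "v0 vI = i"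
 shows "trial k P c K kap ch cw L N E wt a mu b f i (v0 vFP) (v0 vBB) (bfl om a all_pairs) v0 m0" proof -
 from st obtain F1 where F1: "v0 vBB = F1 * H" "F1 + 1 <= v0 vFP" "buckets_at om a (F1 * H) m0"
  unfolding stm_def stb_def by blast
 have e: "env v0" "v0 vA = a" "v0 vPA = 2 ^ a" "v0 vFP <= B" using st by (simp_all add: stm_def stb_def stw_def st_def)
 have "(F1 + 1) * H <= v0 vFP * H" using F1(2) by (rule mult_right_mono) simp
 hence BB: "v0 vBB + H <= v0 vFP * H" using F1(1) by simp
 have "(v0 vFP + 2) * H < 2 ^ w" by (rule room') (use e assms in linarith)
 thus ?thesis using assms BB F1 e length_bfl_all by unfold_locales (auto simp: stm_def env_def buckets_at_def)
qed

lemma zero_less_BM: "2 ^ (G + kap) <= BM" proof -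
 have m: "y <= K * L * z" "y <= L * z" if "y <= z" for y z
  using mult_le_mono[OF L_le(2) that] mult_le_mono[OF L that] by simp_all
 have "2 ^ (G + kap) <= 2 ^ (G + kap) * (2 :: nat)" by simp
 hence "2 ^ (G + kap) <= K * L * (K * L * (K * L * (2 ^ (G + kap) * 2)))" by (intro m(1))
 hence "2 ^ (G + kap) <= 1 + K * L * (K * L * (K * L * (2 ^ (G + kap) * 2)))" by linarith
 hence "2 ^ (G + kap) <= L * (K * L * (1 + K * L * (K * L * (K * L * (2 ^ (G + kap) * 2)))))" by (intro m(2) m(1))
 thus ?thesis by linarith
qed

lemma trial_step:
 assumes ps: "a < K * L" "mu < K * L" "b < K * L" "f < K * L" "mu <= f" "i < 2 ^ w" "B + 2 <= BM"
 shows "hoare w (%v m. stm om a mu b f B v m & v vI = i) trial_com (trial_coeff * 2 ^ f) (stm om a mu b f (B + 2))"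
proof (rule hoare_pre)
 fix v0 m0 assume s: "stm om a mu b f B v0 m0 & v0 vI = i"
 interpret trial k P c K q C0 kap ch cw L N E wt a mu b f i "v0 vFP" "v0 vBB" "bfl om a all_pairs" v0 m0
  by (rule trial_locale) (use ps s in auto)
 have tb: "tabs m0" and F4: "4 <= v0 vFP" "v0 vFP <= B" and en: "env v0" and fl: "v0 vFlag ~= 0 --> has_zero_clique"
  and fr: "!!y. v0 vFP * H <= y ==> m0 y = 0" and rt: "rtab om m0" and vA: "v0 vA = a" "v0 vPA = 2 ^ a"
  and vMu: "v0 vMu = mu" "v0 vB = b" "v0 vF = f" using s by (auto simp: stm_def stb_def stw_def st_def)
 obtain F1 where F1: "v0 vBB = F1 * H" "F1 + 1 <= v0 vFP" "buckets_at om a (F1 * H) m0"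
  using s unfolding stm_def stb_def by blast
 have "4 * H <= base" using F4(1) by (rule mult_right_mono) simp
 have F1H: "F1 * H + H <= base" using mult_right_mono[OF F1(2), of H] by simp
 have F3: "3 <= v0 vFP" using F4 by simp
 show "hoare w (%v m. v = v0 & m = m0) trial_com (trial_coeff * 2 ^ f) (stm om a mu b f (B + 2))"
 proof (rule hoare_conseq[OF trial_correct[OF tb F3] _ _ trial_time_le])
  fix v m assume a: "frame2 v & (v vFlag ~= 0 --> v0 vFlag ~= 0 \<or> has_zero_clique) &
    (ALL y. y < base \<or> base + 2 * H <= y --> m y = m0 y)"
  hence f2: "frame2 v" and fl': "v vFlag ~= 0 --> has_zero_clique" and my: "!!y. y < base ==> m y = m0 y"
   and my2: "!!y. base + 2 * H <= y ==> m y = m0 y" using fl by auto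
  have "x ~: range vreg" if "x < 40" for x using that by (auto simp: vreg_def)
  hence vx: "v x = v0 x" if "x ~: {vFP, vBase, vOb, vM, vS, vD, vK, vLen, vJ, vW, vPc, vOc, vFu, vFlag}" "x < 40" for x
   using f2 that unfolding frame2_def by blast
  have FP: "v vFP = v0 vFP + 2" using f2 by (simp add: frame2_def)
  have "env v" using en unfolding env_def by (simp add: vx)
  moreover have "tabs m" by (rule tabs_cong[OF tb]) (rule my, use `4 * H <= base` in linarith)
  moreover have "ALL y>=v vFP * H. m y = 0" proof (intro allI impI)
   fix y assume "v vFP * H <= y"
   hence "base + 2 * H <= y" by (simp add: FP algebra_simps)
   thus "m y = 0" using my2 fr[of y] by simp
  qed
  ultimately have "st (B + 2) v m" using fl' FP F4 by (simp add: st_def)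
  moreover have "rtab om m" by (rule rtab_cong[OF rt]) (rule my, use `4 * H <= base` in linarith)
  moreover have "buckets_at om a (F1 * H) m" by (rule buckets_at_cong[OF F1(3) ps(1)]) (rule my, use F1H in linarith)
  moreover have "v vBB = F1 * H" "F1 + 1 <= v vFP" using F1 FP by (simp_all add: vx)
  moreover have "v vMu = mu" "v vB = b" "v vF = f" "v vA = a" "v vPA = 2 ^ a" using vMu vA by (simp_all add: vx)
  ultimately show "stm om a mu b f (B + 2) v m" unfolding stm_def stb_def stw_def by blast
 qed auto
qed

lemma trial_hit:
 assumes ps: "a < K * L" "mu < K * L" "b < K * L" "f < K * L" "mu <= f" "i < 2 ^ w" "B + 2 <= BM"
  and hit: "hits om a mu b f i"
 shows "phoare w (%v m. stm om a mu b f B v m & v vI = i) trial_com (3 / 4) (%v m. v vFlag ~= 0)" proof (rule phoare_pre)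
 fix v0 m0 assume s: "stm om a mu b f B v0 m0 & v0 vI = i"
 interpret trial k P c K q C0 kap ch cw L N E wt a mu b f i "v0 vFP" "v0 vBB" "bfl om a all_pairs" v0 m0
  by (rule trial_locale) (use ps s in auto)
 have "chosen = chosen_bucket om a f i" by (rule ext) (simp add: chosen_def chosen_bucket_def)
 hence inp: "inp = inst_input om a mu b f i" by (simp add: inp_def inst_input_def ES_def edges_upto_def pad_list_def)
 obtain Y where Y: "3 / 4 <= success_prob wl P inp (2 ^ f) Y"
  "!!out. out : Y ==> EX j. Suc j * k <= length out & I.zero_clique (%p. out ! (j * k + p) mod 2 ^ L)"
  using hit unfolding hits_def wl_def inp by blast
 show "phoare w (%v m. v = v0 & m = m0) trial_com (3 / 4) (%v m. v vFlag ~= 0)" by (rule trial_finds[OF _ _ _ _ Y])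
    (use s hit in "auto simp: stm_def stb_def stw_def st_def hits_def inp wl_def")
qed

definition tries_time where "tries_time = (trial_coeff + 20) * 2 ^ (G + kap)"

lemma pow_less_w: "(2 :: nat) ^ (G + kap) < 2 ^ w" proof -
 have "(BM + 2) * 1 <= (BM + 2) * H" using H_pos by (intro mult_left_mono) auto
 hence "(BM + 2) * 1 < 2 ^ w" using room by (rule le_less_trans)
 moreover have "2 ^ (G + kap) <= (BM + 2) * 1" unfolding mult_1_right by (rule trans_le_add1[OF zero_less_BM])
 ultimately show ?thesis by (rule le_less_trans[rotated])
qed

lemma eval_tries:
 assumes "stm om a mu b f B v m" "a * DD + f <= G"
 shows "eval w (Lit 1 [<<] (Var vA [*] Lit DD [+] Lit kap)) v m = 2 ^ (a * DD + kap)" proof -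
 have le: "a * DD + kap <= G + kap" using assms(2) by simp
 hence lt: "(2 :: nat) ^ (a * DD + kap) < 2 ^ w" by (intro le_less_trans[OF power_increasing pow_less_w]) auto
 moreover have "a * DD + kap < 2 ^ (a * DD + kap)" by (rule less_exp)
 ultimately have "a * DD + kap < 2 ^ w" by linarith
 thus ?thesis using assms(1) lt w_pos by (simp add: stm_def stb_def push_bit_eq_mult mod_simps)
qed

lemma stm_vI [simp]: "stm om a mu b f B (v(vI := x)) m = stm om a mu b f B v m"
 by (simp add: stm_def stb_def stw_def st_def env_def)

lemma tries_body:
 assumes "a < K * L" "mu < K * L" "b < K * L" "f < K * L" "mu <= f" "a * DD + f <= G"
  and "j < (2 :: nat) ^ (a * DD + kap)"
 shows "j < (2 :: nat) ^ w" proof -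
 have "(2 :: nat) ^ (a * DD + kap) <= 2 ^ (G + kap)" using assms by (intro power_increasing) auto
 thus ?thesis using assms(7) pow_less_w by linarith
qed

lemma tries_correct:
 assumes ps: "a < K * L" "mu < K * L" "b < K * L" "f < K * L" "mu <= f" "a * DD + f <= G"
  and B: "B + 2 ^ (G + kap) * 2 <= BM"
 shows "hoare w (stm om a mu b f B) tries_com tries_time (stm om a mu b f (B + 2 ^ (G + kap) * 2))"
  "i < 2 ^ (a * DD + kap) ==> hits om a mu b f i ==>
    phoare w (stm om a mu b f B) tries_com (3 / 4) (%v m. v vFlag ~= 0)" proof -
 have pw: "2 ^ (a * DD + kap) * 2 <= 2 ^ (G + kap) * (2 :: nat)" using ps by (simp add: power_increasing)
 have B': "B + 2 ^ (a * DD + kap) * 2 <= BM" using pw B by linarith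
 have mono: "stm om a mu b f B1 v m ==> B1 <= B2 ==> stm om a mu b f B2 v m" for B1 B2 v m
  by (auto simp: stm_def stb_def stw_def st_def)
 have time: "esize (Lit 1 [<<] (Var vA [*] Lit DD [+] Lit kap)) + 2 + 2 ^ (a * DD + kap) * (trial_coeff * 2 ^ f + 4) <= tries_time"
 proof -
  have "2 ^ (a * DD + kap) * 2 ^ f <= (2 :: nat) ^ (G + kap)"
   unfolding power_add[symmetric] using ps by (intro power_increasing) auto
  from mult_left_mono[OF this, of trial_coeff]
  have 1: "2 ^ (a * DD + kap) * (trial_coeff * 2 ^ f) <= trial_coeff * 2 ^ (G + kap)" by (simp add: ac_simps)
  have "1 <= (2 :: nat) ^ (G + kap)" by simp
  moreover have "esize (Lit 1 [<<] (Var vA [*] Lit DD [+] Lit kap)) + 2 = 9" by simp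
  ultimately show ?thesis using 1 pw unfolding tries_time_def distrib_left distrib_right by linarith
 qed
 note ev = eval_tries[OF _ ps(6)]
 have upd: "stm om a mu b f B v m ==> stm om a mu b f B (v(vI := x)) m" for B v m x by (simp only: stm_vI)
 note body = trial_step[OF ps(1-5) tries_body[OF ps]]
 have "hoare w (stm om a mu b f B) tries_com tries_time (stm om a mu b f (B + 2 ^ (a * DD + kap) * 2))"
  unfolding tries_com_def by (rule grow_for[where S = "stm om a mu b f", OF ev upd body B' time])
 thus "hoare w (stm om a mu b f B) tries_com tries_time (stm om a mu b f (B + 2 ^ (G + kap) * 2))"
  by (rule hoare_conseq) (use pw in "auto elim: mono")
 assume i: "i < 2 ^ (a * DD + kap)" "hits om a mu b f i"
 note hit = trial_hit[OF ps(1-5) tries_body[OF ps i(1)] _ i(2)]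
 show "phoare w (stm om a mu b f B) tries_com (3 / 4) (%v m. v vFlag ~= 0)"
  using grow_for_prob[where S = "stm om a mu b f", OF ev upd body B' sticky_trial w_pos _ i(1) hit]
  unfolding tries_com_def by simp
qed

lemma stb_mono: "stb om a B1 v m ==> B1 <= B2 ==> stb om a B2 v m" by (auto simp: stb_def stw_def st_def)

lemma stb_upd [simp]:
 "stb om a B (v(vF := x)) m = stb om a B v m" "stb om a B (v(vB := x)) m = stb om a B v m"
 "stb om a B (v(vMu := x)) m = stb om a B v m" by (simp_all add: stb_def stw_def st_def env_def)

lemma st_upd [simp]:
 "stw om B (v(vA := x)) m = stw om B v m" "st B (v(vRep := x)) m = st B v m" by (simp_all add: stw_def st_def env_def)

lemma eval_KL: "v vL = L ==> eval w KL_exp v m = K * L" proof -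
 assume v: "v vL = L"
 have "K * L < 2 ^ (K * L)" by (rule less_exp)
 also have "... <= H" by (rule le_H[of "K * L"]) (use chL in linarith, simp)
 also have "... < 2 ^ w" by (rule H_less)
 finally show ?thesis using v by (simp add: KL_exp_def mod_simps)
qed

lemma eval_guard:
 assumes s: "stm om a mu b f B v m" and ps: "a < K * L" "f < K * L" "mu < K * L"
 shows "eval w guard v m = (if a * DD + f <= G & mu <= f then 1 else 0)" proof -
 have v: "v vA = a" "v vF = f" "v vMu = mu" "v vG = G"
  using s by (simp_all add: stm_def stb_def stw_def st_def env_def G_def)
 have r: "(4 + 2) * H < 2 ^ w" by (rule room') simp
 have H4: "y < 2 ^ w" if "y <= 3 * H" for y by (rule le_less_trans[OF _ r]) (use that in simp)
 have pow: "x + 1 <= H" if "x < K * L" for x using less_exp[of x] pow_KL_le_H[OF that] by linarith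
 have "a <= 2 ^ a" using less_exp[of a] by simp
 hence "a * DD <= C2 * 2 ^ a" by (subst mult.commute) (rule mult_le_mono, simp_all)
 also have "... <= C2 * 2 ^ a * (4 * (2 ^ L * 2 ^ L))" by simp
 also have "... <= H" by (rule slot_le_H[OF ps(1)])
 finally have aD: "a * DD <= H" .
 have G: "G + 1 < 2 ^ w" proof -
  have "G + 1 <= 2 ^ G" using Suc_leI[OF less_exp[of G]] by simp
  also have "... <= 2 ^ (G + kap)" by (rule power_increasing) auto
  finally show ?thesis using pow_less_w by linarith
 qed
 have "a * DD + f < 2 ^ w" "f + 1 < 2 ^ w" using aD pow[OF ps(2)] by (auto intro!: H4)
 thus ?thesis using v G w_pos by (simp add: guard_def mod_simps less_Suc_eq_le)
qed

definition inc :: nat where "inc = 2 ^ (G + kap) * 2"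

definition level where "level t = 5 + K * L * (t + 4)"

lemma level: "esize KL_exp + 2 + K * L * (t + 4) <= level t" by (simp add: level_def KL_exp_def)

lemma f_correct:
 fixes om :: "nat => nat"
 assumes ps: "a < K * L" "mu < K * L" "b < K * L" and B: "B + K * L * inc <= BM"
 defines "S == %B v m. stb om a B v m & v vMu = mu & v vB = b"
 shows "hoare w (S B) f_com (level (esize guard + 2 + tries_time)) (S (B + K * L * inc))"
  "f < K * L ==> mu <= f ==> a * DD + f <= G ==> i < 2 ^ (a * DD + kap) ==> hits om a mu b f i ==>
    phoare w (S B) f_com (3 / 4) (%v m. v vFlag ~= 0)" proof -
 have ev: "S B v m ==> eval w KL_exp v m = K * L" for B v m
  by (rule eval_KL) (simp add: S_def stb_def stw_def st_def env_def)
 have upd: "S B v m ==> S B (v(vF := x)) m" for B v m x by (simp add: S_def)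
 have Sm: "(S B v m & v vF = j) \<longleftrightarrow> stm om a mu b j B v m" for B v m j by (auto simp: S_def stm_def)
 have body: "hoare w (%v m. S B v m & v vF = j) (Cond guard tries_com Skip) (esize guard + 2 + tries_time) (S (B + inc))"
  if j: "j < K * L" and B: "B + inc <= BM" for j B proof (rule hoare_cond[OF _ _ order_refl])
  show "hoare w (%v m. (S B v m & v vF = j) & eval w guard v m ~= 0) tries_com tries_time (S (B + inc))"
  proof (cases "a * DD + j <= G & mu <= j")
   case True
   have "hoare w (stm om a mu b j B) tries_com tries_time (stm om a mu b j (B + inc))"
    unfolding inc_def by (rule tries_correct(1)) (use ps j True B in "auto simp: inc_def")
   thus ?thesis by (rule hoare_conseq) (auto simp: Sm[symmetric])
  next
   case False
   show ?thesis proof (rule hoare_pre)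
    fix v m assume "(S B v m & v vF = j) & eval w guard v m ~= 0"
    hence "stm om a mu b j B v m" "eval w guard v m ~= 0" using Sm by blast+
    with trans[OF eval_guard[OF this(1) ps(1) j ps(2)] if_not_P[OF False]] have False by blast
    thus "hoare w (%v' m'. v' = v & m' = m) tries_com tries_time (S (B + inc))" ..
   qed
  qed
  show "hoare w (%v m. (S B v m & v vF = j) & eval w guard v m = 0) Skip tries_time (S (B + inc))"
   by (rule hoare_wp) (auto simp: S_def intro: stb_mono)
 qed
 show "hoare w (S B) f_com (level (esize guard + 2 + tries_time)) (S (B + K * L * inc))"
  unfolding f_com_def by (rule grow_for[where S = S, OF ev upd body B level])
 assume f: "f < K * L" "mu <= f" "a * DD + f <= G" "i < 2 ^ (a * DD + kap)" "hits om a mu b f i"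
 have hit: "phoare w (%v m. S B v m & v vF = f) (Cond guard tries_com Skip) (3 / 4) (%v m. v vFlag ~= 0)"
  if B: "B + inc <= BM" for B unfolding phoare_def Sm proof (intro allI impI)
  fix v m assume s: "stm om a mu b f B v m"
  hence "eval w guard v m ~= 0" using eval_guard[OF s ps(1) f(1) ps(2)] f by simp
  moreover have "phoare w (stm om a mu b f B) tries_com (3 / 4) (%v m. v vFlag ~= 0)"
   by (rule tries_correct(2)[OF ps(1,2,3) f(1,2,3) _ f(4,5)]) (use B in "simp add: inc_def")
  ultimately show "3 / 4 <= prob (outd w (Cond guard tries_com Skip) (v, m)) {x. fst x vFlag ~= 0}"
   using s by (simp add: phoare_def outd_simps)
 qed
 have "sticky (Cond guard tries_com Skip)" using sticky_loops by simp
 from grow_for_prob[where S = S, OF ev upd body B this w_pos _ f(1) hit]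
 show "phoare w (S B) f_com (3 / 4) (%v m. v vFlag ~= 0)" unfolding f_com_def by simp
qed

lemma b_correct:
 fixes om :: "nat => nat"
 assumes ps: "a < K * L" "mu < K * L" and B: "B + K * L * (K * L * inc) <= BM"
 defines "S == %B v m. stb om a B v m & v vMu = mu"
 shows "hoare w (S B) (For vB KL_exp f_com) (level (level (esize guard + 2 + tries_time))) (S (B + K * L * (K * L * inc)))"
  "b < K * L ==> f < K * L ==> mu <= f ==> a * DD + f <= G ==> i < 2 ^ (a * DD + kap) ==> hits om a mu b f i ==>
    phoare w (S B) (For vB KL_exp f_com) (3 / 4) (%v m. v vFlag ~= 0)" proof -
 have ev: "S B v m ==> eval w KL_exp v m = K * L" for B v m
  by (rule eval_KL) (simp add: S_def stb_def stw_def st_def env_def)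
 have upd: "S B v m ==> S B (v(vB := x)) m" for B v m x by (simp add: S_def)
 have body: "hoare w (%v m. S B v m & v vB = j) f_com (level (esize guard + 2 + tries_time)) (S (B + K * L * inc))"
  if j: "j < K * L" and B: "B + K * L * inc <= BM" for j B
  by (rule hoare_conseq[OF f_correct(1)[OF ps j B]]) (auto simp: S_def)
 show "hoare w (S B) (For vB KL_exp f_com) (level (level (esize guard + 2 + tries_time))) (S (B + K * L * (K * L * inc)))"
  by (rule grow_for[where S = S, OF ev upd body B level])
 assume f: "b < K * L" "f < K * L" "mu <= f" "a * DD + f <= G" "i < 2 ^ (a * DD + kap)" "hits om a mu b f i"
 have hit: "phoare w (%v m. S B v m & v vB = b) f_com (3 / 4) (%v m. v vFlag ~= 0)" if B: "B + K * L * inc <= BM" for B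
  by (rule phoare_conseq[OF f_correct(2)[OF ps f(1) B f(2-6)]]) (auto simp: S_def)
 from grow_for_prob[where S = S, OF ev upd body B sticky_loops(2) w_pos _ f(1) hit]
 show "phoare w (S B) (For vB KL_exp f_com) (3 / 4) (%v m. v vFlag ~= 0)" by simp
qed

definition mu_time where "mu_time = level (level (level (esize guard + 2 + tries_time)))"

lemma mu_correct:
 assumes ps: "a < K * L" and B: "B + K * L * (K * L * (K * L * inc)) <= BM"
 shows "hoare w (stb om a B) mu_com mu_time (stb om a (B + K * L * (K * L * (K * L * inc))))"
  "mu < K * L ==> b < K * L ==> f < K * L ==> mu <= f ==> a * DD + f <= G ==> i < 2 ^ (a * DD + kap) ==>
   hits om a mu b f i ==> phoare w (stb om a B) mu_com (3 / 4) (%v m. v vFlag ~= 0)" proof -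
 have ev: "stb om a B v m ==> eval w KL_exp v m = K * L" for B v m
  by (rule eval_KL) (simp add: stb_def stw_def st_def env_def)
 have upd: "stb om a B v m ==> stb om a B (v(vMu := x)) m" for B v m x by simp
 have body: "hoare w (%v m. stb om a B v m & v vMu = j) (For vB KL_exp f_com) (level (level (esize guard + 2 + tries_time)))
   (stb om a (B + K * L * (K * L * inc)))"
  if j: "j < K * L" and B: "B + K * L * (K * L * inc) <= BM" for j B by (rule hoare_conseq[OF b_correct(1)[OF ps j B]]) auto
 show "hoare w (stb om a B) mu_com mu_time (stb om a (B + K * L * (K * L * (K * L * inc))))"
  unfolding mu_com_def mu_time_def by (rule grow_for[where S = "stb om a", OF ev upd body B level])
 assume f: "mu < K * L" "b < K * L" "f < K * L" "mu <= f" "a * DD + f <= G" "i < 2 ^ (a * DD + kap)" "hits om a mu b f i"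
 have st: "sticky (For vB KL_exp f_com)" using sticky_loops by simp
 from grow_for_prob[where S = "stb om a", OF ev upd body B st w_pos _ f(1) b_correct(2)[OF ps f(1) _ f(2-7)]]
 show "phoare w (stb om a B) mu_com (3 / 4) (%v m. v vFlag ~= 0)" unfolding mu_com_def by simp
qed

lemma buckets_step:
 assumes a: "a < K * L" and B: "B + 1 <= BM"
 shows "hoare w (%v m. stw om B v m & v vA = a) buckets_com buckets_time (stb om a (B + 1))" proof (rule hoare_pre)
 fix v0 m0 assume s: "stw om B v0 m0 & v0 vA = a"
 hence tb: "tabs m0" and F4: "4 <= v0 vFP" "v0 vFP <= B" and en: "env v0" and fl: "v0 vFlag ~= 0 --> has_zero_clique"
  and fr: "!!y. v0 vFP * H <= y ==> m0 y = 0" and rt: "rtab om m0" and vA: "v0 vA = a" by (auto simp: stw_def st_def)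
 have "(v0 vFP + 1) * H <= (B + 2) * H" using F4 by (intro mult_right_mono) auto
 hence rm: "(v0 vFP + 1) * H < 2 ^ w" using room'[of B] B by linarith
 interpret bu: buckets k P c K q C0 kap ch cw L N E wt a "v0 vFP" om v0 m0
  by unfold_locales (use a rm F4 en vA tb rt fr in auto)
 have "4 * H <= v0 vFP * H" using F4(1) by (rule mult_right_mono) simp
 show "hoare w (%v m. v = v0 & m = m0) buckets_com buckets_time (stb om a (B + 1))"
 proof (rule hoare_conseq[OF bu.buckets_correct])
  fix v m assume p: "bu.bframe v & (ALL y. y < bu.BB \<or> bu.BB + H <= y --> m y = m0 y) &
   (ALL e<C2. ALL d<2 ^ a. barr m (bu.BB + (e * 2 ^ a + d) * (4 * (2 ^ L * 2 ^ L))) (bfl om a all_pairs e d))"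
  hence f2: "bu.bframe v" and my: "!!y. y < bu.BB ==> m y = m0 y" and my2: "!!y. bu.BB + H <= y ==> m y = m0 y"
   and bu: "buckets_at om a (v0 vFP * H) m" by (auto simp: buckets_at_def)
  have vx: "v x = v0 x" if "x ~: {vPA, vSh, vBB, vFP, vU, vV, vK, vLen}" for x using f2 that unfolding bu.bframe_def by blast
  note D = bu.bframeD[OF f2]
  have "env v" using en unfolding env_def by (simp add: vx)
  moreover have "tabs m" by (rule tabs_cong[OF tb]) (rule my, use `4 * H <= v0 vFP * H` in linarith)
  moreover have "ALL y>=v vFP * H. m y = 0" proof (intro allI impI)
   fix y assume "v vFP * H <= y"
   hence "bu.BB + H <= y" by (simp add: D)
   thus "m y = 0" using my2 fr[of y] by simp
  qed
  moreover have "v vFlag ~= 0 --> has_zero_clique" using fl by (simp add: vx)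
  ultimately have "st (B + 1) v m" using F4 D by (simp add: st_def)
  moreover have "rtab om m" by (rule rtab_cong[OF rt]) (rule my, use `4 * H <= v0 vFP * H` in linarith)
  moreover have "v vA = a" using vA by (simp add: vx)
  moreover have "v vBB = v0 vFP * H" "v0 vFP + 1 <= v vFP" "v vPA = 2 ^ a" using D by simp_all
  ultimately show "stb om a (B + 1) v m" using bu unfolding stb_def stw_def by blast
 qed auto
qed

definition findable where
 "findable om \<longleftrightarrow> (EX a mu b f i. a < K * L & mu < K * L & b < K * L & f < K * L & mu <= f & a * DD + f <= G &
   i < 2 ^ (a * DD + kap) & hits om a mu b f i)"

definition a_inc where "a_inc = K * L * (1 + K * L * (K * L * (K * L * inc)))"

lemma a_correct:
 assumes B: "B + a_inc <= BM"
 shows "hoare w (stw om B) a_com (level (buckets_time + mu_time)) (stw om (B + a_inc))"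
  "findable om ==> phoare w (stw om B) a_com (3 / 4) (%v m. v vFlag ~= 0)" proof -
 let ?D = "1 + K * L * (K * L * (K * L * inc))"
 have ev: "stw om B v m ==> eval w KL_exp v m = K * L" for B v m by (rule eval_KL) (simp add: stw_def st_def env_def)
 have upd: "stw om B v m ==> stw om B (v(vA := x)) m" for B v m x by simp
 have BK: "B + K * L * ?D <= BM" using B by (simp add: a_inc_def)
 have bs: "hoare w (%v m. stw om B v m & v vA = j) buckets_com buckets_time (stb om j (B + 1))"
  and B1: "(B + 1) + K * L * (K * L * (K * L * inc)) <= BM"
  if j: "j < K * L" and B: "B + ?D <= BM" for j B by (rule buckets_step[OF j]) (use B in linarith)+
 have body: "hoare w (%v m. stw om B v m & v vA = j) (buckets_com ;; mu_com) (buckets_time + mu_time) (stw om (B + ?D))"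
  if j: "j < K * L" and B: "B + ?D <= BM" for j B
  by (rule hoare_conseq[OF hoare_seq[OF bs[OF j B] mu_correct(1)[OF j B1[OF j B]] order_refl]])
    (auto simp: stb_def add.assoc)
 show "hoare w (stw om B) a_com (level (buckets_time + mu_time)) (stw om (B + a_inc))"
  unfolding a_com_def a_inc_def by (rule grow_for[where S = "stw om", OF ev upd body BK level])
 assume "findable om"
 then obtain a mu b f i where f: "a < K * L" "mu < K * L" "b < K * L" "f < K * L" "mu <= f" "a * DD + f <= G"
  "i < 2 ^ (a * DD + kap)" "hits om a mu b f i" unfolding findable_def by blast
 have hit: "phoare w (%v m. stw om B v m & v vA = a) (buckets_com ;; mu_com) (3 / 4) (%v m. v vFlag ~= 0)"
  if B: "B + ?D <= BM" for B by (rule phoare_seq_hoare[OF bs[OF f(1) B] mu_correct(2)[OF f(1) B1[OF f(1) B] f(2-8)]])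
 have "sticky (buckets_com ;; mu_com)" using sticky_buckets sticky_loops by simp
 from grow_for_prob[where S = "stw om", OF ev upd body BK this w_pos _ f(1) hit]
 show "phoare w (stw om B) a_com (3 / 4) (%v m. v vFlag ~= 0)" unfolding a_com_def by simp
qed

end

section \<open>Setup, repetition and the complete program\<close>

context prog
begin

text \<open>Doubling while the power is below \<open>N\<close> makes \<open>vL\<close> the least
  exponent with \<open>N <= 2 ^ L\<close>. \<open>N\<close> rounds are more than enough and still
  cheap.\<close>

definition size_com where "size_com = (Asg vN (Mem (Lit 0)) ;; Asg vEc (Mem (Lit 1)) ;; Asg vL (Lit 0) ;; Asg vPL (Lit 1)) ;;
   For vJ (Var vN) (Cond (Bin Less (Var vPL) (Var vN)) (Asg vPL (Var vPL [+] Var vPL) ;; Asg vL (Var vL [+] Lit 1)) Skip)"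

definition const_com where
 "const_com = Asg vH (Lit 1 [<<] (Lit ch [*] Var vL)) ;; Asg vR3 (Lit 3 [*] Var vH) ;; Asg vFP (Lit 4) ;;
   Asg vFlag (Lit 0) ;; Asg vG (Bin Div (Lit (k * q - 1) [*] Var vL) (Lit q) [+] Lit C0)"

text \<open>Each edge is entered in both orientations, so a later lookup need not order its
  endpoints.\<close>

definition edge_com where
 "edge_com = (Asg vK (Lit 2 [+] Lit 4 [*] Var vI) ;; Asg vU (Mem (Var vK)) ;; Asg vV (Mem (Var vK [+] Lit 1)) ;;
    Asg vS (Mem (Var vK [+] Lit 2)) ;; Asg vZ (Mem (Var vK [+] Lit 3))) ;;
   Cond (Var vS) (Asg vZ (Lit 0 [-] Var vZ)) Skip ;;
   Sto (adj_exp (Var vU) (Var vV)) (Lit 1) ;; Sto (adj_exp (Var vV) (Var vU)) (Lit 1) ;;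
   Sto (wt_exp (Var vU) (Var vV)) (Var vZ) ;; Sto (wt_exp (Var vV) (Var vU)) (Var vZ)"

definition setup_com where "setup_com = size_com ;; const_com ;; For vI (Var vEc) edge_com"

definition main_com where "main_com = setup_com ;; rep_com ;; Cond (Var vFlag) (Asg vFlag (Lit 1)) Skip"

end

context main
begin

definition hlen where "hlen = 1 + k * k * 2 ^ L"

lemma hlen_eq: "hash.len k (2 ^ L) = hlen" using hash.len_def[of w k 0 "2 ^ L"] k by (simp add: hash_def hlen_def)

lemma hlen_le: "hlen <= H" using rtab_len hlen_eq by simp

definition tabof :: "(nat => nat) => nat => nat" where
 "tabof m i = (if i < hlen then m (3 * H + i) else 0)"

lemma st_vars [simp]: "st B (v(vJ := x)) m = st B v m" "st B (v(vZ := x)) m = st B v m" by (simp_all add: st_def env_def)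

lemma st_mem:
 assumes "st B v m" "!!y. y < 3 * H \<or> 4 * H <= y ==> m' y = m y"
 shows "st B v m'" proof -
 have "tabs m'" by (rule tabs_cong[of m]) (use assms in "auto simp: st_def")
 moreover have "m' y = 0" if "v vFP * H <= y" for y proof -
  have "4 * H <= v vFP * H" using assms(1) by (intro mult_right_mono) (auto simp: st_def)
  hence "m' y = m y" using that by (intro assms(2)) linarith
  thus ?thesis using assms(1) that by (simp add: st_def)
 qed
 ultimately show ?thesis using assms(1) by (auto simp: st_def)
qed

lemma six_H: "y <= 6 * H ==> y < 2 ^ w" using room'[of 4] by simp

definition draw_time where "draw_time = 7 + hlen * 10"

lemma eval_hlen: "v vPL = 2 ^ L ==> eval w (Lit (k * k) [*] Var vPL [+] Lit 1) v m = hlen" proof -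
 have "hlen < 2 ^ w" by (rule six_H) (use hlen_le in linarith)
 thus "v vPL = 2 ^ L ==> eval w (Lit (k * k) [*] Var vPL [+] Lit 1) v m = hlen" using w_pos by (simp add: hlen_def mod_simps)
qed

lemma draw_words:
 "hoare w (st B) draw_com draw_time (%v m. st B v m & (ALL i<hlen. m (3 * H + i) < 2 ^ w))" unfolding draw_com_def fill_def
proof (rule hoare_for[where n = hlen and I = "%j v m. st B v m & (ALL i<hlen. j <= i --> m (3 * H + i) < 2 ^ w)"
   and B = "%j v m. st B v m & v vJ = j & (ALL i<hlen. Suc j <= i --> m (3 * H + i) < 2 ^ w)"
   and t = "maxtime (Rnd vZ ;; Sto (Bin Plus (Var vR3) (Var vJ)) (Var vZ))"])
 fix v m assume s: "st B v m"
 hence "v vPL = 2 ^ L" by (simp add: st_def env_def)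
 from eval_hlen[of v, OF this] show "eval w (Lit (k * k) [*] Var vPL [+] Lit 1) v m = hlen & st B (v(vJ := hlen)) m &
   (ALL i<hlen. hlen <= i --> m (3 * H + i) < 2 ^ w)" using s by simp
next
 fix j assume j: "j < hlen"
 show "hoare w (%v m. st B v m & v vJ = j & (ALL i<hlen. Suc j <= i --> m (3 * H + i) < 2 ^ w))
   (Rnd vZ ;; Sto (Bin Plus (Var vR3) (Var vJ)) (Var vZ))
   (maxtime (Rnd vZ ;; Sto (Bin Plus (Var vR3) (Var vJ)) (Var vZ)))
   (%v m. st B v m & (ALL i<hlen. j <= i --> m (3 * H + i) < 2 ^ w))" proof (rule hoare_wp)
  fix v m assume s: "st B v m & v vJ = j & (ALL i<hlen. Suc j <= i --> m (3 * H + i) < 2 ^ w)"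
  have "3 * H + j < 2 ^ w" by (rule six_H) (use j hlen_le in linarith)
  moreover have "v vR3 = 3 * H" using s by (simp add: st_def env_def)
  ultimately have ev: "eval w (Bin Plus (Var vR3) (Var vJ)) (v(vZ := x)) m' = 3 * H + j" for x m' using s by simp
  have "st B (v(vZ := x)) (m(3 * H + j := x))" for x by (rule st_mem[of _ _ m]) (use s j hlen_le in auto)
  moreover have "(m(3 * H + j := x)) (3 * H + i) < 2 ^ w" if "x < 2 ^ w" "j <= i" "i < hlen" for x i using that s by auto
  ultimately show "wp w (Rnd vZ ;; Sto (Bin Plus (Var vR3) (Var vJ)) (Var vZ))
    (%v m. st B v m & (ALL i<hlen. j <= i --> m (3 * H + i) < 2 ^ w)) v m"
   unfolding wp.simps ev by (simp only: eval.simps fun_upd_same) blast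
 qed simp
qed (auto simp: draw_time_def)

lemma draw_stw:
 assumes "st B v m" "ALL i<hlen. m (3 * H + i) < 2 ^ w"
 shows "stw (tabof m) B v m" using assms by (auto simp: stw_def rtab_def hlen_eq tabof_def)

lemma draw_correct: "hoare w (st B) draw_com draw_time (%v m. EX om. stw om B v m)"
 by (rule hoare_conseq[OF draw_words]) (auto dest: draw_stw)

lemma draw_finds:
 assumes A: "A <= PiE_dflt {..<hlen} 0 (%_. {..<2 ^ w})" "3 * (2 ^ w) ^ hlen <= 4 * card A"
  and f: "!!om. om : A ==> findable om"
 shows "phoare w (st B) draw_com (3 / 4) (%v m. EX om. findable om & stw om B v m)" proof -
 have "phoare w (st B) draw_com (3 / 4) (%v m. tabof m : A)" unfolding phoare_def proof (intro allI impI)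
  fix v m assume s: "st B v m"
  hence v: "v vPL = 2 ^ L" "v vR3 = 3 * H" by (simp_all add: st_def env_def)
  have r: "v vR3 + hlen <= 2 ^ w" unfolding v by (rule less_imp_le[OF six_H]) (use hlen_le in linarith)
  have "real (3 * (2 ^ w) ^ hlen) <= real (4 * card A)" using A(2) by (rule of_nat_mono)
  hence "3 / 4 * real ((2 ^ w) ^ hlen) <= real (card A)" by simp
  from fill_prob[of vR3 vJ vZ w "Lit (k * k) [*] Var vPL [+] Lit 1" v m hlen A "3 / 4", OF _ _ _ eval_hlen[of v, OF v(1)] r A(1) this]
  show "3 / 4 <= prob (outd w draw_com (v, m)) {x. tabof (snd x) : A}" unfolding draw_com_def v tabof_def[abs_def] by simp
 qed
 from phoare_hoare[OF this draw_words] show ?thesis by (rule phoare_conseq) (auto dest: draw_stw f)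
qed

definition a_time where "a_time = level (buckets_time + mu_time)"

definition rep_time where "rep_time = 3 + L * (draw_time + a_time + 4)"

lemma BM_eq: "BM = 4 + L * a_inc" by (simp add: a_inc_def inc_def)

lemma rep_body:
 assumes "B + a_inc <= BM"
 shows "hoare w (st B) (draw_com ;; a_com) (draw_time + a_time) (st (B + a_inc))" proof -
 have "hoare w (%v m. EX om. stw om B v m) a_com a_time (%v m. EX om. stw om (B + a_inc) v m)"
  unfolding a_time_def by (rule hoare_all) (rule a_correct(1)[OF assms])
 from hoare_seq[OF draw_correct this order_refl] show ?thesis by (rule hoare_conseq) (auto simp: stw_def)
qed

lemma rep_correct: "hoare w (st 4) rep_com rep_time (st BM)" unfolding rep_com_def BM_eq proof (rule grow_for[where S = st])
 show "st B v m ==> eval w (Var vL) v m = L" for B v m by (simp add: st_def env_def)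
 show "st B v m ==> st B (v(vRep := x)) m" for B v m x by simp
 show "hoare w (%v m. st B v m & v vRep = j) (draw_com ;; a_com) (draw_time + a_time) (st (B + a_inc))"
  if "B + a_inc <= BM" for j B by (rule hoare_conseq[OF rep_body[OF that]]) auto
 show "4 + L * a_inc <= BM" unfolding BM_eq ..
qed (simp add: rep_time_def)

lemma rep_finds:
 assumes A: "A <= PiE_dflt {..<hlen} 0 (%_. {..<2 ^ w})" "3 * (2 ^ w) ^ hlen <= 4 * card A"
  and f: "!!om. om : A ==> findable om"
 shows "phoare w (st 4) rep_com (1 - 1 / 2 ^ L) (%v m. v vFlag ~= 0)" unfolding rep_com_def
proof (rule phoare_for_repeat[where n = L and I = "%j. st (4 + (L - j) * a_inc)" and B = "%j v m. st (4 + (L - Suc j) * a_inc) v m & v vRep = j"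
   and G = "%v m. v vFlag ~= 0" and t = "draw_time + a_time"])
 have le: "4 + (L - Suc j) * a_inc + a_inc <= BM" if "j < L" for j proof -
  have "Suc (L - Suc j) * a_inc <= L * a_inc" using that by (intro mult_right_mono) auto
  thus ?thesis unfolding BM_eq by simp
 qed
 have body: "hoare w (%v m. st (4 + (L - Suc j) * a_inc) v m & v vRep = j) (draw_com ;; a_com) (draw_time + a_time)
   (st (4 + (L - j) * a_inc))" if j: "j < L" for j proof -
  have eq: "L - j = Suc (L - Suc j)" using j by simp
  have eq4: "4 + Suc (L - Suc j) * a_inc = 4 + (L - Suc j) * a_inc + a_inc" by simp
  show ?thesis unfolding eq eq4 by (rule hoare_conseq[OF rep_body[OF le[OF j]]]) auto
 qed
 show "hoare w (%v m. st (4 + (L - Suc j) * a_inc) v m & v vRep = j) (draw_com ;; a_com) (draw_time + a_time)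
   (st (4 + (L - j) * a_inc))" if j: "j < L" for j by (rule body[OF j])
 have "sticky (draw_com ;; a_com)" using sticky_loops by simp
 from hoare_sticky[OF body this w_pos]
 show "hoare w (%v m. (st (4 + (L - Suc j) * a_inc) v m & v vRep = j) & v vFlag ~= 0) (draw_com ;; a_com) (draw_time + a_time)
   (%v m. st (4 + (L - j) * a_inc) v m & v vFlag ~= 0)" if "j < L" for j using that .
 show "phoare w (%v m. st (4 + (L - Suc j) * a_inc) v m & v vRep = j) (draw_com ;; a_com) (1 / 2) (%v m. v vFlag ~= 0)"
  if j: "j < L" for j proof -
  let ?B = "4 + (L - Suc j) * a_inc"
  have "phoare w (%v m. EX om. findable om & stw om ?B v m) a_com (3 / 4) (%v m. v vFlag ~= 0)"
   using a_correct(2)[OF le[OF j]] unfolding phoare_def by blast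
  \<comment> \<open>The table is good with probability 3/4 and the simulated run succeeds with
    probability 3/4; 9/16 exceeds 1/2.\<close>
  from phoare_seq[OF draw_finds[OF A f] this, where r = "1 / 2"] show ?thesis by (rule phoare_conseq) auto
 qed
qed (auto simp: st_def env_def)

end

locale whole = main k P c K q C0 kap ch cw L N E wt
 for k :: nat and P :: program and c K q C0 kap ch cw L N :: nat and E :: "nat set set" and wt :: "nat set => int" +
 fixes es :: "(nat \<times> nat) list"
 assumes N2: "2 <= N" and LN: "2 ^ (L - 1) < N" and es: "edge_list E es"
  and q: "1 <= q" and cw2: "2 * (k * q + C0) <= 2 ^ cw"
begin

definition m0 where "m0 = (%a. if a < length (weighted_input N es wt) then weighted_input N es wt ! a else 0)"

lemma winp:
 "length (weighted_input N es wt) = 2 + 4 * length es" "weighted_input N es wt ! 0 = N" "weighted_input N es wt ! 1 = length es"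
 "j < length es ==> d < 4 ==> weighted_input N es wt ! (2 + 4 * j + d) =
   [fst (es ! j), snd (es ! j), if wt {fst (es ! j), snd (es ! j)} < 0 then 1 else 0, nat \<bar>wt {fst (es ! j), snd (es ! j)}\<bar>] ! d"
proof -
 let ?g = "%(u, v). [u, v, if wt {u, v} < 0 then 1 else 0, nat \<bar>wt {u, v}\<bar>]"
 have len: "length (concat (map ?g xs)) = 4 * length xs" for xs by (induction xs) auto
 thus "length (weighted_input N es wt) = 2 + 4 * length es" by (simp add: weighted_input_def)
 show "weighted_input N es wt ! 0 = N" "weighted_input N es wt ! 1 = length es" by (simp_all add: weighted_input_def)
 have nth: "concat (map ?g xs) ! (4 * j + d) = ?g (xs ! j) ! d" if "j < length xs" "d < 4" for xs j d
  using that proof (induction xs arbitrary: j)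
  case (Cons x xs)
  have lx: "length (?g x) = 4" by (simp add: case_prod_unfold)
  show ?case proof (cases j)
   case 0
   thus ?thesis using Cons.prems lx by (simp add: nth_append)
  next
   case (Suc j')
   have "(?g x @ concat (map ?g xs)) ! (4 * j + d) = concat (map ?g xs) ! (4 * j' + d)" unfolding nth_append lx Suc by simp
   thus ?thesis using Cons.IH[of j'] Cons.prems Suc by simp
  qed
 qed simp
 assume "j < length es" "d < 4"
 from nth[OF this] show "weighted_input N es wt ! (2 + 4 * j + d) =
   [fst (es ! j), snd (es ! j), if wt {fst (es ! j), snd (es ! j)} < 0 then 1 else 0, nat \<bar>wt {fst (es ! j), snd (es ! j)}\<bar>] ! d"
  by (simp add: weighted_input_def case_prod_unfold)
qed

lemma es_edge:
 assumes "j < length es"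
 shows "{fst (es ! j), snd (es ! j)} : E" "fst (es ! j) < 2 ^ L" "snd (es ! j) < 2 ^ L" proof -
 have "(%(u, v). {u, v}) (es ! j) : set (map (%(u, v). {u, v}) es)" using assms by auto
 thus "{fst (es ! j), snd (es ! j)} : E" using es by (simp add: edge_list_def case_prod_unfold)
 hence "{fst (es ! j), snd (es ! j)} <= {..<N}" using E by (auto simp: simple_graph_def)
 thus "fst (es ! j) < 2 ^ L" "snd (es ! j) < 2 ^ L" using NL by auto
qed

lemma length_es: "length es <= 2 ^ L * 2 ^ L" proof -
 have "distinct es" using es by (simp add: edge_list_def distinct_map)
 hence "length es = card (set es)" by (simp add: distinct_card)
 also have "... <= card ({..<2 ^ L :: nat} \<times> {..<2 ^ L :: nat})"
  by (rule card_mono) (use es_edge in "force simp: in_set_conv_nth")+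
 finally show ?thesis by simp
qed

lemma winp_le: "2 + 4 * length es <= H" proof (rule le_H)
 have "(1 :: nat) <= 2 ^ L * 2 ^ L" by simp
 hence "2 + 4 * length es <= 8 * (2 ^ L * 2 ^ L)" using length_es by linarith
 also have "... = 2 ^ (3 + (L + L))" unfolding power_add by simp
 finally show "2 + 4 * length es <= 2 ^ (3 + (L + L))" .
 have "10 * L <= ch * L" using chL by linarith
 moreover have "3 + (L + L) <= 10 * L" using L by presburger
 ultimately show "3 + (L + L) <= ch * L" by (rule order_trans[rotated])
qed

lemma m0_high: "H <= y ==> m0 y = 0" using winp_le winp(1) by (simp add: m0_def)

lemma m0_low:
 "m0 0 = N" "m0 1 = length es"
 "j < length es ==> d < 4 ==> m0 (2 + 4 * j + d) =
   [fst (es ! j), snd (es ! j), if wt {fst (es ! j), snd (es ! j)} < 0 then 1 else 0, nat \<bar>wt {fst (es ! j), snd (es ! j)}\<bar>] ! d"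
proof -
 show "m0 0 = N" by (simp add: m0_def winp(1,2))
 show "m0 1 = length es" using winp(3) by (simp add: m0_def winp(1))
 assume jd: "j < length es" "d < 4"
 hence "2 + 4 * j + d < length (weighted_input N es wt)" unfolding winp(1) by linarith
 thus "m0 (2 + 4 * j + d) = [fst (es ! j), snd (es ! j), if wt {fst (es ! j), snd (es ! j)} < 0 then 1 else 0,
   nat \<bar>wt {fst (es ! j), snd (es ! j)}\<bar>] ! d" unfolding m0_def winp(4)[OF jd] by (rule if_P)
qed

definition size_time where
 "size_time = 10 + (3 + N * (maxtime (Cond (Bin Less (Var vPL) (Var vN)) (Asg vPL (Var vPL [+] Var vPL) ;; Asg vL (Var vL [+] Lit 1)) Skip) + 4))"

definition sized where "sized l v m \<longleftrightarrow> v vN = N & v vEc = length es & v vL = l & v vPL = 2 ^ l & m = m0"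

lemma pow_L_less: "(2 :: nat) ^ L < 2 ^ w" proof -
 have "2 ^ L <= H" by (rule le_H[of L]) (use chL in linarith, simp)
 thus ?thesis by (intro six_H) linarith
qed

lemma size_correct: "hoare w (%v m. m = m0) size_com size_time (sized L)" unfolding size_com_def
proof (rule hoare_seq[where R = "sized 0"])
 show "hoare w (%v m. m = m0) (Asg vN (Mem (Lit 0)) ;; Asg vEc (Mem (Lit 1)) ;; Asg vL (Lit 0) ;; Asg vPL (Lit 1)) 10 (sized 0)"
  by (rule hoare_wp) (use w_pos m0_low in "simp_all add: sized_def")
 let ?b = "Cond (Bin Less (Var vPL) (Var vN)) (Asg vPL (Var vPL [+] Var vPL) ;; Asg vL (Var vL [+] Lit 1)) Skip"
 show "hoare w (sized 0) (For vJ (Var vN) ?b) (3 + N * (maxtime ?b + 4)) (sized L)"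
 proof (rule hoare_for[where n = N and I = "%j. sized (min (N - j) L)" and B = "%j. sized (min (N - Suc j) L)"])
  fix j assume j: "j < N"
  define l where "l = min (N - Suc j) L"
  have l': "min (N - j) L = (if l < L then Suc l else l)" using j by (auto simp: l_def min_def)
  have lN: "2 ^ l < N \<longleftrightarrow> l < L" proof
   assume "l < L"
   hence "(2 :: nat) ^ l <= 2 ^ (L - 1)" by (intro power_increasing) auto
   thus "2 ^ l < N" using LN by linarith
  next
   assume a: "2 ^ l < N"
   show "l < L" proof (rule ccontr)
    assume "~ l < L"
    hence "l = L" by (simp add: l_def)
    thus False using a NL by simp
   qed
  qed
  have p: "(2 :: nat) ^ l + 2 ^ l < 2 ^ w" "Suc l < 2 ^ w" if "l < L" proof -
   have "(2 :: nat) ^ Suc l <= 2 ^ L" using that by (intro power_increasing) auto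
   moreover have "Suc l < 2 ^ Suc l" by (rule less_exp)
   ultimately show "(2 :: nat) ^ l + 2 ^ l < 2 ^ w" "Suc l < 2 ^ w" using pow_L_less unfolding power_Suc mult_2 by linarith+
  qed
  show "hoare w (sized l) ?b (maxtime ?b) (sized (min (N - j) L))" unfolding l'
   by (rule hoare_wp) (use p lN w_pos in "auto simp: sized_def mult_2")
 next
  have "L - 1 < 2 ^ (L - 1)" by (rule less_exp)
  hence "min (N - 0) L = L" using LN by linarith
  thus "sized (min (N - 0) L) v m ==> sized L v m" for v m by (simp only:)
 qed (auto simp: sized_def)
qed (simp add: size_time_def)

definition tabE where
 "tabE F m \<longleftrightarrow> (ALL x<2 ^ L. ALL y<2 ^ L. m (H + (x * 2 ^ L + y)) = (if {x, y} : F then 1 else 0) &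
   ({x, y} : F --> m (2 * H + (x * 2 ^ L + y)) = word w (wt {x, y})))"

definition einv where "einv F v m \<longleftrightarrow> env v & v vFP = 4 & v vFlag = 0 & v vEc = length es & tabE F m &
   (ALL y<H. m y = m0 y) & (ALL y>=3 * H. m y = 0)"

text \<open>The constants of the program must fit into words already for the smallest
  \<open>L\<close>: with X = k q + C0, one has X L < X^L 2^L = (2 X)^L, and \<open>cw2\<close>
  bounds 2 X by \<open>2 ^ cw\<close>.\<close>

lemma small_const: "y <= (k * q + C0) * L ==> y < 2 ^ w" proof -
 let ?X = "k * q + C0"
 assume "y <= ?X * L"
 have X: "1 <= ?X" using q k by (cases "k * q") auto
 have "?X * L < ?X * 2 ^ L" using X less_exp[of L] by (intro mult_strict_left_mono) auto
 also have "... <= ?X ^ L * 2 ^ L" using X L by (intro mult_right_mono self_le_power) auto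
 also have "... = (2 * ?X) ^ L" unfolding power_mult_distrib by (rule mult.commute)
 also have "... <= (2 ^ cw) ^ L" using cw2 by (rule power_mono) simp
 also have "... = 2 ^ w" by (simp add: w_def power_mult)
 finally show "y < 2 ^ w" using `y <= ?X * L` by linarith
qed

lemma const_correct: "hoare w (sized L) const_com (maxtime const_com) (einv {})" proof (rule hoare_wp)
 fix v m assume s: "sized L v m"
 let ?X = "k * q + C0"
 have XL: "?X <= ?X * L" using L by simp
 have kq: "k * q - 1 < 2 ^ w" "C0 < 2 ^ w" "q < 2 ^ w" proof -
  have "q <= k * q" using k by simp
  hence "q <= ?X" by linarith
  show "k * q - 1 < 2 ^ w" "C0 < 2 ^ w" "q < 2 ^ w" using `q <= ?X` by - (rule small_const, use XL in linarith)+
 qed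
 have kqL: "(k * q - 1) * L < 2 ^ w" by (rule small_const) (rule mult_right_mono, simp_all)
 have "((k * q - 1) * L) div q <= (k * q - 1) * L" by simp
 moreover have "(k * q - 1) * L + C0 <= (k * q - 1) * L + C0 * L" using L by simp
 moreover have "(k * q - 1) * L + C0 * L <= ?X * L" unfolding distrib_right[symmetric] by (rule mult_right_mono) simp_all
 ultimately have G: "((k * q - 1) * L) div q + C0 < 2 ^ w" by (intro small_const) linarith
 have "((k * q - 1) * L) div q < 2 ^ w" using G by linarith
 note G = G this
 have "ch * L < 2 ^ (ch * L)" by (rule less_exp)
 hence chl: "ch * L < 2 ^ w" "ch < 2 ^ w" "(2 :: nat) ^ (ch * L) < 2 ^ w" proof -
  have "2 ^ (ch * L) = H" by (simp add: H_def)
  thus 1: "ch * L < 2 ^ w" "(2 :: nat) ^ (ch * L) < 2 ^ w" using `ch * L < 2 ^ (ch * L)` by (auto intro!: six_H)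
  have "ch * 1 <= ch * L" using L by (rule mult_left_mono) simp
  from le_less_trans[OF this 1(1)] show "ch < 2 ^ w" by (simp only: mult_1_right)
 qed
 have H3: "3 * H < 2 ^ w" "3 < (2 :: nat) ^ w" "4 < (2 :: nat) ^ w" using H_pos by (auto intro!: six_H)
 have "tabE {} m0" by (simp add: tabE_def m0_high)
 thus "wp w const_com (einv {}) v m" using s kq kqL G chl H3 w_pos
  by (simp add: const_com_def sized_def einv_def env_def H_def push_bit_eq_mult m0_high mod_simps)
qed simp

definition stores_com where
 "stores_com = Sto (adj_exp (Var vU) (Var vV)) (Lit 1) ;; Sto (adj_exp (Var vV) (Var vU)) (Lit 1) ;;
   Sto (wt_exp (Var vU) (Var vV)) (Var vZ) ;; Sto (wt_exp (Var vV) (Var vU)) (Var vZ)"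

lemma wp_stores:
 assumes i: "einv F v m" and u: "v vU = u" "v vV = u'" "u < 2 ^ L" "u' < 2 ^ L" and z: "v vZ = word w (wt {u, u'})"
 shows "wp w stores_com (einv (insert {u, u'} F)) v m" proof -
 let ?g = "%x y. x * 2 ^ L + y :: nat"
 have v: "v vPL = 2 ^ L" "v vH = H" using i by (simp_all add: einv_def env_def)
 have g: "?g x y < H" if "x < 2 ^ L" "y < 2 ^ L" for x y by (rule vertex_index_le_H[OF that])
 have lt: "2 * H + ?g u u' < 2 ^ w" "2 * H + ?g u' u < 2 ^ w" "H + ?g u u' < 2 ^ w" "H + ?g u' u < 2 ^ w"
  using g[OF u(3,4)] g[OF u(4,3)] by (auto intro!: six_H)
 have ev: "eval w (adj_exp (Var vU) (Var vV)) v m' = H + ?g u u'" "eval w (adj_exp (Var vV) (Var vU)) v m' = H + ?g u' u"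
  "eval w (wt_exp (Var vU) (Var vV)) v m' = 2 * H + ?g u u'" "eval w (wt_exp (Var vV) (Var vU)) v m' = 2 * H + ?g u' u"
  "eval w (Lit 1) v m' = 1" "eval w (Var vZ) v m' = word w (wt {u, u'})" for m'
  using lt u v z w_pos by (simp_all add: adj_exp_def wt_exp_def mod_simps)
 let ?m = "m(H + ?g u u' := 1, H + ?g u' u := 1, 2 * H + ?g u u' := word w (wt {u, u'}), 2 * H + ?g u' u := word w (wt {u, u'}))"
 have out: "?m y = m y" if "y < H \<or> 3 * H <= y" for y using that g[OF u(3,4)] g[OF u(4,3)] by auto
 have inj: "?g x y = ?g a b \<longleftrightarrow> x = a & y = b" if "y < 2 ^ L" "b < 2 ^ L" for x y a b proof
  assume "?g x y = ?g a b"
  hence "?g x y div 2 ^ L = ?g a b div 2 ^ L" "?g x y mod 2 ^ L = ?g a b mod 2 ^ L" by simp_all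
  thus "x = a & y = b" using that by simp
 qed simp
 have "tabE (insert {u, u'} F) ?m" unfolding tabE_def proof (intro allI impI)
  fix x y assume xy: "x < (2 :: nat) ^ L" "y < (2 :: nat) ^ L"
  note gl = g[OF xy] g[OF u(3,4)] g[OF u(4,3)]
  have ne: "H + ?g x y ~= 2 * H + ?g u u'" "H + ?g x y ~= 2 * H + ?g u' u"
   "2 * H + ?g x y ~= H + ?g u u'" "2 * H + ?g x y ~= H + ?g u' u" using gl by linarith+
  have iff: "?g x y = ?g u u' \<or> ?g x y = ?g u' u \<longleftrightarrow> {x, y} = {u, u'}"
   using inj[OF xy(2) u(4)] inj[OF xy(2) u(3)] by (auto simp: doubleton_eq_iff)
  have mz: "?m z = (if z = 2 * H + ?g u u' \<or> z = 2 * H + ?g u' u then word w (wt {u, u'})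
    else if z = H + ?g u u' \<or> z = H + ?g u' u then 1 else m z)" for z by (simp only: fun_upd_apply) auto
  have 1: "?m (H + ?g x y) = (if {x, y} = {u, u'} then 1 else m (H + ?g x y))"
   by (simp only: mz add_left_cancel iff ne if_False simp_thms)
  have 2: "?m (2 * H + ?g x y) = (if {x, y} = {u, u'} then word w (wt {u, u'}) else m (2 * H + ?g x y))"
   by (simp only: mz add_left_cancel iff ne if_False simp_thms)
  have t: "m (H + ?g x y) = (if {x, y} : F then 1 else 0)" "{x, y} : F --> m (2 * H + ?g x y) = word w (wt {x, y})"
   using i xy by (simp_all add: einv_def tabE_def)
  show "?m (H + ?g x y) = (if {x, y} : insert {u, u'} F then 1 else 0) &
    ({x, y} : insert {u, u'} F --> ?m (2 * H + ?g x y) = word w (wt {x, y}))" proof (cases "{x, y} = {u, u'}")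
   case True
   thus ?thesis unfolding 1 2 if_P[OF True] by simp
  next
   case False
   thus ?thesis unfolding 1 2 if_not_P[OF False] using t by simp
  qed
 qed
 moreover have "einv (insert {u, u'} F) v m1" if "tabE (insert {u, u'} F) m1" "!!y. y < H \<or> 3 * H <= y ==> m1 y = m y" for m1
  using i that by (auto simp: einv_def)
 ultimately have "einv (insert {u, u'} F) v ?m" using out by blast
 thus ?thesis unfolding stores_com_def wp.simps ev .
qed

lemma edge_correct:
 assumes j: "j < length es"
 shows "hoare w (%v m. einv F v m & v vI = j) edge_com (maxtime edge_com) (einv (insert {fst (es ! j), snd (es ! j)} F))"
proof (rule hoare_wp)
 fix v m assume i: "einv F v m & v vI = j"
 let ?u = "fst (es ! j)" and ?v = "snd (es ! j)"
 have lt: "2 + 4 * j + d < H" if "d < 4" for d using winp_le j that by linarith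
 have lw: "2 + 4 * j + d < 2 ^ w" if "d < 4" for d using lt[OF that] by (intro six_H) linarith
 have m: "m (2 + 4 * j + d) = [?u, ?v, if wt {?u, ?v} < 0 then 1 else 0, nat \<bar>wt {?u, ?v}\<bar>] ! d" if "d < 4" for d
  using i lt[OF that] m0_low(3)[OF j that] by (simp add: einv_def)
 have m': "m (2 + 4 * j) = ?u" "m (2 + 4 * j + 1) = ?v" "m (2 + 4 * j + 2) = (if wt {?u, ?v} < 0 then 1 else 0)"
  "m (2 + 4 * j + 3) = nat \<bar>wt {?u, ?v}\<bar>" using m[of 0] m[of 1] m[of 2] m[of 3] by simp_all
 note edge = es_edge[OF j]
 have w4: "2 < (2 :: nat) ^ w" "3 < (2 :: nat) ^ w" "4 < (2 :: nat) ^ w" using H_pos by (auto intro!: six_H)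
 define v1 where "v1 = v(vK := 2 + 4 * j, vU := ?u, vV := ?v, vS := if wt {?u, ?v} < 0 then 1 else 0, vZ := nat \<bar>wt {?u, ?v}\<bar>)"
 have ev: "eval w (Lit 2 [+] Lit 4 [*] Var vI) v m = 2 + 4 * j" using i lw[of 0] w4 by (simp add: mod_simps)
 have e2: "v' vK = 2 + 4 * j ==> eval w (Mem (Var vK)) v' m = ?u"
  "v' vK = 2 + 4 * j ==> eval w (Mem (Var vK [+] Lit 1)) v' m = ?v"
  "v' vK = 2 + 4 * j ==> eval w (Mem (Var vK [+] Lit 2)) v' m = (if wt {?u, ?v} < 0 then 1 else 0)"
  "v' vK = 2 + 4 * j ==> eval w (Mem (Var vK [+] Lit 3)) v' m = nat \<bar>wt {?u, ?v}\<bar>" for v'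
  using lw[of 1] lw[of 2] lw[of 3] w4 w_pos m' by (simp_all add: mod_simps add.commute)
 have "\<bar>wt {?u, ?v}\<bar> <= 2 ^ (100 * k * L)" by (rule wt[OF edge(1)])
 also have "(2 :: int) ^ (100 * k * L) < 2 ^ w" proof (rule power_strict_increasing)
  have "100 * k * L < cw * L" using cw(3) K L by simp
  thus "100 * k * L < w" by (simp add: w_def)
 qed simp
 finally have ab: "\<bar>wt {?u, ?v}\<bar> < 2 ^ w" .
 define z where "z = word w (wt {?u, ?v})"
 have pos: "nat \<bar>wt {?u, ?v}\<bar> = z" if "~ wt {?u, ?v} < 0" using that ab by (simp add: z_def word_def)
 have neg: "eval w (Lit 0 [-] Var vZ) v1 m = z" if "wt {?u, ?v} < 0" proof -
  have "word w (- wt {?u, ?v}) = nat \<bar>wt {?u, ?v}\<bar>" using that ab by (simp add: word_def)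
  moreover have "0 mod 2 ^ w = word w 0" by (simp add: word_def)
  ultimately have "eval w (Lit 0 [-] Var vZ) v1 m = eval_binop w Minus (word w 0) (word w (- wt {?u, ?v}))"
   by (simp add: v1_def)
  thus ?thesis unfolding word_minus z_def by simp
 qed
 have e1: "einv F v1 m" "einv F (v1(vZ := z)) m" using i by (simp_all add: einv_def env_def v1_def)
 have st: "wp w stores_com (einv (insert {?u, ?v} F)) (v1(vZ := z)) m"
  by (rule wp_stores[OF e1(2)]) (use edge in "simp_all add: v1_def z_def")
 have v1z: "v1(vZ := z) = v1" if "~ wt {?u, ?v} < 0" unfolding v1_def pos[OF that] by simp
 have "wp w (Cond (Var vS) (Asg vZ (Lit 0 [-] Var vZ)) Skip ;; stores_com) (einv (insert {?u, ?v} F)) v1 m"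
 proof (cases "wt {?u, ?v} < 0")
  case True
  hence "eval w (Var vS) v1 m = 1" by (simp add: v1_def)
  thus ?thesis unfolding wp.simps neg[OF True] using st by simp
 next
  case False
  hence "eval w (Var vS) v1 m = 0" by (simp add: v1_def)
  thus ?thesis unfolding wp.simps using st v1z[OF False] by simp
 qed
 moreover have "wp w (Asg vK (Lit 2 [+] Lit 4 [*] Var vI) ;; Asg vU (Mem (Var vK)) ;; Asg vV (Mem (Var vK [+] Lit 1)) ;;
    Asg vS (Mem (Var vK [+] Lit 2)) ;; Asg vZ (Mem (Var vK [+] Lit 3))) Q v m = Q v1 m" for Q
  unfolding wp.simps ev by (simp add: e2 v1_def del: eval.simps eval_binop.simps One_nat_def)
 ultimately show "wp w edge_com (einv (insert {?u, ?v} F)) v m"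
  unfolding edge_com_def stores_com_def[symmetric] by (subst wp.simps(5)) (simp only:)
qed simp

definition setup_time where "setup_time = size_time + (maxtime const_com + (3 + length es * (maxtime edge_com + 4)))"

theorem setup_correct: "hoare w (%v m. m = m0) setup_com setup_time (st 4)" unfolding setup_com_def
proof (rule hoare_seq[OF size_correct hoare_seq[OF const_correct _ order_refl]])
 let ?F = "%j. set (map (%(u, v). {u, v}) (drop j es))"
 show "hoare w (einv {}) (For vI (Var vEc) edge_com) (3 + length es * (maxtime edge_com + 4)) (st 4)"
 proof (rule hoare_for[where n = "length es" and I = "%j. einv (?F j)" and B = "%j v m. einv (?F (Suc j)) v m & v vI = j"])
  fix j assume j: "j < length es"
  have "drop j es = es ! j # drop (Suc j) es" using j by (simp add: Cons_nth_drop_Suc)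
  hence "?F j = insert {fst (es ! j), snd (es ! j)} (?F (Suc j))" by (simp add: case_prod_unfold)
  thus "hoare w (%v m. einv (?F (Suc j)) v m & v vI = j) edge_com (maxtime edge_com) (einv (?F j))"
   using edge_correct[OF j] by simp
 next
  fix v m assume "einv (?F 0) v m"
  moreover have "?F 0 = E" using es by (simp add: edge_list_def)
  ultimately show "st 4 v m" by (simp add: einv_def st_def tabE_def tabs_def)
 qed (auto simp: einv_def env_def)
qed (simp add: setup_time_def)

end

section \<open>Most random tables admit a right guess\<close>

lemma digits_exist:
 "EX i. i div 2 ^ (a * n) = x & (ALL e<n. i div 2 ^ (a * e) mod 2 ^ a = \<beta> e)"
 if "!!e. e < n ==> \<beta> e < 2 ^ a" for x :: nat using that proof (induction n arbitrary: x)
 case (Suc n)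
 then obtain i where i: "i div 2 ^ (a * n) = x * 2 ^ a + \<beta> n" "ALL e<n. i div 2 ^ (a * e) mod 2 ^ a = \<beta> e"
  by (metis less_Suc_eq)
 have "i div 2 ^ (a * Suc n) = i div 2 ^ (a * n) div 2 ^ a"
  unfolding mult_Suc_right add.commute[of a] power_add by (rule div_mult2_eq)
 also have "... = x" using Suc.prems[of n] by (simp add: i(1))
 finally show ?case using i Suc.prems[of n] by (intro exI[of _ i]) (auto simp: less_Suc_eq)
qed simp

text \<open>Write the buckets of all pairs but the last as digits and the carry on top. The
  divisibility says that the last digit, which \<open>dig\<close> computes from the others, is the
  remaining bucket.\<close>

lemma (in prog) decode:
 assumes "0 < C2" "!!e. e < C2 ==> \<beta> e < 2 ^ a" "x < 2 ^ kap" "2 ^ a dvd (SUM e<C2. \<beta> e) + x"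
 obtains i where "i < 2 ^ (a * DD + kap)" "!!e. e < C2 ==> dig a i e = \<beta> e" proof -
 obtain i where i: "i div 2 ^ (a * DD) = x" "!!e. e < DD ==> i div 2 ^ (a * e) mod 2 ^ a = \<beta> e"
  using digits_exist[of DD \<beta> a x] assms(2) by auto
 have lt: "i < 2 ^ (a * DD + kap)"
  using i(1) assms(3) by (simp add: power_add div_less_iff_less_mult mult.commute flip: i(1))
 have dig: "dig a i e = \<beta> e" if e: "e < C2" for e proof (cases "e < DD")
  case True
  thus ?thesis using i(2) by (simp add: dig.simps)
 next
  case False
  hence eD: "e = DD" using e by simp
  have C2: "{..<C2} = insert DD {..<DD}" using assms(1) by auto
  have s: "(SUM e<DD. i div 2 ^ (a * e) mod 2 ^ a) = (SUM e<DD. \<beta> e)" by (rule sum.cong) (use i(2) in auto)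
  have "int (2 ^ a) dvd int ((SUM e<C2. \<beta> e) + x)" using assms(4) by (simp only: int_dvd_int_iff)
  hence "2 ^ a dvd int (SUM e<DD. \<beta> e) + int (\<beta> DD) + int x" unfolding C2 by (simp add: add.commute)
  hence "2 ^ a dvd (- int (SUM e<DD. \<beta> e) - int x) - int (\<beta> DD)"
   by (subst dvd_minus_iff[symmetric]) (simp add: algebra_simps)
  hence "(- int (SUM e<DD. \<beta> e) - int x) mod 2 ^ a = int (\<beta> DD) mod 2 ^ a" by (simp add: mod_eq_dvd_iff)
  also have "... = int (\<beta> DD)" using assms(2)[of DD] e eD by simp
  finally have "nat ((- int (SUM e<DD. i div 2 ^ (a * e) mod 2 ^ a) - int (i div 2 ^ (a * DD))) mod 2 ^ a) = \<beta> DD"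
   unfolding s i(1) by (simp only: nat_int)
  thus ?thesis unfolding dig.simps if_not_P[OF False] unfolding eD .
 qed
 show ?thesis by (rule that[OF lt dig])
qed

abbreviation lists_in :: "nat => program => nat => nat => nat => nat => nat set set => (nat \<times> nat) list => nat => bool" where
 "lists_in k P c n mu f E es b == input_fits (c * (mu + 1)) (listing_input n es (2 ^ b)) &
   3 / 4 <= success_prob (c * (mu + 1)) P (listing_input n es (2 ^ b)) (2 ^ f) (listing_answers k n E (2 ^ b))"

context main
begin

text \<open>For a table that is good in the sense of \<open>card_good_tables\<close>, the guess that
  encodes the buckets of the hidden clique \<open>s\<close> builds the graph
  \<open>inst_edges\<close> of these buckets. There \<open>P\<close> is asked for more cliques than
  there are false ones, so \<open>listing_finds_zero_clique\<close> applies to every correct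
  output.\<close>

theorem good_tables_exist:
 assumes zc: "has_zero_clique"
  and ps: "a < K * L" "f < K * L" "L + kap <= mu" "mu <= f" "\<nu> <= f" "a * DD + f <= G"
  and M: "8 * C2 * (2 ^ a + (2 ^ L)\<^sup>2) <= 2 ^ \<nu> * 2 ^ a"
  and t: "!!j. 1 <= j ==> j <= k ==> 48 * 2 ^ k * C2 * (2 ^ L) ^ j <= 2 ^ b0 * 2 ^ (a * (C2 - ((k - j) choose 2)))"
  and lister: "!!E' es'. simple_graph (2 ^ (L + kap) + 2 ^ mu) E' ==> no_isolated (2 ^ (L + kap) + 2 ^ mu) E' ==>
   edge_list E' es' ==> 2 ^ mu <= card E' ==> card E' <= 2 ^ mu + 2 ^ \<nu> ==>
   EX b>=b0. b < K * L & lists_in k P c (2 ^ (L + kap) + 2 ^ mu) mu f E' es' b"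
 shows "EX A<=PiE_dflt {..<hlen} 0 (%_. {..<2 ^ w}). 3 * (2 ^ w) ^ hlen <= 4 * card A & (ALL om:A. findable om)" proof -
 have mu: "mu < K * L" using ps by linarith
 have aw: "a + 100 * k * L <= w" proof -
  have "(100 * k + K) * L <= cw * L" using cw(3) by (intro mult_right_mono) auto
  thus ?thesis using ps(1) by (simp add: w_def distrib_right)
 qed
 interpret I: inst w k a L E wt N kap mu proof unfold_locales
  have "k <= k * k" by (cases k) auto
  thus "k <= 2 ^ kap" using kap by (rule order_trans)
 qed (use k aw E NL in auto)
 obtain S where "S : cliques k N E" "clique_weight E wt S = 0" using zc unfolding has_zero_clique_def by blast
 from I.zero_clique_complete[OF this] obtain s where s: "I.zero_clique s" "!!p. p < k ==> s p < 2 ^ L" by blast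
 let ?wt = "%u v. if {u, v} : E then wt {u, v} else 0"
 define A where "A = {om : I.\<Omega>. card (I.false_tuples s om) < 2 ^ b0 & card (I.same_edges s om) <= 2 ^ \<nu>}"
 have len: "I.len = hlen" by (simp add: hlen_eq)
 have "3 * card I.\<Omega> <= 4 * card A" unfolding A_def proof (rule I.card_good_tables)
  show "I.weight s = 0" by (rule I.zero_clique_weight[OF s(1)])
  show "\<bar>?wt u v\<bar> <= 2 ^ (w - a)" for u v proof -
   have "(2 :: int) ^ (100 * k * L) <= 2 ^ (w - a)" using aw by (intro power_increasing) auto
   hence "\<bar>wt {u, v}\<bar> <= 2 ^ (w - a)" if "{u, v} : E" using wt[OF that] by (rule order_trans[rotated])
   thus ?thesis by simp
  qed
 qed (use s(2) M t in auto)
 hence c: "3 * (2 ^ w) ^ hlen <= 4 * card A" unfolding I.card_\<Omega> len .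
 have sub: "A <= PiE_dflt {..<hlen} 0 (%_. {..<2 ^ w})" unfolding A_def I.\<Omega>_def len by blast
 have R: "I.R = 2 ^ (L + kap)" by (rule I.R_def)
 have "findable om" if om: "om : A" for om proof -
  define \<beta> where "\<beta> = (%(p, l). I.bkt (I.Z om p l (s p) (s l)))"
  have ft: "card (I.false_tuples s om) < 2 ^ b0" and se: "card (I.same_edges s om) <= 2 ^ \<nu>"
   using om by (simp_all add: A_def)
  obtain x where x: "x < C2" "2 ^ a dvd (SUM (p, l):prs k. I.bkt (I.Z om p l (s p) (s l))) + x"
   using I.zero_weight_digits[OF I.zero_clique_weight[OF s(1)]] by blast
  have "(SUM (p, l):prs k. I.bkt (I.Z om p l (s p) (s l))) = (SUM e:set (prl k). \<beta> e)"
   by (simp add: set_prl \<beta>_def)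
  also have "... = sum_list (map \<beta> (prl k))" by (rule sum.distinct_set_conv_list[OF distinct_prl])
  also have "... = (SUM e<C2. \<beta> (prl k ! e))" by (simp add: sum_list_sum_nth length_prl atLeast0LessThan)
  finally have dv: "2 ^ a dvd (SUM e<C2. \<beta> (prl k ! e)) + x" using x(2) by simp
  have bl: "\<beta> (prl k ! e) < 2 ^ a" for e by (simp add: \<beta>_def case_prod_unfold I.bkt_less)
  have "x < 2 ^ kap" using x(1) C2_le by simp
  from decode[OF C2_pos bl this dv] obtain i
   where i: "i < 2 ^ (a * DD + kap)" "!!e. e < C2 ==> dig a i e = \<beta> (prl k ! e)" by blast
  define lst where "lst e = filter (%y. {fst y, snd y} : E & I.bkt (I.Z om (fst e) (snd e) (fst y) (snd y)) = \<beta> e) all_pairs" for e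
  have bfl: "bfl om a all_pairs e (dig a i e) = map (%(u, v). (I.code (fst (prl k ! e)) u, I.code (snd (prl k ! e)) v)) (lst (prl k ! e))"
   if "e < C2" for e
   using i(2)[OF that] by (simp add: bfl_def in_bucket_def[abs_def] code_pair_def I.code_def lst_def case_prod_unfold)
  have lst: "distinct (lst e) & set (lst e) = I.bucket_edges om e (\<beta> e)" for e proof
   show "distinct (lst e)" unfolding lst_def by (rule distinct_filter[OF all_pairs_props(1)])
   show "set (lst e) = I.bucket_edges om e (\<beta> e)"
    unfolding lst_def I.bucket_edges_def set_filter all_pairs_props(2) by auto
  qed
  \<comment> \<open>All edges in these buckets collide with an edge of \<open>s\<close>, so
    \<open>same_edges\<close> bounds their number and the cut-off at \<open>2 ^ f\<close> does not
    strike.\<close>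
  have len_lst: "length (lst e) <= 2 ^ f" if e: "e : prs k" for e proof -
   obtain p l where pl: "e = (p, l)" by fastforce
   have fS: "finite (I.same_edges s om)"
    by (rule finite_subset[of _ "prs k \<times> {..<2 ^ L} \<times> {..<2 ^ L}"]) (auto simp: I.same_edges_def)
   have "length (lst e) = card (set (lst e))" by (rule distinct_card[symmetric]) (use lst in blast)
   also have "... = card (Pair e ` set (lst e))" by (simp add: card_image inj_on_def)
   also have "... <= card (I.same_edges s om)" proof (rule card_mono[OF fS])
    show "Pair e ` set (lst e) <= I.same_edges s om"
     using e pl lst[of e] by (auto simp: I.same_edges_def I.bucket_edges_def \<beta>_def)
   qed
   also have "... <= 2 ^ \<nu>" by (rule se)
   also have "... <= 2 ^ f" using ps by (intro power_increasing) auto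
   finally show ?thesis .
  qed
  have ch: "chosen_bucket om a f i e = map (%(u, v). (I.code (fst (prl k ! e)) u, I.code (snd (prl k ! e)) v)) (lst (prl k ! e))"
   if e: "e < C2" for e proof -
   have "prl k ! e : prs k" using e by (metis length_prl nth_mem set_prl)
   thus ?thesis unfolding chosen_bucket_def bfl[OF e] using len_lst by simp
  qed
  have "map (chosen_bucket om a f i) [0..<C2] =
    map (%e. map (%(u, v). (I.code (fst e) u, I.code (snd e) v)) (lst e)) (map ((!) (prl k)) [0..<C2])" using ch by simp
  also have "map ((!) (prl k)) [0..<C2] = prl k" using map_nth[of "prl k"] by (simp add: length_prl)
  finally have es: "inst_input om a mu b f i = listing_input (2 ^ (L + kap) + 2 ^ mu)
    (I.pads @ concat (map (%e. map (%(u, v). (I.code (fst e) u, I.code (snd e) v)) (lst e)) (prl k))) (2 ^ b)" for b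
   by (simp only: inst_input_def I.pads_def R)
  let ?es = "I.pads @ concat (map (%e. map (%(u, v). (I.code (fst e) u, I.code (snd e) v)) (lst e)) (prl k))"
  have \<beta>: "\<beta> (p, l) = I.bkt (I.Z om p l (s p) (s l))" for p l by (simp add: \<beta>_def)
  have el: "edge_list (I.inst_edges om \<beta>) ?es" by (rule I.inst_edge_list[OF distinct_prl set_prl lst])
  have "EX b>=b0. b < K * L & lists_in k P c (2 ^ (L + kap) + 2 ^ mu) mu f (I.inst_edges om \<beta>) ?es b"
  proof (rule lister[OF _ _ el])
   show "simple_graph (2 ^ (L + kap) + 2 ^ mu) (I.inst_edges om \<beta>)" using I.inst_simple unfolding R .
   show "no_isolated (2 ^ (L + kap) + 2 ^ mu) (I.inst_edges om \<beta>)" using I.inst_no_isolated[OF ps(3)] unfolding R .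
   show "2 ^ mu <= card (I.inst_edges om \<beta>)" by (rule I.card_inst_edges(1)[OF \<beta>])
   show "card (I.inst_edges om \<beta>) <= 2 ^ mu + 2 ^ \<nu>" using I.card_inst_edges(2)[OF \<beta>] se by linarith
  qed
  then obtain b where b: "b0 <= b" "b < K * L" "input_fits (c * (mu + 1)) (inst_input om a mu b f i)"
   "3 / 4 <= success_prob (c * (mu + 1)) P (inst_input om a mu b f i) (2 ^ f)
     (listing_answers k (2 ^ (L + kap) + 2 ^ mu) (I.inst_edges om \<beta>) (2 ^ b))" unfolding es by blast
  have "(2 :: nat) ^ b0 <= 2 ^ b" using b(1) by (intro power_increasing) auto
  hence ftb: "card (I.false_tuples s om) < 2 ^ b" using ft by linarith
  have "hits om a mu b f i" unfolding hits_def
  proof (intro conjI exI[of _ "listing_answers k (2 ^ (L + kap) + 2 ^ mu) (I.inst_edges om \<beta>) (2 ^ b)"] ballI b(3,4))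
   fix out assume "out : listing_answers k (2 ^ (L + kap) + 2 ^ mu) (I.inst_edges om \<beta>) (2 ^ b)"
   from I.listing_finds_zero_clique[OF s \<beta> ftb, unfolded R, OF _ this]
   show "EX j. Suc j * k <= length out & I.zero_clique (%p. out ! (j * k + p) mod 2 ^ L)" by blast
  qed
  thus ?thesis unfolding findable_def using ps mu b i by blast
 qed
 thus ?thesis using sub c by blast
qed

end

text \<open>The strict bound on the time leaves one step for the final \<open>Out\<close>, after
  which the machine has halted.\<close>

lemma success_ccode:
 assumes "loop_ok cm" "cvars cm <= {..<t}" "r < t" "input_fits w xs"
  and time: "!!x k. (x, k) : set_pmf (sem w cm (%_. 0, mem (init_config xs))) ==> k < T"
 shows "success_prob w (ccode t 0 cm @ [Out r]) xs T Y =
  prob (outd w cm (%_. 0, mem (init_config xs))) {x. [fst x r] : Y}" proof -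
 let ?Q = "ccode t 0 cm @ [Out r]" and ?s = "init_config xs" and ?x = "(%_. 0, mem (init_config xs))"
 have len: "length (ccode t 0 cm) = csize cm" by simp
 have "map_pmf (%s. halted ?Q s & outp s : Y) (run w ?Q T ?s) =
   bind_pmf (sem w cm ?x) (%(x', k). return_pmf ([fst x' r] : Y))" proof (rule reachD[OF reach_ccode[OF assms(1,2)]])
  show "code_at ?Q (pc ?s) (ccode t (pc ?s) cm)" using code_at_infix[of "[]"] by (simp add: init_config_def)
  show "rel w t ?s ?x" using assms(4) by (auto simp: rel_def init_config_def input_fits_def)
  show "k <= T" if "(x', k) : set_pmf (sem w cm ?x)" for x' k using time[OF that] by simp
  fix x' k s' assume x: "(x', k) : set_pmf (sem w cm ?x)" and rl: "rel w t s' x'" and p: "pc s' = pc ?s + csize cm"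
  have p: "pc s' = csize cm" using p by (simp add: init_config_def)
  obtain n where n: "T - k = Suc n" using time[OF x] by (metis Suc_diff_Suc)
  let ?s1 = "s'\<lparr>pc := Suc (pc s'), outp := outp s' @ [regs s' r]\<rparr>"
  have st: "step w ?Q s' = return_pmf ?s1" using p len by (simp add: step_def halted_def nth_append)
  have hl: "halted ?Q ?s1" using p len by (simp add: halted_def)
  have "run w ?Q n ?s1 = return_pmf ?s1" by (induction n) (simp_all add: run.simps(2) step_def hl bind_return_pmf)
  hence "run w ?Q (T - k) s' = return_pmf ?s1" unfolding n by (simp add: run.simps(2) st bind_return_pmf)
  moreover have "outp ?s1 = [fst x' r]" using rl assms(3) by (simp add: rel_def)
  ultimately show "map_pmf (%s. halted ?Q s & outp s : Y) (run w ?Q (T - k) s') =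
    (case (x', k) of (x', k) => return_pmf ([fst x' r] : Y))" using hl by simp
 qed
 also have "... = map_pmf (%x. [fst x r] : Y) (outd w cm ?x)"
  by (simp add: outd_def map_pmf_def bind_assoc_pmf bind_return_pmf case_prod_unfold)
 finally have "prob (map_pmf (%s. halted ?Q s & outp s : Y) (run w ?Q T ?s)) {True} =
   prob (map_pmf (%x. [fst x r] : Y) (outd w cm ?x)) {True}" by simp
 thus ?thesis unfolding success_prob_def measure_map_pmf by (simp add: vimage_def)
qed

section \<open>The machine program and its success probability\<close>

context prog
begin

definition reg_no where "reg_no = 40 + reg_bound P"

definition final_prog where "final_prog = ccode reg_no 0 main_com @ [Out vFlag]"

lemma cvars_main: "cvars main_com <= {..<reg_no}" proof -
 have foldr_vars: "evars (foldr (%(p, l) e. Bin f (Mem (A p l)) e) ps (Lit n)) <= X"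
  if "!!p l. evars (A p l) <= X" for f A ps n X using that by (induction ps) (simp_all add: case_prod_unfold)
 have foldr_vars': "evars (foldr (%l' e. A l' [+] e) ps (Lit n)) <= X"
  if "!!l. evars (A l) <= X" for A ps n X using that by (induction ps) simp_all
 have y: "evars (y_exp p) <= {..<40}" for p by (simp add: y_exp_def)
 have ok: "evars ok_exp <= {..<40}" unfolding ok_exp_def by (rule foldr_vars) (use y in "auto simp: adj_exp_def")
 have sm: "evars sum_exp <= {..<40}" unfolding sum_exp_def by (rule foldr_vars) (use y in "auto simp: wt_exp_def")
 have g: "evars (g_exp p l x) <= {..<40}" if "evars x <= {..<40}" for p l x using that by (simp add: g_exp_def)
 have Y: "evars (Y_exp p l x) <= {..<40}" if "evars x <= {..<40}" for p l x
  using g[OF that] foldr_vars'[of "%l'. g_exp p l' x" "{..<40}"] that by (auto simp: Y_exp_def)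
 have z: "evars (z_exp p l) <= {..<40}" for p l using Y[of "Var vU"] Y[of "Var vV"] by (auto simp: z_exp_def wt_exp_def)
 have ap: "cvars (append_com e) <= {..<40}" for e
  using z by (auto simp: append_com_def slot_exp_def Let_def split: prod.splits)
 have bu: "cvars buckets_com <= {..<40}"
  using ap by (auto simp: buckets_com_def prep_com_def pair_com_def cvars_seqs adj_exp_def)
 have si: "cvars (sim_instr x) <= {..<reg_no}" if "set (instr_regs x) <= {..<reg_bound P}" for x
  using that by (cases x) (auto simp: vreg_def reg_no_def)
 have di: "cvars (dispatch j xs) <= {..<reg_no}" if "set xs <= set P" for j xs using that proof (induction xs arbitrary: j)
  case (Cons x xs)
  have "cvars (sim_instr x) <= {..<reg_no}" by (rule si) (use Cons.prems instr_regs_less in auto)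
  thus ?case using Cons by (auto simp: reg_no_def)
 qed (simp add: reg_no_def)
 have "cvars (digit_com e) <= {..<40}" for e by (cases "e < DD") (simp_all add: digit_com_def)
 hence "cvars (copy_com e) <= {..<40}" for e by (simp add: copy_com_def copy_loop_def copy_body_def slot_exp_def)
 hence bld: "cvars build_com <= {..<40}"
  by (simp add: build_com_def alloc_com_def pads_com_def pads_body_def header_com_def R_exp_def cvars_seqs UN_subset_iff)
 have chk: "cvars check_com <= {..<40}" using ok sm by (simp add: check_com_def check_body_def)
 have ini: "cvars init_com <= {..<40}" by (simp add: init_com_def)
 have zer: "cvars zero_regs_com <= {..<reg_no}" by (auto simp: zero_regs_com_def cvars_seqs vreg_def reg_no_def)
 have le: "X <= {..<40} ==> X <= {..<reg_no}" for X by (auto simp: reg_no_def)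
 have "cvars sim_loop <= {..<reg_no}" using di[of P 0] by (simp add: sim_loop_def reg_no_def)
 hence tr: "cvars trial_com <= {..<reg_no}" using le[OF bld] le[OF chk] le[OF ini] zer by (simp add: trial_com_def)
 have "cvars edge_com <= {..<40}" "cvars size_com <= {..<40}" "cvars const_com <= {..<40}"
  by (auto simp: edge_com_def size_com_def const_com_def adj_exp_def wt_exp_def)
 thus ?thesis using bu tr
  by (auto simp: main_com_def setup_com_def rep_com_def a_com_def mu_com_def f_com_def tries_com_def draw_com_def
    fill_def guard_def KL_exp_def reg_no_def)
qed

lemma loop_ok_main: "loop_ok main_com" proof -
 have "loop_ok (sim_instr x)" for x by (cases x) auto
 hence di: "loop_ok (dispatch j xs)" for j xs by (induction xs arbitrary: j) auto
 have vr: "x ~: range vreg" if "x < 40" for x using that by (auto simp: vreg_def)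
 have wd: "x ~: writes (dispatch j xs)" if "x < 40" "x ~= vPc" "x ~= vOc" for x j xs
  using writes_dispatch[of j xs] vr[OF that(1)] that by auto
 have ap: "loop_ok (append_com e)" "writes (append_com e) = {vK, vLen}" for e
  by (auto simp: append_com_def Let_def split: prod.splits)
 have bu: "loop_ok buckets_com" "writes buckets_com <= {vPA, vSh, vBB, vFP, vU, vV, vK, vLen}"
  using ap by (auto simp: buckets_com_def prep_com_def pair_com_def loop_ok_seqs writes_seqs)
 have zr: "x ~: writes zero_regs_com" if "x < 40" for x using vr[OF that] by (auto simp: zero_regs_com_def writes_seqs)
 have zl: "loop_ok zero_regs_com" by (auto simp: zero_regs_com_def loop_ok_seqs)
 have tr: "loop_ok trial_com" "x < 40 ==> x ~: {vFP, vBase, vOb, vM, vS, vD, vK, vLen, vJ, vW, vPc, vOc, vFu, vFlag} ==> x ~: writes trial_com" for x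
  using di wd zl zr vr by (auto simp: trial_com_def build_com_def init_com_def sim_loop_def check_com_def check_body_def
    alloc_com_def pads_com_def pads_body_def header_com_def copy_com_def digit_com_def copy_loop_def copy_body_def
    loop_ok_seqs writes_seqs)
 show ?thesis using tr bu
  by (auto simp: main_com_def setup_com_def size_com_def const_com_def edge_com_def rep_com_def a_com_def mu_com_def f_com_def
    tries_com_def draw_com_def fill_def)
qed

end

context whole
begin

definition main_time where "main_time = setup_time + (rep_time + 5)"

lemma main_correct:
 "hoare w (%v m. m = m0) main_com main_time (%v m. v vFlag <= 1 & (v vFlag ~= 0 --> has_zero_clique))"
 unfolding main_com_def main_time_def by (rule hoare_seq[OF setup_correct hoare_seq[OF rep_correct hoare_wp order_refl]])
   (use w_pos in "auto simp: st_def")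

lemma main_finds:
 assumes A: "A <= PiE_dflt {..<hlen} 0 (%_. {..<2 ^ w})" "3 * (2 ^ w) ^ hlen <= 4 * card A"
  and f: "!!om. om : A ==> findable om"
 shows "phoare w (%v m. m = m0) main_com (1 - 1 / 2 ^ L) (%v m. v vFlag = 1)" proof -
 have last: "hoare w (%v m. v vFlag ~= 0) (Cond (Var vFlag) (Asg vFlag (Lit 1)) Skip) 5 (%v m. v vFlag = 1)"
  by (rule hoare_wp) (use w_pos in auto)
 have "phoare w (st 4) (rep_com ;; Cond (Var vFlag) (Asg vFlag (Lit 1)) Skip) (1 - 1 / 2 ^ L) (%v m. v vFlag = 1)"
  by (rule phoare_seq[OF rep_finds[OF A f] phoare_of_hoare[OF last]]) auto
 thus ?thesis unfolding main_com_def by (rule phoare_seq_hoare[OF setup_correct])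
qed

lemma mem_init: "mem (init_config (weighted_input N es wt)) = m0" by (simp add: init_config_def m0_def)

lemma winp_fits: "input_fits w (weighted_input N es wt)" proof -
 have H: "y < 2 ^ w" if "y <= H" for y using that by (intro six_H) simp
 have N: "N < 2 ^ w" using NL pow_L_less by linarith
 have "2 + 4 * length es < 2 ^ w" by (rule H[OF winp_le])
 moreover from this have "length es < 2 ^ w" by linarith
 moreover have "x < 2 ^ w" if x: "(u, v) : set es" "x : {u, v, if wt {u, v} < 0 then 1 else 0, nat \<bar>wt {u, v}\<bar>}" for u v x
 proof -
  obtain j where j: "j < length es" "es ! j = (u, v)" using x(1) by (auto simp: in_set_conv_nth)
  note e = es_edge[OF j(1), unfolded j(2) fst_conv snd_conv]
  have "(2 :: int) ^ (100 * k * L) < 2 ^ w" proof (rule power_strict_increasing)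
   have "100 * k * L < cw * L" using cw(3) K L by simp
   thus "100 * k * L < w" by (simp add: w_def)
  qed simp
  hence "\<bar>wt {u, v}\<bar> < 2 ^ w" by (rule le_less_trans[OF wt[OF e(1)]])
  hence "nat \<bar>wt {u, v}\<bar> < 2 ^ w" by (simp add: nat_less_iff)
  moreover have "1 < (2 :: nat) ^ w" using w_pos by (intro one_less_power) auto
  moreover have "u < 2 ^ w" "v < 2 ^ w" using e(2,3) pow_L_less by linarith+
  moreover have "(0 :: nat) < 2 ^ w" by simp
  moreover have "x = u \<or> x = v \<or> x = 0 \<or> x = 1 \<or> x = nat \<bar>wt {u, v}\<bar>" using x(2) by (auto split: if_splits)
  ultimately show ?thesis by (elim disjE) (simp_all only:)
 qed
 ultimately show ?thesis using N unfolding input_fits_def by (simp add: winp(1)) (fastforce simp: weighted_input_def)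
qed

text \<open>\<open>main_correct\<close> covers every outcome, so without a zero clique the answer 0
  is certain. Only positive instances depend on the random table and on the simulated runs.\<close>

theorem decides:
 assumes "main_time < T"
  and "has_zero_clique ==> EX A<=PiE_dflt {..<hlen} 0 (%_. {..<2 ^ w}). 3 * (2 ^ w) ^ hlen <= 4 * card A & (ALL om:A. findable om)"
 shows "1 - 1 / real N <= success_prob w final_prog (weighted_input N es wt) T (if has_zero_clique then {[1]} else {[0]})"
proof -
 let ?Y = "if has_zero_clique then {[1]} else {[0 :: nat]}"
 have "success_prob w final_prog (weighted_input N es wt) T ?Y =
   prob (outd w main_com (%_. 0, m0)) {x. [fst x vFlag] : ?Y}" unfolding final_prog_def mem_init[symmetric]
 proof (rule success_ccode[OF loop_ok_main cvars_main _ winp_fits])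
  show "vFlag < reg_no" by (simp add: reg_no_def)
  fix x n assume "(x, n) : set_pmf (sem w main_com (%_. 0, mem (init_config (weighted_input N es wt))))"
  hence "n <= main_time" using hoareD[OF main_correct, of m0] by (cases x) (auto simp: mem_init)
  thus "n < T" using assms(1) by simp
 qed
 also have "1 - 1 / real N <= ..." proof (cases has_zero_clique)
  case True
  obtain A where A: "A <= PiE_dflt {..<hlen} 0 (%_. {..<2 ^ w})" "3 * (2 ^ w) ^ hlen <= 4 * card A" "!!om. om : A ==> findable om"
   using assms(2)[OF True] by blast
  have "real N <= 2 ^ L" using NL by (metis of_nat_le_iff of_nat_numeral of_nat_power)
  hence "1 - 1 / real N <= 1 - 1 / 2 ^ L" using N2 by (simp add: frac_le)
  also have "... <= prob (outd w main_com (%_. 0, m0)) {x. fst x vFlag = 1}"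
   using main_finds[OF A] unfolding phoare_def by blast
  finally show ?thesis using True by simp
 next
  case False
  have "prob (outd w main_com (%_. 0, m0)) {x. [fst x vFlag] : ?Y} = 1" proof (rule prob_eq_1I)
   fix x assume "x : set_pmf (outd w main_com (%_. 0, m0))"
   from hoare_outd[OF main_correct _ this] False show "x : {x. [fst x vFlag] : ?Y}" by auto
  qed
  thus ?thesis by simp
 qed
 finally show ?thesis .
qed

end

section \<open>Running time of the complete program\<close>

context prog
begin

definition lev :: "nat => nat" where "lev s = 5 + K * (s + 4)"

definition setup_coeff where "setup_coeff =
   (13 + (maxtime (Cond (Bin Less (Var vPL) (Var vN)) (Asg vPL (Var vPL [+] Var vPL) ;; Asg vL (Var vL [+] Lit 1)) Skip) + 4)) +
   (maxtime const_com + (3 + (maxtime edge_com + 4)))"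

definition pair_coeff where
 "pair_coeff = 3 + (esize (Mem (adj_exp (Var vU) (Var vV))) + 2 + C2 * (SUM e<C2. maxtime (append_com e)) + 4) + 4"

definition mu_coeff where "mu_coeff = lev (lev (lev (esize guard + 2 + (trial_coeff + 20))))"

definition a_coeff where "a_coeff = lev (maxtime prep_com + (3 + pair_coeff) + mu_coeff)"

definition time_coeff where "time_coeff = setup_coeff + ((3 + (7 + (1 + k * k) * 10 + a_coeff + 4)) + 6)"

end

lemma add_scaled: "(x :: nat) <= y * F ==> x' <= y' * F ==> x + x' <= (y + y') * F" by (simp add: distrib_right)

lemma mult_scaled:
 fixes x X F y Y :: nat
 assumes "x <= X" "y <= Y * F"
 shows "x * y <= Y * (X * F)" using mult_le_mono[OF assms] by (simp add: ac_simps)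

lemma scaled_mono: "(x :: nat) <= y * F ==> F <= F' ==> x <= y * F'" by (meson le_trans mult_le_mono2)

context whole
begin

lemma two_L_le_G: "2 * L <= G" proof -
 have "3 * q <= k * q" using k by (rule mult_right_mono) simp
 hence "2 * q <= k * q - 1" using q by linarith
 hence "(2 * q) * L <= (k * q - 1) * L" by (rule mult_right_mono) simp
 hence "(2 * q) * L div q <= ((k * q - 1) * L) div q" by (rule div_le_mono)
 moreover have "(2 * q) * L div q = 2 * L" using q by (simp add: mult.assoc mult.left_commute[of 2 q])
 ultimately show ?thesis unfolding G_def by linarith
qed

lemma level_scaled:
 assumes "t <= s * F" "1 <= F"
 shows "level t <= lev s * (L * F)" proof -
 have "t + 4 <= (s + 4) * F" by (intro add_scaled assms(1) le_scaled[OF order_refl assms(2)])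
 hence "K * L * (t + 4) <= K * L * ((s + 4) * F)" by (rule mult_left_mono) simp
 also have "... = (K * (s + 4)) * (L * F)" by (simp only: ac_simps)
 finally have "K * L * (t + 4) <= (K * (s + 4)) * (L * F)" .
 moreover have "1 <= L * F" using L assms(2) by (metis mult_le_mono nat_mult_1)
 ultimately show ?thesis unfolding level_def lev_def by (intro add_scaled le_scaled[OF order_refl])
qed

text \<open>The five factors \<open>L\<close> stem from the loops that guess \<open>a\<close>,
  \<open>mu\<close>, \<open>b\<close> and \<open>f\<close>, and from the repetition. Reading the
  input and filling the buckets take time of order 4^L, which is covered because
  \<open>2 * L <= G\<close>.\<close>

theorem main_time_le: "main_time < time_coeff * (L ^ 5 * 2 ^ (G + kap))" proof -
 define X where "X = (2 :: nat) ^ (G + kap)"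
 have X1: "1 <= X" by (simp add: X_def)
 have LL: "2 ^ L * 2 ^ L <= X" proof -
  have "2 ^ L * 2 ^ L = (2 :: nat) ^ (2 * L)" by (simp add: mult_2 power_add)
  also have "... <= X" unfolding X_def using two_L_le_G by (intro power_increasing) auto
  finally show ?thesis .
 qed
 have "(2 :: nat) ^ L * 1 <= 2 ^ L * 2 ^ L" by (rule mult_left_mono) simp_all
 hence L1: "2 ^ L <= X" using LL by linarith
 have step: "1 <= L * F" if "1 <= F" for F using mult_le_mono[OF L that] by simp
 have grow: "F <= L * F" for F using mult_le_mono[OF L order_refl, of F] by simp
 note Z = le_scaled[OF order_refl X1]
 have N: "N * y <= y * X" for y using mult_le_mono[OF order_trans[OF NL L1] order_refl, of y] by (simp add: mult.commute)
 have es: "length es * y <= y * X" for y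
  using mult_le_mono[OF order_trans[OF length_es LL] order_refl, of y] by (simp add: mult.commute)
 have set_up: "setup_time <= setup_coeff * X" proof -
  have "size_time = 13 + N * (maxtime (Cond (Bin Less (Var vPL) (Var vN)) (Asg vPL (Var vPL [+] Var vPL) ;; Asg vL (Var vL [+] Lit 1)) Skip) + 4)"
   unfolding size_time_def by (simp add: add.assoc[symmetric])
  thus ?thesis unfolding setup_time_def setup_coeff_def by (simp only:) (intro add_scaled Z N es)
 qed
 have hl: "hlen * y <= ((1 + k * k) * y) * X" for y proof -
  have "hlen <= (1 + k * k) * X" unfolding hlen_def by (rule add_scaled) (use X1 L1 in "simp_all add: mult_le_mono2")
  hence "hlen * y <= (1 + k * k) * X * y" by (rule mult_right_mono) simp
  thus ?thesis by (simp only: ac_simps)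
 qed
 have draw: "draw_time <= (7 + (1 + k * k) * 10) * X" unfolding draw_time_def by (intro add_scaled hl Z)
 have L2: "2 ^ L * y <= Y * (2 ^ L * 2 ^ L)" if "y <= Y * 2 ^ L" for y Y :: nat by (rule mult_scaled[OF order_refl that])
 note ZL = le_scaled[of _ _ "2 ^ L", OF order_refl]
 have inner: "3 + 2 ^ L * (pair_time + 4) + 4 <= pair_coeff * 2 ^ L"
  unfolding pair_coeff_def pair_time_def by (intro add_scaled ZL) (simp_all add: mult.commute)
 have buckets: "buckets_time <= (maxtime prep_com + (3 + pair_coeff)) * X"
  unfolding buckets_time_def by (intro add_scaled scaled_mono[OF L2[OF inner] LL] Z)
 have "esize guard + 2 + tries_time <= (esize guard + 2 + (trial_coeff + 20)) * X"
  unfolding tries_time_def X_def[symmetric] by (intro add_scaled Z order_refl)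
 hence mu: "mu_time <= mu_coeff * (L * (L * (L * X)))" unfolding mu_time_def mu_coeff_def by (intro level_scaled step X1)
 have XL: "X <= L * (L * (L * X))" by (rule order_trans[OF grow order_trans[OF grow grow]])
 have a: "a_time <= a_coeff * (L * (L * (L * (L * X))))" unfolding a_time_def a_coeff_def
  by (intro level_scaled add_scaled[OF scaled_mono[OF buckets XL] mu] step X1)
 let ?F = "L * (L * (L * (L * X)))"
 have XF: "X <= ?F" by (rule order_trans[OF XL grow])
 have F1: "1 <= ?F" by (intro step X1)
 have "draw_time + a_time + 4 <= (7 + (1 + k * k) * 10 + a_coeff + 4) * ?F"
  by (rule add_scaled[OF add_scaled[OF scaled_mono[OF draw XF] a] le_scaled[OF order_refl F1]])
 from mult_scaled[OF order_refl this, of L] le_scaled[OF order_refl step[OF F1], of 3]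
 have "rep_time <= (3 + (7 + (1 + k * k) * 10 + a_coeff + 4)) * (L * ?F)"
  unfolding rep_time_def by (rule add_scaled[rotated])
 moreover have "setup_time <= setup_coeff * (L * ?F)" by (rule scaled_mono[OF set_up order_trans[OF XF grow]])
 moreover have "6 <= 6 * (L * ?F)" by (rule le_scaled[OF order_refl step[OF F1]])
 ultimately have "setup_time + (rep_time + 6) <= time_coeff * (L * ?F)"
  unfolding time_coeff_def by (intro add_scaled[of setup_time] add_scaled[of rep_time])
 thus ?thesis unfolding main_time_def X_def by (simp add: numeral_eq_Suc ac_simps)
qed

end

text \<open>What must be known about \<open>P\<close> for one \<open>L\<close>. There are
  \<open>2 ^ mu\<close> pendant edges and at most \<open>2 ^ \<nu>\<close> hashed ones, and false
  cliques number fewer than \<open>2 ^ b0\<close>. The number \<open>2 ^ b\<close> of cliques to be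
  requested may depend on the size of the instance, which is known only after hashing; hence
  \<open>b\<close> is existential here and guessed by the program.\<close>

definition lists_cliques where "lists_cliques k P c K q C0 kap L a mu f \<nu> \<longleftrightarrow>
   a < K * L & f < K * L & L + kap <= mu & mu <= f & \<nu> <= f & a * ((k choose 2) - 1) + f <= ((k * q - 1) * L) div q + C0 &
   8 * (k choose 2) * (2 ^ a + (2 ^ L)\<^sup>2) <= 2 ^ \<nu> * 2 ^ a &
   (EX b0. (ALL j. 1 <= j --> j <= k -->
     48 * 2 ^ k * (k choose 2) * (2 ^ L) ^ j <= 2 ^ b0 * 2 ^ (a * ((k choose 2) - ((k - j) choose 2)))) &
    (ALL E es. simple_graph (2 ^ (L + kap) + 2 ^ mu) E --> no_isolated (2 ^ (L + kap) + 2 ^ mu) E -->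
     edge_list E es --> 2 ^ mu <= card E --> card E <= 2 ^ mu + 2 ^ \<nu> -->
     (EX b>=b0. b < K * L & lists_in k P c (2 ^ (L + kap) + 2 ^ mu) mu f E es b)))"

lemma room_bound:
 fixes K L G H kap C0 k :: nat
 assumes L: "1 <= L" and K: "1 <= K" and G: "G <= k * L + C0" and H: "H = 2 ^ (ch * L)"
  and cw: "ch + k + C0 + kap + 4 * K + 12 <= cw"
 shows "(4 + L * (K * L * (1 + K * L * (K * L * (K * L * (2 ^ (G + kap) * 2))))) + 2) * H < 2 ^ (cw * L)" proof -
 let ?Y = "K * L * (1 + K * L * (K * L * (K * L * (2 ^ (G + kap) * 2))))"
 define M where "M = (2 :: nat) ^ (K * L)"
 define X where "X = (2 :: nat) ^ (k * L + C0 + kap)"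
 let ?Z = "M * (M * (M * (M * (X * 4))))"
 have KM: "K * L <= M" unfolding M_def using less_exp[of "K * L"] by simp
 have LM: "L <= 2 ^ L" using less_exp[of L] by simp
 have GX: "2 ^ (G + kap) <= X" unfolding X_def using G by (intro power_increasing) auto
 have M1: "1 <= M" and X1: "1 <= X" by (simp_all add: M_def X_def)
 have p1: "1 <= M * (M * (M * (X * 2)))" using M1 X1 by simp
 have "L * ?Y <=
   2 ^ L * (M * (1 + M * (M * (M * (X * 2)))))" by (intro mult_le_mono add_mono KM LM GX order_refl)
 also have "... <= 2 ^ L * (M * (M * (M * (M * (X * 2))) + M * (M * (M * (X * 2)))))"
  by (intro mult_le_mono add_mono p1 order_refl)
 also have "... = 2 ^ L * ?Z" by (simp add: algebra_simps)
 finally have 1: "L * ?Y <= 2 ^ L * ?Z" .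
 have "1 <= 2 ^ L * ?Z" using M1 X1 by simp
 with 1 have "4 + L * ?Y + 2 <= 8 * (2 ^ L * ?Z)" by linarith
 also have "... = 2 ^ (5 + L + 4 * (K * L) + (k * L + C0 + kap))" proof -
  have "4 * (K * L) = K * L + (K * L + (K * L + K * L))" by simp
  hence M4: "M * (M * (M * M)) = 2 ^ (4 * (K * L))" by (simp only: M_def power_add[symmetric])
  have "8 * (2 ^ L * ?Z) = 2 ^ 5 * 2 ^ L * (M * (M * (M * M))) * X" by simp
  thus ?thesis unfolding M4 X_def by (simp only: power_add)
 qed
 also have "... < 2 ^ ((k + C0 + kap + 4 * K + 12) * L)" proof (rule power_strict_increasing)
  have le: "C0 * 1 <= C0 * L" "kap * 1 <= kap * L" using L by (intro mult_left_mono; simp)+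
  have arith: "5 + L + x + (y + u + v) < y + u' + v' + x + 12 * L" if "u * 1 <= u'" "v * 1 <= v'" for x y u v u' v' :: nat
   using that L by presburger
  show "5 + L + 4 * (K * L) + (k * L + C0 + kap) < (k + C0 + kap + 4 * K + 12) * L"
   using arith[OF le, of "4 * (K * L)" "k * L"] by (simp only: distrib_right mult.assoc)
 qed simp
 finally have "(4 + L * ?Y + 2) * H
   < 2 ^ ((k + C0 + kap + 4 * K + 12) * L) * H" using H by simp
 also have "... = 2 ^ ((ch + k + C0 + kap + 4 * K + 12) * L)" by (simp add: H power_add[symmetric] algebra_simps)
 also have "... <= 2 ^ (cw * L)" using cw by (intro power_increasing mult_right_mono) auto
 finally show ?thesis .
qed

text \<open>The fifth power of x <= 2 powr x at x = L / (10 q). The polylogarithmic factor thus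
  costs only half of the saving L / q in the exponent.\<close>

lemma pow5_le:
 fixes q L :: nat
 assumes "1 <= q"
 shows "real L ^ 5 <= real ((10 * q) ^ 5) * 2 powr (real L / (2 * real q))" proof -
 define x where "x = real L / (10 * real q)"
 have "x <= 2 powr x" proof -
  have x0: "0 <= x" by (simp add: x_def)
  have "real (nat \<lfloor>x\<rfloor>) + 1 <= 2 ^ nat \<lfloor>x\<rfloor>"
   using Suc_leI[OF less_exp[of "nat \<lfloor>x\<rfloor>"]] by (metis of_nat_Suc of_nat_le_iff of_nat_numeral of_nat_power add.commute)
  moreover have "x <= real (nat \<lfloor>x\<rfloor>) + 1" using x0 by linarith
  moreover have "(2 :: real) ^ nat \<lfloor>x\<rfloor> <= 2 powr x" using x0 by (simp add: powr_realpow[symmetric])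
  ultimately show ?thesis by linarith
 qed
 hence "x ^ 5 <= (2 powr x) ^ 5" by (intro power_mono) (simp_all add: x_def)
 also have "... = 2 powr (5 * x)" by (simp add: powr_realpow[symmetric] powr_powr mult.commute)
 also have "5 * x = real L / (2 * real q)" by (simp add: x_def)
 finally have "x ^ 5 <= 2 powr (real L / (2 * real q))" .
 hence "real ((10 * q) ^ 5) * x ^ 5 <= real ((10 * q) ^ 5) * 2 powr (real L / (2 * real q))" by (intro mult_left_mono) auto
 moreover have "real ((10 * q) ^ 5) * x ^ 5 = real L ^ 5" using assms by (simp add: x_def power_divide power_mult_distrib)
 ultimately show ?thesis by simp
qed

theorem reduction:
 assumes k: "3 <= k" and c: "1 <= c" and K: "1 <= K" and q: "1 <= q" and kap: "k * k <= 2 ^ kap"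
  and lister: "!!L. 1 <= L ==> EX a mu f \<nu>. lists_cliques k P c K q C0 kap L a mu f \<nu>"
 shows "~ exact_clique_hypothesis k" proof -
 define ch where "ch = c * K + 4 * K + 3 * kap + 10"
 \<comment> \<open>A sum of everything it has to dominate; \<open>x <= 2 ^ x\<close> turns this into
   the exponential conditions as well.\<close>
 define cw where "cw = ch + K + 12 + pc_bound P + 2 + (101 * k + 4 * K + 2 * kap) + C0 + 2 * (k * q + C0)"
 define Q where "Q = prog.final_prog k P c K q C0 kap ch cw"
 define tcf where "tcf = real (prog.time_coeff k P c K q C0 kap ch cw)"
 define A where "A = tcf * real ((10 * q) ^ 5) * 2 ^ (C0 + kap) * 2 ^ k"
 \<comment> \<open>The exponent of the running time is (k - 1 / (2 q)) L, since half of the saving L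
   / q goes into \<open>L ^ 5\<close>. Relative to the bound N powr k this is the power 1 -
   \<delta>. The factor \<open>2 ^ k\<close> in \<open>A\<close> pays for 2^L being up to 2
   N.\<close>
 define \<delta> where "\<delta> = 1 / (2 * real q * real k)"
 have pcw: "x <= cw ==> x <= 2 ^ cw" for x using less_exp[of cw] by linarith
 have "solves_within Q cw A \<delta> x" if x: "x : exact_clique_tasks k" for x proof -
  obtain N E es W where x: "x = \<lparr>task_input = weighted_input N es W, task_size = N,
    task_answers = (if EX S:cliques k N E. clique_weight E W S = 0 then {[1]} else {[0]}), task_bound = real N powr real k\<rparr>"
   and N: "2 <= N" and E: "simple_graph N E" and es: "edge_list E es" and W: "!!e. e : E ==> \<bar>W e\<bar> <= int N ^ (100 * k)"
   using x unfolding exact_clique_tasks_def by blast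
  define L where "L = nat \<lceil>log 2 (real N)\<rceil>"
  have log0: "0 < log 2 (real N)" using N by simp
  have L1: "1 <= L" unfolding L_def using log0 by linarith
  have NL: "N <= 2 ^ L" proof -
   have "log 2 (real N) <= real L" unfolding L_def by linarith
   hence "real N <= 2 powr real L" using N by (simp add: log_le_iff)
   hence "real N <= real (2 ^ L)" by (simp add: powr_realpow)
   thus ?thesis by (simp only: of_nat_le_iff)
  qed
  have LN: "2 ^ (L - 1) < N" proof -
   have "real (L - 1) < log 2 (real N)" unfolding L_def using log0 by linarith
   hence "2 powr real (L - 1) < real N" using N by (simp add: less_log_iff)
   hence "real (2 ^ (L - 1)) < real N" by (simp add: powr_realpow)
   thus ?thesis by (simp only: of_nat_less_iff)
  qed
  have W': "\<bar>W e\<bar> <= 2 ^ (100 * k * L)" if "e : E" for e proof -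
   have "\<bar>W e\<bar> <= int N ^ (100 * k)" by (rule W[OF that])
   also have "... <= (2 ^ L) ^ (100 * k)" proof (rule power_mono)
    have "int N <= int (2 ^ L)" using NL by (simp only: of_nat_le_iff)
    thus "int N <= 2 ^ L" by simp
   qed simp
   also have "... = 2 ^ (100 * k * L)" by (simp add: power_mult[symmetric] mult.commute)
   finally show ?thesis .
  qed
  interpret red k P c K q C0 kap ch cw L N E W proof unfold_locales
   show "pc_bound P + 2 <= 2 ^ cw" by (rule pcw) (simp add: cw_def)
  qed (use k L1 NL E c K kap W' ch_def in "auto simp: cw_def")
  have Gk: "G <= k * L + C0" proof -
   have "((k * q - 1) * L) div q <= (k * q * L) div q" by (intro div_le_mono mult_right_mono) auto
   also have "... = k * L" using q by (simp add: mult.commute[of k q] mult.assoc)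
   finally show ?thesis by (simp add: G_def)
  qed
  interpret whole k P c K q C0 kap ch cw L N E W es proof unfold_locales
   show "2 * (k * q + C0) <= 2 ^ cw" by (rule pcw) (simp add: cw_def)
   show "(4 + L * (K * L * (1 + K * L * (K * L * (K * L * (2 ^ (G + kap) * 2))))) + 2) * H < 2 ^ w"
    unfolding w_def by (rule room_bound[OF L1 K Gk H_def]) (simp add: cw_def)
  qed (use N LN es q in auto)
  have find: "EX A<=PiE_dflt {..<hlen} 0 (%_. {..<2 ^ w}). 3 * (2 ^ w) ^ hlen <= 4 * card A & (ALL om:A. findable om)"
   if zc: has_zero_clique proof -
   obtain a mu f \<nu> where "lists_cliques k P c K q C0 kap L a mu f \<nu>" using lister[OF L1] by blast
   then obtain b0 where l: "a < K * L" "f < K * L" "L + kap <= mu" "mu <= f" "\<nu> <= f" "a * DD + f <= G"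
    "8 * C2 * (2 ^ a + (2 ^ L)\<^sup>2) <= 2 ^ \<nu> * 2 ^ a"
    "!!j. 1 <= j ==> j <= k ==> 48 * 2 ^ k * C2 * (2 ^ L) ^ j <= 2 ^ b0 * 2 ^ (a * (C2 - ((k - j) choose 2)))"
    "!!E es. simple_graph (2 ^ (L + kap) + 2 ^ mu) E ==> no_isolated (2 ^ (L + kap) + 2 ^ mu) E ==>
     edge_list E es ==> 2 ^ mu <= card E ==> card E <= 2 ^ mu + 2 ^ \<nu> ==>
     (EX b>=b0. b < K * L & lists_in k P c (2 ^ (L + kap) + 2 ^ mu) mu f E es b)" unfolding lists_cliques_def G_def by blast
   show ?thesis by (rule good_tables_exist[OF zc l])
  qed
  define T where "T = nat \<lfloor>A * (real N powr real k) powr (1 - \<delta>)\<rfloor>"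
  have "real (main_time + 1) <= real (time_coeff * (L ^ 5 * 2 ^ (G + kap)))"
   using main_time_le by (simp add: Suc_le_eq del: of_nat_add of_nat_mult of_nat_power)
  also have "... = tcf * (real L ^ 5 * 2 powr real (G + kap))" by (simp add: tcf_def powr_realpow del: of_nat_add)
  also have "... <= tcf * ((real ((10 * q) ^ 5) * 2 powr (real L / (2 * real q))) * 2 powr ((real k - 1 / real q) * real L + real (C0 + kap)))"
  proof (intro mult_left_mono mult_mono pow5_le[OF q] powr_mono)
   have "real (((k * q - 1) * L) div q) <= real ((k * q - 1) * L) / real q" by (rule of_nat_div_le_of_nat)
   also have "real ((k * q - 1) * L) = (real k * real q - 1) * real L" using k q by (simp add: of_nat_diff)
   also have "... / real q = (real k - 1 / real q) * real L" using q by (simp add: field_simps)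
   finally show "real (G + kap) <= (real k - 1 / real q) * real L + real (C0 + kap)" by (simp add: G_def)
  qed (auto simp: tcf_def)
  also have "... = tcf * real ((10 * q) ^ 5) * 2 ^ (C0 + kap) * 2 powr ((real k - 1 / (2 * real q)) * real L)" proof -
   have "2 powr (real L / (2 * real q)) * 2 powr ((real k - 1 / real q) * real L + real (C0 + kap)) =
     2 powr ((real k - 1 / (2 * real q)) * real L) * 2 powr real (C0 + kap)"
    unfolding powr_add[symmetric] using q by (intro arg_cong[of _ _ "(powr) 2"]) (simp add: field_simps)
   moreover have "2 powr real (C0 + kap) = 2 ^ (C0 + kap)" by (rule powr_realpow) simp
   ultimately show ?thesis by (simp only: mult.assoc) (simp only: ac_simps)
  qed
  also have "... <= tcf * real ((10 * q) ^ 5) * 2 ^ (C0 + kap) * (2 ^ k * (real N powr real k) powr (1 - \<delta>))"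
  proof (rule mult_left_mono)
   let ?e = "real k - 1 / (2 * real q)"
   have e0: "0 <= ?e" "?e <= real k" proof -
    have "1 / (2 * real q) <= 1" using q by (simp add: field_simps)
    thus "0 <= ?e" using k by linarith
   qed simp
   have "2 powr real L <= 2 * real N" proof -
    have "2 ^ L = 2 * (2 :: nat) ^ (L - 1)" using L1 by (cases L) auto
    hence "2 ^ L <= 2 * N" using LN by linarith
    hence "real (2 ^ L) <= real (2 * N)" by (simp only: of_nat_le_iff)
    thus ?thesis by (simp add: powr_realpow)
   qed
   hence "(2 powr real L) powr ?e <= (2 * real N) powr ?e" using e0 by (intro powr_mono2) auto
   also have "... = 2 powr ?e * real N powr ?e" by (simp add: powr_mult)
   also have "... <= 2 powr real k * real N powr ?e" using e0 by (intro mult_right_mono powr_mono) auto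
   also have "real N powr ?e = (real N powr real k) powr (1 - \<delta>)"
    unfolding powr_powr \<delta>_def using k q by (intro arg_cong[of _ _ "(powr) (real N)"]) (simp add: field_simps)
   also have "(2 :: real) powr real k = 2 ^ k" by (rule powr_realpow) simp
   finally show "2 powr (?e * real L) <= 2 ^ k * (real N powr real k) powr (1 - \<delta>)"
    unfolding powr_powr mult.commute[of ?e] .
  qed (simp add: tcf_def)
  also have "... = A * (real N powr real k) powr (1 - \<delta>)" by (simp add: A_def)
  finally have "main_time + 1 <= T" unfolding T_def by (simp add: le_nat_floor)
  hence "main_time < T" by simp
  from decides[OF this find] have "1 - 1 / real N <= success_prob w Q (weighted_input N es W) T (task_answers x)"
   by (simp add: Q_def x has_zero_clique_def)
  moreover have "word_length cw N = w" unfolding w_def unfolding word_length_def L_def ..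
  ultimately show ?thesis using winp_fits by (simp add: solves_within_def x T_def)
 qed
 moreover have "0 < \<delta>" using k q by (simp add: \<delta>_def)
 ultimately show ?thesis unfolding exact_clique_hypothesis_def requires_time_def by blast
qed

section \<open>Parts of the input that must be read\<close>

definition loads :: "program => nat set => config => bool" where
 "loads P B s \<longleftrightarrow> ~ halted P s & (EX r a. P ! pc s = Load r a & regs s a : B)"

fun read_prob :: "nat => program => nat set => nat => config => real" where
 "read_prob w P B 0 s = 0"
| "read_prob w P B (Suc T) s =
   (if loads P B s then 1 else measure_pmf.expectation (step w P s) (read_prob w P B T))"

definition agree_outside :: "nat set => config => config => bool" where
 "agree_outside B s s' \<longleftrightarrow> pc s = pc s' & regs s = regs s' & outp s = outp s' & (ALL x. x ~: B --> mem s x = mem s' x)"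

lemma finite_step: "finite (set_pmf (step w P s))" proof -
 have "finite (set_pmf (exec_instr w i s))" for i by (cases i) (auto simp: lessThan_empty_iff)
 thus ?thesis by (simp add: step_def)
qed

lemma read_prob_bounds: "0 <= read_prob w P B T s" "read_prob w P B T s <= 1" proof (induction T arbitrary: s)
 case (Suc T)
 {
  case 1
  show ?case using Suc.IH(1) by (simp add: integral_nonneg_AE)
 next
  case 2
  have "measure_pmf.expectation (step w P s) (read_prob w P B T) <= measure_pmf.expectation (step w P s) (%_. 1)"
   by (intro integral_mono integrable_measure_pmf_finite[OF finite_step] Suc.IH(2))
  thus ?case by simp
 }
qed simp_all

text \<open>A coupling: both steps are images of one random source \<open>U\<close>, the word drawn
  by \<open>Rand\<close> or a constant, and agree outside \<open>B\<close> for each of its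
  values.\<close>

lemma step_agree:
 assumes "agree_outside B s s'" "~ loads P B s"
 shows "EX (U :: nat pmf) g g'. step w P s = map_pmf g U & step w P s' = map_pmf g' U & finite (set_pmf U) & (ALL v. agree_outside B (g v) (g' v))"
proof (cases "halted P s")
 case True
 hence "halted P s'" using assms(1) by (simp add: halted_def agree_outside_def)
 thus ?thesis using True assms(1)
  by (intro exI[of _ "return_pmf 0"] exI[of _ "%_. s"] exI[of _ "%_. s'"]) (simp add: step_def)
next
 case False
 hence h: "~ halted P s'" using assms(1) by (simp add: halted_def agree_outside_def)
 have eq: "P ! pc s' = P ! pc s" using assms(1) by (simp add: agree_outside_def)
 have det: ?thesis if "step w P s = return_pmf x" "step w P s' = return_pmf x'" "agree_outside B x x'" for x x'
  using that by (intro exI[of _ "return_pmf 0"] exI[of _ "%_. x"] exI[of _ "%_. x'"]) simp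
 have det2: ?thesis if "!!r. P ! pc s ~= Rand r" proof -
  have "regs s a ~: B" if "P ! pc s = Load r a" for r a using that assms(2) False by (auto simp: loads_def)
  hence "EX x x'. exec_instr w (P ! pc s) s = return_pmf x & exec_instr w (P ! pc s) s' = return_pmf x' & agree_outside B x x'"
   using that assms(1) by (cases "P ! pc s") (auto simp: agree_outside_def set_reg_def)
  thus ?thesis using det False h eq by (auto simp: step_def)
 qed
 show ?thesis proof (cases "EX r. P ! pc s = Rand r")
  case True
  then obtain r where "P ! pc s = Rand r" by blast
  thus ?thesis using False h eq assms(1)
   by (intro exI[of _ "pmf_of_set {..<2 ^ w}"] exI[of _ "%v. set_reg r v s"] exI[of _ "%v. set_reg r v s'"])
     (auto simp: step_def agree_outside_def set_reg_def lessThan_empty_iff)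
 qed (rule det2, blast)
qed

text \<open>The coupled runs stay in agreement until a cell of \<open>B\<close> is loaded. The
  second hypothesis says that the event \<open>V\<close> cannot see the contents of
  \<open>B\<close>.\<close>

lemma run_agree:
 assumes "agree_outside B s s'" "!!x x'. agree_outside B x x' ==> x : V ==> x' : V"
 shows "prob (run w P T s) V <= prob (run w P T s') V + read_prob w P B T s"
 using assms(1) proof (induction T arbitrary: s s')
 case 0
 thus ?case using assms(2)[OF 0] by (auto simp: indicator_def)
next
 case (Suc T)
 show ?case proof (cases "loads P B s")
  case True
  have "prob (run w P (Suc T) s) V <= 1" by simp
  moreover have "0 <= prob (run w P (Suc T) s') V" by simp
  moreover have "read_prob w P B (Suc T) s = 1" using True by simp
  ultimately show ?thesis by linarith
 next
  case False
  obtain U :: "nat pmf" and g g' where U: "step w P s = map_pmf g U" "step w P s' = map_pmf g' U" "finite (set_pmf U)"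
   "!!v. agree_outside B (g v) (g' v)" using step_agree[OF Suc.prems False, of w] by blast
  note int = integrable_measure_pmf_finite[OF U(3)]
  have "prob (run w P (Suc T) s) V = measure_pmf.expectation U (%v. prob (run w P T (g v)) V)"
   by (simp add: run.simps(2) U(1) bind_map_pmf prob_bind_pmf)
  also have "... <= measure_pmf.expectation U (%v. prob (run w P T (g' v)) V + read_prob w P B T (g v))"
   by (intro integral_mono int Suc.IH U(4))
  also have "... = measure_pmf.expectation U (%v. prob (run w P T (g' v)) V) +
    measure_pmf.expectation U (%v. read_prob w P B T (g v))" by (intro Bochner_Integration.integral_add int)
  also have "measure_pmf.expectation U (%v. prob (run w P T (g' v)) V) = prob (run w P (Suc T) s') V"
   by (simp add: run.simps(2) U(2) bind_map_pmf prob_bind_pmf)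
  also have "measure_pmf.expectation U (%v. read_prob w P B T (g v)) = read_prob w P B (Suc T) s"
   using False by (simp add: U(1))
  finally show ?thesis .
 qed
qed

text \<open>A step reads at most one cell.\<close>

lemma sum_read_prob_le:
 assumes "finite I" "!!i j. i : I ==> j : I ==> i ~= j ==> B i \<inter> B j = {}"
 shows "(SUM i:I. read_prob w P (B i) T s) <= real T" proof (induction T arbitrary: s)
 case (Suc T)
 note int = integrable_measure_pmf_finite[OF finite_step]
 have one: "(SUM i:I. if loads P (B i) s then 1 else 0 :: real) <= 1" proof (cases "EX i:I. loads P (B i) s")
  case True
  then obtain i where i: "i : I" "loads P (B i) s" by blast
  have "~ loads P (B j) s" if "j : I" "j ~= i" for j using i that assms(2)[OF that(1) i(1)] by (auto simp: loads_def)
  hence "(SUM i:I. if loads P (B i) s then 1 else 0 :: real) = (SUM j:I. if j = i then 1 else 0)"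
   using i by (intro sum.cong) auto
  also have "... = 1" using i(1) assms(1) by simp
  finally show ?thesis by simp
 next
  case False
  hence "(SUM i:I. if loads P (B i) s then 1 else 0 :: real) = 0" by (intro sum.neutral) auto
  thus ?thesis by simp
 qed
 have "read_prob w P (B i) (Suc T) s <= (if loads P (B i) s then 1 else 0) +
   measure_pmf.expectation (step w P s) (read_prob w P (B i) T)" for i
  using read_prob_bounds(1) by (simp add: integral_nonneg_AE)
 hence "(SUM i:I. read_prob w P (B i) (Suc T) s) <=
   (SUM i:I. (if loads P (B i) s then 1 else 0) + measure_pmf.expectation (step w P s) (read_prob w P (B i) T))"
  by (intro sum_mono)
 also have "... = (SUM i:I. if loads P (B i) s then 1 else 0) + measure_pmf.expectation (step w P s) (%x. SUM i:I. read_prob w P (B i) T x)"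
  by (simp add: sum.distrib Bochner_Integration.integral_sum[OF int])
 also have "measure_pmf.expectation (step w P s) (%x. SUM i:I. read_prob w P (B i) T x) <= measure_pmf.expectation (step w P s) (%_. real T)"
  by (intro integral_mono int Suc.IH)
 finally show ?case using one by simp
qed simp

text \<open>A clique on \<open>{..<k}\<close> lacking the edge between 0 and 1, and a complete bipartite graph.\<close>

definition junk :: "nat => nat => (nat \<times> nat) list" where
 "junk k a = map (%i. (k + i div a, k + a + i mod a)) [0..<a * a]"

definition almost_clique :: "nat => (nat \<times> nat) list" where
 "almost_clique k = filter (%e. e ~= (1, 0)) (prl k)"

definition easy_list :: "nat => nat => (nat \<times> nat) list" where
 "easy_list k a = junk k a @ almost_clique k"

definition hard_list :: "nat => nat => nat => (nat \<times> nat) list" where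
 "hard_list k a i = (junk k a)[i := (1, 0)] @ almost_clique k"

definition edges_of :: "(nat \<times> nat) list => nat set set" where
 "edges_of es = set (map (%(u, v). {u, v}) es)"

lemma length_junk [simp]: "length (junk k a) = a * a" by (simp add: junk_def)

lemma length_almost_clique:
 assumes "2 <= k"
 shows "length (almost_clique k) = (k choose 2) - 1" proof -
 have "(1, 0) : set (prl k)" using assms by (simp add: set_prl prs_def)
 have "length (almost_clique k) = card (set (almost_clique k))"
  by (rule distinct_card[symmetric]) (simp add: almost_clique_def distinct_prl)
 also have "set (almost_clique k) = set (prl k) - {(1, 0)}" by (auto simp: almost_clique_def)
 also have "card ... = card (set (prl k)) - 1" using `(1, 0) : set (prl k)` by simp
 also have "card (set (prl k)) = k choose 2" by (simp add: set_prl card_prs)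
 finally show ?thesis .
qed

lemma set_almost_clique: "set (almost_clique k) = {(p, l). l < p & p < k & (p, l) ~= (1, 0)}"
 by (auto simp: almost_clique_def set_prl prs_def)

lemma junk_nth: "i < a * a ==> junk k a ! i = (k + i div a, k + a + i mod a)" by (simp add: junk_def)

lemma junkD:
 fixes a i :: nat
 assumes "i < a * a"
 shows "i div a < a" "i mod a < a" proof -
 have "0 < a" using assms by (cases a) auto
 thus "i div a < a" "i mod a < a" using assms by (simp_all add: div_less_iff_less_mult)
qed

lemma set_junk: "set (junk k a) = {(k + x, k + a + y) |x y. x < a & y < a}" proof -
 have "(k + x, k + a + y) : set (junk k a)" if "x < a" "y < a" for x y proof -
  have "(x + 1) * a <= a * a" using that by (intro mult_right_mono) auto
  hence "x * a + y < a * a" using that by simp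
  moreover have "(x * a + y) div a = x" "(x * a + y) mod a = y" using that by simp_all
  ultimately show ?thesis unfolding junk_def by (auto simp: image_iff intro!: bexI[of _ "x * a + y"])
 qed
 thus ?thesis using junkD by (auto simp: junk_def)
qed

lemma inj_junk: "distinct (map (%(u, v). {u, v}) (junk k a))" proof -
 have "i = j" if "i < a * a" "j < a * a" "{k + i div a, k + a + i mod a} = {k + j div a, k + a + j mod a}" for i j proof -
  have "i div a = j div a" "i mod a = j mod a" using that(3) junkD[OF that(1)] junkD[OF that(2)] by (auto simp: doubleton_eq_iff)
  thus ?thesis by (metis div_mult_mod_eq)
 qed
 thus ?thesis by (auto simp: junk_def distinct_map inj_on_def)
qed

lemma distinct_almost: "distinct (map (%(u, v). {u, v}) (almost_clique k))"
 by (auto simp: distinct_map almost_clique_def distinct_prl inj_on_def set_prl prs_def doubleton_eq_iff)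

lemma easy_edge_list: "edge_list (edges_of (easy_list k a)) (easy_list k a)" proof -
 have "distinct (map (%(u, v). {u, v}) (easy_list k a))" unfolding easy_list_def map_append distinct_append
  using inj_junk distinct_almost by (auto simp: set_junk set_almost_clique doubleton_eq_iff)
 thus ?thesis by (simp add: edge_list_def edges_of_def)
qed

lemma hard_edge_list:
 assumes "i < a * a" "2 <= k"
 shows "edge_list (edges_of (hard_list k a i)) (hard_list k a i)" proof -
 have sub: "set ((map (%(u, v). {u, v}) (junk k a))[i := {1, 0}]) <= insert {1, 0} ((%(u, v). {u, v}) ` set (junk k a))"
  using set_update_subset_insert[of "map (%(u, v). {u, v}) (junk k a)" i "{1, 0}"] by (simp only: set_map)
 have ne: "(case x of (u, v) => {u, v}) ~= {1, 0}" if "x : set (junk k a)" for x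
  using that assms(2) unfolding set_junk by (auto simp only: mem_Collect_eq prod.case doubleton_eq_iff)
 have "{1, 0} ~: (%(u, v). {u, v}) ` set (junk k a)" by (rule notI, erule imageE) (rule notE[OF ne sym])
 hence "{1, 0} ~: set (map (%(u, v). {u, v}) (junk k a)) - {map (%(u, v). {u, v}) (junk k a) ! i}"
  unfolding set_map by (intro notI, elim DiffE) (rule notE)
 hence "distinct ((map (%(u, v). {u, v}) (junk k a))[i := {1, 0}])" by (rule distinct_list_update[OF inj_junk])
 moreover have "insert {1, 0} ((%(u, v). {u, v}) ` set (junk k a)) \<inter> set (map (%(u, v). {u, v}) (almost_clique k)) = {}"
  by (auto simp: set_junk set_almost_clique doubleton_eq_iff)
 hence "set ((map (%(u, v). {u, v}) (junk k a))[i := {1, 0}]) \<inter> set (map (%(u, v). {u, v}) (almost_clique k)) = {}"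
  using sub by blast
 ultimately have "distinct (map (%(u, v). {u, v}) (hard_list k a i))"
  unfolding hard_list_def map_append map_update prod.case distinct_append using distinct_almost by blast
 thus ?thesis by (simp add: edge_list_def edges_of_def)
qed

lemma card_edges_of:
 assumes "edge_list (edges_of es) es"
 shows "card (edges_of es) = length es" using assms distinct_card[of "map (%(u, v). {u, v}) es"] by (simp add: edge_list_def)

lemma set_hard: "set (hard_list k a i) <= insert (1, 0) (set (easy_list k a))"
 using set_update_subset_insert[of "junk k a" i "(1, 0)"] by (auto simp: hard_list_def easy_list_def)

lemma simple_easy: "2 <= k ==> simple_graph (k + 2 * a) (edges_of (easy_list k a))"
 by (auto simp: simple_graph_def edges_of_def easy_list_def set_junk set_almost_clique card_insert_if)

lemma edges_ofI: "(u, v) : set es ==> {u, v} : edges_of es"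
 unfolding edges_of_def set_map by (drule imageI[where f = "%(u, v). {u, v}"]) (simp only: prod.case)

lemma simple_hard: "2 <= k ==> simple_graph (k + 2 * a) (edges_of (hard_list k a i))" proof -
 assume k: "2 <= k"
 have "edges_of (hard_list k a i) <= insert {1, 0} (edges_of (easy_list k a))"
  using set_hard[of k a i] unfolding edges_of_def set_map
  by (drule_tac image_mono[where f = "%(u, v). {u, v}"]) (simp only: image_insert prod.case)
 moreover have "e <= {..<k + 2 * a} & card e = 2" if "e : insert {1, 0} (edges_of (easy_list k a))" for e using that proof
  assume "e = {1, 0}"
  thus ?thesis using k by simp
 next
  assume "e : edges_of (easy_list k a)"
  with simple_easy[OF k, of a] show ?thesis unfolding simple_graph_def by (rule bspec)
 qed
 ultimately show ?thesis unfolding simple_graph_def by (intro ballI) (drule (1) subsetD)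
qed

lemma no_isolated_if:
 assumes "simple_graph n E" "!!x. x < n ==> EX y. {x, y} : E"
 shows "no_isolated n E" unfolding no_isolated_def proof
 show "\<Union> E <= {..<n}" using assms(1) by (auto simp: simple_graph_def)
 show "{..<n} <= \<Union> E" proof
  fix x assume "x : {..<n}"
  then obtain y where "{x, y} : E" using assms(2)[of x] by auto
  thus "x : \<Union> E" by (rule UnionI) simp
 qed
qed

lemma almost_neighbour:
 assumes "3 <= k" "x < k"
 shows "EX y. {x, y} : edges_of (almost_clique k)" proof -
 have mem: "{p, l} : edges_of (almost_clique k)" if "l < p" "p < k" "(p, l) ~= (1, 0)" for p l
  by (rule edges_ofI) (use that in "simp add: set_almost_clique")
 have "{0, 2} : edges_of (almost_clique k)" "{1, 2} : edges_of (almost_clique k)"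
  using mem[of 0 2] mem[of 1 2] assms by (simp_all add: insert_commute)
 moreover have "{x, 0} : edges_of (almost_clique k)" if "2 <= x" using mem[of 0 x] that assms by simp
 moreover consider "x = 0" | "x = 1" | "2 <= x" by linarith
 ultimately show ?thesis by cases blast+
qed

text \<open>Two different edges at every vertex of the bipartite part, so that replacing any one
  edge isolates nobody; this takes sides of size at least 2.\<close>

lemma junk_neighbour:
 assumes "2 <= a" "k <= x" "x < k + 2 * a"
 shows "EX j<a * a. EX j'<a * a. j ~= j' & (EX y. {x, y} = (%(u, v). {u, v}) (junk k a ! j)) & (EX y. {x, y} = (%(u, v). {u, v}) (junk k a ! j'))"
proof -
 have lt: "u * a + v < a * a" if "u < a" "v < a" for u v proof -
  have "(u + 1) * a <= a * a" using that by (intro mult_right_mono) auto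
  thus ?thesis using that by simp
 qed
 have nth: "junk k a ! (u * a + v) = (k + u, k + a + v)" if "u < a" "v < a" for u v
  using lt[OF that] that by (simp add: junk_nth)
 show ?thesis proof (cases "x < k + a")
  case True
  define u where "u = x - k"
  have u: "u < a" "x = k + u" using True assms by (auto simp: u_def)
  have "0 < a" "1 < a" using assms by auto
  show ?thesis
   by (rule exI[of _ "u * a + 0"], rule conjI[OF lt[OF u(1) `0 < a`]], rule exI[of _ "u * a + 1"], rule conjI[OF lt[OF u(1) `1 < a`]])
     (use nth[OF u(1) `0 < a`] nth[OF u(1) `1 < a`] u in auto)
 next
  case False
  define v where "v = x - k - a"
  have v: "v < a" "x = k + a + v" using False assms by (auto simp: v_def)
  have "0 < a" "1 < a" using assms by auto
  show ?thesis
   by (rule exI[of _ "0 * a + v"], rule conjI[OF lt[OF `0 < a` v(1)]], rule exI[of _ "1 * a + v"], rule conjI[OF lt[OF `1 < a` v(1)]])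
     (use nth[OF `0 < a` v(1)] nth[OF `1 < a` v(1)] v `0 < a` in "auto simp: insert_commute")
 qed
qed

lemma no_isolated_hard:
 assumes "3 <= k" "2 <= a"
 shows "no_isolated (k + 2 * a) (edges_of (easy_list k a))" "no_isolated (k + 2 * a) (edges_of (hard_list k a i))" proof -
 have nb: "EX y. {x, y} : edges_of ((if b then (junk k a)[i := (1, 0)] else junk k a) @ almost_clique k)" if "x < k + 2 * a" for x b
 proof (cases "x < k")
  case True
  then obtain y where "{x, y} : edges_of (almost_clique k)" using almost_neighbour[OF assms(1)] by blast
  moreover have "edges_of (almost_clique k) <= edges_of (xs @ almost_clique k)" for xs unfolding edges_of_def by simp
  ultimately show ?thesis by blast
 next
  case False
  hence "k <= x" by simp
  from junk_neighbour[OF assms(2) this that] obtain j j' y y'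
   where j: "j < a * a" "j' < a * a" "j ~= j'" "{x, y} = (%(u, v). {u, v}) (junk k a ! j)"
   "{x, y'} = (%(u, v). {u, v}) (junk k a ! j')" by blast
  have mem: "(%(u, v). {u, v}) (junk k a ! l) : edges_of ((if b then (junk k a)[i := (1, 0)] else junk k a) @ almost_clique k)"
   if "l < a * a" "l ~= i" for l proof -
   have "junk k a ! l : set (if b then (junk k a)[i := (1, 0)] else junk k a)" proof (cases b)
    case True
    have "(junk k a)[i := (1, 0)] ! l : set ((junk k a)[i := (1, 0)])" using that by (intro nth_mem) simp
    thus ?thesis using True that by simp
   qed (use that in simp)
   thus ?thesis unfolding edges_of_def set_map set_append image_Un by (intro UnI1 imageI)
  qed
  have "j ~= i \<or> j' ~= i" using j(3) by blast
  thus ?thesis proof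
   assume "j ~= i"
   from mem[OF j(1) this] show ?thesis unfolding j(4)[symmetric] by (rule exI)
  next
   assume "j' ~= i"
   from mem[OF j(2) this] show ?thesis unfolding j(5)[symmetric] by (rule exI)
  qed
 qed
 show "no_isolated (k + 2 * a) (edges_of (easy_list k a))"
  by (rule no_isolated_if[OF simple_easy]) (use assms nb[of _ False] in "auto simp: easy_list_def")
 show "no_isolated (k + 2 * a) (edges_of (hard_list k a i))"
  by (rule no_isolated_if[OF simple_hard]) (use assms nb[of _ True] in "auto simp: hard_list_def")
qed

lemma easy_edgeD:
 assumes "{x, y} : edges_of (easy_list k a)"
 shows "(x < k & y < k & {x, y} ~= {0, 1}) \<or> (k <= x & x < k + a & k + a <= y) \<or> (k <= y & y < k + a & k + a <= x)"
proof -
 obtain e where e: "e : set (easy_list k a)" "{x, y} = (%(u, v). {u, v}) e"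
  using assms unfolding edges_of_def set_map by (rule imageE)
 obtain u v where uv: "e = (u, v)" by fastforce
 have eq: "{x, y} = {u, v}" using e(2) unfolding uv prod.case .
 hence xy: "x = u & y = v \<or> x = v & y = u" by (simp only: doubleton_eq_iff)
 have "(u, v) : set (junk k a) \<or> (u, v) : set (almost_clique k)" using e(1) by (simp add: uv easy_list_def)
 then consider "k <= u" "u < k + a" "k + a <= v" | "v < u" "u < k" "~ (u = 1 & v = 0)"
  by (auto simp: set_junk set_almost_clique)
 thus ?thesis proof cases
  case 1
  thus ?thesis using xy by auto
 next
  case 2
  hence "{u, v} ~= {0, 1}" unfolding doubleton_eq_iff by auto
  hence "{x, y} ~= {0, 1}" unfolding eq .
  moreover have "x < k" "y < k" using xy 2 by auto
  ultimately show ?thesis by (intro disjI1 conjI)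
 qed
qed

text \<open>Inside \<open>{..<k}\<close> the edge between 0 and 1 is missing, and the rest is a
  separate bipartite graph without triangles.\<close>

lemma easy_no_clique:
 assumes "3 <= k"
 shows "cliques k n (edges_of (easy_list k a)) = {}" proof (rule ccontr)
 assume "cliques k n (edges_of (easy_list k a)) ~= {}"
 then obtain S where S: "card S = k" "!!u v. u : S ==> v : S ==> u ~= v ==> {u, v} : edges_of (easy_list k a)"
  unfolding cliques_def by blast
 have fin: "finite S" using S(1) assms by (intro card_ge_0_finite) simp
 show False proof (cases "S <= {..<k}")
  case True
  hence "S = {..<k}" using S(1) by (intro card_subset_eq) auto
  hence "{0, 1} : edges_of (easy_list k a)" using assms by (intro S(2)) auto
  from easy_edgeD[OF this] show False proof (elim disjE conjE)
   assume "{0, 1 :: nat} ~= {0, 1}"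
   thus False by (rule notE) (rule refl)
  qed (use assms in linarith)+
 next
  case False
  then obtain x where x: "x : S" "x ~: {..<k}" by blast
  hence kx: "k <= x" by simp
  have "S - {x} ~= {}" "S - {x} - {y} ~= {}" for y proof -
   have "card {x, y} <= 2" by (simp add: card_insert_if)
   hence "~ S <= {x, y}" using card_mono[of "{x, y}" S] S(1) assms by auto
   thus "S - {x} ~= {}" "S - {x} - {y} ~= {}" by blast+
  qed
  then obtain y z where y: "y : S" "y ~= x" and z: "z : S" "z ~= x" "z ~= y" by blast
  show False
   using easy_edgeD[OF S(2)[OF x(1) y(1)]] easy_edgeD[OF S(2)[OF x(1) z(1)]] easy_edgeD[OF S(2)[OF y(1) z(1)]] kx y z
   by linarith
 qed
qed

lemma hard_clique:
 assumes "3 <= k" "i < a * a"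
 shows "{..<k} : cliques k (k + 2 * a) (edges_of (hard_list k a i))" proof -
 have e: "{p, l} : edges_of (hard_list k a i)" if "l < p" "p < k" for p l proof (rule edges_ofI, cases "(p, l) = (1, 0)")
  case True
  have "(1, 0) : set ((junk k a)[i := (1, 0)])" by (rule set_update_memI) (use assms in simp)
  thus "(p, l) : set (hard_list k a i)" unfolding True hard_list_def by simp
 next
  case False
  thus "(p, l) : set (hard_list k a i)" using that by (simp add: hard_list_def set_almost_clique)
 qed
 have "{u, v} : edges_of (hard_list k a i)" if "u < k" "v < k" "u ~= v" for u v
  using that e[of u v] e[of v u] by (cases u v rule: linorder_cases) (simp_all add: insert_commute)
 thus ?thesis by (auto simp: cliques_def)
qed

text \<open>The empty output is the only correct one for the easy graph and incorrect for every hard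
  graph. Its probabilities, at least 3/4 and at most 1/4, differ by 1/2, so each of the
  \<open>a * a\<close> disjoint pairs of cells is read with probability at least 1/2. A step reads
  from at most one of them.\<close>

theorem listing_lower_bound:
 assumes k: "3 <= k" and a: "1 <= a" and t: "1 <= t"
  and easy: "3 / 4 <= success_prob w P (listing_input (k + 2 * a) (easy_list k a) t) T
   (listing_answers k (k + 2 * a) (edges_of (easy_list k a)) t)"
  and hard: "!!i. i < a * a ==> 3 / 4 <= success_prob w P (listing_input (k + 2 * a) (hard_list k a i) t) T
   (listing_answers k (k + 2 * a) (edges_of (hard_list k a i)) t)"
 shows "real (a * a) / 2 <= real T" proof -
 let ?n = "k + 2 * a"
 let ?s = "init_config (listing_input ?n (easy_list k a) t)"
 let ?s' = "%i. init_config (listing_input ?n (hard_list k a i) t)"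
 define V where "V = {s. halted P s & outp s = []}"
 define B where "B i = {3 + 2 * i, 4 + 2 * i :: nat}" for i
 have ea: "listing_answers k ?n (edges_of (easy_list k a)) t = {[]}"
  using easy_no_clique[OF k] by (auto simp: listing_answers_def)
 have e: "3 / 4 <= prob (run w P T ?s) V" using easy unfolding success_prob_def ea V_def by simp
 have r: "1 / 2 <= read_prob w P (B i) T ?s" if i: "i < a * a" for i proof -
  have fin: "finite (cliques k ?n (edges_of (hard_list k a i)))"
   by (rule finite_subset[of _ "Pow {..<?n}"]) (auto simp: cliques_def)
  with hard_clique[OF k i] have pos: "0 < card (cliques k ?n (edges_of (hard_list k a i)))" unfolding card_gt_0_iff by blast
  have ne: "[] ~: listing_answers k ?n (edges_of (hard_list k a i)) t" proof
   assume "[] : listing_answers k ?n (edges_of (hard_list k a i)) t"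
   thus False unfolding listing_answers_def mem_Collect_eq proof (elim exE conjE)
    fix Ks
    assume Ks: "[] = concat Ks" "length Ks = min t (card (cliques k ?n (edges_of (hard_list k a i))))"
     and len: "ALL K:set Ks. length K = k & set K : cliques k ?n (edges_of (hard_list k a i))"
    have "length Ks ~= 0" unfolding Ks(2) using pos t by (simp add: min_def)
    then obtain K where K: "K : set Ks" by (cases Ks) auto
    have "ALL xs:set Ks. xs = []" using Ks(1) by (metis concat_eq_Nil_conv)
    with K have "K = []" by blast
    moreover have "length K = k" using len K by blast
    ultimately show False using k by simp
   qed
  qed
  have "3 / 4 <= prob (run w P T (?s' i)) {s. halted P s & outp s : listing_answers k ?n (edges_of (hard_list k a i)) t}"
   using hard[OF i] unfolding success_prob_def .
  also have "... <= prob (run w P T (?s' i)) (- V)" by (rule measure_pmf.finite_measure_mono) (use ne in "auto simp: V_def")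
  also have "... = 1 - prob (run w P T (?s' i)) V"
   using measure_pmf.prob_compl[of V "run w P T (?s' i)"] by (simp add: Compl_eq_Diff_UNIV)
  finally have h: "prob (run w P T (?s' i)) V <= 1 / 4" by simp
  have len: "length (hard_list k a i) = length (easy_list k a)" by (simp add: hard_list_def easy_list_def)
  have eq: "hard_list k a i ! j = easy_list k a ! j" if "j ~= i" for j
   using that by (simp add: hard_list_def easy_list_def nth_append)
  have nth: "listing_input ?n (hard_list k a i) t ! x = listing_input ?n (easy_list k a) t ! x"
   if x: "x < 3 + 2 * length (easy_list k a)" "x ~: B i" for x proof (cases "x < 3")
   case True
   then consider "x = 0" | "x = 1" | "x = 2" by linarith
   thus ?thesis by cases (simp_all only: listing_input_nth len)
  next
   case False
   have "x = 3 + 2 * ((x - 3) div 2) \<or> x = 4 + 2 * ((x - 3) div 2)" using False by presburger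
   then obtain j where j: "x = 3 + 2 * j \<or> x = 4 + 2 * j" by blast
   hence "j < length (easy_list k a)" "j ~= i" using x by (auto simp: B_def)
   thus ?thesis using j eq[OF `j ~= i`] len by (elim disjE) (simp_all only: listing_input_nth)
  qed
  have "agree_outside (B i) ?s (?s' i)" unfolding agree_outside_def init_config_def using nth len by auto
  hence "prob (run w P T ?s) V <= prob (run w P T (?s' i)) V + read_prob w P (B i) T ?s"
   by (rule run_agree) (auto simp: V_def agree_outside_def halted_def)
  thus ?thesis using e h by linarith
 qed
 have "real (a * a) / 2 = (SUM i<a * a. 1 / 2)" by simp
 also have "... <= (SUM i<a * a. read_prob w P (B i) T ?s)" by (rule sum_mono) (use r in auto)
 also have "... <= real T" by (rule sum_read_prob_le) (auto simp: B_def)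
 finally show ?thesis .
qed

section \<open>The choice of the parameters\<close>

lemma success_prob_mono:
 assumes "i <= j"
 shows "success_prob w P xs i Y <= success_prob w P xs j Y" proof -
 define V where "V = {s. halted P s & outp s : Y}"
 have "prob (run w P i s) V <= prob (run w P (Suc i) s) V" for i s proof (induction i arbitrary: s)
  case 0
  show ?case proof (cases "s : V")
   case True
   thus ?thesis by (simp add: V_def run.simps(2) step_def bind_return_pmf)
  qed simp
 next
  case (Suc i)
  have "prob (run w P (Suc i) s) V = measure_pmf.expectation (step w P s) (%x. prob (run w P i x) V)"
   unfolding run.simps(2)[of w P i] by (rule prob_bind_pmf)
  also have "... <= measure_pmf.expectation (step w P s) (%x. prob (run w P (Suc i) x) V)"
   by (intro integral_mono integrable_measure_pmf_finite[OF finite_step] Suc.IH)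
  also have "... = prob (run w P (Suc (Suc i)) s) V"
   unfolding run.simps(2)[of w P "Suc i"] by (rule prob_bind_pmf[symmetric])
  finally show ?case .
 qed
 hence "prob (run w P i (init_config xs)) V <= prob (run w P j (init_config xs)) V" using assms by (rule lift_Suc_mono_le)
 thus ?thesis by (simp add: success_prob_def V_def)
qed

text \<open>The constant \<open>C >= 2\<close> leaves room for rounding the number of cliques up to
  an integer or to a power of two.\<close>

lemma polylog_closeI:
 assumes "2 <= N" "2 <= C" "real N powr \<gamma> <= real t" "real t <= 2 * real N powr \<gamma>"
 shows "polylog_close C d \<gamma> N t" proof -
 have "1 <= log 2 (real N)" using assms(1) by (simp add: le_log_iff)
 hence "1 <= log 2 (real N) ^ d" by (rule one_le_power)
 hence c: "2 <= C * log 2 (real N) ^ d" using mult_mono[of 2 C 1 "log 2 (real N) ^ d"] assms(2) by simp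
 have "real N powr \<gamma> / (C * log 2 (real N) ^ d) <= real N powr \<gamma> / 1" using c by (intro divide_left_mono) auto
 moreover have "2 * real N powr \<gamma> <= C * log 2 (real N) ^ d * real N powr \<gamma>"
  using c by (rule mult_right_mono) simp
 ultimately show ?thesis using assms(3,4) unfolding polylog_close_def by simp
qed

text \<open>Cutting \<epsilon> off at 1/2 keeps the exponent positive, and \<open>max A 1\<close>
  removes the sign of \<open>A\<close>. The factor 2 comes from
  \<open>t <= 2 * x powr \<gamma>\<close>.\<close>

lemma time_bound_le:
 fixes x t \<gamma> p e \<epsilon> A :: real
 assumes x: "1 <= x" and t: "1 <= t" "t <= 2 * x powr \<gamma>" and p: "0 <= p" "0 <= e" "e <= 1" and "0 < \<epsilon>"
  and T: "2 * max A 1 * x powr ((p + \<gamma> * e) * (1 - min \<epsilon> (1 / 2))) <= real T"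
 shows "nat \<lfloor>A * (x powr p * t powr e) powr (1 - \<epsilon>)\<rfloor> <= T" proof -
 let ?X = "x powr p * t powr e" and ?d = "1 - min \<epsilon> (1 / 2)"
 have X1: "1 <= ?X" using mult_mono[of 1 "x powr p" 1 "t powr e"] ge_one_powr_ge_zero[of x p] ge_one_powr_ge_zero[of t e] x t p by simp
 have d: "0 <= ?d" "?d <= 1" using `0 < \<epsilon>` by (simp_all add: min_def)
 have "t powr e <= (2 * x powr \<gamma>) powr e" using t p by (intro powr_mono2) auto
 also have "... = 2 powr e * x powr (\<gamma> * e)" using x by (simp add: powr_mult powr_powr)
 also have "... <= 2 powr 1 * x powr (\<gamma> * e)" using p by (intro mult_right_mono powr_mono) auto
 finally have "?X <= x powr p * (2 * x powr (\<gamma> * e))" by (intro mult_left_mono) auto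
 also have "... = 2 * x powr (p + \<gamma> * e)" by (simp add: powr_add)
 finally have X: "?X <= 2 * x powr (p + \<gamma> * e)" .
 have "?X powr (1 - \<epsilon>) <= ?X powr ?d" using X1 by (intro powr_mono) auto
 also have "... <= (2 * x powr (p + \<gamma> * e)) powr ?d" using X X1 d by (intro powr_mono2) auto
 also have "... = 2 powr ?d * x powr ((p + \<gamma> * e) * ?d)" using x by (simp add: powr_mult powr_powr)
 also have "... <= 2 powr 1 * x powr ((p + \<gamma> * e) * ?d)" using d by (intro mult_right_mono powr_mono) auto
 finally have "max A 1 * ?X powr (1 - \<epsilon>) <= max A 1 * (2 * x powr ((p + \<gamma> * e) * ?d))"
  by (intro mult_left_mono) auto
 moreover have "A * ?X powr (1 - \<epsilon>) <= max A 1 * ?X powr (1 - \<epsilon>)" by (intro mult_right_mono) auto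
 ultimately have "A * ?X powr (1 - \<epsilon>) <= real T" using T by (simp add: ac_simps)
 thus ?thesis by linarith
qed

lemma no_subquadratic:
 assumes "r < 2"
 shows "EX a>=2 :: nat. B * real a powr r + 1 < real (a * a) / 2" proof -
 have "((%a. B * real a powr (r - 2) + real a powr (- 2)) \<longlongrightarrow> B * 0 + 0) sequentially"
  using assms by (intro tendsto_intros tendsto_neg_powr filterlim_real_sequentially) auto
 hence "\<forall>\<^sub>F a in sequentially. B * real a powr (r - 2) + real a powr (- 2) < 1 / 2"
  by (rule order_tendstoD) simp
 then obtain a0 where a0: "!!a. a0 <= a ==> B * real a powr (r - 2) + real a powr (- 2) < 1 / 2"
  unfolding eventually_sequentially by blast
 define a where "a = max a0 2"
 have a: "2 <= a" by (simp add: a_def)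
 have "B * real a powr (r - 2) + real a powr (- 2) < 1 / 2" by (rule a0) (simp add: a_def)
 hence s1: "real a powr 2 * (B * real a powr (r - 2) + real a powr (- 2)) < real a powr 2 * (1 / 2)"
  using a by (intro mult_strict_left_mono) auto
 have s2: "real a powr 2 * (B * real a powr (r - 2) + real a powr (- 2)) = B * real a powr r + 1" proof -
  have "real a powr 2 * real a powr (r - 2) = real a powr r" "real a powr 2 * real a powr (- 2) = 1"
   unfolding powr_add[symmetric] using a by simp_all
  thus ?thesis by (simp add: distrib_left mult.left_commute[of _ B])
 qed
 have s3: "real a powr 2 = real (a * a)" using a by (simp add: powr_numeral power2_eq_square)
 have "B * real a powr r + 1 < real (a * a) / 2" using s1 unfolding s2 unfolding s3 by simp
 thus ?thesis using a by blast
qed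

text \<open>With i = k - j for the number \<open>j\<close> of differing parts, this makes j = k the
  worst case of the union bound over false tuples; it is where
  \<open>\<sigma> <= 2 / (k - 1)\<close> enters.\<close>

lemma sigma_choose_le:
 assumes "0 <= \<sigma>" "\<sigma> <= 2 / (real k - 1)" "i <= k - 1" "2 <= k"
 shows "\<sigma> * real (i choose 2) <= real i" proof -
 have "real (i choose 2) = real i * (real i - 1) / 2" proof (cases i)
  case (Suc n)
  have "even (i * (i - 1))" by (cases "even i") auto
  hence "2 * (i choose 2) = i * (i - 1)" unfolding choose_two by (rule dvd_mult_div_cancel)
  hence "2 * real (i choose 2) = real i * real (i - 1)" by (metis of_nat_mult of_nat_numeral)
  thus ?thesis using Suc by simp
 qed simp
 moreover have "\<sigma> * (real i * (real i - 1) / 2) <= real i" proof (cases "i = 0")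
  case False
  have "\<sigma> * (real i - 1) <= 2 / (real k - 1) * (real k - 1)" using assms False by (intro mult_mono) auto
  also have "... = 2" proof -
   have "real k - 1 ~= 0" using assms(4) by simp
   thus ?thesis by (rule nonzero_eq_divide_eq[THEN iffD1]) simp
  qed
  finally have "\<sigma> * (real i - 1) / 2 * real i <= 1 * real i" by (intro mult_right_mono) auto
  thus ?thesis by (simp add: ac_simps)
 qed simp
 ultimately show ?thesis by (simp only:)
qed

text \<open>Exponents to the base n = 2^L: \<sigma> of the number of buckets, \<open>g\<close> of
  the number of cliques to list, \<open>r\<close> of the time of one run of \<open>P\<close>. The
  surplus \<open>c3\<close> in \<open>a\<close> absorbs the constants of the union bound, and
  \<open>C0\<close> the rounding.\<close>

lemma lists_cliquesI:
 fixes \<sigma> g r cf :: real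
 assumes k: "3 <= k" and L: "1 <= L" and q: "1 <= q"
  and \<sigma>: "0 <= \<sigma>" "\<sigma> <= 2 / (real k - 1)" and g: "g + \<sigma> * real (k choose 2) = real k"
  and r: "\<sigma> * real ((k choose 2) - 1) + r <= real k - 1 / real q"
  and c3: "48 * 2 ^ k * (k choose 2) <= 2 ^ c3" and a: "a = nat \<lceil>\<sigma> * real L\<rceil> + c3"
  and f: "real f <= r * real L + cf" "f < K * L" and b0: "g * real L <= real b0"
  and C0: "real ((k choose 2) - 1) * (1 + real c3) + cf + 1 <= real C0"
  and K: "c3 + 2 <= K" and mu: "L + kap <= mu" "mu <= f" and \<nu>: "\<nu> <= f" "8 * (k choose 2) * (2 ^ a + (2 ^ L)\<^sup>2) <= 2 ^ \<nu> * 2 ^ a"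
  and inst: "!!E es. simple_graph (2 ^ (L + kap) + 2 ^ mu) E ==> no_isolated (2 ^ (L + kap) + 2 ^ mu) E ==>
     edge_list E es ==> 2 ^ mu <= card E ==> card E <= 2 ^ mu + 2 ^ \<nu> ==>
     EX b>=b0. b < K * L & lists_in k P c (2 ^ (L + kap) + 2 ^ mu) mu f E es b"
 shows "lists_cliques k P c K q C0 kap L a mu f \<nu>" proof -
 let ?C2 = "k choose 2"
 have "2 / (real k - 1) <= 1" using k by simp
 hence "\<sigma> * real L <= 1 * real L" using \<sigma> by (intro mult_right_mono) auto
 hence "\<lceil>\<sigma> * real L\<rceil> <= int L" by (simp add: ceiling_le_iff)
 hence aL: "a <= L + c3" unfolding a by linarith
 have "0 <= \<sigma> * real L" using \<sigma>(1) by simp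
 hence "real a = of_int \<lceil>\<sigma> * real L\<rceil> + real c3" unfolding a by simp
 hence ar: "\<sigma> * real L + real c3 <= real a" "real a <= \<sigma> * real L + 1 + real c3" by linarith+
 have "c3 * 1 <= c3 * L" using L by (intro mult_left_mono) auto
 hence "a < (c3 + 2) * L" using aL L unfolding distrib_right by linarith
 also have "... <= K * L" using K by (rule mult_right_mono) simp
 finally have aK: "a < K * L" .
 have guard: "a * (?C2 - 1) + f <= ((k * q - 1) * L) div q + C0" proof -
  define D where "D = real (?C2 - 1)"
  let ?D = D and ?Y = "(k * q - 1) * L"
  have D0: "0 <= D" by (simp add: D_def)
  note r = r[folded D_def] and C0 = C0[folded D_def]
  have s: "real (a * (?C2 - 1) + f) = real a * D + real f" unfolding of_nat_add of_nat_mult D_def ..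
  have "real a * ?D <= (\<sigma> * real L + 1 + real c3) * ?D" using ar D0 by (intro mult_right_mono) auto
  hence "real (a * (?C2 - 1) + f) <= (\<sigma> * ?D + r) * real L + (1 + real c3) * ?D + cf"
   using f(1) unfolding s by (simp add: algebra_simps)
  also have "... <= (real k - 1 / real q) * real L + (1 + real c3) * ?D + cf"
   using r by (intro add_right_mono mult_right_mono) auto
  also have "(real k - 1 / real q) * real L = real ?Y / real q" using q k by (simp add: of_nat_diff field_simps)
  \<comment> \<open>Rounding down in \<open>G\<close> costs less than 1, which the summand 1 in the
    bound on \<open>C0\<close> repays.\<close>
  also have "real ?Y / real q <= real (?Y div q) + 1" proof -
   have "?Y < q * (?Y div q) + q" using q mod_less_divisor[of q ?Y] mult_div_mod_eq[of q ?Y] by linarith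
   hence "real ?Y <= real (q * (?Y div q) + q)" by (simp only: of_nat_le_iff)
   also have "... = real q * (real (?Y div q) + 1)" by (simp add: algebra_simps)
   finally show ?thesis using q by (simp add: pos_divide_le_eq mult.commute)
  qed
  finally have "real (a * (?C2 - 1) + f) <= real (?Y div q) + (1 + (1 + real c3) * ?D + cf)" by simp
  also have "... <= real (?Y div q + C0)" using C0 by (simp add: mult.commute)
  finally show ?thesis by (simp only: of_nat_le_iff)
 qed
 have few: "48 * 2 ^ k * ?C2 * (2 ^ L) ^ j <= 2 ^ b0 * 2 ^ (a * (?C2 - ((k - j) choose 2)))" if j: "1 <= j" "j <= k" for j
 proof -
  define X where "X = ?C2 - ((k - j) choose 2)"
  have le: "((k - j) choose 2) <= ((k - 1) choose 2)" unfolding choose_two by (intro div_le_mono mult_le_mono) (use j in auto)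
  have ch: "?C2 = (k - 1) + ((k - 1) choose 2)" using k by (cases k) (simp_all add: numeral_2_eq_2)
  have X1: "1 <= X" and XC: "real X = real ?C2 - real ((k - j) choose 2)" using le ch k by (simp_all add: X_def of_nat_diff)
  have "\<sigma> * real ((k - j) choose 2) <= real (k - j)" by (rule sigma_choose_le[OF \<sigma>]) (use j k in auto)
  hence "real j <= g + \<sigma> * real X" using g j by (simp add: XC algebra_simps of_nat_diff)
  hence "real j * real L <= (g + \<sigma> * real X) * real L" by (rule mult_right_mono) simp
  also have "... <= real b0 + (\<sigma> * real L) * real X" using b0 by (simp add: algebra_simps)
  finally have "real (L * j) <= real b0 + (\<sigma> * real L) * real X" by (simp add: mult.commute)
  moreover have "(\<sigma> * real L + real c3) * real X <= real a * real X" using ar by (intro mult_right_mono) auto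
  \<comment> \<open>As \<open>X >= 1\<close>, the surplus in \<open>a\<close> yields at least the
    factor \<open>2 ^ c3\<close>, which pays for \<open>48 * 2 ^ k * (k choose 2)\<close>.\<close>
  moreover have "real c3 * 1 <= real c3 * real X" using X1 by (intro mult_left_mono) auto
  ultimately have "real c3 + real (L * j) <= real b0 + real a * real X" by (simp add: distrib_right)
  hence "real (c3 + L * j) <= real (b0 + a * X)" by simp
  hence e: "c3 + L * j <= b0 + a * X" by (simp only: of_nat_le_iff)
  have "48 * 2 ^ k * ?C2 * (2 ^ L) ^ j <= 2 ^ c3 * (2 ^ L) ^ j" using c3 by (rule mult_right_mono) simp
  also have "... = 2 ^ (c3 + L * j)" by (simp add: power_add power_mult)
  also have "... <= 2 ^ (b0 + a * X)" using e by (intro power_increasing) auto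
  finally show ?thesis by (simp add: power_add X_def)
 qed
 show ?thesis unfolding lists_cliques_def using aK f(2) mu \<nu> guard few inst by blast
qed

lemma word_length_size:
 assumes "L <= mu"
 shows "word_length c (2 ^ L + 2 ^ mu) = c * (mu + 1)" proof -
 let ?n = "2 ^ L + 2 ^ mu :: nat"
 have "(2 :: nat) ^ L <= 2 ^ mu" using assms by (intro power_increasing) auto
 hence "?n <= 2 ^ (mu + 1)" by simp
 hence "real ?n <= real (2 ^ (mu + 1))" by (simp only: of_nat_le_iff)
 also have "real (2 ^ (mu + 1)) = 2 powr real (mu + 1)" using powr_realpow[of 2 "mu + 1"] by simp
 finally have "real ?n <= 2 powr real (mu + 1)" .
 hence "log 2 (real ?n) <= real (mu + 1)" by (subst log_le_iff) (auto intro: add_pos_pos)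
 moreover have "real (2 ^ mu) < real ?n" by (simp only: of_nat_less_iff) simp
 hence "2 powr real mu < real ?n" by (simp add: powr_realpow)
 hence "real mu < log 2 (real ?n)" by (subst less_log_iff) (auto intro: add_pos_pos)
 ultimately have "nat \<lceil>log 2 (real ?n)\<rceil> = mu + 1" by linarith
 thus ?thesis unfolding word_length_def by (simp only:)
qed

text \<open>\<open>kap + 3\<close> bits pay for \<open>8 * C2\<close>, and one more bit for the two
  summands.\<close>

lemma buckets_size:
 assumes "C2 <= 2 ^ kap" "kap + 4 <= \<nu>" "2 * L + kap + 4 <= \<nu> + a"
 shows "8 * C2 * (2 ^ a + (2 ^ L)\<^sup>2) <= 2 ^ \<nu> * (2 :: nat) ^ a" proof -
 have "8 * C2 <= 2 ^ (kap + 3)" using assms(1) by (simp add: power_add)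
 hence "8 * C2 * (2 ^ a + (2 ^ L)\<^sup>2) <= 2 ^ (kap + 3) * (2 ^ a + (2 ^ L)\<^sup>2)" by (rule mult_right_mono) simp
 also have "... = 2 ^ (kap + 3 + a) + 2 ^ (kap + 3 + 2 * L)"
  by (simp add: power_add distrib_left power_mult[symmetric] mult.commute[of L])
 also have "... <= 2 ^ (\<nu> + a - 1) + 2 ^ (\<nu> + a - 1)" using assms by (intro add_mono power_increasing) auto
 also have "... = 2 ^ (\<nu> + a)" using assms by (cases "\<nu> + a") auto
 finally show ?thesis by (simp add: power_add)
qed

lemma C2_le_pow:
 assumes "k * k <= 2 ^ kap"
 shows "k choose 2 <= 2 ^ kap" proof -
 have "k choose 2 <= k * k" unfolding choose_two by (rule order_trans[OF div_le_dividend]) simp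
 thus ?thesis using assms by simp
qed

lemma real_choose_two: "real (k choose 2) = real k * (real k - 1) / 2" proof (cases k)
 case (Suc n)
 have "even (k * (k - 1))" by (cases "even k") auto
 hence "2 * (k choose 2) = k * (k - 1)" unfolding choose_two by (rule dvd_mult_div_cancel)
 hence "2 * real (k choose 2) = real k * real (k - 1)" by (metis of_nat_mult of_nat_numeral)
 thus ?thesis using Suc by simp
qed simp

lemma exists_clique_list_size:
 assumes "0 <= \<gamma>" "1 <= x"
 shows "x powr \<gamma> <= real (nat \<lceil>x powr \<gamma>\<rceil>)" "real (nat \<lceil>x powr \<gamma>\<rceil>) <= 2 * x powr \<gamma>" "1 <= nat \<lceil>x powr \<gamma>\<rceil>"
proof -
 have "1 <= x powr \<gamma>" using assms by (simp add: ge_one_powr_ge_zero)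
 thus "x powr \<gamma> <= real (nat \<lceil>x powr \<gamma>\<rceil>)" "real (nat \<lceil>x powr \<gamma>\<rceil>) <= 2 * x powr \<gamma>" "1 <= nat \<lceil>x powr \<gamma>\<rceil>"
  by linarith+
qed

lemma kap_exists: "EX kap. 1 <= kap & k * k <= 2 ^ kap" for k :: nat proof (intro exI[of _ "k * k + 1"] conjI)
 show "k * k <= 2 ^ (k * k + 1)" using less_exp[of "k * k + 1"] by linarith
qed simp

lemma powr_two: "x powr y = 2 powr (y * log 2 x)" if "0 < x" for x y :: real using that by (simp add: powr_def log_def)

lemma pow_two_cover:
 fixes A \<rho> l :: real
 assumes "2 <= A" "0 <= \<rho>" "0 <= l"
 defines "f == nat \<lceil>\<rho> * l + log 2 A\<rceil>"
 shows "A * (2 powr l) powr \<rho> <= real (2 ^ f)" "real f <= \<rho> * l + log 2 A + 1" "\<rho> * l + 1 <= real f" proof -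
 have la: "1 <= log 2 A" using assms(1) by (simp add: le_log_iff)
 have nn: "0 <= \<rho> * l" using assms by simp
 have f: "\<rho> * l + log 2 A <= real f" unfolding f_def by linarith
 show "\<rho> * l + 1 <= real f" using f la by linarith
 show "real f <= \<rho> * l + log 2 A + 1" unfolding f_def using la nn by linarith
 have "A * (2 powr l) powr \<rho> = 2 powr (\<rho> * l + log 2 A)"
  using assms(1) by (simp add: powr_add powr_powr mult.commute)
 also have "... <= 2 powr real f" using f by (intro powr_mono) auto
 finally show "A * (2 powr l) powr \<rho> <= real (2 ^ f)" by (simp add: powr_realpow)
qed

lemma pow_two_between:
 fixes x :: real
 assumes "0 <= \<gamma>" "1 <= x"
 defines "b == nat \<lceil>\<gamma> * log 2 x\<rceil>"
 shows "x powr \<gamma> <= real (2 ^ b)" "real (2 ^ b) <= 2 * x powr \<gamma>" "\<gamma> * log 2 x <= real b" "real b <= \<gamma> * log 2 x + 1"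
proof -
 have nn: "0 <= \<gamma> * log 2 x" using assms by simp
 show b: "\<gamma> * log 2 x <= real b" "real b <= \<gamma> * log 2 x + 1" unfolding b_def using nn by linarith+
 have x: "x powr \<gamma> = 2 powr (\<gamma> * log 2 x)" using assms by (intro powr_two) auto
 have B: "real (2 ^ b) = 2 powr real b" by (simp add: powr_realpow)
 show "x powr \<gamma> <= real (2 ^ b)" unfolding x B using b by (intro powr_mono) auto
 have "2 powr real b <= 2 powr (\<gamma> * log 2 x + 1)" using b by (intro powr_mono) auto
 thus "real (2 ^ b) <= 2 * x powr \<gamma>" unfolding x B by (simp add: powr_add)
qed

lemma requires_timeI:
 assumes "!!\<epsilon> P c A. 0 < \<epsilon> ==> (!!x. x : X ==> solves_within P c A \<epsilon> x) ==> False"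
 shows "requires_time X" using assms unfolding requires_time_def by blast

lemma exists_rate:
 assumes "0 < (\<delta> :: real)"
 shows "EX q :: nat. 1 <= q & 1 / real q <= \<delta>" proof -
 obtain q :: nat where q: "q ~= 0" "inverse (real q) < \<delta>" using assms real_arch_inverse by blast
 thus ?thesis by (intro exI[of _ q]) (auto simp: inverse_eq_divide)
qed

lemma exists_nat_ge: "EX K :: nat. x <= real K & m <= K" proof (intro exI conjI)
 show "x <= real (nat \<lceil>x\<rceil> + m)" by linarith
qed simp

lemma word_factor_pos:
 assumes "input_fits (word_length c n) (listing_input n' es t)"
 shows "1 <= c" using assms by (cases c) (auto simp: input_fits_def word_length_def)

lemma length_lists:
 assumes "2 <= k"
 shows "length (easy_list k a) = a * a + ((k choose 2) - 1)" "length (hard_list k a i) = a * a + ((k choose 2) - 1)"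
 using length_almost_clique[OF assms] by (simp_all add: easy_list_def hard_list_def)

text \<open>Serves both parts of the theorem. \<open>sz\<close> selects the size N in which time is
  measured, nodes or edges, and the instances built have N = n^\<beta> up to constants. N^j bounds
  the hashed edges that do not change N by more than a constant: \<open>j = 2\<close> for nodes and
  \<open>j = 1\<close> for edges. Equation \<open>g\<close> says that N^\<gamma> is about the number
  of false cliques, and \<open>key\<close> that the number of guesses times the claimed time is
  n^k.\<close>

theorem listing_requires_time:
 fixes \<gamma> \<sigma> \<beta> p e D :: real
 assumes k: "3 <= k" and hyp: "exact_clique_hypothesis k" and \<gamma>: "0 <= \<gamma>" and C: "2 <= C"
  and tasks: "!!n E es t. 2 <= n ==> simple_graph n E ==> no_isolated n E ==> edge_list E es ==> 2 <= card E ==>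
   polylog_close C d \<gamma> (sz n (card E)) t ==>
   \<lparr>task_input = listing_input n es t, task_size = n, task_answers = listing_answers k n E t,
    task_bound = real (sz n (card E)) powr p * real t powr e\<rparr> : X"
  and sz2: "!!n m. 2 <= n ==> 2 <= m ==> 2 <= sz n m"
  and sz: "!!L mu m. L <= mu ==> 2 ^ mu <= m ==> m <= 2 ^ mu + 2 ^ (j * mu) ==>
   2 ^ mu <= sz (2 ^ L + 2 ^ mu) m & sz (2 ^ L + 2 ^ mu) m <= 2 ^ (mu + 1)"
  and sz_hard: "!!a. 2 <= a ==> real (sz (k + 2 * a) (a * a + ((k choose 2) - 1))) <= D * real a powr (2 / real j)"
  and p: "0 < p" "0 <= e" "e <= 1" and \<sigma>: "0 <= \<sigma>" "\<sigma> <= 2 / (real k - 1)" and \<beta>: "1 <= \<beta>" "\<beta> <= 2"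
  and j: "1 <= j" "2 <= real j * \<beta> + \<sigma>"
  and g: "\<gamma> * \<beta> + \<sigma> * real (k choose 2) = real k"
  and key: "\<sigma> * (real (k choose 2) - 1) + (p + \<gamma> * e) * \<beta> = real k"
 shows "requires_time X" proof (rule requires_timeI)
 fix \<epsilon> A :: real and P c
 assume \<epsilon>: "0 < \<epsilon>" and solves: "!!x. x : X ==> solves_within P c A \<epsilon> x"
 \<comment> \<open>\<tau> is the exponent in N of the claimed time bound for t = N^\<gamma>, and
   \<rho> that of the supposed faster algorithm; limiting \<epsilon> keeps \<rho>
   nonnegative.\<close>
 define \<epsilon>' where "\<epsilon>' = min \<epsilon> (1 / 2)"
 define \<tau> where "\<tau> = p + \<gamma> * e"
 define \<rho> where "\<rho> = \<tau> * (1 - \<epsilon>')"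
 define A' where "A' = 2 * max A 1"
 have \<epsilon>': "0 < \<epsilon>'" "\<epsilon>' <= 1 / 2" using \<epsilon> by (simp_all add: \<epsilon>'_def)
 have \<tau>0: "0 < \<tau>" using p \<gamma> by (simp add: \<tau>_def add_pos_nonneg)
 have \<rho>0: "0 <= \<rho>" using \<tau>0 \<epsilon>' by (simp add: \<rho>_def)
 have A2: "2 <= A'" by (simp add: A'_def)
 have k2: "2 <= k" using k by simp
 have c1: "1 <= k choose 2" using k2 binomial_eq_0_iff[of k 2] by linarith
 have run: "input_fits (word_length c n) (listing_input n es t) &
   3 / 4 <= success_prob (word_length c n) P (listing_input n es t) T (listing_answers k n E t)"
  if E: "4 <= n" "simple_graph n E" "no_isolated n E" "edge_list E es" "2 <= card E"
   and t: "real (sz n (card E)) powr \<gamma> <= real t" "real t <= 2 * real (sz n (card E)) powr \<gamma>"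
   and T: "A' * real (sz n (card E)) powr \<rho> <= real T" for n E es t T proof -
  let ?N = "sz n (card E)"
  let ?B = "real ?N powr p * real t powr e"
  have n: "2 <= n" using E(1) by simp
  have N: "2 <= ?N" using sz2[OF n E(5)] .
  from solves[OF tasks[OF n E(2-5) polylog_closeI[OF N C t]]] have s: "input_fits (word_length c n) (listing_input n es t)"
   "1 - 1 / real n <= success_prob (word_length c n) P (listing_input n es t) (nat \<lfloor>A * ?B powr (1 - \<epsilon>)\<rfloor>) (listing_answers k n E t)"
   by (simp_all add: solves_within_def Let_def)
  have "1 <= real ?N powr \<gamma>" using N \<gamma> by (simp add: ge_one_powr_ge_zero)
  hence t1: "1 <= real t" using t by linarith
  have "nat \<lfloor>A * ?B powr (1 - \<epsilon>)\<rfloor> <= T"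
   by (rule time_bound_le[OF _ t1 t(2) _ _ _ \<epsilon>]) (use N p T in "simp_all add: \<rho>_def \<tau>_def \<epsilon>'_def A'_def")
  moreover have "3 / 4 <= 1 - 1 / real n" using E(1) by (simp add: field_simps)
  ultimately show ?thesis using success_prob_mono s by (meson order_trans)
 qed
 let ?h = "%a. sz (k + 2 * a) (a * a + ((k choose 2) - 1))"
 have hard_run: "input_fits (word_length c (k + 2 * a)) (listing_input (k + 2 * a) es t) &
   3 / 4 <= success_prob (word_length c (k + 2 * a)) P (listing_input (k + 2 * a) es t) T (listing_answers k (k + 2 * a) (edges_of es) t)"
  if a: "2 <= a" and T: "A' * real (?h a) powr \<rho> <= real T" and t: "t = nat \<lceil>real (?h a) powr \<gamma>\<rceil>"
   and es: "simple_graph (k + 2 * a) (edges_of es)" "no_isolated (k + 2 * a) (edges_of es)" "edge_list (edges_of es) es"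
    "length es = a * a + ((k choose 2) - 1)" for a T t es proof -
  have c: "card (edges_of es) = a * a + ((k choose 2) - 1)" using card_edges_of[OF es(3)] es(4) by simp
  have m: "2 <= card (edges_of es)" using mult_le_mono[OF a a] unfolding c by simp
  have n: "4 <= k + 2 * a" using a by simp
  have "1 <= real (?h a)" using sz2[OF _ m, of "k + 2 * a"] k unfolding c by linarith
  note t' = exists_clique_list_size[OF \<gamma> this, folded t]
  show ?thesis by (rule run[OF n es(1-3) m]) (use t' T in "simp_all only: c")
 qed
 have hard: "real (a * a) / 2 <= real T" if a: "2 <= a" and T: "A' * real (?h a) powr \<rho> <= real T" for a T proof -
  have x: "1 <= real (?h a)" using sz2[of "k + 2 * a" "a * a + ((k choose 2) - 1)"] mult_le_mono[OF a a] k by linarith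
  have a1: "1 <= a" using a by simp
  note h = hard_run[OF a T refl, THEN conjunct2]
  show ?thesis by (rule listing_lower_bound[OF k a1 exists_clique_list_size(3)[OF \<gamma> x]
      h[OF simple_easy[OF k2] no_isolated_hard(1)[OF k a] easy_edge_list length_lists(1)[OF k2]]
      h[OF simple_hard[OF k2] no_isolated_hard(2)[OF k a] hard_edge_list[OF _ k2] length_lists(2)[OF k2]]])
 qed
 \<comment> \<open>The adversary forces a^2 / 2 steps on instances with N of order at most a^(2/j),
   so no correct algorithm has exponent below \<open>j\<close>. This is needed for
   \<open>2 ^ f\<close> to cover the copying of up to 2^(j mu) edges.\<close>
 have \<rho>j: "real j <= \<rho>" proof (rule ccontr)
  assume "~ real j <= \<rho>"
  hence "2 / real j * \<rho> < 2" using j by (simp add: field_simps)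
  then obtain a :: nat where a: "2 <= a" "(A' * D powr \<rho>) * real a powr (2 / real j * \<rho>) + 1 < real (a * a) / 2"
   using no_subquadratic by metis
  define T where "T = nat \<lceil>A' * real (?h a) powr \<rho>\<rceil>"
  have nn: "0 <= A' * real (?h a) powr \<rho>" using A2 by simp
  have "real (a * a) / 2 <= real T" by (rule hard[OF a(1)]) (unfold T_def, rule real_nat_ceiling_ge)
  also have "... <= A' * real (?h a) powr \<rho> + 1" unfolding T_def using nn by linarith
  also have "A' * real (?h a) powr \<rho> <= A' * (D * real a powr (2 / real j)) powr \<rho>"
   using sz_hard[OF a(1)] \<rho>0 A2 by (intro mult_left_mono powr_mono2) auto
  also have "... = (A' * D powr \<rho>) * real a powr (2 / real j * \<rho>)" by (simp only: powr_mult powr_powr mult.assoc)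
  finally show False using a(2) by linarith
 qed
 obtain kap where kap: "1 <= kap" "k * k <= 2 ^ kap" using kap_exists by blast
 obtain c3 where c3: "48 * 2 ^ k * (k choose 2) <= 2 ^ c3"
  using less_exp[of "48 * 2 ^ k * (k choose 2)"] less_imp_le by blast
 \<comment> \<open>The faster algorithm saves \<tau> \<epsilon>' \<beta> in the exponent of n, and
   \<beta> is at least 1; \<open>q\<close> makes 1 / q no larger than this saving.\<close>
 obtain q where q: "1 <= q" "1 / real q <= \<tau> * \<epsilon>'" using exists_rate[of "\<tau> * \<epsilon>'"] \<tau>0 \<epsilon>' by auto
 have r: "\<sigma> * real ((k choose 2) - 1) + \<rho> * \<beta> <= real k - 1 / real q" proof -
  have "\<tau> * \<epsilon>' * 1 <= \<tau> * \<epsilon>' * \<beta>" using \<tau>0 \<beta> \<epsilon>' by (intro mult_left_mono) auto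
  moreover have "\<rho> * \<beta> = \<tau> * \<beta> - \<tau> * \<epsilon>' * \<beta>" by (simp add: \<rho>_def algebra_simps)
  ultimately show ?thesis using key q(2) unfolding \<tau>_def[symmetric] by (simp only: of_nat_diff[OF c1] of_nat_1)
 qed
 \<comment> \<open>Collects the constants of f <= \<rho> (mu + 1) + log A' + 1 with mu <= \<beta> L
   + kap + 5.\<close>
 define cf where "cf = \<rho> * (real kap + 6) + log 2 A' + 1"
 obtain C0 where C0: "real ((k choose 2) - 1) * (1 + real c3) + cf + 1 <= real C0" using exists_nat_ge by blast
 obtain K where K: "\<rho> * (real kap + 8) + log 2 A' + \<gamma> * (real kap + 8) + 3 <= real K" "c3 + 2 <= K"
  using exists_nat_ge by blast
 have la: "0 <= log 2 A'" using A2 by simp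
 have lister: "EX a mu f \<nu>. lists_cliques k P c K q C0 kap L a mu f \<nu>" if L: "1 <= L" for L proof -
  \<comment> \<open>The pendant edges bring N to about n^\<beta>. The slack \<open>kap + 4\<close>
    makes room for all copies of the vertices and for the constants in
    \<open>buckets_size\<close>.\<close>
  define mu where "mu = nat \<lceil>\<beta> * real L\<rceil> + kap + 4"
  have bL: "real L <= \<beta> * real L" "\<beta> * real L <= 2 * real L"
   using mult_right_mono[OF \<beta>(1), of "real L"] mult_right_mono[OF \<beta>(2), of "real L"] by simp_all
  have mur: "\<beta> * real L + real kap + 4 <= real mu" "real mu <= \<beta> * real L + real kap + 5"
   using bL unfolding mu_def by linarith+
  have "real (L + kap + 4) <= real mu" using mur bL by simp
  hence muL: "L + kap + 4 <= mu" by (simp only: of_nat_le_iff)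
  have jmu: "mu <= j * mu" using j(1) by simp
  define l where "l = mu + 1"
  define f where "f = nat \<lceil>\<rho> * real l + log 2 A'\<rceil>"
  \<comment> \<open>Since N is at least \<open>2 ^ mu\<close>, every exponent \<open>b\<close>
    chosen for an actual instance is at least this one.\<close>
  define b0 where "b0 = nat \<lceil>\<gamma> * real mu\<rceil>"
  have l0: "0 <= real l" by simp
  note f = pow_two_cover[OF A2 \<rho>0 l0, folded f_def]
  have L1: "1 <= real L" using L by simp
  have "real kap * 1 <= real kap * real L" using L1 by (rule mult_left_mono) simp
  hence "real l <= (real kap + 8) * real L" using mur bL L1 unfolding distrib_right l_def of_nat_add by linarith
  hence lL: "y * real l <= (y * (real kap + 8)) * real L" if "0 <= y" for y
   using mult_left_mono[OF _ that] by (simp add: mult.assoc)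
  have Lc: "y <= y * real L" if "0 <= y" for y using mult_left_mono[of 1 "real L" y] that L by simp
  have KL: "(\<rho> * (real kap + 8)) * real L + log 2 A' * real L + (\<gamma> * (real kap + 8)) * real L + 3 * real L <= real (K * L)"
   using mult_right_mono[OF K(1), of "real L"] by (simp add: distrib_right)
  have nn: "0 <= (\<rho> * (real kap + 8)) * real L" "0 <= (\<gamma> * (real kap + 8)) * real L" using \<rho>0 \<gamma> by simp_all
  have "real f < real (K * L)" using f(2) lL[OF \<rho>0] Lc[OF la] Lc[of 3] KL nn by linarith
  hence fK: "f < K * L" by (simp only: of_nat_less_iff)
  have "real j * real l <= \<rho> * real l" using \<rho>j by (rule mult_right_mono) simp
  hence "real (j * l + 1) <= real f" using f(3) by simp
  hence fl: "j * l + 1 <= f" by (simp only: of_nat_le_iff)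
  let ?a = "nat \<lceil>\<sigma> * real L\<rceil> + c3"
  have "lists_cliques k P c K q C0 kap L ?a mu f (j * mu)"
  proof (rule lists_cliquesI[OF k L q(1) \<sigma> g r c3 refl _ fK _ C0 K(2)])
   have "\<rho> * real mu <= \<rho> * (\<beta> * real L + real kap + 5)" using mur \<rho>0 by (intro mult_left_mono) auto
   thus "real f <= \<rho> * \<beta> * real L + cf" using f(2) by (simp add: cf_def l_def algebra_simps)
   have "\<gamma> * (\<beta> * real L) <= \<gamma> * real mu" using mur \<gamma> by (intro mult_left_mono) auto
   thus "\<gamma> * \<beta> * real L <= real b0" unfolding b0_def mult.assoc by linarith
   have jf: "j * mu <= f" using fl by (simp add: l_def)
   show "L + kap <= mu" "mu <= f" "j * mu <= f" using muL jf order_trans[OF jmu jf] by simp_all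
   show "8 * (k choose 2) * (2 ^ ?a + (2 ^ L)\<^sup>2) <= 2 ^ (j * mu) * 2 ^ ?a"
   proof (rule buckets_size[OF C2_le_pow[OF kap(2)]])
    have "2 * real L <= (real j * \<beta> + \<sigma>) * real L" using j(2) by (rule mult_right_mono) simp
    moreover have "real j * (\<beta> * real L + real kap + 4) <= real j * real mu" using mur(1) by (rule mult_left_mono) simp
    moreover have "1 * (real kap + 4) <= real j * (real kap + 4)" using j(1) by (intro mult_right_mono) auto
    moreover have "\<sigma> * real L <= real ?a" using real_nat_ceiling_ge[of "\<sigma> * real L"] unfolding of_nat_add by linarith
    ultimately have "real (2 * L + kap + 4) <= real (j * mu + ?a)" by (simp add: algebra_simps)
    thus "2 * L + kap + 4 <= j * mu + ?a" by (simp only: of_nat_le_iff)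
   qed (use muL jmu in linarith)
   fix E es
   assume E: "simple_graph (2 ^ (L + kap) + 2 ^ mu) E" "no_isolated (2 ^ (L + kap) + 2 ^ mu) E" "edge_list E es"
    "2 ^ mu <= card E" "card E <= 2 ^ mu + 2 ^ (j * mu)"
   let ?n = "2 ^ (L + kap) + 2 ^ mu :: nat" and ?N = "sz (2 ^ (L + kap) + 2 ^ mu) (card E)"
   define b where "b = nat \<lceil>\<gamma> * log 2 (real ?N)\<rceil>"
   have "(2 :: nat) ^ 2 <= 2 ^ mu" using muL by (intro power_increasing) auto
   hence n4: "4 <= ?n" and m2: "2 <= card E" and mu4: "(4 :: nat) <= 2 ^ mu" using E(4) by simp_all
   have N: "2 ^ mu <= ?N" "?N <= 2 ^ l" using sz[OF _ E(4,5), of "L + kap"] muL by (simp_all add: l_def)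
   have x1: "1 <= real ?N" and x0: "0 < real ?N" using N mu4 by linarith+
   note b = pow_two_between[OF \<gamma> x1, folded b_def]
   have "2 powr real mu <= real ?N" and Nl: "real ?N <= 2 powr real l"
    using N[folded of_nat_le_iff[where 'a = real]] by (simp_all add: powr_realpow)
   hence lm: "real mu <= log 2 (real ?N)" "log 2 (real ?N) <= real l" using x0 by (simp_all add: le_log_iff log_le_iff)
   have b0b: "b0 <= b" unfolding b0_def b_def using lm \<gamma> by (intro nat_mono ceiling_mono mult_left_mono) auto
   have "\<gamma> * log 2 (real ?N) <= \<gamma> * real l" using lm \<gamma> by (intro mult_left_mono) auto
   hence "real b < real (K * L)" using b(4) lL[OF \<gamma>] Lc[OF la] Lc[of 3] la KL nn by linarith
   hence bK: "b < K * L" by (simp only: of_nat_less_iff)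
   have "A' * real ?N powr \<rho> <= A' * (2 powr real l) powr \<rho>" using Nl \<rho>0 A2 by (intro mult_left_mono powr_mono2) auto
   hence fm: "A' * real ?N powr \<rho> <= real (2 ^ f)" using f(1) by linarith
   have wl: "word_length c ?n = c * (mu + 1)" by (rule word_length_size) (use muL in simp)
   show "EX b>=b0. b < K * L & lists_in k P c ?n mu f E es b"
    using run[OF n4 E(1-3) m2 b(1,2) fm] b0b bK unfolding wl by blast
  qed
  thus ?thesis by blast
 qed
 have "1 <= c"
  using hard_run[OF order_refl real_nat_ceiling_ge refl simple_easy[OF k2] no_isolated_hard(1)[OF k order_refl] easy_edge_list length_lists(1)[OF k2]]
  by (blast intro: word_factor_pos)
 moreover have "1 <= K" using K(2) by simp
 ultimately show False using reduction[OF k _ _ q(1) kap(2) lister] hyp by blast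
qed

theorem node_listing_requires_time:
 assumes k: "3 <= k" and "exact_clique_hypothesis k" and \<gamma>: "0 <= \<gamma>" "\<gamma> <= real k" and "2 <= C"
 shows "requires_time (node_listing_tasks k \<gamma> C d)" proof -
 \<comment> \<open>Here N is the number of nodes, so \<beta> = 1, and equation \<open>g\<close> of
   \<open>listing_requires_time\<close> leaves this value for \<sigma>.\<close>
 define \<sigma> where "\<sigma> = (real k - \<gamma>) / real (k choose 2)"
 have C2: "0 < real (k choose 2)" using k by (simp add: zero_less_binomial)
 have g: "\<gamma> * 1 + \<sigma> * real (k choose 2) = real k" using C2 by (simp add: \<sigma>_def)
 have \<sigma>0: "0 <= \<sigma>" using \<gamma> by (simp add: \<sigma>_def)
 have kk: "2 <= real k * (real k - 1)" using mult_mono[of 3 "real k" 2 "real k - 1"] k by simp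
 show ?thesis
 proof (rule listing_requires_time[OF k assms(2) \<gamma>(1) assms(5), where sz = "%n m. n" and j = 2 and D = "real (k + 2)" and \<beta> = 1 and \<sigma> = \<sigma>])
  show "2 ^ mu <= 2 ^ L + (2 :: nat) ^ mu & 2 ^ L + 2 ^ mu <= (2 :: nat) ^ (mu + 1)" if "L <= mu" for L mu :: nat
   using power_increasing[OF that, of "2 :: nat"] by simp
  show "real (k + 2 * a) <= real (k + 2) * real a powr (2 / real 2)" if "2 <= a" for a
   using mult_left_mono[of 1 "real a" "real k"] that by (simp add: algebra_simps)
  have "\<sigma> <= real k / real (k choose 2)" unfolding \<sigma>_def using \<gamma> C2 by (intro divide_right_mono) auto
  also have "... = 2 / (real k - 1)" using k by (simp add: real_choose_two field_simps)
  finally show "\<sigma> <= 2 / (real k - 1)" .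
  define h where "h = 2 / (real k * (real k - 1))"
  have "\<sigma> = (real k - \<gamma>) * h" "2 / (real k - 1) = real k * h" using k by (simp_all add: \<sigma>_def h_def real_choose_two)
  thus "\<sigma> * (real (k choose 2) - 1) + (2 / (real k - 1) + \<gamma> * (1 - 2 / (real k * (real k - 1)))) * 1 = real k"
   unfolding h_def[symmetric] using g by (simp add: algebra_simps)
 qed (use k kk g \<sigma>0 in "auto simp: node_listing_tasks_def")
qed

theorem edge_listing_requires_time:
 assumes k: "3 <= k" and "exact_clique_hypothesis k" and \<gamma>: "0 <= \<gamma>" "\<gamma> <= real k / 2" and "2 <= C"
 shows "requires_time (edge_listing_tasks k \<gamma> C d)" proof -
 define \<Delta> where "\<Delta> = real (k choose 2) - \<gamma>"
 \<comment> \<open>Buckets contain about n^(2 - \<sigma>) edges, so \<beta> = 2 - \<sigma>. Solving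
   \<gamma> (2 - \<sigma>) + \<sigma> (k choose 2) = k gives this value; it is nonnegative because
   \<gamma> is at most k / 2.\<close>
 define \<sigma> where "\<sigma> = (real k - 2 * \<gamma>) / \<Delta>"
 define p where "p = 1 / (real k - 2)"
 define e where "e = 1 - 2 / (real k * (real k - 2))"
 have C2: "real (k choose 2) = real k * (real k - 1) / 2" by (rule real_choose_two)
 have "real k * 2 <= real k * (real k - 1)" using k by (intro mult_left_mono) auto
 hence "real k / 2 <= \<Delta>" using \<gamma> by (simp add: \<Delta>_def C2)
 hence \<Delta>: "0 < \<Delta>" using k by simp
 have \<sigma>\<Delta>: "\<sigma> * \<Delta> = real k - 2 * \<gamma>" using \<Delta> by (simp add: \<sigma>_def)
 have \<sigma>0: "0 <= \<sigma>" using \<gamma> \<Delta> by (simp add: \<sigma>_def)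
 have "\<gamma> * 2 <= \<gamma> * (2 * (real k - 1))" using \<gamma> k by (intro mult_left_mono) auto
 hence "(real k - 2 * \<gamma>) * (real k - 1) <= 2 * \<Delta>" by (simp add: \<Delta>_def C2 algebra_simps)
 hence \<sigma>1: "\<sigma> <= 2 / (real k - 1)" using \<Delta> k by (simp add: \<sigma>_def divide_le_eq mult.commute pos_le_divide_eq)
 have "2 / (real k - 1) <= 1" using k by simp
 hence \<beta>: "1 <= 2 - \<sigma>" using \<sigma>1 by simp
 have kk: "3 <= real k * (real k - 2)" using mult_mono[of 3 "real k" 1 "real k - 2"] k by simp
 have p': "p * (real k * (real k - 2)) = real k" using k by (simp add: p_def)
 have e': "e * (real k * (real k - 2)) = real k * (real k - 2) - 2"
  using kk order_less_irrefl[of "0 :: real"] by (cases "real k * (real k - 2) = 0") (simp_all add: e_def left_diff_distrib)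
 \<comment> \<open>The balance \<open>key\<close> is checked after multiplication by \<Delta>, the
   denominator of \<sigma>; this leaves polynomial identities in \<open>k\<close> and
   \<gamma>.\<close>
 have "(p + \<gamma> * e) * ((2 - \<sigma>) * \<Delta>) = (p + \<gamma> * e) * (real k * (real k - 2))"
  unfolding left_diff_distrib \<sigma>\<Delta> by (simp add: \<Delta>_def C2 field_simps)
 also have "... = real k + \<gamma> * (real k * (real k - 2) - 2)" unfolding distrib_right mult.assoc p' e' ..
 finally have t: "(p + \<gamma> * e) * ((2 - \<sigma>) * \<Delta>) = real k + \<gamma> * (real k * (real k - 2) - 2)" .
 have "(\<sigma> * (real (k choose 2) - 1) + (p + \<gamma> * e) * (2 - \<sigma>)) * \<Delta> =
   (\<sigma> * \<Delta>) * (real (k choose 2) - 1) + (p + \<gamma> * e) * ((2 - \<sigma>) * \<Delta>)" by (simp add: algebra_simps)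
 also have "... = real k * \<Delta>" unfolding \<sigma>\<Delta> t by (simp add: \<Delta>_def C2 field_simps)
 finally have key: "\<sigma> * (real (k choose 2) - 1) + (p + \<gamma> * e) * (2 - \<sigma>) = real k" using \<Delta> by simp
 show ?thesis
 proof (rule listing_requires_time[OF k assms(2) \<gamma>(1) assms(5), where sz = "%n m. m" and j = 1 and D = "real (k choose 2)"
     and \<beta> = "2 - \<sigma>" and \<sigma> = \<sigma> and p = p and e = e])
  show "real (a * a + ((k choose 2) - 1)) <= real (k choose 2) * real a powr (2 / real 1)" if "2 <= a" for a proof -
   have "1 <= k choose 2" using k C2 binomial_eq_0_iff[of k 2] by linarith
   hence "(k choose 2) * (a * a) = ((k choose 2) - 1) * (a * a) + a * a" by (simp add: diff_mult_distrib)
   moreover have "((k choose 2) - 1) * 1 <= ((k choose 2) - 1) * (a * a)" using that by (intro mult_left_mono) auto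
   ultimately have "real (a * a + ((k choose 2) - 1)) <= real ((k choose 2) * (a * a))" unfolding of_nat_le_iff by linarith
   thus ?thesis using that by (simp add: powr_numeral power2_eq_square)
  qed
  show "\<gamma> * (2 - \<sigma>) + \<sigma> * real (k choose 2) = real k" using \<sigma>\<Delta> by (simp add: \<Delta>_def algebra_simps)
 qed (use k kk key \<sigma>0 \<sigma>1 \<beta> in "auto simp: edge_listing_tasks_def p_def e_def")
qed

theorem theorem1p4:
  fixes k :: nat
  assumes "k \<ge> 3"
    and "exact_clique_hypothesis k"
  shows "(\<forall>\<gamma>\<in>{0..real k}. \<forall>C\<ge>2. \<forall>d. requires_time (node_listing_tasks k \<gamma> C d)) \<and>
         (\<forall>\<gamma>\<in>{0..real k / 2}. \<forall>C\<ge>2. \<forall>d. requires_time (edge_listing_tasks k \<gamma> C d))"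
  using node_listing_requires_time[OF assms] edge_listing_requires_time[OF assms] by auto

end
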